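(* Let $R$ be a commutative ring and let $H$ be an $R$-Hopf algebra. (1) The $H$-coring $H\otimes_R^r H$ is coseparable. (2) The functor $$\mathrm{Hom}^{H\otimes_R^r H}(H\otimes_R^r H,-):\ \mathbb{M}^{H\otimes_R^r H}\to\mathbb{M}_{[H\otimes_R^r H,-]}$$ is an equivalence. (3) The category of $H$-Hopf modules and the category of $[H,-]$-Hopf modules are equivalent.
   Context: Write $\Delta(b)=b_{(1)}\otimes b_{(2)}$ for the coproduct of $H$ (summation understood) and $\varepsilon$ for the counit. For a ring $A$, an $A$-coring $\mathcal C$ is an $A$-bimodule with coassociative and counital $A$-bimodule maps $\Delta_{\mathcal C}:\mathcal C\to\mathcal C\otimes_A\mathcal C$, $\varepsilon_{\mathcal C}:\mathcal C\to A$. It is coseparable if $\Delta_{\mathcal C}$ is a split monomorphism of $\mathcal C$-bicomodules; equivalently, there is an $A$-bimodule map $\delta:\mathcal C\otimes_A\mathcal C\to A$ with $\delta\circ\Delta_{\mathcal C}=\varepsilon_{\mathcal C}$ and $(I_{\mathcal C}\otimes_A\delta)\circ(\Delta_{\mathcal C}\otimes_A I_{\mathcal C})=(\delta\otimes_A I_{\mathcal C})\circ(I_{\mathcal C}\otimes_A\Delta_{\mathcal C})$. $\mathbb{M}^{\mathcal C}$ is the category of right $\mathcal C$-comodules, with $\mathrm{Hom}^{\mathcal C}$ the comodule maps. $[\mathcal C,-]=\mathrm{Hom}_A(\mathcal C,-)$ (right $A$-linear maps, $(fa)(c)=f(ac)$) is a monad on right $A$-modules with multiplication induced by $\Delta_{\mathcal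 C}$ (via $\mathrm{Hom}_A(\mathcal C,\mathrm{Hom}_A(\mathcal C,M))\cong\mathrm{Hom}_A(\mathcal C\otimes_A\mathcal C,M)$, $F\mapsto[c\otimes d\mapsto F(c)(d)]$) and unit induced by $\varepsilon_{\mathcal C}$; $\mathbb{M}_{[\mathcal C,-]}$ is its category of (Eilenberg–Moore) modules. For $Q\in\mathbb{M}^{\mathcal C}$, $\mathrm{Hom}^{\mathcal C}(\mathcal C,Q)$ is a $[\mathcal C,-]$-module by $\mathrm{Hom}_A(\mathcal C,\mathrm{Hom}^{\mathcal C}(\mathcal C,Q))\cong\mathrm{Hom}^{\mathcal C}(\mathcal C\otimes_A\mathcal C,Q)\xrightarrow{\mathrm{Hom}^{\mathcal C}(\Delta_{\mathcal C},Q)}\mathrm{Hom}^{\mathcal C}(\mathcal C,Q)$. $H\otimes_R^r H$ is the $R$-module $H\otimes_R H$ made an $H$-coring by the $H$-actions $d\cdot(a\otimes b)\cdot c=da\,c_{(1)}\otimes b\,c_{(2)}$, coproduct $a\otimes b\mapsto(a\otimes b_{(1)})\otimes_H(1_H\otimes b_{(2)})$ and counit $a\otimes b\mapsto a\,\varepsilon(b)$. A ($B$-)Hopf module over a bialgebra $B$ is a right $B$-module $M$ with a right $B$-comodule structure $\varrho:M\to M\otimes_R B$ such that $\varrho(mb)=\varrho(m)\Delta(b)$; morphisms are $B$-linear $B$-colinear maps. A $[B,-]$-Hopf module is a right $B$-module $M$ with an $R$-linear map $\alpha_M:\mathrm{Hom}_R(B,M)\to M$ making $M$ a module of the monad $\mathrm{Hom}_R(B,-)$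 on $\mathbb{M}_R$ (multiplication induced by $\Delta$, unit by $\varepsilon$) such that $\alpha_M(f)b=\alpha_M\big(f(b_{(1)}-)\,b_{(2)}\big)$ for all $f\in\mathrm{Hom}_R(B,M)$, $b\in B$; morphisms are the maps compatible with both structures. *)

theory Defs
  imports "HOL-Algebra.Module" "HOL-Algebra.Free_Abelian_Groups"
begin

section \<open>Modules and bimodules over a (noncommutative) ring\<close>

text \<open>As in \<^theory>\<open>HOL-Algebra.Module\<close>, modules extend the ring record to inherit its additive
  notation; the fields \<open>mult\<close> and \<open>one\<close> of a module carry no information.\<close>

record ('a, 'm) right_mod = "'m ring" +
  ract :: "'m \<Rightarrow> 'a \<Rightarrow> 'm" (infixl \<open>\<triangleleft>\<index>\<close> 70)

record ('a, 'm) bimod = "('a, 'm) right_mod" +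
  lact :: "'a \<Rightarrow> 'm \<Rightarrow> 'm" (infixr \<open>\<triangleright>\<index>\<close> 70)

locale right_module = ring A + M: abelian_group M
  for A :: "('a, 'p) ring_scheme" (structure) and M :: "('a, 'm, 'q) right_mod_scheme" (structure) +
  assumes ract_closed: "\<lbrakk>x \<in> carrier M; a \<in> carrier A\<rbrakk> \<Longrightarrow> x \<triangleleft>\<^bsub>M\<^esub> a \<in> carrier M"
    and ract_add_left: "\<lbrakk>x \<in> carrier M; y \<in> carrier M; a \<in> carrier A\<rbrakk>
      \<Longrightarrow> (x \<oplus>\<^bsub>M\<^esub> y) \<triangleleft>\<^bsub>M\<^esub> a = x \<triangleleft>\<^bsub>M\<^esub> a \<oplus>\<^bsub>M\<^esub> y \<triangleleft>\<^bsub>M\<^esub> a"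
    and ract_add_right: "\<lbrakk>x \<in> carrier M; a \<in> carrier A; b \<in> carrier A\<rbrakk>
      \<Longrightarrow> x \<triangleleft>\<^bsub>M\<^esub> (a \<oplus> b) = x \<triangleleft>\<^bsub>M\<^esub> a \<oplus>\<^bsub>M\<^esub> x \<triangleleft>\<^bsub>M\<^esub> b"
    and ract_assoc: "\<lbrakk>x \<in> carrier M; a \<in> carrier A; b \<in> carrier A\<rbrakk>
      \<Longrightarrow> x \<triangleleft>\<^bsub>M\<^esub> (a \<otimes> b) = (x \<triangleleft>\<^bsub>M\<^esub> a) \<triangleleft>\<^bsub>M\<^esub> b"
    and ract_one: "x \<in> carrier M \<Longrightarrow> x \<triangleleft>\<^bsub>M\<^esub> \<one> = x"

locale bimodule = right_module A M
  for A :: "('a, 'p) ring_scheme" (structure) and M :: "('a, 'm, 'q) bimod_scheme" (structure) +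
  assumes lact_closed: "\<lbrakk>x \<in> carrier M; a \<in> carrier A\<rbrakk> \<Longrightarrow> a \<triangleright>\<^bsub>M\<^esub> x \<in> carrier M"
    and lact_add_right: "\<lbrakk>x \<in> carrier M; y \<in> carrier M; a \<in> carrier A\<rbrakk>
      \<Longrightarrow> a \<triangleright>\<^bsub>M\<^esub> (x \<oplus>\<^bsub>M\<^esub> y) = (a \<triangleright>\<^bsub>M\<^esub> x) \<oplus>\<^bsub>M\<^esub> (a \<triangleright>\<^bsub>M\<^esub> y)"
    and lact_add_left: "\<lbrakk>x \<in> carrier M; a \<in> carrier A; b \<in> carrier A\<rbrakk>
      \<Longrightarrow> (a \<oplus> b) \<triangleright>\<^bsub>M\<^esub> x = (a \<triangleright>\<^bsub>M\<^esub> x) \<oplus>\<^bsub>M\<^esub> (b \<triangleright>\<^bsub>M\<^esub> x)"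
    and lact_assoc: "\<lbrakk>x \<in> carrier M; a \<in> carrier A; b \<in> carrier A\<rbrakk>
      \<Longrightarrow> (a \<otimes> b) \<triangleright>\<^bsub>M\<^esub> x = a \<triangleright>\<^bsub>M\<^esub> (b \<triangleright>\<^bsub>M\<^esub> x)"
    and lact_one: "x \<in> carrier M \<Longrightarrow> \<one> \<triangleright>\<^bsub>M\<^esub> x = x"
    and lact_ract: "\<lbrakk>x \<in> carrier M; a \<in> carrier A; b \<in> carrier A\<rbrakk>
      \<Longrightarrow> (a \<triangleright>\<^bsub>M\<^esub> x) \<triangleleft>\<^bsub>M\<^esub> b = a \<triangleright>\<^bsub>M\<^esub> (x \<triangleleft>\<^bsub>M\<^esub> b)"

definition regular_bimod :: "('a, 'p) ring_scheme \<Rightarrow> ('a, 'a) bimod" where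
  "regular_bimod A = \<lparr>carrier = carrier A, monoid.mult = undefined, one = undefined,
     ring.zero = ring.zero A, add = add A, ract = monoid.mult A, lact = monoid.mult A\<rparr>"

definition right_hom ::
    "('a, 'p) ring_scheme \<Rightarrow> ('a, 'm, 'q) right_mod_scheme \<Rightarrow> ('a, 'n, 's) right_mod_scheme
      \<Rightarrow> ('m \<Rightarrow> 'n) set" where
  "right_hom A M N = {f \<in> hom (add_monoid M) (add_monoid N).
     \<forall>x\<in>carrier M. \<forall>a\<in>carrier A. f (x \<triangleleft>\<^bsub>M\<^esub> a) = f x \<triangleleft>\<^bsub>N\<^esub> a}"

definition bimod_hom ::
    "('a, 'p) ring_scheme \<Rightarrow> ('a, 'm, 'q) bimod_scheme \<Rightarrow> ('a, 'n, 's) bimod_scheme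
      \<Rightarrow> ('m \<Rightarrow> 'n) set" where
  "bimod_hom A M N = {f \<in> right_hom A M N.
     \<forall>x\<in>carrier M. \<forall>a\<in>carrier A. f (a \<triangleright>\<^bsub>M\<^esub> x) = a \<triangleright>\<^bsub>N\<^esub> f x}"

text \<open>\<open>hom_module A C M\<close> is the right \<open>A\<close>-module \<open>[C, M] = Hom\<^sub>A(C, M)\<close>, with \<open>(f a)(c) = f (a c)\<close>.
  Its elements are extensional functions, so that equality in it is equality of maps on \<open>C\<close>.\<close>

definition hom_module ::
    "('a, 'p) ring_scheme \<Rightarrow> ('a, 'c, 'q) bimod_scheme \<Rightarrow> ('a, 'm, 's) right_mod_scheme
      \<Rightarrow> ('a, 'c \<Rightarrow> 'm) right_mod" where
  "hom_module A C M = \<lparr>carrier = right_hom A C M \<inter> extensional (carrier C),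
     monoid.mult = undefined, one = undefined,
     ring.zero = (\<lambda>c\<in>carrier C. \<zero>\<^bsub>M\<^esub>),
     add = (\<lambda>f g. \<lambda>c\<in>carrier C. f c \<oplus>\<^bsub>M\<^esub> g c),
     ract = (\<lambda>f a. \<lambda>c\<in>carrier C. f (a \<triangleright>\<^bsub>C\<^esub> c))\<rparr>"


section \<open>Tensor products\<close>

text \<open>\<open>M \<otimes>\<^sub>A N\<close> is the free abelian group on \<open>M \<times> N\<close> modulo the usual relations.\<close>

type_synonym ('m, 'n) tensor = "('m \<times> 'n \<Rightarrow>\<^sub>0 int) set"

definition tensor_relators ::
    "('a, 'p) ring_scheme \<Rightarrow> ('a, 'm, 'q) right_mod_scheme \<Rightarrow> ('a, 'n, 's) bimod_scheme
      \<Rightarrow> ('m \<times> 'n \<Rightarrow>\<^sub>0 int) set" where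
  "tensor_relators A M N =
     {frag_of (x \<oplus>\<^bsub>M\<^esub> x', y) - frag_of (x, y) - frag_of (x', y) | x x' y.
        x \<in> carrier M \<and> x' \<in> carrier M \<and> y \<in> carrier N} \<union>
     {frag_of (x, y \<oplus>\<^bsub>N\<^esub> y') - frag_of (x, y) - frag_of (x, y') | x y y'.
        x \<in> carrier M \<and> y \<in> carrier N \<and> y' \<in> carrier N} \<union>
     {frag_of (x \<triangleleft>\<^bsub>M\<^esub> a, y) - frag_of (x, a \<triangleright>\<^bsub>N\<^esub> y) | x a y.
        x \<in> carrier M \<and> a \<in> carrier A \<and> y \<in> carrier N}"

definition tensor_relations ::
    "('a, 'p) ring_scheme \<Rightarrow> ('a, 'm, 'q) right_mod_scheme \<Rightarrow> ('a, 'n, 's) bimod_scheme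
      \<Rightarrow> ('m \<times> 'n \<Rightarrow>\<^sub>0 int) set" where
  "tensor_relations A M N =
     generate (free_Abelian_group (carrier M \<times> carrier N)) (tensor_relators A M N)"

definition tensor_group ::
    "('a, 'p) ring_scheme \<Rightarrow> ('a, 'm, 'q) right_mod_scheme \<Rightarrow> ('a, 'n, 's) bimod_scheme
      \<Rightarrow> ('m, 'n) tensor monoid" where
  "tensor_group A M N =
     free_Abelian_group (carrier M \<times> carrier N) Mod tensor_relations A M N"

definition tensor_elem ::
    "('a, 'p) ring_scheme \<Rightarrow> ('a, 'm, 'q) right_mod_scheme \<Rightarrow> ('a, 'n, 's) bimod_scheme
      \<Rightarrow> 'm \<Rightarrow> 'n \<Rightarrow> ('m, 'n) tensor" where
  "tensor_elem A M N x y =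
     tensor_relations A M N #>\<^bsub>free_Abelian_group (carrier M \<times> carrier N)\<^esub> frag_of (x, y)"

text \<open>The additive map \<open>M \<otimes>\<^sub>A N \<rightarrow> P\<close> with \<open>x \<otimes> y \<mapsto> \<phi> x y\<close>; meaningful for \<open>A\<close>-balanced
  biadditive \<open>\<phi>\<close>, for which it exists and is unique.\<close>

definition tensor_lift ::
    "('a, 'p) ring_scheme \<Rightarrow> ('a, 'm, 'q) right_mod_scheme \<Rightarrow> ('a, 'n, 's) bimod_scheme
      \<Rightarrow> ('x, 't) ring_scheme \<Rightarrow> ('m \<Rightarrow> 'n \<Rightarrow> 'x) \<Rightarrow> ('m, 'n) tensor \<Rightarrow> 'x" where
  "tensor_lift A M N P \<phi> =
     (THE h. h \<in> hom (tensor_group A M N) (add_monoid P) \<inter> extensional (carrier (tensor_group A M N)) \<and>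
        (\<forall>x\<in>carrier M. \<forall>y\<in>carrier N. h (tensor_elem A M N x y) = \<phi> x y))"

text \<open>\<open>tensor_right\<close> is the right module \<open>M \<otimes>\<^sub>A N\<close> for a right module \<open>M\<close> and a bimodule \<open>N\<close>;
  \<open>tensor_bimod\<close> is the bimodule \<open>M \<otimes>\<^sub>A N\<close> for bimodules \<open>M\<close>, \<open>N\<close>.\<close>

definition tensor_add_group ::
    "('a, 'p) ring_scheme \<Rightarrow> ('a, 'm, 'q) right_mod_scheme \<Rightarrow> ('a, 'n, 's) bimod_scheme
      \<Rightarrow> ('m, 'n) tensor ring" where
  "tensor_add_group A M N = \<lparr>carrier = carrier (tensor_group A M N),
     monoid.mult = undefined, one = undefined,
     ring.zero = one (tensor_group A M N), add = monoid.mult (tensor_group A M N)\<rparr>"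

definition tensor_right ::
    "('a, 'p) ring_scheme \<Rightarrow> ('a, 'm, 'q) right_mod_scheme \<Rightarrow> ('a, 'n, 's) bimod_scheme
      \<Rightarrow> ('a, ('m, 'n) tensor) right_mod" where
  "tensor_right A M N = ring.extend (tensor_add_group A M N)
     \<lparr>ract = (\<lambda>t a. tensor_lift A M N (tensor_add_group A M N)
        (\<lambda>x y. tensor_elem A M N x (y \<triangleleft>\<^bsub>N\<^esub> a)) t)\<rparr>"

definition tensor_bimod ::
    "('a, 'p) ring_scheme \<Rightarrow> ('a, 'm, 'q) bimod_scheme \<Rightarrow> ('a, 'n, 's) bimod_scheme
      \<Rightarrow> ('a, ('m, 'n) tensor) bimod" where
  "tensor_bimod A M N = right_mod.extend (tensor_right A M N)
     \<lparr>lact = (\<lambda>a. tensor_lift A M N (tensor_add_group A M N)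
        (\<lambda>x y. tensor_elem A M N (a \<triangleright>\<^bsub>M\<^esub> x) y))\<rparr>"

text \<open>\<open>tensor_map A M N M' N' f g\<close> is \<open>f \<otimes> g : M \<otimes>\<^sub>A N \<rightarrow> M' \<otimes>\<^sub>A N'\<close>.\<close>

definition tensor_map ::
    "('a, 'p) ring_scheme \<Rightarrow> ('a, 'm, 'q) right_mod_scheme \<Rightarrow> ('a, 'n, 's) bimod_scheme
      \<Rightarrow> ('a, 'k, 't) right_mod_scheme \<Rightarrow> ('a, 'l, 'v) bimod_scheme
      \<Rightarrow> ('m \<Rightarrow> 'k) \<Rightarrow> ('n \<Rightarrow> 'l) \<Rightarrow> ('m, 'n) tensor \<Rightarrow> ('k, 'l) tensor" where
  "tensor_map A M N M' N' f g =
     tensor_lift A M N (tensor_add_group A M' N') (\<lambda>x y. tensor_elem A M' N' (f x) (g y))"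

text \<open>The associativity isomorphism \<open>(M \<otimes> N) \<otimes> P \<rightarrow> M \<otimes> (N \<otimes> P)\<close> and its inverse.\<close>

definition tensor_assoc ::
    "('a, 'p) ring_scheme \<Rightarrow> ('a, 'm, 'q) right_mod_scheme \<Rightarrow> ('a, 'n, 's) bimod_scheme
      \<Rightarrow> ('a, 'k, 't) bimod_scheme \<Rightarrow> (('m, 'n) tensor, 'k) tensor \<Rightarrow> ('m, ('n, 'k) tensor) tensor" where
  "tensor_assoc A M N P =
     tensor_lift A (tensor_right A M N) P (tensor_add_group A M (tensor_bimod A N P))
       (\<lambda>t z. tensor_lift A M N (tensor_add_group A M (tensor_bimod A N P))
          (\<lambda>x y. tensor_elem A M (tensor_bimod A N P) x (tensor_elem A N P y z)) t)"

definition tensor_assoc_inv ::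
    "('a, 'p) ring_scheme \<Rightarrow> ('a, 'm, 'q) right_mod_scheme \<Rightarrow> ('a, 'n, 's) bimod_scheme
      \<Rightarrow> ('a, 'k, 't) bimod_scheme \<Rightarrow> ('m, ('n, 'k) tensor) tensor \<Rightarrow> (('m, 'n) tensor, 'k) tensor" where
  "tensor_assoc_inv A M N P =
     tensor_lift A M (tensor_bimod A N P) (tensor_add_group A (tensor_right A M N) P)
       (\<lambda>x t. tensor_lift A N P (tensor_add_group A (tensor_right A M N) P)
          (\<lambda>y z. tensor_elem A (tensor_right A M N) P (tensor_elem A M N x y) z) t)"


section \<open>Corings and their comodules\<close>

record ('a, 'c) coring = "('a, 'c) bimod" +
  cop :: "'c \<Rightarrow> ('c, 'c) tensor"
  cou :: "'c \<Rightarrow> 'a"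

locale is_coring = bimodule A C
  for A :: "('a, 'p) ring_scheme" and C :: "('a, 'c, 'q) coring_scheme" +
  assumes cop_hom: "cop C \<in> bimod_hom A C (tensor_bimod A C C)"
    and cou_hom: "cou C \<in> bimod_hom A C (regular_bimod A)"
    and coassociative: "c \<in> carrier C \<Longrightarrow>
      tensor_assoc A C C C (tensor_map A C C (tensor_bimod A C C) C (cop C) id (cop C c))
        = tensor_map A C C C (tensor_bimod A C C) id (cop C) (cop C c)"
    and left_counital: "c \<in> carrier C \<Longrightarrow>
      tensor_lift A C C C (\<lambda>x y. cou C x \<triangleright>\<^bsub>C\<^esub> y) (cop C c) = c"
    and right_counital: "c \<in> carrier C \<Longrightarrow>
      tensor_lift A C C C (\<lambda>x y. x \<triangleleft>\<^bsub>C\<^esub> cou C y) (cop C c) = c"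

record ('a, 'm, 'c) comod = "('a, 'm) right_mod" +
  coact :: "'m \<Rightarrow> ('m, 'c) tensor"

locale right_comodule = right_module A M
  for A :: "('a, 'p) ring_scheme" and C :: "('a, 'c, 'q) coring_scheme"
    and M :: "('a, 'm, 'c, 's) comod_scheme" +
  assumes coact_hom: "coact M \<in> right_hom A M (tensor_right A M C)"
    and coact_coassociative: "x \<in> carrier M \<Longrightarrow>
      tensor_assoc A M C C (tensor_map A M C (tensor_right A M C) C (coact M) id (coact M x))
        = tensor_map A M C M (tensor_bimod A C C) id (cop C) (coact M x)"
    and coact_counital: "x \<in> carrier M \<Longrightarrow>
      tensor_lift A M C M (\<lambda>y c. y \<triangleleft>\<^bsub>M\<^esub> cou C c) (coact M x) = x"

definition comod_hom ::
    "('a, 'p) ring_scheme \<Rightarrow> ('a, 'c, 'q) coring_scheme \<Rightarrow> ('a, 'm, 'c, 's) comod_scheme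
      \<Rightarrow> ('a, 'n, 'c, 't) comod_scheme \<Rightarrow> ('m \<Rightarrow> 'n) set" where
  "comod_hom A C M N = {f \<in> right_hom A M N.
     \<forall>x\<in>carrier M. tensor_map A M C N C f id (coact M x) = coact N (f x)}"

definition regular_comod :: "('a, 'c, 'q) coring_scheme \<Rightarrow> ('a, 'c, 'c) comod" where
  "regular_comod C = \<lparr>carrier = carrier C, monoid.mult = undefined, one = undefined,
     ring.zero = ring.zero C, add = add C, ract = ract C, coact = cop C\<rparr>"


section \<open>Coseparable corings\<close>

record ('a, 'm, 'c) bicomod = "('a, 'm) bimod" +
  lcoact :: "'m \<Rightarrow> ('c, 'm) tensor"
  rcoact :: "'m \<Rightarrow> ('m, 'c) tensor"

definition bicomod_hom ::
    "('a, 'p) ring_scheme \<Rightarrow> ('a, 'c, 'q) coring_scheme \<Rightarrow> ('a, 'm, 'c, 's) bicomod_scheme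
      \<Rightarrow> ('a, 'n, 'c, 't) bicomod_scheme \<Rightarrow> ('m \<Rightarrow> 'n) set" where
  "bicomod_hom A C M N = {f \<in> bimod_hom A M N.
     (\<forall>x\<in>carrier M. tensor_map A C M C N id f (lcoact M x) = lcoact N (f x)) \<and>
     (\<forall>x\<in>carrier M. tensor_map A M C N C f id (rcoact M x) = rcoact N (f x))}"

definition regular_bicomod :: "('a, 'c, 'q) coring_scheme \<Rightarrow> ('a, 'c, 'c) bicomod" where
  "regular_bicomod C = \<lparr>carrier = carrier C, monoid.mult = undefined, one = undefined,
     ring.zero = ring.zero C, add = add C, ract = ract C, lact = lact C, lcoact = cop C, rcoact = cop C\<rparr>"

text \<open>\<open>C \<otimes>\<^sub>A C\<close> with left coaction \<open>\<Delta> \<otimes> C\<close> and right coaction \<open>C \<otimes> \<Delta>\<close>.\<close>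

definition tensor_bicomod ::
    "('a, 'p) ring_scheme \<Rightarrow> ('a, 'c, 'q) coring_scheme \<Rightarrow> ('a, ('c, 'c) tensor, 'c) bicomod" where
  "tensor_bicomod A C = bimod.extend (tensor_bimod A C C)
     \<lparr>lcoact = (\<lambda>t. tensor_assoc A C C C (tensor_map A C C (tensor_bimod A C C) C (cop C) id t)),
      rcoact = (\<lambda>t. tensor_assoc_inv A C C C (tensor_map A C C C (tensor_bimod A C C) id (cop C) t))\<rparr>"

definition coseparable :: "('a, 'p) ring_scheme \<Rightarrow> ('a, 'c, 'q) coring_scheme \<Rightarrow> bool" where
  "coseparable A C \<longleftrightarrow>
     cop C \<in> bicomod_hom A C (regular_bicomod C) (tensor_bicomod A C) \<and>
     (\<exists>\<pi> \<in> bicomod_hom A C (tensor_bicomod A C) (regular_bicomod C).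
        \<forall>c\<in>carrier C. \<pi> (cop C c) = c)"


section \<open>The monad \<open>[C, -]\<close> and its modules\<close>

definition monad_map ::
    "('a, 'p) ring_scheme \<Rightarrow> ('a, 'c, 'q) coring_scheme \<Rightarrow> ('a, 'm, 's) right_mod_scheme
      \<Rightarrow> ('m \<Rightarrow> 'n) \<Rightarrow> ('c \<Rightarrow> 'm) \<Rightarrow> 'c \<Rightarrow> 'n" where
  "monad_map A C M g = (\<lambda>f\<in>carrier (hom_module A C M). compose (carrier C) g f)"

definition monad_unit ::
    "('a, 'c, 'q) coring_scheme \<Rightarrow> ('a, 'm, 's) right_mod_scheme \<Rightarrow> 'm \<Rightarrow> 'c \<Rightarrow> 'm" where
  "monad_unit C M x = (\<lambda>c\<in>carrier C. x \<triangleleft>\<^bsub>M\<^esub> cou C c)"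

definition monad_mult ::
    "('a, 'p) ring_scheme \<Rightarrow> ('a, 'c, 'q) coring_scheme \<Rightarrow> ('a, 'm, 's) right_mod_scheme
      \<Rightarrow> ('c \<Rightarrow> 'c \<Rightarrow> 'm) \<Rightarrow> 'c \<Rightarrow> 'm" where
  "monad_mult A C M F = (\<lambda>c\<in>carrier C. tensor_lift A C C M (\<lambda>x y. F x y) (cop C c))"

record ('a, 'm, 'c) em_mod = "('a, 'm) right_mod" +
  alg :: "('c \<Rightarrow> 'm) \<Rightarrow> 'm"

locale em_module = right_module A M
  for A :: "('a, 'p) ring_scheme" and C :: "('a, 'c, 'q) coring_scheme"
    and M :: "('a, 'm, 'c, 's) em_mod_scheme" +
  assumes alg_hom: "alg M \<in> right_hom A (hom_module A C M) M"
    and alg_unit: "x \<in> carrier M \<Longrightarrow> alg M (monad_unit C M x) = x"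
    and alg_mult: "F \<in> carrier (hom_module A C (hom_module A C M)) \<Longrightarrow>
      alg M (monad_map A C (hom_module A C M) (alg M) F) = alg M (monad_mult A C M F)"

definition em_hom ::
    "('a, 'p) ring_scheme \<Rightarrow> ('a, 'c, 'q) coring_scheme \<Rightarrow> ('a, 'm, 'c, 's) em_mod_scheme
      \<Rightarrow> ('a, 'n, 'c, 't) em_mod_scheme \<Rightarrow> ('m \<Rightarrow> 'n) set" where
  "em_hom A C M N = {g \<in> right_hom A M N.
     \<forall>f\<in>carrier (hom_module A C M). g (alg M f) = alg N (monad_map A C M g f)}"


section \<open>Categories and equivalences\<close>

record ('o, 'm) category =
  Ob :: "'o set"
  Ar :: "'o \<Rightarrow> 'o \<Rightarrow> 'm set"
  Idn :: "'o \<Rightarrow> 'm"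
  Cmp :: "'o \<Rightarrow> 'o \<Rightarrow> 'o \<Rightarrow> 'm \<Rightarrow> 'm \<Rightarrow> 'm"
    \<comment> \<open>\<open>Cmp \<C> X Y Z g f\<close> is the composite of \<open>f : X \<rightarrow> Y\<close> and \<open>g : Y \<rightarrow> Z\<close>\<close>

locale is_category =
  fixes \<C> :: "('o, 'm) category"
  assumes Idn_Ar: "X \<in> Ob \<C> \<Longrightarrow> Idn \<C> X \<in> Ar \<C> X X"
    and Cmp_Ar: "\<lbrakk>X \<in> Ob \<C>; Y \<in> Ob \<C>; Z \<in> Ob \<C>; f \<in> Ar \<C> X Y; g \<in> Ar \<C> Y Z\<rbrakk>
      \<Longrightarrow> Cmp \<C> X Y Z g f \<in> Ar \<C> X Z"
    and Cmp_Idn_right: "\<lbrakk>X \<in> Ob \<C>; Y \<in> Ob \<C>; f \<in> Ar \<C> X Y\<rbrakk>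
      \<Longrightarrow> Cmp \<C> X X Y f (Idn \<C> X) = f"
    and Cmp_Idn_left: "\<lbrakk>X \<in> Ob \<C>; Y \<in> Ob \<C>; f \<in> Ar \<C> X Y\<rbrakk>
      \<Longrightarrow> Cmp \<C> X Y Y (Idn \<C> Y) f = f"
    and Cmp_assoc: "\<lbrakk>W \<in> Ob \<C>; X \<in> Ob \<C>; Y \<in> Ob \<C>; Z \<in> Ob \<C>;
        f \<in> Ar \<C> W X; g \<in> Ar \<C> X Y; h \<in> Ar \<C> Y Z\<rbrakk>
      \<Longrightarrow> Cmp \<C> W Y Z h (Cmp \<C> W X Y g f) = Cmp \<C> W X Z (Cmp \<C> X Y Z h g) f"

record ('o, 'm, 'p, 'n) functr =
  Fob :: "'o \<Rightarrow> 'p"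
  Far :: "'o \<Rightarrow> 'o \<Rightarrow> 'm \<Rightarrow> 'n"

locale is_functor = source: is_category \<C> + target: is_category \<D>
  for \<C> :: "('o, 'm) category" and \<D> :: "('p, 'n) category" and F :: "('o, 'm, 'p, 'n) functr" +
  assumes Fob_Ob: "X \<in> Ob \<C> \<Longrightarrow> Fob F X \<in> Ob \<D>"
    and Far_Ar: "\<lbrakk>X \<in> Ob \<C>; Y \<in> Ob \<C>; f \<in> Ar \<C> X Y\<rbrakk>
      \<Longrightarrow> Far F X Y f \<in> Ar \<D> (Fob F X) (Fob F Y)"
    and Far_Idn: "X \<in> Ob \<C> \<Longrightarrow> Far F X X (Idn \<C> X) = Idn \<D> (Fob F X)"
    and Far_Cmp: "\<lbrakk>X \<in> Ob \<C>; Y \<in> Ob \<C>; Z \<in> Ob \<C>; f \<in> Ar \<C> X Y; g \<in> Ar \<C> Y Z\<rbrakk>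
      \<Longrightarrow> Far F X Z (Cmp \<C> X Y Z g f)
        = Cmp \<D> (Fob F X) (Fob F Y) (Fob F Z) (Far F Y Z g) (Far F X Y f)"

definition id_functor :: "('o, 'm, 'o, 'm) functr" where
  "id_functor = \<lparr>Fob = (\<lambda>X. X), Far = (\<lambda>X Y f. f)\<rparr>"

definition comp_functor ::
    "('p, 'n, 'q, 'k) functr \<Rightarrow> ('o, 'm, 'p, 'n) functr \<Rightarrow> ('o, 'm, 'q, 'k) functr" where
  "comp_functor G F = \<lparr>Fob = (\<lambda>X. Fob G (Fob F X)),
     Far = (\<lambda>X Y f. Far G (Fob F X) (Fob F Y) (Far F X Y f))\<rparr>"

definition isos :: "('o, 'm) category \<Rightarrow> 'o \<Rightarrow> 'o \<Rightarrow> 'm set" where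
  "isos \<C> X Y = {f \<in> Ar \<C> X Y. \<exists>g\<in>Ar \<C> Y X.
     Cmp \<C> X Y X g f = Idn \<C> X \<and> Cmp \<C> Y X Y f g = Idn \<C> Y}"

definition naturally_isomorphic ::
    "('o, 'm) category \<Rightarrow> ('p, 'n) category \<Rightarrow> ('o, 'm, 'p, 'n) functr
      \<Rightarrow> ('o, 'm, 'p, 'n) functr \<Rightarrow> bool" where
  "naturally_isomorphic \<C> \<D> F G \<longleftrightarrow>
     (\<exists>\<tau>. (\<forall>X\<in>Ob \<C>. \<tau> X \<in> isos \<D> (Fob F X) (Fob G X)) \<and>
       (\<forall>X\<in>Ob \<C>. \<forall>Y\<in>Ob \<C>. \<forall>f\<in>Ar \<C> X Y.
          Cmp \<D> (Fob F X) (Fob F Y) (Fob G Y) (\<tau> Y) (Far F X Y f)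
            = Cmp \<D> (Fob F X) (Fob G X) (Fob G Y) (Far G X Y f) (\<tau> X)))"

definition is_equivalence ::
    "('o, 'm) category \<Rightarrow> ('p, 'n) category \<Rightarrow> ('o, 'm, 'p, 'n) functr \<Rightarrow> bool" where
  "is_equivalence \<C> \<D> F \<longleftrightarrow> is_functor \<C> \<D> F \<and>
     (\<exists>G. is_functor \<D> \<C> G \<and>
        naturally_isomorphic \<C> \<C> (comp_functor G F) id_functor \<and>
        naturally_isomorphic \<D> \<D> (comp_functor F G) id_functor)"

definition equivalent_categories :: "('o, 'm) category \<Rightarrow> ('p, 'n) category \<Rightarrow> bool" where
  "equivalent_categories \<C> \<D> \<longleftrightarrow> (\<exists>F. is_equivalence \<C> \<D> F)"

text \<open>Categories of modules with additional structure consist of the structures whose carrier is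
  a subset of a type \<open>'u\<close>, which plays the role of the universe. Statements that compare such
  categories require \<open>'u\<close> to be closed under the formation of \<open>'i\<close>-indexed families, in the sense
  that \<open>'i \<Rightarrow> 'u\<close> embeds into \<open>'u\<close>. Every type \<open>'w\<close> embeds into such a universe, namely
  \<open>nat \<times> 'i \<Rightarrow> 'w\<close>.\<close>

definition closed_under_families :: "'i itself \<Rightarrow> 'u itself \<Rightarrow> bool" where
  "closed_under_families TYPE('i) TYPE('u) \<longleftrightarrow> (\<exists>e :: ('i \<Rightarrow> 'u) \<Rightarrow> 'u. inj e)"

text \<open>Morphisms are extensional functions, so that equal maps are equal morphisms.\<close>

definition comod_category ::
    "('a, 'p) ring_scheme \<Rightarrow> ('a, 'c, 'q) coring_scheme
      \<Rightarrow> (('a, 'u, 'c) comod, 'u \<Rightarrow> 'u) category" where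
  "comod_category A C = \<lparr>Ob = {M. right_comodule A C M},
     Ar = (\<lambda>M N. comod_hom A C M N \<inter> extensional (carrier M)),
     Idn = (\<lambda>M. \<lambda>x\<in>carrier M. x),
     Cmp = (\<lambda>M N P g f. compose (carrier M) g f)\<rparr>"

definition em_category ::
    "('a, 'p) ring_scheme \<Rightarrow> ('a, 'c, 'q) coring_scheme
      \<Rightarrow> (('a, 'u, 'c) em_mod, 'u \<Rightarrow> 'u) category" where
  "em_category A C = \<lparr>Ob = {M. em_module A C M},
     Ar = (\<lambda>M N. em_hom A C M N \<inter> extensional (carrier M)),
     Idn = (\<lambda>M. \<lambda>x\<in>carrier M. x),
     Cmp = (\<lambda>M N P g f. compose (carrier M) g f)\<rparr>"

text \<open>The functor \<open>Hom\<^sup>C(C, -)\<close>. The structure map \<open>Hom\<^sub>A(C, Hom\<^sup>C(C, Q)) \<rightarrow> Hom\<^sup>C(C, Q)\<close> sends \<open>F\<close> to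
  \<open>c \<mapsto> F c\<^sub>1 c\<^sub>2\<close>, i.e. is the same formula as the multiplication of the monad \<open>[C, -]\<close>. On
  comodules in \<open>'u\<close> the functor takes values in the modules in \<open>'c \<Rightarrow> 'u\<close>; if \<open>'u\<close> is closed under
  \<open>'c\<close>-indexed families, this is a universe of the same size as \<open>'u\<close>.\<close>

definition comod_hom_em ::
    "('a, 'p) ring_scheme \<Rightarrow> ('a, 'c, 'q) coring_scheme \<Rightarrow> ('a, 'm, 'c, 's) comod_scheme
      \<Rightarrow> ('a, 'c \<Rightarrow> 'm, 'c) em_mod" where
  "comod_hom_em A C Q = right_mod.extend
     ((hom_module A C Q)
        \<lparr>carrier := comod_hom A C (regular_comod C) Q \<inter> extensional (carrier C)\<rparr>)
     \<lparr>alg = monad_mult A C Q\<rparr>"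

definition comod_hom_functor ::
    "('a, 'p) ring_scheme \<Rightarrow> ('a, 'c, 'q) coring_scheme
      \<Rightarrow> (('a, 'u, 'c) comod, 'u \<Rightarrow> 'u, ('a, 'c \<Rightarrow> 'u, 'c) em_mod, ('c \<Rightarrow> 'u) \<Rightarrow> ('c \<Rightarrow> 'u)) functr" where
  "comod_hom_functor A C = \<lparr>Fob = comod_hom_em A C,
     Far = (\<lambda>P Q g. \<lambda>f\<in>carrier (comod_hom_em A C P). compose (carrier C) g f)\<rparr>"


section \<open>Bialgebras, Hopf algebras and Hopf modules\<close>

record ('r, 'h) bialgebra = "('r, 'h) module" +
  comult :: "'h \<Rightarrow> ('h, 'h) tensor"
  counit :: "'h \<Rightarrow> 'r"

text \<open>\<open>\<otimes>\<^sub>R\<close> of \<open>R\<close>-modules is the tensor product above, \<open>R\<close> acting on both sides in the same way; an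
  \<open>R\<close>-coalgebra is an \<open>R\<close>-coring of this kind. \<open>under_coalgebra H\<close> is the coalgebra underlying \<open>H\<close>.\<close>

definition under_coalgebra :: "('r, 'h, 'z) bialgebra_scheme \<Rightarrow> ('r, 'h) coring" where
  "under_coalgebra H = \<lparr>carrier = carrier H, monoid.mult = undefined, one = undefined,
     ring.zero = ring.zero H, add = add H, ract = (\<lambda>x r. r \<odot>\<^bsub>H\<^esub> x), lact = (\<lambda>r x. r \<odot>\<^bsub>H\<^esub> x),
     cop = comult H, cou = counit H\<rparr>"

text \<open>Restriction of scalars along \<open>R \<rightarrow> H\<close>, \<open>r \<mapsto> r 1\<^sub>H\<close>.\<close>

definition restrict_scalars ::
    "('r, 'h, 'z) bialgebra_scheme \<Rightarrow> ('h, 'm, 's) right_mod_scheme \<Rightarrow> ('r, 'm) right_mod" where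
  "restrict_scalars H M = \<lparr>carrier = carrier M, monoid.mult = undefined, one = undefined,
     ring.zero = ring.zero M, add = add M, ract = (\<lambda>x r. x \<triangleleft>\<^bsub>M\<^esub> (r \<odot>\<^bsub>H\<^esub> \<one>\<^bsub>H\<^esub>))\<rparr>"

text \<open>\<open>(m \<otimes> h) (b \<otimes> b') = m b \<otimes> h b'\<close> in \<open>M \<otimes>\<^sub>R H\<close>, for a right \<open>H\<close>-module \<open>M\<close> and
  \<open>b \<otimes> b' \<in> H \<otimes>\<^sub>R H\<close>.\<close>

definition tensor_act ::
    "('r, 'p) ring_scheme \<Rightarrow> ('r, 'h, 'z) bialgebra_scheme \<Rightarrow> ('h, 'm, 's) right_mod_scheme
      \<Rightarrow> ('m, 'h) tensor \<Rightarrow> ('h, 'h) tensor \<Rightarrow> ('m, 'h) tensor" where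
  "tensor_act R H M t u =
     (let M\<^sub>R = restrict_scalars H M; H\<^sub>R = under_coalgebra H; T = tensor_add_group R M\<^sub>R H\<^sub>R in
      tensor_lift R M\<^sub>R H\<^sub>R T
        (\<lambda>m h. tensor_lift R H\<^sub>R H\<^sub>R T
           (\<lambda>b b'. tensor_elem R M\<^sub>R H\<^sub>R (m \<triangleleft>\<^bsub>M\<^esub> b) (h \<otimes>\<^bsub>H\<^esub> b')) u) t)"

locale is_bialgebra = module R H + H: ring H
  for R :: "('r, 'p) ring_scheme" and H :: "('r, 'h, 'z) bialgebra_scheme" +
  assumes smult_mult_left: "\<lbrakk>r \<in> carrier R; a \<in> carrier H; b \<in> carrier H\<rbrakk>
      \<Longrightarrow> (r \<odot>\<^bsub>H\<^esub> a) \<otimes>\<^bsub>H\<^esub> b = r \<odot>\<^bsub>H\<^esub> (a \<otimes>\<^bsub>H\<^esub> b)"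
    and smult_mult_right: "\<lbrakk>r \<in> carrier R; a \<in> carrier H; b \<in> carrier H\<rbrakk>
      \<Longrightarrow> a \<otimes>\<^bsub>H\<^esub> (r \<odot>\<^bsub>H\<^esub> b) = r \<odot>\<^bsub>H\<^esub> (a \<otimes>\<^bsub>H\<^esub> b)"
    and coalgebra: "is_coring R (under_coalgebra H)"
    and comult_mult: "\<lbrakk>a \<in> carrier H; b \<in> carrier H\<rbrakk>
      \<Longrightarrow> comult H (a \<otimes>\<^bsub>H\<^esub> b) = tensor_act R H (regular_bimod H) (comult H a) (comult H b)"
    and comult_one: "comult H \<one>\<^bsub>H\<^esub>
      = tensor_elem R (under_coalgebra H) (under_coalgebra H) \<one>\<^bsub>H\<^esub> \<one>\<^bsub>H\<^esub>"
    and counit_mult: "\<lbrakk>a \<in> carrier H; b \<in> carrier H\<rbrakk>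
      \<Longrightarrow> counit H (a \<otimes>\<^bsub>H\<^esub> b) = counit H a \<otimes>\<^bsub>R\<^esub> counit H b"
    and counit_one: "counit H \<one>\<^bsub>H\<^esub> = \<one>\<^bsub>R\<^esub>"

definition is_antipode ::
    "('r, 'p) ring_scheme \<Rightarrow> ('r, 'h, 'z) bialgebra_scheme \<Rightarrow> ('h \<Rightarrow> 'h) \<Rightarrow> bool" where
  "is_antipode R H S \<longleftrightarrow>
     (let H\<^sub>R = under_coalgebra H in
      S \<in> right_hom R H\<^sub>R H\<^sub>R \<and>
      (\<forall>b\<in>carrier H.
         tensor_lift R H\<^sub>R H\<^sub>R H (\<lambda>x y. S x \<otimes>\<^bsub>H\<^esub> y) (comult H b) = counit H b \<odot>\<^bsub>H\<^esub> \<one>\<^bsub>H\<^esub> \<and>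
         tensor_lift R H\<^sub>R H\<^sub>R H (\<lambda>x y. x \<otimes>\<^bsub>H\<^esub> S y) (comult H b) = counit H b \<odot>\<^bsub>H\<^esub> \<one>\<^bsub>H\<^esub>))"

locale hopf_algebra = is_bialgebra R H
  for R :: "('r, 'p) ring_scheme" and H :: "('r, 'h, 'z) bialgebra_scheme" +
  assumes antipode: "\<exists>S. is_antipode R H S"

text \<open>The \<open>H\<close>-coring \<open>H \<otimes>\<^sub>R\<^sup>r H\<close>: the bimodule with \<open>d (a \<otimes> b) c = d a c\<^sub>1 \<otimes> b c\<^sub>2\<close>, coproduct
  \<open>a \<otimes> b \<mapsto> (a \<otimes> b\<^sub>1) \<otimes>\<^sub>H (1 \<otimes> b\<^sub>2)\<close> and counit \<open>a \<otimes> b \<mapsto> a \<epsilon>(b)\<close>.\<close>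

definition hopf_bimod ::
    "('r, 'p) ring_scheme \<Rightarrow> ('r, 'h, 'z) bialgebra_scheme \<Rightarrow> ('h, ('h, 'h) tensor) bimod" where
  "hopf_bimod R H =
     (let H\<^sub>R = under_coalgebra H; T = tensor_add_group R H\<^sub>R H\<^sub>R in
      ring.extend T
        \<lparr>ract = (\<lambda>t c. tensor_act R H (regular_bimod H) t (comult H c)),
         lact = (\<lambda>d. tensor_map R H\<^sub>R H\<^sub>R H\<^sub>R H\<^sub>R (\<lambda>a. d \<otimes>\<^bsub>H\<^esub> a) id)\<rparr>)"

definition hopf_coring ::
    "('r, 'p) ring_scheme \<Rightarrow> ('r, 'h, 'z) bialgebra_scheme \<Rightarrow> ('h, ('h, 'h) tensor) coring" where
  "hopf_coring R H =
     (let H\<^sub>R = under_coalgebra H; B = hopf_bimod R H; BB = tensor_add_group H B B;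
          elem = tensor_elem R H\<^sub>R H\<^sub>R in
      bimod.extend B
        \<lparr>cop = tensor_lift R H\<^sub>R H\<^sub>R BB
           (\<lambda>a b. tensor_lift R H\<^sub>R H\<^sub>R BB
              (\<lambda>b\<^sub>1 b\<^sub>2. tensor_elem H B B (elem a b\<^sub>1) (elem \<one>\<^bsub>H\<^esub> b\<^sub>2)) (comult H b)),
         cou = tensor_lift R H\<^sub>R H\<^sub>R H (\<lambda>a b. counit H b \<odot>\<^bsub>H\<^esub> a)\<rparr>)"

text \<open>A right \<open>H\<close>-module is an \<open>R\<close>-module by restriction of scalars. A Hopf module is recorded as a
  right \<open>H\<close>-module with a coaction \<open>M \<rightarrow> M \<otimes>\<^sub>R H\<close>, an \<open>[H, -]\<close>-Hopf module as a right \<open>H\<close>-module with a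
  map \<open>Hom\<^sub>R(H, M) \<rightarrow> M\<close>.\<close>

definition restrict_comod ::
    "('r, 'h, 'z) bialgebra_scheme \<Rightarrow> ('h, 'm, 'h) comod \<Rightarrow> ('r, 'm, 'h) comod" where
  "restrict_comod H M = right_mod.extend (restrict_scalars H M) \<lparr>coact = coact M\<rparr>"

definition restrict_em ::
    "('r, 'h, 'z) bialgebra_scheme \<Rightarrow> ('h, 'm, 'h) em_mod \<Rightarrow> ('r, 'm, 'h) em_mod" where
  "restrict_em H M = right_mod.extend (restrict_scalars H M) \<lparr>alg = alg M\<rparr>"

locale hopf_module = right_module H M
  for R :: "('r, 'p) ring_scheme" and H :: "('r, 'h, 'z) bialgebra_scheme"
    and M :: "('h, 'm, 'h) comod" +
  assumes comodule: "right_comodule R (under_coalgebra H) (restrict_comod H M)"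
    and compatible: "\<lbrakk>m \<in> carrier M; b \<in> carrier H\<rbrakk>
      \<Longrightarrow> coact M (m \<triangleleft>\<^bsub>M\<^esub> b) = tensor_act R H M (coact M m) (comult H b)"

locale hom_hopf_module = right_module H M
  for R :: "('r, 'p) ring_scheme" and H :: "('r, 'h, 'z) bialgebra_scheme"
    and M :: "('h, 'm, 'h) em_mod" +
  assumes em_module: "em_module R (under_coalgebra H) (restrict_em H M)"
    and compatible: "\<lbrakk>f \<in> carrier (hom_module R (under_coalgebra H) (restrict_em H M)); b \<in> carrier H\<rbrakk>
      \<Longrightarrow> alg M f \<triangleleft>\<^bsub>M\<^esub> b = alg M (\<lambda>a\<in>carrier H.
            tensor_lift R (under_coalgebra H) (under_coalgebra H) M
              (\<lambda>b\<^sub>1 b\<^sub>2. f (b\<^sub>1 \<otimes>\<^bsub>H\<^esub> a) \<triangleleft>\<^bsub>M\<^esub> b\<^sub>2) (comult H b))"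

definition hopf_module_category ::
    "('r, 'p) ring_scheme \<Rightarrow> ('r, 'h, 'z) bialgebra_scheme
      \<Rightarrow> (('h, 'u, 'h) comod, 'u \<Rightarrow> 'u) category" where
  "hopf_module_category R H = \<lparr>Ob = {M. hopf_module R H M},
     Ar = (\<lambda>M N. right_hom H M N \<inter>
       comod_hom R (under_coalgebra H) (restrict_comod H M) (restrict_comod H N) \<inter>
       extensional (carrier M)),
     Idn = (\<lambda>M. \<lambda>x\<in>carrier M. x),
     Cmp = (\<lambda>M N P g f. compose (carrier M) g f)\<rparr>"

definition hom_hopf_module_category ::
    "('r, 'p) ring_scheme \<Rightarrow> ('r, 'h, 'z) bialgebra_scheme
      \<Rightarrow> (('h, 'u, 'h) em_mod, 'u \<Rightarrow> 'u) category" where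
  "hom_hopf_module_category R H = \<lparr>Ob = {M. hom_hopf_module R H M},
     Ar = (\<lambda>M N. right_hom H M N \<inter>
       em_hom R (under_coalgebra H) (restrict_em H M) (restrict_em H N) \<inter>
       extensional (carrier M)),
     Idn = (\<lambda>M. \<lambda>x\<in>carrier M. x),
     Cmp = (\<lambda>M N P g f. compose (carrier M) g f)\<rparr>"

end

theory Submission
  imports Defs
begin

text \<open>A cointegral \<open>\<delta> : C \<otimes>\<^sub>A C \<rightarrow> A\<close> makes \<open>m \<otimes> d \<mapsto> m\<^sub>0 \<delta>(m\<^sub>1, d)\<close> a colinear retraction of the coaction of a
  comodule, so every comodule is a retract of a cofree one; dually, every \<open>[C, -]\<close>-module \<open>M\<close> splits an
  idempotent endomorphism of the cofree comodule \<open>M \<otimes>\<^sub>A C\<close>, whose image is the comodule corresponding to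
  \<open>M\<close>. For \<open>C = H \<otimes>\<^sub>R\<^sup>r H\<close> a cointegral is \<open>(a \<otimes> b) \<otimes> (c \<otimes> d) \<mapsto> \<epsilon>(c) a S(b) d\<close>. Finally, both categories
  of Hopf modules are equivalent to the category of \<open>R\<close>-modules: a Hopf module is \<open>N \<otimes>\<^sub>R H\<close> for its module \<open>N\<close>
  of coinvariants \<open>m\<^sub>0 S(m\<^sub>1)\<close>, and an \<open>[H, -]\<close>-Hopf module is \<open>Hom\<^sub>R(H, N)\<close> for its module \<open>N\<close> of invariants
  \<open>\<alpha>(m S(-))\<close>.\<close>

text \<open>The formula of the cointegral has a source:
  \<open>a \<otimes> b \<mapsto> a b\<^sub>1 \<otimes> b\<^sub>2\<close> is an isomorphism from the
  Sweedler coring \<open>H \<otimes>\<^sub>R H\<close> of the extension R -> H onto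
  \<open>H \<otimes>\<^sub>R\<^sup>r H\<close>, with inverse
  \<open>a \<otimes> b \<mapsto> a S(b\<^sub>1) \<otimes> b\<^sub>2\<close>. Since \<epsilon> splits
  R -> H, the Sweedler coring has the cointegral
  \<open>a \<otimes> b \<otimes> d \<mapsto> a \<epsilon>(b) d\<close>, and the formula is its
  transport. The form of the proof is dictated by size. An object is a structure on a subset of one
  fixed type, while the tensor products and Hom sets that realize a given object live on other
  types. So no quasi-inverse is written down: each functor is shown to be full, faithful and
  essentially surjective, and structures are built on whatever set is prescribed, a cardinality
  argument embedding a tensor product into the universe. All element computations are Sweedler sums.
  Each is the lift of a balanced map, and two sums are compared by induction over elementary tensors
  or by pulling additive maps into the lift.\<close>

text \<open>\<open>x \<triangleleft>[M] a\<close>, \<open>x \<oplus>[M] y\<close> etc. name the structure in brackets, and \<open>x ::: M\<close> is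
  \<open>x \<in> carrier M\<close>.\<close>

abbreviation (input) in_carrier (infix ":::" 50) where "x ::: M \<equiv> x \<in> carrier M"
abbreviation (input) ract_in ("(_ \<triangleleft>[_] _)" [70, 0, 71] 70) where "x \<triangleleft>[M] a \<equiv> ract M x a"
abbreviation (input) lact_in ("(_ \<triangleright>[_] _)" [71, 0, 70] 70) where "a \<triangleright>[M] x \<equiv> lact M a x"
abbreviation (input) add_in ("(_ \<oplus>[_] _)" [65, 0, 66] 65) where "x \<oplus>[M] y \<equiv> add M x y"
abbreviation (input) mult_in ("(_ \<otimes>[_] _)" [70, 0, 71] 70) where "x \<otimes>[M] y \<equiv> monoid.mult M x y"
abbreviation (input) smult_in ("(_ \<odot>[_] _)" [70, 0, 71] 70) where "r \<odot>[M] x \<equiv> smult M r x"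
abbreviation (input) one_in ("\<one>[_]") where "\<one>[M] \<equiv> one M"
abbreviation (input) zero_in ("\<zero>[_]") where "\<zero>[M] \<equiv> ring.zero M"

abbreviation "add_hom M N \<equiv> hom (add_monoid M) (add_monoid N)"
abbreviation "tlift \<equiv> tensor_lift"
abbreviation "telem \<equiv> tensor_elem"
abbreviation "tgroup \<equiv> tensor_add_group"
abbreviation "tright \<equiv> tensor_right"
abbreviation "tbimod \<equiv> tensor_bimod"

section \<open>Additive maps\<close>

lemma hom_add:
  "[|f \<in> add_hom M P; x ::: M; y ::: M|] ==> f (x \<oplus>[M] y) = f x \<oplus>[P] f y"
  by (simp add: hom_def)

lemma hom_carrier_add:
  "[|f \<in> add_hom M P; x ::: M|] ==> f x ::: P"
  by (auto simp: hom_def)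

lemma add_homI:
  assumes "\<And>x. x ::: M ==> f x ::: P"
    and "\<And>x y. [|x ::: M; y ::: M|] ==> f (x \<oplus>[M] y) = f x \<oplus>[P] f y"
  shows "f \<in> add_hom M P"
  using assms by (simp add: hom_def)

lemma hom_zero:
  assumes "f \<in> add_hom M P" "abelian_group M" "abelian_group P"
  shows "f \<zero>[M] = \<zero>[P]"
  using hom_one[OF assms(1)] assms(2,3) by (simp add: abelian_group.a_group)

lemma right_homI:
  assumes "\<And>x. x ::: M ==> f x ::: P"
    and "\<And>x y. [|x ::: M; y ::: M|] ==> f (x \<oplus>[M] y) = f x \<oplus>[P] f y"
    and "\<And>x a. [|x ::: M; a ::: A|] ==> f (x \<triangleleft>[M] a) = f x \<triangleleft>[P] a"
  shows "f \<in> right_hom A M P"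
  using assms by (simp add: right_hom_def add_homI)

lemma right_homD:
  assumes "f \<in> right_hom A M P"
  shows "f \<in> add_hom M P"
    and "x ::: M ==> f x ::: P"
    and "[|x ::: M; y ::: M|] ==> f (x \<oplus>[M] y) = f x \<oplus>[P] f y"
    and "[|x ::: M; a ::: A|] ==> f (x \<triangleleft>[M] a) = f x \<triangleleft>[P] a"
  using assms by (auto simp: right_hom_def hom_add intro: hom_carrier_add)

text \<open>Only the left action of the second tensor factor enters the tensor product, so second factors
  are compared by additive maps commuting with the left action.\<close>

definition left_hom ::
    "('a, 'p) ring_scheme => ('a, 'm, 'q) bimod_scheme => ('a, 'n, 's) bimod_scheme => ('m => 'n) set" where
  "left_hom A M N = {f \<in> add_hom M N.
     \<forall>x\<in>carrier M. \<forall>a\<in>carrier A. f (a \<triangleright>[M] x) = a \<triangleright>[N] f x}"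

lemma left_homI:
  assumes "\<And>x. x ::: M ==> f x ::: P"
    and "\<And>x y. [|x ::: M; y ::: M|] ==> f (x \<oplus>[M] y) = f x \<oplus>[P] f y"
    and "\<And>x a. [|x ::: M; a ::: A|] ==> f (a \<triangleright>[M] x) = a \<triangleright>[P] f x"
  shows "f \<in> left_hom A M P"
  using assms by (simp add: left_hom_def add_homI)

lemma left_homD:
  assumes "f \<in> left_hom A M P"
  shows "f \<in> add_hom M P"
    and "x ::: M ==> f x ::: P"
    and "[|x ::: M; y ::: M|] ==> f (x \<oplus>[M] y) = f x \<oplus>[P] f y"
    and "[|x ::: M; a ::: A|] ==> f (a \<triangleright>[M] x) = a \<triangleright>[P] f x"
  using assms by (auto simp: left_hom_def hom_add intro: hom_carrier_add)

lemma bimod_hom_iff: "f \<in> bimod_hom A M N \<longleftrightarrow> f \<in> right_hom A M N \<and> f \<in> left_hom A M N"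
  by (auto simp: bimod_hom_def left_hom_def right_hom_def)

lemma id_right_hom: "id \<in> right_hom A M M"
  by (auto intro: right_homI)

lemma id_left_hom: "id \<in> left_hom A M M"
  by (auto intro: left_homI)


section \<open>The universal property of the tensor product\<close>

locale tensor_prod = right_module A M + N: bimodule A N
  for A :: "('a, 'p) ring_scheme" (structure)
    and M :: "('a, 'm, 'q) right_mod_scheme" and N :: "('a, 'n, 's) bimod_scheme"
begin

lemma relators_subset: "tensor_relators A M N \<subseteq> carrier (free_Abelian_group (carrier M \<times> carrier N))"
proof -
  have **: "frag_of p - frag_of q ::: (free_Abelian_group S)" if "p \<in> S" "q \<in> S"
    for p q :: "'m \<times> 'n" and S
    using that keys_diff[of "frag_of p" "frag_of q"] by auto
  have *: "frag_of p - frag_of q - frag_of r ::: (free_Abelian_group S)" if "p \<in> S" "q \<in> S" "r \<in> S"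
    for p q r :: "'m \<times> 'n" and S
    using that **[OF that(1,2)] keys_diff[of "frag_of p - frag_of q" "frag_of r"] by auto
  show ?thesis
    unfolding tensor_relators_def
    by (intro Un_least subsetI; elim CollectE exE conjE; hypsubst; (rule * | rule **))
       (simp_all add: ract_closed N.lact_closed M.add.m_closed N.M.add.m_closed)
qed

lemma relations_normal: "tensor_relations A M N \<lhd> free_Abelian_group (carrier M \<times> carrier N)"
  unfolding tensor_relations_def
  by (intro comm_group.subgroup_imp_normal abelian_free_Abelian_group group.generate_is_subgroup
      group_free_Abelian_group relators_subset)

lemma tensor_group_comm: "comm_group (tensor_group A M N)"
  unfolding tensor_group_def
  by (intro comm_group.abelian_FactGroup abelian_free_Abelian_group normal_imp_subgroup relations_normal)

lemma tensor_abelian_group: "abelian_group (tgroup A M N)"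
proof -
  interpret T: comm_group "tensor_group A M N" by (rule tensor_group_comm)
  show ?thesis
    by (rule abelian_groupI)
       (use T.l_inv_ex in "auto simp: tensor_add_group_def T.m_ac")
qed

lemma quotient_hom:
  "(%u. tensor_relations A M N #>\<^bsub>free_Abelian_group (carrier M \<times> carrier N)\<^esub> u)
     \<in> hom (free_Abelian_group (carrier M \<times> carrier N)) (add_monoid (tgroup A M N))"
  using normal.r_coset_hom_Mod[OF relations_normal]
  by (simp add: hom_def tensor_add_group_def tensor_group_def)

lemma telem_closed:
  "[|x ::: M; y ::: N|] ==> telem A M N x y ::: (tgroup A M N)"
  using hom_in_carrier[OF quotient_hom, of "frag_of (x, y)"]
  by (simp add: tensor_elem_def)

lemma quotient_relator:
  assumes "u \<in> tensor_relators A M N"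
  shows "tensor_relations A M N #>\<^bsub>free_Abelian_group (carrier M \<times> carrier N)\<^esub> u
    = \<zero>[tgroup A M N]"
proof -
  have "u \<in> tensor_relations A M N"
    unfolding tensor_relations_def by (rule generate.incl[OF assms])
  then show ?thesis
    using subgroup.rcos_const[OF normal_imp_subgroup[OF relations_normal] group_free_Abelian_group]
    by (simp add: tensor_add_group_def tensor_group_def FactGroup_def)
qed

lemma quotient_diff:
  assumes "u ::: (free_Abelian_group (carrier M \<times> carrier N))"
    "v ::: (free_Abelian_group (carrier M \<times> carrier N))" "u - v \<in> tensor_relators A M N"
  shows "tensor_relations A M N #>\<^bsub>free_Abelian_group (carrier M \<times> carrier N)\<^esub> u
    = tensor_relations A M N #>\<^bsub>free_Abelian_group (carrier M \<times> carrier N)\<^esub> v"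
proof -
  interpret T: abelian_group "tgroup A M N" by (rule tensor_abelian_group)
  have *: "u = (u - v) \<otimes>\<^bsub>free_Abelian_group (carrier M \<times> carrier N)\<^esub> v" by simp
  show ?thesis
    apply (subst *)
    apply (subst hom_mult[OF quotient_hom])
    using assms(1,2) subsetD[OF relators_subset assms(3)] hom_in_carrier[OF quotient_hom assms(2)]
    by (simp_all add: quotient_relator[OF assms(3)])
qed

lemma quotient_add:
  assumes "u ::: (free_Abelian_group (carrier M \<times> carrier N))"
    "v ::: (free_Abelian_group (carrier M \<times> carrier N))"
  shows "tensor_relations A M N #>\<^bsub>free_Abelian_group (carrier M \<times> carrier N)\<^esub> (u + v)
    = (tensor_relations A M N #>\<^bsub>free_Abelian_group (carrier M \<times> carrier N)\<^esub> u) \<oplus>[tgroup A M N]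
      (tensor_relations A M N #>\<^bsub>free_Abelian_group (carrier M \<times> carrier N)\<^esub> v)"
  using hom_mult[OF quotient_hom assms] by simp

lemma telem_add_left:
  assumes "x ::: M" "x' ::: M" "y ::: N"
  shows "telem A M N (x \<oplus>[M] x') y
    = telem A M N x y \<oplus>[tgroup A M N] telem A M N x' y"
proof -
  have "frag_of (x \<oplus>[M] x', y) - (frag_of (x, y) + frag_of (x', y)) \<in> tensor_relators A M N"
    unfolding tensor_relators_def diff_diff_eq[symmetric] using assms by blast
  from quotient_diff[OF _ _ this] show ?thesis
    using assms keys_add[of "frag_of (x, y)" "frag_of (x', y)"]
    by (auto simp: tensor_elem_def quotient_add[symmetric])
qed

lemma telem_add_right:
  assumes "x ::: M" "y ::: N" "y' ::: N"
  shows "telem A M N x (y \<oplus>[N] y')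
    = telem A M N x y \<oplus>[tgroup A M N] telem A M N x y'"
proof -
  have "frag_of (x, y \<oplus>[N] y') - (frag_of (x, y) + frag_of (x, y')) \<in> tensor_relators A M N"
    unfolding tensor_relators_def diff_diff_eq[symmetric] using assms by blast
  from quotient_diff[OF _ _ this] show ?thesis
    using assms keys_add[of "frag_of (x, y)" "frag_of (x, y')"]
    by (auto simp: tensor_elem_def quotient_add[symmetric])
qed

lemma telem_balanced:
  assumes "x ::: M" "a ::: A" "y ::: N"
  shows "telem A M N (x \<triangleleft>[M] a) y = telem A M N x (a \<triangleright>[N] y)"
proof -
  have "frag_of (x \<triangleleft>[M] a, y) - frag_of (x, a \<triangleright>[N] y) \<in> tensor_relators A M N"
    unfolding tensor_relators_def using assms by blast
  from quotient_diff[OF _ _ this] show ?thesis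
    using assms by (simp add: tensor_elem_def ract_closed N.lact_closed)
qed

text \<open>Neither zero nor negatives need a case of their own: the negative of x \<otimes> y is
  (-x) \<otimes> y, again elementary, and zero is the sum of 0 \<otimes> 0 and its negative.\<close>

lemma tensor_induct [consumes 1, case_names elem add]:
  assumes t: "t ::: (tgroup A M N)"
    and elem: "\<And>x y. [|x ::: M; y ::: N|] ==> Q (telem A M N x y)"
    and add: "\<And>s t. [|s ::: (tgroup A M N); t ::: (tgroup A M N); Q s; Q t|]
      ==> Q (s \<oplus>[tgroup A M N] t)"
  shows "Q t"
proof -
  let ?F = "free_Abelian_group (carrier M \<times> carrier N)"
  let ?q = "%u. tensor_relations A M N #>\<^bsub>?F\<^esub> u"
  interpret T: abelian_group "tgroup A M N" by (rule tensor_abelian_group)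
  have neg_elem: "\<ominus>\<^bsub>tgroup A M N\<^esub> telem A M N x y = telem A M N (\<ominus>\<^bsub>M\<^esub> x) y"
    if "x ::: M" "y ::: N" for x y
  proof -
    have "(%x. telem A M N x y) \<in> add_hom M (tgroup A M N)"
      by (rule add_homI) (use that in "auto simp: telem_closed telem_add_left")
    from group_hom.hom_inv[OF group_hom.intro[OF M.a_group T.a_group group_hom_axioms.intro[OF this]], of x] that
    show ?thesis by (simp add: a_inv_def)
  qed
  obtain u where u: "u ::: ?F" "t = ?q u"
    using t by (auto simp: tensor_add_group_def tensor_group_def carrier_FactGroup)
  have qc: "?q u ::: (tgroup A M N)" if "u ::: ?F" for u
    using hom_in_carrier[OF quotient_hom that] by simp
  \<comment> \<open>Induction over the free group passes through differences, so the claim is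
    carried for a coset and its inverse together.\<close>
  have "Q (?q u) \<and> Q (\<ominus>\<^bsub>tgroup A M N\<^esub> ?q u)"
    using u(1)[simplified]
  proof (induction u rule: free_Abelian_group_induct[consumes 1, case_names zero diff one])
    case zero
    have "Q \<zero>[tgroup A M N]"
    proof -
      have z: "telem A M N \<zero>[M] \<zero>[N] ::: (tgroup A M N)"
        by (simp add: telem_closed)
      have "Q (telem A M N \<zero>[M] \<zero>[N] \<oplus>[tgroup A M N] \<ominus>\<^bsub>tgroup A M N\<^esub> telem A M N \<zero>[M] \<zero>[N])"
        by (rule add) (use z neg_elem in "auto intro!: elem telem_closed")
      then show ?thesis using z T.r_neg by simp
    qed
    moreover have "?q 0 = \<zero>[tgroup A M N]"
      using hom_one[OF quotient_hom group_free_Abelian_group T.a_group] by simp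
    ultimately show ?case using T.add.inv_one by (simp add: a_inv_def)
  next
    case (diff x y)
    have nm: "?q (- y) = \<ominus>\<^bsub>tgroup A M N\<^esub> ?q y"
      using group_hom.hom_inv[OF group_hom.intro[OF group_free_Abelian_group T.a_group group_hom_axioms.intro[OF quotient_hom]], of y] diff
      by (simp add: a_inv_def)
    have "?q (x - y) = ?q x \<oplus>[tgroup A M N] \<ominus>\<^bsub>tgroup A M N\<^esub> ?q y"
      using quotient_add[of x "- y"] diff nm by simp
    moreover have "?q x ::: (tgroup A M N)" "?q y ::: (tgroup A M N)"
      using qc diff by simp_all
    ultimately show ?case
      using diff(3,4) by (auto simp: T.minus_add intro!: add)
  next
    case (one a)
    then show ?case
      by (cases a) (auto simp: neg_elem elem tensor_elem_def[symmetric])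
  qed
  then show ?thesis using u by simp
qed

lemma tensor_hom_eq:
  assumes "h \<in> add_hom (tgroup A M N) P"
    "k \<in> add_hom (tgroup A M N) P"
    "\<And>x y. [|x ::: M; y ::: N|] ==> h (telem A M N x y) = k (telem A M N x y)"
    "t ::: (tgroup A M N)"
  shows "h t = k t"
  using assms(4) by (induction rule: tensor_induct) (simp_all add: assms(3) hom_add[OF assms(1)] hom_add[OF assms(2)])

end

text \<open>The target is a bare abelian group, because only the right action on \<open>M\<close>
  and the left action on \<open>N\<close> enter the universal property. The same locale then serves
  Sweedler sums with values in modules, rings and further tensor products.\<close>

locale bal = tensor_prod A M N + P: abelian_group P
  for A :: "('a, 'p) ring_scheme" (structure)
    and M :: "('a, 'm, 'q) right_mod_scheme" and N :: "('a, 'n, 's) bimod_scheme"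
    and P :: "('x, 't) ring_scheme" and \<phi> :: "'m => 'n => 'x" +
  assumes bal_closed: "[|x ::: M; y ::: N|] ==> \<phi> x y ::: P"
    and bal_add_left: "[|x ::: M; x' ::: M; y ::: N|] ==> \<phi> (x \<oplus>[M] x') y = \<phi> x y \<oplus>[P] \<phi> x' y"
    and bal_add_right: "[|x ::: M; y ::: N; y' ::: N|] ==> \<phi> x (y \<oplus>[N] y') = \<phi> x y \<oplus>[P] \<phi> x y'"
    and bal_balanced: "[|x ::: M; a ::: A; y ::: N|] ==> \<phi> (x \<triangleleft>[M] a) y = \<phi> x (a \<triangleright>[N] y)"
begin

text \<open>The free abelian group extends \<open>\<phi>\<close> to a homomorphism that kills the
  three kinds of relators and hence factors through the quotient. Restricting it to the carrier
  makes it the unique extensional solution, as the description operator in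
  \<open>tensor_lift\<close> demands.\<close>

lemma lift_exists:
  "\<exists>!h. h \<in> hom (tensor_group A M N) (add_monoid P) \<inter> extensional (carrier (tensor_group A M N)) \<and>
        (\<forall>x\<in>carrier M. \<forall>y\<in>carrier N. h (telem A M N x y) = \<phi> x y)"
proof -
  let ?F = "free_Abelian_group (carrier M \<times> carrier N)"
  have "case_prod \<phi> ` (carrier M \<times> carrier N) \<subseteq> carrier (add_monoid P)"
    using bal_closed by auto
  from comm_group.free_Abelian_group_universal[OF P.a_comm_group this]
  obtain h where h: "h \<in> hom ?F (add_monoid P)" "\<And>x y. x ::: M ==> y ::: N ==> h (frag_of (x, y)) = \<phi> x y"
    by (metis SigmaI case_prod_conv)
  interpret h: group_hom ?F "add_monoid P" h
    by (intro group_hom.intro group_free_Abelian_group P.a_group group_hom_axioms.intro h)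
  have minus: "h (u - v) = h u \<ominus>\<^bsub>P\<^esub> h v" if "Poly_Mapping.keys u \<subseteq> carrier M \<times> carrier N" "Poly_Mapping.keys v \<subseteq> carrier M \<times> carrier N" for u v
    using h.hom_mult[of u "- v"] h.hom_inv[of v] that by (simp add: a_inv_def a_minus_def)
  have kd: "Poly_Mapping.keys (frag_of p - frag_of q) \<subseteq> S" if "p \<in> S" "q \<in> S" for p q :: "'m \<times> 'n" and S
    using that keys_diff[of "frag_of p" "frag_of q"] by auto
  have cancel: "(a \<oplus>[P] b) \<ominus>\<^bsub>P\<^esub> a \<ominus>\<^bsub>P\<^esub> b = \<zero>[P]" if "a ::: P" "b ::: P" for a b
    using that by (simp add: a_minus_def P.a_comm[of a b] P.a_assoc P.r_neg P.r_neg2)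
  have "tensor_relators A M N \<subseteq> kernel ?F (add_monoid P) h"
  proof
    fix u assume u: "u \<in> tensor_relators A M N"
    have "u ::: ?F" by (rule subsetD[OF relators_subset u])
    moreover have "h u = \<zero>[P]"
      using u unfolding tensor_relators_def
      by (elim UnE CollectE exE conjE; hypsubst)
         (simp_all add: minus kd h bal_closed ract_closed N.lact_closed M.add.m_closed N.M.add.m_closed
            bal_add_left bal_add_right bal_balanced cancel P.r_neg a_minus_def[of P "\<phi> _ _" "\<phi> _ _"])
    ultimately show "u \<in> kernel ?F (add_monoid P) h"
      by (simp add: kernel_def)
  qed
  then have "tensor_relations A M N \<subseteq> kernel ?F (add_monoid P) h"
    unfolding tensor_relations_def by (rule h.G.generate_subgroup_incl[OF _ h.subgroup_kernel])
  from h.FactGroup_universal_kernel[OF relations_normal this]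
  obtain g where g: "g \<in> hom (?F Mod tensor_relations A M N) (add_monoid P)"
    "\<And>x. x ::: ?F ==> g (tensor_relations A M N #>\<^bsub>?F\<^esub> x) = h x"
    by blast
  let ?T = "carrier (tensor_group A M N)"
  interpret T: comm_group "tensor_group A M N" by (rule tensor_group_comm)
  have ec: "telem A M N x y \<in> ?T" if "x ::: M" "y ::: N" for x y
    using telem_closed[OF that] by (simp add: tensor_add_group_def)
  have 1: "restrict g ?T \<in> hom (tensor_group A M N) (add_monoid P) \<inter> extensional ?T"
    using g(1) T.m_closed by (auto simp: hom_def tensor_group_def)
  have 2: "restrict g ?T (telem A M N x y) = \<phi> x y" if "x ::: M" "y ::: N" for x y
  proof -
    have "g (telem A M N x y) = \<phi> x y"
      unfolding tensor_elem_def using g(2)[of "frag_of (x, y)"] h(2) that by simp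
    then show ?thesis using ec[OF that] by simp
  qed
  show ?thesis
  proof (rule ex1I[of _ "restrict g ?T"])
    fix k assume k: "k \<in> hom (tensor_group A M N) (add_monoid P) \<inter> extensional ?T \<and>
        (\<forall>x\<in>carrier M. \<forall>y\<in>carrier N. k (telem A M N x y) = \<phi> x y)"
    have tg: "hom (tensor_group A M N) (add_monoid P) = add_hom (tgroup A M N) P"
      by (simp add: hom_def tensor_add_group_def)
    have "k t = restrict g ?T t" if "t \<in> ?T" for t
    proof (rule tensor_hom_eq[of _ P])
      show "k \<in> add_hom (tgroup A M N) P"
        "restrict g ?T \<in> add_hom (tgroup A M N) P"
        using k 1 tg by auto
    qed (use k 2 that in "simp_all add: tensor_add_group_def")
    then show "k = restrict g ?T" using k by (auto intro!: extensionalityI[of _ ?T])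
  qed (use 1 2 in auto)
qed

lemma lift_hom: "tlift A M N P \<phi> \<in> add_hom (tgroup A M N) P"
  and lift_elem: "[|x ::: M; y ::: N|] ==> tlift A M N P \<phi> (telem A M N x y) = \<phi> x y"
  using theI'[OF lift_exists]
  unfolding tensor_lift_def[symmetric] by (auto simp: hom_def tensor_add_group_def)

lemma lift_closed: "t ::: (tgroup A M N) ==> tlift A M N P \<phi> t ::: P"
  by (rule hom_carrier_add[OF lift_hom])

lemma lift_add:
  "[|s ::: (tgroup A M N); t ::: (tgroup A M N)|]
    ==> tlift A M N P \<phi> (s \<oplus>[tgroup A M N] t) = tlift A M N P \<phi> s \<oplus>[P] tlift A M N P \<phi> t"
  by (rule hom_add[OF lift_hom])

lemma lift_unique:
  assumes "k \<in> add_hom (tgroup A M N) P"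
    "\<And>x y. [|x ::: M; y ::: N|] ==> k (telem A M N x y) = \<phi> x y"
    "t ::: (tgroup A M N)"
  shows "tlift A M N P \<phi> t = k t"
  using tensor_hom_eq[OF lift_hom assms(1) _ assms(3)] assms(2) lift_elem by simp

end

lemma tlift_cong:
  assumes "M = M'" "N = N'" "P = P'"
    and "\<And>x y. [|x ::: M'; y ::: N'|] ==> \<phi> x y = \<psi> x y" "t = t'"
  shows "tlift A M N P \<phi> t = tlift A M' N' P' \<psi> t'"
  unfolding tensor_lift_def using assms by (simp cong: conj_cong ball_cong)

lemma lift_cong: "(!!x y. [|x ::: M; y ::: N|] ==> \<phi> x y = \<phi>' x y) ==> tlift A M N P \<phi> t = tlift A M N P \<phi>' t"
  by (rule tlift_cong[OF refl refl refl _ refl])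

text \<open>As a congruence rule this lets the simplifier rewrite the summand of a Sweedler sum with
  the memberships of the summation variables at hand.\<close>

lemma tlift_cong_simp [cong]:
  assumes "M = M'" "N = N'" "P = P'"
    and "\<And>x y. x ::: M' =simp=> y ::: N' =simp=> \<phi> x y = \<psi> x y" "t = t'"
  shows "tlift A M N P \<phi> t = tlift A M' N' P' \<psi> t'"
  using assms unfolding simp_implies_def by (rule tlift_cong)

lemma balI:
  assumes "right_module A M" "bimodule A N" "abelian_group P"
    and "\<And>x y. [|x ::: M; y ::: N|] ==> \<phi> x y ::: P"
    and "\<And>x x' y. [|x ::: M; x' ::: M; y ::: N|] ==> \<phi> (x \<oplus>[M] x') y = \<phi> x y \<oplus>[P] \<phi> x' y"
    and "\<And>x y y'. [|x ::: M; y ::: N; y' ::: N|] ==> \<phi> x (y \<oplus>[N] y') = \<phi> x y \<oplus>[P] \<phi> x y'"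
    and "\<And>x a y. [|x ::: M; a ::: A; y ::: N|] ==> \<phi> (x \<triangleleft>[M] a) y = \<phi> x (a \<triangleright>[N] y)"
  shows "bal A M N P \<phi>"
  using assms by (intro bal.intro tensor_prod.intro bal_axioms.intro)

lemmas balD = bal.bal_closed bal.bal_add_left bal.bal_add_right bal.bal_balanced

lemma bal_cong:
  assumes "bal A M N P \<phi>" "\<And>x y. [|x ::: M; y ::: N|] ==> \<phi> x y = \<psi> x y"
  shows "bal A M N P \<psi>"
proof -
  interpret bal A M N P \<phi> by fact
  show ?thesis
    by (rule balI) (simp_all add: assms(2)[symmetric] bal_closed bal_add_left bal_add_right bal_balanced
        ract_closed N.lact_closed right_module_axioms N.bimodule_axioms P.abelian_group_axioms)
qed

context tensor_prod
begin

lemma telem_bal: "bal A M N (tgroup A M N) (telem A M N)"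
  by (rule balI)
     (simp_all add: right_module_axioms N.bimodule_axioms tensor_abelian_group telem_closed
       telem_add_left telem_add_right telem_balanced)

end

context bal
begin

lemma bal_compose:
  assumes "f \<in> right_hom A M' M" "g \<in> left_hom A N' N" "right_module A M'" "bimodule A N'"
  shows "bal A M' N' P (%x y. \<phi> (f x) (g y))"
  by (rule balI)
     (simp_all add: assms right_homD[OF assms(1)] left_homD[OF assms(2)] P.abelian_group_axioms
      bal_closed bal_add_left bal_add_right bal_balanced)

lemma bal_additive:
  assumes "h \<in> add_hom P P'" "abelian_group P'"
  shows "bal A M N P' (%x y. h (\<phi> x y))"
  by (rule balI)
     (simp_all add: assms right_module_axioms N.bimodule_axioms hom_carrier_add[OF assms(1)] hom_add[OF assms(1)]
      bal_closed bal_add_left bal_add_right bal_balanced)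

text \<open>The workhorse of the Sweedler calculus: every additive map may be pulled into a sum,
  since both sides are additive in \<open>t\<close> and agree on elementary tensors.\<close>

lemma lift_additive:
  assumes "h \<in> add_hom P P'" "abelian_group P'" "t ::: (tgroup A M N)"
  shows "h (tlift A M N P \<phi> t) = tlift A M N P' (%x y. h (\<phi> x y)) t"
proof -
  have "h \<circ> tlift A M N P \<phi> \<in> add_hom (tgroup A M N) P'"
    by (rule add_homI)
       (use lift_hom in "auto simp: lift_closed hom_carrier_add[OF assms(1)] lift_add hom_add[OF assms(1)]")
  from bal.lift_unique[OF bal_additive[OF assms(1,2)] this _ assms(3)]
  show ?thesis by (simp add: lift_elem)
qed

lemma lift_sum:
  assumes "bal A M N P \<psi>" "t ::: (tgroup A M N)"
  shows "tlift A M N P (%x y. \<phi> x y \<oplus>[P] \<psi> x y) t = tlift A M N P \<phi> t \<oplus>[P] tlift A M N P \<psi> t"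
proof -
  interpret \<psi>: bal A M N P \<psi> by fact
  have b: "bal A M N P (%x y. \<phi> x y \<oplus>[P] \<psi> x y)"
    by (rule balI)
       (simp_all add: right_module_axioms N.bimodule_axioms P.abelian_group_axioms bal_closed \<psi>.bal_closed
         bal_add_left \<psi>.bal_add_left bal_add_right \<psi>.bal_add_right bal_balanced \<psi>.bal_balanced P.a_ac)
  show ?thesis
    by (rule bal.lift_unique[OF b _ _ assms(2)], rule add_homI)
       (simp_all add: lift_closed \<psi>.lift_closed lift_add \<psi>.lift_add lift_elem \<psi>.lift_elem P.a_ac)
qed

end


lemma abelian_group_transfer:
  assumes "abelian_group S" "carrier T = carrier S" "add T = add S" "ring.zero T = ring.zero S"
  shows "abelian_group T"
proof -
  interpret S: abelian_group S by fact
  show ?thesis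
    by (rule abelian_groupI) (use assms S.add.l_inv_ex in "auto simp: S.a_ac")
qed


section \<open>Module structures on tensor products\<close>

lemma tright_simps [simp]:
  fixes M :: "('a, 'm, 'q) right_mod_scheme"
  shows
  "carrier (tright A M N) = carrier (tgroup A M N)"
  "add (tright A M N) = add (tgroup A M N)"
  "ring.zero (tright A M N) = ring.zero (tgroup A M N)"
  "hom (add_monoid (tright A M N)) X = hom (add_monoid (tgroup A M N)) X"
  "hom Y (add_monoid (tright A M N)) = hom Y (add_monoid (tgroup A M N))"
  by (simp_all add: tensor_right_def tensor_add_group_def ring.extend_def hom_def)

lemma tbimod_simps [simp]:
  fixes M :: "('a, 'm, 'q) bimod_scheme"
  shows
  "carrier (tbimod A M N) = carrier (tgroup A M N)"
  "add (tbimod A M N) = add (tgroup A M N)"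
  "ring.zero (tbimod A M N) = ring.zero (tgroup A M N)"
  "hom (add_monoid (tbimod A M N)) X = hom (add_monoid (tgroup A M N)) X"
  "hom Y (add_monoid (tbimod A M N)) = hom Y (add_monoid (tgroup A M N))"
  "ract (tbimod A M N) = ract (tright A M N)"
  by (simp_all add: tensor_bimod_def tensor_right_def tensor_add_group_def ring.extend_def right_mod.extend_def hom_def)

lemma ract_tright:
  "t \<triangleleft>[tright A M N] a = tlift A M N (tgroup A M N) (%x y. telem A M N x (y \<triangleleft>[N] a)) t"
  by (simp add: tensor_right_def ring.extend_def tensor_add_group_def)

text \<open>\<open>tensor_lift\<close> sees only the additive group of its target, so the target may
  be exchanged for any structure with the same addition and carrier.\<close>

lemma tlift_tright [simp]:
  "tlift A M N (tright B K L) \<phi> t = tlift A M N (tgroup B K L) \<phi> t"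
  "tlift A M N (tbimod B K' L) \<phi> t = tlift A M N (tgroup B K' L) \<phi> t"
  unfolding tensor_lift_def tright_simps(5) tbimod_simps(5) by (rule refl)+

lemma right_hom_tbimod [simp]:
  "right_hom B X (tbimod A M N) = right_hom B X (tright A M N)"
  "right_hom B (tbimod A M N) X = right_hom B (tright A M N) X"
  by (simp_all add: right_hom_def hom_def)

lemma lact_tbimod:
  "a \<triangleright>[tbimod A M N] t = tlift A M N (tgroup A M N) (%x y. telem A M N (a \<triangleright>[M] x) y) t"
  by (simp add: tensor_bimod_def right_mod.extend_def tensor_right_def[of A M N] ring.extend_def)

lemma right_moduleI:
  assumes "ring A" "abelian_group M"
    and "\<And>x a. [|x ::: M; a ::: A|] ==> x \<triangleleft>[M] a ::: M"
    and "\<And>x y a. [|x ::: M; y ::: M; a ::: A|]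
      ==> (x \<oplus>[M] y) \<triangleleft>[M] a = x \<triangleleft>[M] a \<oplus>[M] y \<triangleleft>[M] a"
    and "\<And>x a b. [|x ::: M; a ::: A; b ::: A|]
      ==> x \<triangleleft>[M] (a \<oplus>[A] b) = x \<triangleleft>[M] a \<oplus>[M] x \<triangleleft>[M] b"
    and "\<And>x a b. [|x ::: M; a ::: A; b ::: A|]
      ==> x \<triangleleft>[M] (a \<otimes>[A] b) = (x \<triangleleft>[M] a) \<triangleleft>[M] b"
    and "\<And>x. x ::: M ==> x \<triangleleft>[M] \<one>[A] = x"
  shows "right_module A M"
  using assms by (intro right_module.intro right_module_axioms.intro)

lemma bimoduleI:
  assumes "right_module A M"
    and "\<And>x a. [|x ::: M; a ::: A|] ==> a \<triangleright>[M] x ::: M"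
    and "\<And>x y a. [|x ::: M; y ::: M; a ::: A|]
      ==> a \<triangleright>[M] (x \<oplus>[M] y) = (a \<triangleright>[M] x) \<oplus>[M] (a \<triangleright>[M] y)"
    and "\<And>x a b. [|x ::: M; a ::: A; b ::: A|]
      ==> (a \<oplus>[A] b) \<triangleright>[M] x = (a \<triangleright>[M] x) \<oplus>[M] (b \<triangleright>[M] x)"
    and "\<And>x a b. [|x ::: M; a ::: A; b ::: A|]
      ==> (a \<otimes>[A] b) \<triangleright>[M] x = a \<triangleright>[M] (b \<triangleright>[M] x)"
    and "\<And>x. x ::: M ==> \<one>[A] \<triangleright>[M] x = x"
    and "\<And>x a b. [|x ::: M; a ::: A; b ::: A|]
      ==> (a \<triangleright>[M] x) \<triangleleft>[M] b = a \<triangleright>[M] (x \<triangleleft>[M] b)"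
  shows "bimodule A M"
  using assms by (intro bimodule.intro bimodule_axioms.intro)

context tensor_prod
begin

lemma ract_bal:
  "a ::: A ==> bal A M N (tgroup A M N) (%x y. telem A M N x (y \<triangleleft>[N] a))"
  by (rule bal.bal_compose[OF telem_bal id_right_hom, simplified])
     (auto intro!: left_homI simp: right_module_axioms N.bimodule_axioms N.ract_closed N.ract_add_left N.lact_ract)

lemma ract_telem:
  "[|x ::: M; y ::: N; a ::: A|]
    ==> telem A M N x y \<triangleleft>[tright A M N] a = telem A M N x (y \<triangleleft>[N] a)"
  by (simp add: ract_tright bal.lift_elem[OF ract_bal])

lemma tright_module: "right_module A (tright A M N)"
proof -
  interpret T: abelian_group "tgroup A M N" by (rule tensor_abelian_group)
  let ?T = "tgroup A M N"
  have cl: "t \<triangleleft>[tright A M N] a ::: ?T" if "t ::: ?T" "a ::: A" for t a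
    using that by (simp add: ract_tright bal.lift_closed[OF ract_bal])
  have add: "(s \<oplus>[?T] t) \<triangleleft>[tright A M N] a = s \<triangleleft>[tright A M N] a \<oplus>[?T] t \<triangleleft>[tright A M N] a"
    if "s ::: ?T" "t ::: ?T" "a ::: A" for s t a
    using that by (simp add: ract_tright bal.lift_add[OF ract_bal])
  show ?thesis
  proof (rule right_moduleI)
    show "abelian_group (tright A M N)"
      by (rule abelian_group_transfer[OF tensor_abelian_group]) simp_all
  next
    fix t a b assume "t ::: (tright A M N)" and ab: "a ::: A" "b ::: A"
    then have "t ::: ?T" by simp
    then show "t \<triangleleft>[tright A M N] (a \<oplus> b)
        = t \<triangleleft>[tright A M N] a \<oplus>[tright A M N] t \<triangleleft>[tright A M N] b"
      by (induction rule: tensor_induct)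
         (use ab in "simp_all add: ract_telem N.ract_add_right telem_add_right N.ract_closed add cl T.a_ac")
  next
    fix t a b assume "t ::: (tright A M N)" and ab: "a ::: A" "b ::: A"
    then have "t ::: ?T" by simp
    then show "t \<triangleleft>[tright A M N] (a \<otimes> b) = t \<triangleleft>[tright A M N] a \<triangleleft>[tright A M N] b"
      by (induction rule: tensor_induct) (use ab in "simp_all add: ract_telem N.ract_assoc N.ract_closed add cl")
  next
    fix t assume "t ::: (tright A M N)"
    then have "t ::: ?T" by simp
    then show "t \<triangleleft>[tright A M N] \<one> = t"
      by (induction rule: tensor_induct) (simp_all add: ract_telem N.ract_one add)
  qed (simp_all add: cl add ring_axioms)
qed

end

lemma bal_lift_ract:
  assumes "bal A M N P \<phi>" "t ::: (tgroup A M N)" "a ::: A"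
  shows "tlift A M N P \<phi> (t \<triangleleft>[tright A M N] a) = tlift A M N P (%x y. \<phi> x (y \<triangleleft>[N] a)) t"
proof -
  interpret bal A M N P \<phi> by fact
  show ?thesis
    unfolding ract_tright
    by (subst bal.lift_additive[OF ract_bal[OF assms(3)] lift_hom P.abelian_group_axioms assms(2)])
       (simp add: lift_elem N.ract_closed assms)
qed

locale tensor_prod2 = M: bimodule A M + N: bimodule A N
  for A :: "('a, 'p) ring_scheme" (structure)
    and M :: "('a, 'm, 'q) bimod_scheme" and N :: "('a, 'n, 's) bimod_scheme"
begin

sublocale tensor_prod A M N ..

lemma lact_bal:
  "a ::: A ==> bal A M N (tgroup A M N) (%x y. telem A M N (a \<triangleright>[M] x) y)"
  by (rule bal.bal_compose[OF telem_bal _ id_left_hom, simplified])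
     (auto intro!: right_homI simp: M.right_module_axioms N.bimodule_axioms M.lact_closed M.lact_add_right M.lact_ract)

lemma lact_telem:
  "[|x ::: M; y ::: N; a ::: A|]
    ==> a \<triangleright>[tbimod A M N] telem A M N x y = telem A M N (a \<triangleright>[M] x) y"
  by (simp add: lact_tbimod bal.lift_elem[OF lact_bal])

lemma tensor_bimodule: "bimodule A (tbimod A M N)"
proof -
  interpret T: abelian_group "tgroup A M N" by (rule tensor_abelian_group)
  interpret R: right_module A "tright A M N" by (rule tright_module)
  let ?T = "tgroup A M N"
  have cl: "a \<triangleright>[tbimod A M N] t ::: ?T" if "t ::: ?T" "a ::: A" for t a
    using that by (simp add: lact_tbimod bal.lift_closed[OF lact_bal])
  have add: "a \<triangleright>[tbimod A M N] (s \<oplus>[?T] t) = (a \<triangleright>[tbimod A M N] s) \<oplus>[?T] (a \<triangleright>[tbimod A M N] t)"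
    if "s ::: ?T" "t ::: ?T" "a ::: A" for s t a
    using that by (simp add: lact_tbimod bal.lift_add[OF lact_bal])
  have rcl: "t \<triangleleft>[tright A M N] a ::: ?T" if "t ::: ?T" "a ::: A" for t a
    using R.ract_closed that by simp
  have radd: "(s \<oplus>[?T] t) \<triangleleft>[tright A M N] a = s \<triangleleft>[tright A M N] a \<oplus>[?T] t \<triangleleft>[tright A M N] a"
    if "s ::: ?T" "t ::: ?T" "a ::: A" for s t a
    using R.ract_add_left that by simp
  show ?thesis
  proof (rule bimoduleI)
    show "right_module A (tbimod A M N)"
      using abelian_group_transfer[OF tensor_abelian_group, of "tbimod A M N"]
      by (intro right_moduleI)
         (simp_all add: R.ract_closed[simplified] R.ract_add_left[simplified] R.ract_add_right[simplified]
            R.ract_assoc[simplified] R.ract_one[simplified] M.ring_axioms)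
  next
    fix t a b assume "t ::: (tbimod A M N)" and ab: "a ::: A" "b ::: A"
    then have t: "t ::: ?T" by simp
    then show "(a \<oplus> b) \<triangleright>[tbimod A M N] t
        = (a \<triangleright>[tbimod A M N] t) \<oplus>[tbimod A M N] (b \<triangleright>[tbimod A M N] t)"
      by (induction rule: tensor_induct)
         (use ab in "simp_all add: lact_telem M.lact_add_left telem_add_left M.lact_closed add cl T.a_ac")
    show "(a \<otimes> b) \<triangleright>[tbimod A M N] t = a \<triangleright>[tbimod A M N] b \<triangleright>[tbimod A M N] t"
      using t by (induction rule: tensor_induct) (use ab in "simp_all add: lact_telem M.lact_assoc M.lact_closed add cl")
    show "(a \<triangleright>[tbimod A M N] t) \<triangleleft>[tbimod A M N] b = a \<triangleright>[tbimod A M N] (t \<triangleleft>[tbimod A M N] b)"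
      using t by (induction rule: tensor_induct)
        (use ab in "simp_all add: lact_telem ract_telem M.lact_closed N.ract_closed add cl radd rcl")
  next
    fix t assume "t ::: (tbimod A M N)"
    then have "t ::: ?T" by simp
    then show "\<one> \<triangleright>[tbimod A M N] t = t"
      by (induction rule: tensor_induct) (simp_all add: lact_telem M.lact_one add)
  qed (simp_all add: cl add)
qed

end

lemma bal_lift_lact:
  assumes "bal A M N P \<phi>" "bimodule A M" "t ::: (tgroup A M N)" "a ::: A"
  shows "tlift A M N P \<phi> (a \<triangleright>[tbimod A M N] t) = tlift A M N P (%x y. \<phi> (a \<triangleright>[M] x) y) t"
proof -
  interpret bal A M N P \<phi> by fact
  interpret M: bimodule A M by fact
  interpret tensor_prod2 A M N ..
  show ?thesis
    unfolding lact_tbimod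
    by (subst bal.lift_additive[OF lact_bal[OF assms(4)] lift_hom P.abelian_group_axioms assms(3)])
       (simp add: lift_elem M.lact_closed assms)
qed

section \<open>Functoriality and associativity\<close>

lemma tensor_map_bal:
  assumes "tensor_prod A M' N'" "f \<in> right_hom A M M'" "g \<in> left_hom A N N'" "right_module A M" "bimodule A N"
  shows "bal A M N (tgroup A M' N') (%x y. telem A M' N' (f x) (g y))"
  by (rule bal.bal_compose[OF tensor_prod.telem_bal[OF assms(1)] assms(2-5)])

lemma tensor_map_elem:
  assumes "tensor_prod A M' N'" "f \<in> right_hom A M M'" "g \<in> left_hom A N N'" "tensor_prod A M N"
    "x ::: M" "y ::: N"
  shows "tensor_map A M N M' N' f g (telem A M N x y) = telem A M' N' (f x) (g y)"
  unfolding tensor_map_def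
  by (rule bal.lift_elem[OF tensor_map_bal]) (use assms in "auto simp: tensor_prod_def")

lemma tensor_map_hom:
  assumes "tensor_prod A M' N'" "f \<in> right_hom A M M'" "g \<in> left_hom A N N'" "tensor_prod A M N"
  shows "tensor_map A M N M' N' f g \<in> add_hom (tgroup A M N) (tgroup A M' N')"
  unfolding tensor_map_def
  by (rule bal.lift_hom[OF tensor_map_bal]) (use assms in "auto simp: tensor_prod_def")

lemma lift_tensor_map:
  assumes "bal A M' N' P \<phi>" "f \<in> right_hom A M M'" "g \<in> left_hom A N N'" "tensor_prod A M N"
    "t ::: (tgroup A M N)"
  shows "tlift A M' N' P \<phi> (tensor_map A M N M' N' f g t) = tlift A M N P (%x y. \<phi> (f x) (g y)) t"
proof -
  interpret b: bal A M' N' P \<phi> by fact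
  have "bal A M N (tgroup A M' N') (%x y. telem A M' N' (f x) (g y))"
    by (rule tensor_map_bal) (use assms b.tensor_prod_axioms in "auto simp: tensor_prod_def")
  from bal.lift_additive[OF this b.lift_hom b.P.abelian_group_axioms assms(5)]
  show ?thesis
    by (simp add: tensor_map_def b.lift_elem right_homD[OF assms(2)] left_homD[OF assms(3)])
qed

text \<open>The summands of two-fold Sweedler sums. Being balanced over \<open>A\<close> in both
  inner places, such a map can be lifted along either bracketing of a triple tensor product.\<close>

locale trilin = right_module A M + N: bimodule A N + K: bimodule A K + P: abelian_group P
  for A :: "('a, 'p) ring_scheme" (structure)
    and M :: "('a, 'm, 'q) right_mod_scheme" and N :: "('a, 'n, 's) bimod_scheme"
    and K :: "('a, 'k, 'u) bimod_scheme"
    and P :: "('x, 't) ring_scheme" and \<phi> :: "'m => 'n => 'k => 'x" +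
  assumes tri_closed: "[|x ::: M; y ::: N; z ::: K|] ==> \<phi> x y z ::: P"
    and tri_add_1: "[|x ::: M; x' ::: M; y ::: N; z ::: K|]
      ==> \<phi> (x \<oplus>[M] x') y z = \<phi> x y z \<oplus>[P] \<phi> x' y z"
    and tri_add_2: "[|x ::: M; y ::: N; y' ::: N; z ::: K|]
      ==> \<phi> x (y \<oplus>[N] y') z = \<phi> x y z \<oplus>[P] \<phi> x y' z"
    and tri_add_3: "[|x ::: M; y ::: N; z ::: K; z' ::: K|]
      ==> \<phi> x y (z \<oplus>[K] z') = \<phi> x y z \<oplus>[P] \<phi> x y z'"
    and tri_balanced_1: "[|x ::: M; a ::: A; y ::: N; z ::: K|]
      ==> \<phi> (x \<triangleleft>[M] a) y z = \<phi> x (a \<triangleright>[N] y) z"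
    and tri_balanced_2: "[|x ::: M; y ::: N; a ::: A; z ::: K|]
      ==> \<phi> x (y \<triangleleft>[N] a) z = \<phi> x y (a \<triangleright>[K] z)"
begin

sublocale NK: tensor_prod2 A N K ..
sublocale MN: tensor_prod A M N ..

lemma bal_12: "z ::: K ==> bal A M N P (%x y. \<phi> x y z)"
  by (rule balI)
     (simp_all add: right_module_axioms N.bimodule_axioms P.abelian_group_axioms tri_closed tri_add_1 tri_add_2 tri_balanced_1)

lemma bal_23: "x ::: M ==> bal A N K P (\<phi> x)"
  by (rule balI)
     (simp_all add: N.right_module_axioms K.bimodule_axioms P.abelian_group_axioms tri_closed tri_add_2 tri_add_3 tri_balanced_2)

lemma bal_left: "bal A (tright A M N) K P (%t z. tlift A M N P (%x y. \<phi> x y z) t)"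
proof (rule balI)
  fix t z z' assume t: "t ::: (tright A M N)" and z: "z ::: K" "z' ::: K"
  have "tlift A M N P (%x y. \<phi> x y (z \<oplus>[K] z')) t = tlift A M N P (%x y. \<phi> x y z \<oplus>[P] \<phi> x y z') t"
    using z by (simp add: tri_add_3)
  also have "... = tlift A M N P (%x y. \<phi> x y z) t \<oplus>[P] tlift A M N P (%x y. \<phi> x y z') t"
    by (rule bal.lift_sum) (use bal_12 z t in auto)
  finally show "tlift A M N P (%x y. \<phi> x y (z \<oplus>[K] z')) t
    = tlift A M N P (%x y. \<phi> x y z) t \<oplus>[P] tlift A M N P (%x y. \<phi> x y z') t" .
qed (simp_all add: MN.tright_module K.bimodule_axioms P.abelian_group_axioms
      bal.lift_closed[OF bal_12] bal.lift_add[OF bal_12] bal_lift_ract[OF bal_12] tri_balanced_2)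

lemma bal_right: "bal A M (tbimod A N K) P (%x t. tlift A N K P (\<phi> x) t)"
proof (rule balI)
  fix t x x' assume t: "t ::: (tbimod A N K)" and x: "x ::: M" "x' ::: M"
  have "tlift A N K P (\<phi> (x \<oplus>[M] x')) t = tlift A N K P (%y z. \<phi> x y z \<oplus>[P] \<phi> x' y z) t"
    using x by (simp add: tri_add_1)
  also have "... = tlift A N K P (\<phi> x) t \<oplus>[P] tlift A N K P (\<phi> x') t"
    by (rule bal.lift_sum) (use bal_23 x t in auto)
  finally show "tlift A N K P (\<phi> (x \<oplus>[M] x')) t
    = tlift A N K P (\<phi> x) t \<oplus>[P] tlift A N K P (\<phi> x') t" .
qed (simp_all add: right_module_axioms NK.tensor_bimodule P.abelian_group_axioms
      bal.lift_closed[OF bal_23] bal.lift_add[OF bal_23] bal_lift_lact[OF bal_23 N.bimodule_axioms] tri_balanced_1)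

end

lemma trilinI:
  assumes "right_module A M" "bimodule A N" "bimodule A K" "abelian_group P"
    and "\<And>x y z. [|x ::: M; y ::: N; z ::: K|] ==> \<phi> x y z ::: P"
    and "\<And>x x' y z. [|x ::: M; x' ::: M; y ::: N; z ::: K|]
      ==> \<phi> (x \<oplus>[M] x') y z = \<phi> x y z \<oplus>[P] \<phi> x' y z"
    and "\<And>x y y' z. [|x ::: M; y ::: N; y' ::: N; z ::: K|]
      ==> \<phi> x (y \<oplus>[N] y') z = \<phi> x y z \<oplus>[P] \<phi> x y' z"
    and "\<And>x y z z'. [|x ::: M; y ::: N; z ::: K; z' ::: K|]
      ==> \<phi> x y (z \<oplus>[K] z') = \<phi> x y z \<oplus>[P] \<phi> x y z'"
    and "\<And>x a y z. [|x ::: M; a ::: A; y ::: N; z ::: K|]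
      ==> \<phi> (x \<triangleleft>[M] a) y z = \<phi> x (a \<triangleright>[N] y) z"
    and "\<And>x y a z. [|x ::: M; y ::: N; a ::: A; z ::: K|]
      ==> \<phi> x (y \<triangleleft>[N] a) z = \<phi> x y (a \<triangleright>[K] z)"
  shows "trilin A M N K P \<phi>"
  using assms by (intro trilin.intro trilin_axioms.intro)

lemma trilin_compose:
  assumes "trilin A M N K P \<phi>" "f \<in> right_hom A M' M" "right_module A M'"
    "h \<in> left_hom A K' K" "bimodule A K'"
  shows "trilin A M' N K' P (%x y z. \<phi> (f x) y (h z))"
proof -
  interpret trilin A M N K P \<phi> by fact
  show ?thesis
    by (rule trilinI)
       (simp_all add: assms N.bimodule_axioms P.abelian_group_axioms tri_closed tri_add_1 tri_add_2 tri_add_3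
         tri_balanced_1 tri_balanced_2 right_homD[OF assms(2)] left_homD[OF assms(4)])
qed

lemma trilin_elem_left:
  assumes "right_module A M" "bimodule A N" "bimodule A K"
  shows "trilin A M N K (tgroup A (tright A M N) K)
    (%x y z. telem A (tright A M N) K (telem A M N x y) z)"
proof -
  interpret M: right_module A M by fact
  interpret N: bimodule A N by fact
  interpret K: bimodule A K by fact
  interpret MN: tensor_prod A M N ..
  interpret MNr: right_module A "tright A M N" by (rule MN.tright_module)
  interpret T: tensor_prod A "tright A M N" K ..
  show ?thesis
    by (rule trilinI)
       (simp_all add: assms T.tensor_abelian_group MN.telem_closed T.telem_closed T.telem_add_right
         MN.telem_add_left MN.telem_add_right MN.telem_balanced N.ract_closed
         T.telem_add_left[simplified] T.telem_balanced[symmetric] MN.ract_telem)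
qed

lemma trilin_elem_right:
  assumes "right_module A M" "bimodule A N" "bimodule A K"
  shows "trilin A M N K (tgroup A M (tbimod A N K))
    (%x y z. telem A M (tbimod A N K) x (telem A N K y z))"
proof -
  interpret M: right_module A M by fact
  interpret N: bimodule A N by fact
  interpret K: bimodule A K by fact
  interpret NK: tensor_prod2 A N K ..
  interpret NKb: bimodule A "tbimod A N K" by (rule NK.tensor_bimodule)
  interpret T: tensor_prod A M "tbimod A N K" ..
  show ?thesis
    by (rule trilinI)
       (simp_all add: assms T.tensor_abelian_group NK.telem_closed T.telem_closed T.telem_add_left
         NK.telem_add_left NK.telem_add_right NK.telem_balanced N.lact_closed N.ract_closed
         T.telem_add_right[simplified] T.telem_balanced NK.lact_telem)
qed

text \<open>This is how associators disappear from calculations: the two iterated lifts of one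
  trilinear map correspond to each other under the associativity isomorphism.\<close>

lemma lift_lift_tensor_assoc:
  assumes "trilin A M N K P \<phi>" "t ::: (tgroup A (tright A M N) K)"
  shows "tlift A M (tbimod A N K) P (%x s. tlift A N K P (\<phi> x) s) (tensor_assoc A M N K t)
    = tlift A (tright A M N) K P (%s z. tlift A M N P (%x y. \<phi> x y z) s) t"
proof -
  interpret trilin A M N K P \<phi> by fact
  interpret R: trilin A M N K "tgroup A M (tbimod A N K)"
    "%x y z. telem A M (tbimod A N K) x (telem A N K y z)"
    by (rule trilin_elem_right[OF right_module_axioms N.bimodule_axioms K.bimodule_axioms])
  show ?thesis
    unfolding tensor_assoc_def
    apply (subst bal.lift_additive[OF R.bal_left bal.lift_hom[OF bal_right] P.abelian_group_axioms assms(2)])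
    apply (rule lift_cong)
    apply (subst bal.lift_additive[OF R.bal_12 bal.lift_hom[OF bal_right] P.abelian_group_axioms])
      apply (simp_all add: bal.lift_elem[OF bal_right] NK.telem_closed bal.lift_elem[OF bal_23])
    done
qed

lemma tensor_assoc_elem:
  assumes "right_module A M" "bimodule A N" "bimodule A K" "x ::: M" "y ::: N" "z ::: K"
  shows "tensor_assoc A M N K (telem A (tright A M N) K (telem A M N x y) z)
    = telem A M (tbimod A N K) x (telem A N K y z)"
proof -
  interpret trilin A M N K "tgroup A M (tbimod A N K)"
    "%x y z. telem A M (tbimod A N K) x (telem A N K y z)"
    by (rule trilin_elem_right[OF assms(1-3)])
  show ?thesis
    unfolding tensor_assoc_def
    by (subst bal.lift_elem[OF bal_left]) (simp_all add: assms MN.telem_closed bal.lift_elem[OF bal_12])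
qed

lemma tensor_assoc_hom:
  assumes "right_module A M" "bimodule A N" "bimodule A K"
  shows "tensor_assoc A M N K \<in> hom (add_monoid (tgroup A (tright A M N) K))
    (add_monoid (tgroup A M (tbimod A N K)))"
  unfolding tensor_assoc_def by (rule bal.lift_hom[OF trilin.bal_left[OF trilin_elem_right[OF assms]]])

lemma tensor_assoc_inv_elem:
  assumes "right_module A M" "bimodule A N" "bimodule A K" "x ::: M" "y ::: N" "z ::: K"
  shows "tensor_assoc_inv A M N K (telem A M (tbimod A N K) x (telem A N K y z))
    = telem A (tright A M N) K (telem A M N x y) z"
proof -
  interpret trilin A M N K "tgroup A (tright A M N) K"
    "%x y z. telem A (tright A M N) K (telem A M N x y) z"
    by (rule trilin_elem_left[OF assms(1-3)])
  show ?thesis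
    unfolding tensor_assoc_inv_def
    by (subst bal.lift_elem[OF bal_right]) (simp_all add: assms NK.telem_closed bal.lift_elem[OF bal_23])
qed

lemma tensor_assoc_inv_hom:
  assumes "right_module A M" "bimodule A N" "bimodule A K"
  shows "tensor_assoc_inv A M N K \<in> hom (add_monoid (tgroup A M (tbimod A N K)))
    (add_monoid (tgroup A (tright A M N) K))"
  unfolding tensor_assoc_inv_def by (rule bal.lift_hom[OF trilin.bal_right[OF trilin_elem_left[OF assms]]])

lemma tensor_assoc_inv_assoc:
  assumes "right_module A M" "bimodule A N" "bimodule A K" "t ::: (tgroup A (tright A M N) K)"
  shows "tensor_assoc_inv A M N K (tensor_assoc A M N K t) = t"
proof -
  interpret M: right_module A M by fact
  interpret N: bimodule A N by fact
  interpret K: bimodule A K by fact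
  interpret MN: tensor_prod A M N ..
  interpret MNr: right_module A "tright A M N" by (rule MN.tright_module)
  interpret T: tensor_prod A "tright A M N" K ..
  interpret T: abelian_group "tgroup A (tright A M N) K" by (rule T.tensor_abelian_group)
  note hom = hom_add[OF tensor_assoc_hom[OF assms(1-3)]] hom_add[OF tensor_assoc_inv_hom[OF assms(1-3)]]
    hom_carrier_add[OF tensor_assoc_hom[OF assms(1-3)]] hom_carrier_add[OF tensor_assoc_inv_hom[OF assms(1-3)]]
  show ?thesis
    using assms(4)
  proof (induction rule: T.tensor_induct)
    case (elem s z)
    then have "s ::: (tgroup A M N)" by simp
    then show ?case
      by (induction rule: MN.tensor_induct)
         (simp_all add: elem(2) tensor_assoc_elem tensor_assoc_inv_elem assms(1-3) T.telem_add_left[simplified]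
           hom T.telem_closed)
  qed (simp add: hom)
qed

lemma tensor_assoc_assoc_inv:
  assumes "right_module A M" "bimodule A N" "bimodule A K" "t ::: (tgroup A M (tbimod A N K))"
  shows "tensor_assoc A M N K (tensor_assoc_inv A M N K t) = t"
proof -
  interpret M: right_module A M by fact
  interpret N: bimodule A N by fact
  interpret K: bimodule A K by fact
  interpret NK: tensor_prod2 A N K ..
  interpret NKb: bimodule A "tbimod A N K" by (rule NK.tensor_bimodule)
  interpret T: tensor_prod A M "tbimod A N K" ..
  interpret T: abelian_group "tgroup A M (tbimod A N K)" by (rule T.tensor_abelian_group)
  note hom = hom_add[OF tensor_assoc_hom[OF assms(1-3)]] hom_add[OF tensor_assoc_inv_hom[OF assms(1-3)]]
    hom_carrier_add[OF tensor_assoc_hom[OF assms(1-3)]] hom_carrier_add[OF tensor_assoc_inv_hom[OF assms(1-3)]]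
  show ?thesis
    using assms(4)
  proof (induction rule: T.tensor_induct)
    case (elem z s)
    then have "s ::: (tgroup A N K)" by simp
    then show ?case
      by (induction rule: NK.tensor_induct)
         (simp_all add: elem(1) tensor_assoc_elem tensor_assoc_inv_elem assms(1-3) T.telem_add_right[simplified]
           hom T.telem_closed)
  qed (simp add: hom)
qed

context tensor_prod
begin

lemma lift_telem: "t ::: (tgroup A M N) ==> tlift A M N (tgroup A M N) (telem A M N) t = t"
  by (rule bal.lift_unique[OF telem_bal], rule add_homI) auto

lemma telem_lift_right:
  assumes "bal B K L N \<phi>" "t ::: (tgroup B K L)" "x ::: M"
  shows "telem A M N x (tlift B K L N \<phi> t) = tlift B K L (tgroup A M N) (%y z. telem A M N x (\<phi> y z)) t"
  by (rule bal.lift_additive[OF assms(1) _ tensor_abelian_group assms(2)], rule add_homI)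
     (use assms(3) in "simp_all add: telem_closed telem_add_right")

lemma telem_lift_left:
  assumes "bal B K L M \<phi>" "t ::: (tgroup B K L)" "x ::: N"
  shows "telem A M N (tlift B K L M \<phi> t) x = tlift B K L (tgroup A M N) (%y z. telem A M N (\<phi> y z) x) t"
  by (rule bal.lift_additive[OF assms(1) _ tensor_abelian_group assms(2)], rule add_homI)
     (use assms(3) in "simp_all add: telem_closed telem_add_left")

end

section \<open>Congruence of tensor products\<close>

text \<open>A tensor product is a concrete quotient determined by the carriers, the additions and
  the two inner actions. Structures that agree in these, such as a comodule and its underlying
  module, have equal and not merely isomorphic tensor products.\<close>

lemma tensor_relations_cong:
  assumes "carrier M = carrier M'" "add M = add M'"
    "\<And>x a. [|x ::: M; a ::: A|] ==> x \<triangleleft>[M] a = x \<triangleleft>[M'] a"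
    "carrier N = carrier N'" "add N = add N'"
    "\<And>x a. [|x ::: N; a ::: A|] ==> a \<triangleright>[N] x = a \<triangleright>[N'] x"
  shows "tensor_relations A M N = tensor_relations A M' N'"
proof -
  have 1: "{frag_of (x \<triangleleft>[M] a, y) - frag_of (x, a \<triangleright>[N] y) | x a y.
        x ::: M \<and> a ::: A \<and> y ::: N}
    = {frag_of (x \<triangleleft>[M'] a, y) - frag_of (x, a \<triangleright>[N'] y) | x a y.
        x ::: M' \<and> a ::: A \<and> y ::: N'}"
    using assms by (intro Collect_cong ex_cong1) auto
  show ?thesis
    unfolding tensor_relations_def tensor_relators_def 1
    by (simp add: assms(1,2,4,5))
qed

lemma telem_cong:
  assumes "carrier M = carrier M'" "carrier N = carrier N'" "tensor_relations A M N = tensor_relations A M' N'"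
  shows "telem A M N = telem A M' N'"
  using assms by (intro ext) (simp add: tensor_elem_def)

lemma tensor_group_cong:
  assumes "carrier M = carrier M'" "carrier N = carrier N'" "tensor_relations A M N = tensor_relations A M' N'"
  shows "tensor_group A M N = tensor_group A M' N'" and "tgroup A M N = tgroup A M' N'"
  using assms by (simp_all add: tensor_group_def tensor_add_group_def)

lemma tlift_module_cong:
  assumes "carrier M = carrier M'" "carrier N = carrier N'" "tensor_relations A M N = tensor_relations A M' N'"
  shows "tlift A M N P \<phi> t = tlift A M' N' P \<phi> t"
  using assms by (simp add: tensor_lift_def tensor_group_cong[OF assms] telem_cong[OF assms])

text \<open>The left action of the first factor does not enter the relations, so
  \<open>tensor_right\<close> serves as normal form for a first factor that is itself a tensor
  product.\<close>

lemma tright_bimod [simp]: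
  fixes M :: "('a, 'm, 'q) bimod_scheme" and K :: "('a, 'k, 'r) bimod_scheme"
  shows "telem A (tbimod A M K) N = telem A (tright A M K) N"
    "tgroup A (tbimod A M K) N = tgroup A (tright A M K) N"
    "tlift A (tbimod A M K) N P \<phi> t = tlift A (tright A M K) N P \<phi> t"
proof -
  have r: "tensor_relations A (tbimod A M K) N = tensor_relations A (tright A M K) N"
    by (rule tensor_relations_cong) simp_all
  show "telem A (tbimod A M K) N = telem A (tright A M K) N"
    "tgroup A (tbimod A M K) N = tgroup A (tright A M K) N"
    "tlift A (tbimod A M K) N P \<phi> t = tlift A (tright A M K) N P \<phi> t"
    using telem_cong[OF _ _ r] tensor_group_cong(2)[OF _ _ r] tlift_module_cong[OF _ _ r] by simp_all
qed

lemma tensor_map_bimod [simp]: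
  fixes M :: "('a, 'm, 'q) bimod_scheme" and K :: "('a, 'k, 'r) bimod_scheme"
  shows "tensor_map A (tbimod A M K) N M' N' f g t = tensor_map A (tright A M K) N M' N' f g t"
    "tensor_map A M'' N'' (tbimod A M K) N f' g' t' = tensor_map A M'' N'' (tright A M K) N f' g' t'"
  by (simp_all add: tensor_map_def)

section \<open>Sweedler calculus for comodules\<close>

text \<open>The Sweedler sum of \<open>\<phi> x\<^sub>0 x\<^sub>1\<close> is \<open>tlift A M C P \<phi> (coact M x)\<close>; the axioms of a comodule become
  rules for iterated lifts of balanced maps into an arbitrary abelian group \<open>P\<close>.\<close>

locale coring_comodule = C: is_coring A C + right_comodule A C M
  for A :: "('a, 'p) ring_scheme" (structure) and C :: "('a, 'c, 'q) coring_scheme"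
    and M :: "('a, 'm, 'c, 's) comod_scheme"
begin

sublocale MC: tensor_prod A M C ..
sublocale CC: tensor_prod2 A C C ..

lemma co_closed: "x ::: M ==> coact M x ::: (tgroup A M C)"
  and co_add: "[|x ::: M; y ::: M|] ==> coact M (x \<oplus>[M] y) = coact M x \<oplus>[tgroup A M C] coact M y"
  and co_ract: "[|x ::: M; a ::: A|] ==> coact M (x \<triangleleft>[M] a) = coact M x \<triangleleft>[tright A M C] a"
  using right_homD[OF coact_hom] by simp_all

lemma lift_co_ract:
  assumes "bal A M C P \<phi>" "x ::: M" "a ::: A"
  shows "tlift A M C P \<phi> (coact M (x \<triangleleft>[M] a)) = tlift A M C P (%y c. \<phi> y (c \<triangleleft>[C] a)) (coact M x)"
  by (simp add: co_ract assms co_closed bal_lift_ract[OF assms(1)])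

lemma cop_right_hom: "cop C \<in> right_hom A C (tbimod A C C)"
  and cop_left_hom: "cop C \<in> left_hom A C (tbimod A C C)"
  using C.cop_hom by (simp_all add: bimod_hom_iff)

text \<open>The lift of \<open>\<phi>\<close> is applied to both sides of
  \<open>coact_coassociative\<close>, and the associator is absorbed by
  \<open>lift_lift_tensor_assoc\<close>.\<close>

lemma co_coassoc:
  assumes "trilin A M C C P \<phi>" "x ::: M"
  shows "tlift A M C P (%y c. tlift A M C P (%u v. \<phi> u v c) (coact M y)) (coact M x)
    = tlift A M C P (%y c. tlift A C C P (\<phi> y) (cop C c)) (coact M x)"
proof -
  interpret trilin A M C C P \<phi> by fact
  interpret MCr: right_module A "tright A M C" by (rule MC.tright_module)
  interpret CCb: bimodule A "tbimod A C C" by (rule CC.tensor_bimodule)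
  interpret T: tensor_prod A "tright A M C" C ..
  interpret U: tensor_prod A M "tbimod A C C" ..
  have "tlift A M (tbimod A C C) P (%x s. tlift A C C P (\<phi> x) s)
      (tensor_assoc A M C C (tensor_map A M C (tright A M C) C (coact M) id (coact M x)))
    = tlift A M (tbimod A C C) P (%x s. tlift A C C P (\<phi> x) s)
      (tensor_map A M C M (tbimod A C C) id (cop C) (coact M x))"
    by (simp add: coact_coassociative assms(2))
  also have "... = tlift A M C P (%y c. tlift A C C P (\<phi> y) (cop C c)) (coact M x)"
    by (subst lift_tensor_map[OF bal_right id_right_hom cop_left_hom MC.tensor_prod_axioms co_closed]) (simp_all add: assms)
  also have "tlift A M (tbimod A C C) P (%x s. tlift A C C P (\<phi> x) s)
      (tensor_assoc A M C C (tensor_map A M C (tright A M C) C (coact M) id (coact M x)))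
    = tlift A (tright A M C) C P (%s z. tlift A M C P (%x y. \<phi> x y z) s)
        (tensor_map A M C (tright A M C) C (coact M) id (coact M x))"
    by (rule lift_lift_tensor_assoc[OF assms(1)],
        rule hom_carrier_add[OF tensor_map_hom[OF T.tensor_prod_axioms coact_hom id_left_hom MC.tensor_prod_axioms]])
       (simp add: co_closed assms)
  also have "... = tlift A M C P (%y c. tlift A M C P (%u v. \<phi> u v c) (coact M y)) (coact M x)"
    by (subst lift_tensor_map[OF bal_left coact_hom id_left_hom MC.tensor_prod_axioms co_closed]) (simp_all add: assms)
  finally show ?thesis by simp
qed

lemma counit_bal: "bal A M C M (%y c. y \<triangleleft>[M] cou C c)"
proof -
  have "cou C \<in> right_hom A C (regular_bimod A)" "cou C \<in> left_hom A C (regular_bimod A)"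
    using C.cou_hom by (simp_all add: bimod_hom_iff)
  from right_homD[OF this(1)] left_homD[OF this(2)] show ?thesis
    by (intro balI)
       (simp_all add: regular_bimod_def right_module_axioms C.bimodule_axioms M.abelian_group_axioms
         ract_closed ract_add_left ract_add_right ract_assoc)
qed

text \<open>Stated with an additive \<open>h\<close> in front because in applications the factor
  \<open>\<epsilon>(x\<^sub>1)\<close> sits inside a larger expression.\<close>

lemma co_counit:
  assumes "h \<in> add_hom M P" "abelian_group P" "x ::: M"
  shows "tlift A M C P (%y c. h (y \<triangleleft>[M] cou C c)) (coact M x) = h x"
  using bal.lift_additive[OF counit_bal assms(1,2) co_closed[OF assms(3)]] coact_counital[OF assms(3)] by simp

lemma bal_coact:
  assumes "trilin A M C K P \<phi>"
  shows "bal A M K P (%y c. tlift A M C P (%u v. \<phi> u v c) (coact M y))"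
proof -
  interpret trilin A M C K P \<phi> by fact
  show ?thesis
    using bal.bal_compose[OF bal_left coact_hom id_left_hom right_module_axioms K.bimodule_axioms] by simp
qed

end

section \<open>Comodule and coring axioms as identities between iterated lifts\<close>

lemma tensor_assoc_map:
  assumes "right_module A M" "bimodule A C" "\<rho> \<in> right_hom A M (tright A M C)" "t ::: (tgroup A M C)"
  shows "tensor_assoc A M C C (tensor_map A M C (tright A M C) C \<rho> id t)
    = tlift A M C (tgroup A M (tbimod A C C))
        (%y c. tlift A M C (tgroup A M (tbimod A C C))
          (%u v. telem A M (tbimod A C C) u (telem A C C v c)) (\<rho> y)) t"
proof -
  interpret trilin A M C C "tgroup A M (tbimod A C C)"
    "%x y z. telem A M (tbimod A C C) x (telem A C C y z)"
    by (rule trilin_elem_right[OF assms(1,2,2)])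
  show ?thesis
    unfolding tensor_assoc_def
    by (subst lift_tensor_map[OF bal_left assms(3) id_left_hom MN.tensor_prod_axioms assms(4)]) simp_all
qed

lemma tensor_map_cop:
  assumes "right_module A M" "bimodule A C" "d \<in> left_hom A C (tbimod A C C)"
  shows "tensor_map A M C M (tbimod A C C) id d t
    = tlift A M C (tgroup A M (tbimod A C C))
        (%y c. tlift A C C (tgroup A M (tbimod A C C))
          (%u v. telem A M (tbimod A C C) y (telem A C C u v)) (d c)) t"
proof -
  interpret M: right_module A M by fact
  interpret C: bimodule A C by fact
  interpret CC: tensor_prod2 A C C ..
  interpret CCb: bimodule A "tbimod A C C" by (rule CC.tensor_bimodule)
  interpret U: tensor_prod A M "tbimod A C C" ..
  have dc: "d c ::: (tgroup A C C)" if "c ::: C" for c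
    using left_homD(2)[OF assms(3) that] by simp
  have "bal A C C (tbimod A C C) (telem A C C)"
    by (rule balI)
       (simp_all add: C.right_module_axioms C.bimodule_axioms CCb.M.abelian_group_axioms CC.telem_closed
         CC.telem_add_left CC.telem_add_right CC.telem_balanced)
  from U.telem_lift_right[OF this dc] show ?thesis
    unfolding tensor_map_def id_apply
    by (intro lift_cong) (simp add: CC.lift_telem dc)
qed

text \<open>Converse of \<open>co_coassoc\<close>: coassociativity need only be tested on the
  universal trilinear map, the elementary tensors
  \<open>u \<otimes> (v \<otimes> c)\<close>.\<close>

lemma right_comoduleI:
  assumes "is_coring A C" "right_module A M" "coact M \<in> right_hom A M (tright A M C)"
    and coassoc: "\<And>x. x ::: M ==>
      tlift A M C (tgroup A M (tbimod A C C))
        (%y c. tlift A M C (tgroup A M (tbimod A C C))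
          (%u v. telem A M (tbimod A C C) u (telem A C C v c)) (coact M y)) (coact M x)
      = tlift A M C (tgroup A M (tbimod A C C))
        (%y c. tlift A C C (tgroup A M (tbimod A C C))
          (%u v. telem A M (tbimod A C C) y (telem A C C u v)) (cop C c)) (coact M x)"
    and "\<And>x. x ::: M ==> tlift A M C M (%y c. y \<triangleleft>[M] cou C c) (coact M x) = x"
  shows "right_comodule A C M"
proof -
  interpret C: is_coring A C by fact
  have d: "cop C \<in> left_hom A C (tbimod A C C)" using C.cop_hom by (simp add: bimod_hom_iff)
  have cl: "coact M x ::: (tgroup A M C)" if "x ::: M" for x
    using right_homD(2)[OF assms(3)] that by simp
  show ?thesis
  proof (intro right_comodule.intro right_comodule_axioms.intro assms)
    fix x assume x: "x ::: M"
    show "tensor_assoc A M C C (tensor_map A M C (tright A M C) C (coact M) id (coact M x))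
      = tensor_map A M C M (tbimod A C C) id (cop C) (coact M x)"
      unfolding tensor_assoc_map[OF assms(2) C.bimodule_axioms assms(3) cl[OF x]] tensor_map_cop[OF assms(2) C.bimodule_axioms d]
      by (rule coassoc[OF x])
  qed
qed

lemma is_coringI:
  assumes bm: "bimodule A C" and d: "cop C \<in> bimod_hom A C (tbimod A C C)"
    and "cou C \<in> bimod_hom A C (regular_bimod A)"
    and coassoc: "\<And>x. x ::: C ==>
      tlift A C C (tgroup A C (tbimod A C C))
        (%y c. tlift A C C (tgroup A C (tbimod A C C))
          (%u v. telem A C (tbimod A C C) u (telem A C C v c)) (cop C y)) (cop C x)
      = tlift A C C (tgroup A C (tbimod A C C))
        (%y c. tlift A C C (tgroup A C (tbimod A C C))
          (%u v. telem A C (tbimod A C C) y (telem A C C u v)) (cop C c)) (cop C x)"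
    and "\<And>c. c ::: C ==> tlift A C C C (%x y. cou C x \<triangleright>[C] y) (cop C c) = c"
    and "\<And>c. c ::: C ==> tlift A C C C (%x y. x \<triangleleft>[C] cou C y) (cop C c) = c"
  shows "is_coring A C"
proof (intro is_coring.intro is_coring_axioms.intro assms)
  interpret bimodule A C by fact
  have d': "cop C \<in> left_hom A C (tbimod A C C)" "cop C \<in> right_hom A C (tright A C C)"
    using d by (simp_all add: bimod_hom_iff)
  fix c assume c: "c ::: C"
  have cl: "cop C c ::: (tgroup A C C)" using right_homD(2)[OF d'(2) c] by simp
  have "tensor_map A C C (tbimod A C C) C (cop C) id (cop C c) = tensor_map A C C (tright A C C) C (cop C) id (cop C c)"
    by simp
  then show "tensor_assoc A C C C (tensor_map A C C (tbimod A C C) C (cop C) id (cop C c))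
      = tensor_map A C C C (tbimod A C C) id (cop C) (cop C c)"
    unfolding tensor_map_cop[OF right_module_axioms bm d'(1)]
    by (simp only: tensor_assoc_map[OF right_module_axioms bm d'(2) cl] coassoc[OF c])
qed

section \<open>Colinear maps\<close>

lemma comod_homI:
  assumes "f \<in> right_hom A M N"
    and "\<And>x. x ::: M ==> tlift A M C (tgroup A N C) (%y c. telem A N C (f y) c) (coact M x) = coact N (f x)"
  shows "f \<in> comod_hom A C M N"
  using assms by (simp add: comod_hom_def tensor_map_def)

lemma comod_homD:
  assumes "f \<in> comod_hom A C M N"
  shows "f \<in> right_hom A M N"
    and "x ::: M ==> tlift A M C (tgroup A N C) (%y c. telem A N C (f y) c) (coact M x) = coact N (f x)"
  using assms by (simp_all add: comod_hom_def tensor_map_def)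

text \<open>Colinearity as a substitution rule: under every balanced map,
  \<open>f(x)\<^sub>0 \<otimes> f(x)\<^sub>1\<close> may be replaced by
  \<open>f(x\<^sub>0) \<otimes> x\<^sub>1\<close>.\<close>

lemma lift_coact_comod_hom:
  assumes "f \<in> comod_hom A C M N" "bal A N C P \<phi>" "right_module A M" "x ::: M"
    "coact M x ::: (tgroup A M C)"
  shows "tlift A N C P \<phi> (coact N (f x)) = tlift A M C P (%y c. \<phi> (f y) c) (coact M x)"
proof -
  interpret bal A N C P \<phi> by fact
  have "tlift A N C P \<phi> (tensor_map A M C N C f id (coact M x)) = tlift A M C P (%y c. \<phi> (f y) (id c)) (coact M x)"
    by (rule lift_tensor_map[OF assms(2) comod_homD(1)[OF assms(1)] id_left_hom])
       (use assms N.bimodule_axioms in "simp_all add: tensor_prod_def")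
  then show ?thesis
    using assms(1,4) by (simp add: comod_hom_def)
qed

lemma comod_hom_compose:
  assumes "f \<in> comod_hom A C M N" "g \<in> comod_hom A C N P" "right_module A M" "tensor_prod A N C" "tensor_prod A P C"
    "\<And>x. x ::: M ==> coact M x ::: (tgroup A M C)"
  shows "(%x. g (f x)) \<in> comod_hom A C M P"
proof (rule comod_homI)
  interpret N: tensor_prod A N C by fact
  interpret P: tensor_prod A P C by fact
  note f = right_homD[OF comod_homD(1)[OF assms(1)]] and g = right_homD[OF comod_homD(1)[OF assms(2)]]
  show "(%x. g (f x)) \<in> right_hom A M P"
    by (rule right_homI) (simp_all add: f g)
  fix x assume x: "x ::: M"
  have b: "bal A N C (tgroup A P C) (%x y. telem A P C (g x) (id y))"
    by (rule bal.bal_compose[OF P.telem_bal comod_homD(1)[OF assms(2)] id_left_hom])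
       (simp_all add: N.right_module_axioms N.N.bimodule_axioms)
  show "tlift A M C (tgroup A P C) (%y c. telem A P C (g (f y)) c) (coact M x) = coact P (g (f x))"
    using lift_coact_comod_hom[OF assms(1) b assms(3) x assms(6)[OF x]] comod_homD(2)[OF assms(2), of "f x"] f(2)[OF x]
    by simp
qed

section \<open>A coring as a right comodule over itself\<close>

lemma regular_comod_simps [simp]:
  fixes C :: "('a, 'c, 'q) coring_scheme"
  shows "carrier (regular_comod C) = carrier C" "add (regular_comod C) = add C" "ring.zero (regular_comod C) = ring.zero C"
    "ract (regular_comod C) = ract C" "coact (regular_comod C) = cop C"
  by (simp_all add: regular_comod_def)

lemma tensor_regular [simp]:
  fixes C :: "('a, 'c, 'q) coring_scheme"
  shows "telem A (regular_comod C) N = telem A (C) N"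
    "tgroup A (regular_comod C) N = tgroup A (C) N"
    "tlift A (regular_comod C) N P \<phi> t = tlift A (C) N P \<phi> t"
proof -
  have r: "tensor_relations A (regular_comod C) N = tensor_relations A (C) N"
    by (rule tensor_relations_cong) simp_all
  show "telem A (regular_comod C) N = telem A (C) N"
    "tgroup A (regular_comod C) N = tgroup A (C) N"
    "tlift A (regular_comod C) N P \<phi> t = tlift A (C) N P \<phi> t"
    using telem_cong[OF _ _ r] tensor_group_cong(2)[OF _ _ r] tlift_module_cong[OF _ _ r] by simp_all
qed

lemma tright_regular [simp]: "tright A (regular_comod C) N = tright A C N"
  by (simp add: tensor_right_def)

lemma tlift_to_regular [simp]: "tlift A M N (regular_comod C) \<phi> t = tlift A M N C \<phi> t"
  by (simp add: tensor_lift_def hom_def)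

lemma tensor_map_regular [simp]:
  "tensor_map A (regular_comod C) N M' N' f g t = tensor_map A C N M' N' f g t"
  "tensor_map A M K (regular_comod C) L f' g' t' = tensor_map A M K C L f' g' t'"
  by (simp_all add: tensor_map_def)

lemma tensor_assoc_regular [simp]: "tensor_assoc A (regular_comod C) N K t = tensor_assoc A C N K t"
  by (simp add: tensor_assoc_def)

context is_coring
begin

sublocale CC: tensor_prod2 A C C ..

lemma cop_right_hom: "cop C \<in> right_hom A C (tbimod A C C)"
  and cop_left_hom: "cop C \<in> left_hom A C (tbimod A C C)"
  using cop_hom by (simp_all add: bimod_hom_iff)

lemma cou_right_hom: "cou C \<in> right_hom A C (regular_bimod A)"
  and cou_left_hom: "cou C \<in> left_hom A C (regular_bimod A)"
  using cou_hom by (simp_all add: bimod_hom_iff)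

lemma cou_closed: "c ::: C ==> cou C c ::: A"
  and cou_add: "[|c ::: C; d ::: C|] ==> cou C (c \<oplus>[C] d) = cou C c \<oplus>[A] cou C d"
  and cou_ract: "[|c ::: C; a ::: A|] ==> cou C (c \<triangleleft>[C] a) = cou C c \<otimes>[A] a"
  and cou_lact: "[|c ::: C; a ::: A|] ==> cou C (a \<triangleright>[C] c) = a \<otimes>[A] cou C c"
  using right_homD[OF cou_right_hom] left_homD[OF cou_left_hom] by (simp_all add: regular_bimod_def)

lemma regular_right_module: "right_module A (regular_comod C)"
  by (rule right_moduleI)
     (simp_all add: ring_axioms abelian_group_transfer[OF M.abelian_group_axioms] ract_closed ract_add_left ract_add_right ract_assoc ract_one)

lemma regular_right_comodule: "right_comodule A C (regular_comod C)"
proof -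
  have "right_hom A (regular_comod C) (tright A C C) = right_hom A C (tright A C C)"
    by (simp add: right_hom_def hom_def)
  then show ?thesis
    by (intro right_comodule.intro right_comodule_axioms.intro regular_right_module)
       (use cop_right_hom coassociative right_counital in simp_all)
qed

lemma cop_closed: "c ::: C ==> cop C c ::: (tgroup A C C)"
  and cop_add: "[|x ::: C; y ::: C|] ==> cop C (x \<oplus>[C] y) = cop C x \<oplus>[tgroup A C C] cop C y"
  and cop_ract: "[|x ::: C; a ::: A|] ==> cop C (x \<triangleleft>[C] a) = cop C x \<triangleleft>[tright A C C] a"
  and cop_lact: "[|x ::: C; a ::: A|] ==> cop C (a \<triangleright>[C] x) = a \<triangleright>[tbimod A C C] cop C x"
  using right_homD[OF cop_right_hom] left_homD[OF cop_left_hom] by simp_all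

lemma lift_cop_ract:
  assumes "bal A C C P \<phi>" "x ::: C" "a ::: A"
  shows "tlift A C C P \<phi> (cop C (x \<triangleleft>[C] a)) = tlift A C C P (%y c. \<phi> y (c \<triangleleft>[C] a)) (cop C x)"
  by (simp add: cop_ract assms cop_closed bal_lift_ract[OF assms(1)])

lemma lift_cop_lact:
  assumes "bal A C C P \<phi>" "x ::: C" "a ::: A"
  shows "tlift A C C P \<phi> (cop C (a \<triangleright>[C] x)) = tlift A C C P (%y c. \<phi> (a \<triangleright>[C] y) c) (cop C x)"
  by (simp add: cop_lact assms cop_closed bal_lift_lact[OF assms(1)] bimodule_axioms)

lemma lift_cop_add:
  assumes "bal A C C P \<phi>" "x ::: C" "y ::: C"
  shows "tlift A C C P \<phi> (cop C (x \<oplus>[C] y)) = tlift A C C P \<phi> (cop C x) \<oplus>[P] tlift A C C P \<phi> (cop C y)"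
  by (simp add: cop_add assms cop_closed bal.lift_add[OF assms(1)])

lemma lift_cop_closed:
  assumes "bal A C C P \<phi>" "x ::: C"
  shows "tlift A C C P \<phi> (cop C x) ::: P"
  by (simp add: assms cop_closed bal.lift_closed[OF assms(1)])

text \<open>The rule for comodules, applied to the coring as a right comodule over itself.\<close>

lemma cop_coassoc:
  assumes "trilin A C C C P \<phi>" "x ::: C"
  shows "tlift A C C P (%y c. tlift A C C P (%u v. \<phi> u v c) (cop C y)) (cop C x)
    = tlift A C C P (%y c. tlift A C C P (\<phi> y) (cop C c)) (cop C x)"
proof -
  interpret R: right_comodule A C "regular_comod C" by (rule regular_right_comodule)
  interpret R: coring_comodule A C "regular_comod C" ..
  interpret trilin A C C C P \<phi> by fact
  have "trilin A (regular_comod C) C C P \<phi>"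
    by (rule trilinI)
       (simp_all add: R.right_module_axioms bimodule_axioms P.abelian_group_axioms tri_closed tri_add_1 tri_add_2 tri_add_3 tri_balanced_1 tri_balanced_2)
  from R.co_coassoc[OF this, simplified, OF assms(2)] show ?thesis .
qed

lemma left_counit_bal: "bal A C C C (%x y. cou C x \<triangleright>[C] y)"
  by (rule balI)
     (simp_all add: right_module_axioms bimodule_axioms M.abelian_group_axioms cou_closed lact_closed cou_add cou_ract
       lact_add_left lact_add_right lact_assoc)

lemma right_counit_bal: "bal A C C C (%x y. x \<triangleleft>[C] cou C y)"
  by (rule balI)
     (simp_all add: right_module_axioms bimodule_axioms M.abelian_group_axioms cou_closed ract_closed cou_add cou_lact
       ract_add_left ract_add_right ract_assoc)

lemma cop_counit_left:
  assumes "h \<in> add_hom C P" "abelian_group P" "c ::: C"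
  shows "tlift A C C P (%x y. h (cou C x \<triangleright>[C] y)) (cop C c) = h c"
  using bal.lift_additive[OF left_counit_bal assms(1,2) cop_closed[OF assms(3)]] left_counital[OF assms(3)] by simp

lemma cop_counit_right:
  assumes "h \<in> add_hom C P" "abelian_group P" "c ::: C"
  shows "tlift A C C P (%x y. h (x \<triangleleft>[C] cou C y)) (cop C c) = h c"
  using bal.lift_additive[OF right_counit_bal assms(1,2) cop_closed[OF assms(3)]] right_counital[OF assms(3)] by simp

lemma bal_cop_right:
  assumes "trilin A M C C P \<phi>"
  shows "bal A M C P (%x c. tlift A C C P (\<phi> x) (cop C c))"
proof -
  interpret trilin A M C C P \<phi> by fact
  show ?thesis
    using bal.bal_compose[OF bal_right id_right_hom cop_left_hom trilin.axioms(1)[OF assms] bimodule_axioms] by simp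
qed

lemma bal_cop_left:
  assumes "trilin A C C K P \<phi>"
  shows "bal A C K P (%c z. tlift A C C P (%u v. \<phi> u v z) (cop C c))"
proof -
  interpret trilin A C C K P \<phi> by fact
  have "cop C \<in> right_hom A C (tright A C C)"
    using cop_right_hom by simp
  from bal.bal_compose[OF bal_left this id_left_hom trilin.axioms(1)[OF assms] K.bimodule_axioms]
  show ?thesis by simp
qed

end

section \<open>Cofree comodules and retracts\<close>

text \<open>The coaction is \<open>M \<otimes> \<Delta>\<close> followed by reassociation, written
  out on elements so that it lands in \<open>(M \<otimes>\<^sub>A C) \<otimes>\<^sub>A C\<close>
  without an associator.\<close>

definition cofree_comod ::
    "('a, 'p) ring_scheme => ('a, 'c, 'q) coring_scheme => ('a, 'm, 's) right_mod_scheme => ('a, ('m, 'c) tensor, 'c) comod" where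
  "cofree_comod A C M = right_mod.extend (tright A M C)
     \<lparr>coact = (let T = tgroup A (tright A M C) C in
        tlift A M C T
         (%m c. tlift A C C T (%u v. telem A (tright A M C) C (telem A M C m u) v) (cop C c)))\<rparr>"

lemma cofree_comod_simps [simp]:
  fixes M :: "('a, 'm, 's) right_mod_scheme"
  shows "carrier (cofree_comod A C M) = carrier (tgroup A M C)"
    "add (cofree_comod A C M) = add (tgroup A M C)"
    "ring.zero (cofree_comod A C M) = ring.zero (tgroup A M C)"
    "ract (cofree_comod A C M) = ract (tright A M C)"
    "coact (cofree_comod A C M) = tlift A M C (tgroup A (tright A M C) C)
         (%m c. tlift A C C (tgroup A (tright A M C) C)
           (%u v. telem A (tright A M C) C (telem A M C m u) v) (cop C c))"
  by (simp_all add: cofree_comod_def right_mod.extend_def tensor_right_def[of A M C] tensor_add_group_def[of A M C] ring.extend_def Let_def)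

lemma tensor_cofree [simp]:
  fixes C :: "('a, 'c, 'q) coring_scheme"
  shows "telem A (cofree_comod A C M) N = telem A (tright A M C) N"
    "tgroup A (cofree_comod A C M) N = tgroup A (tright A M C) N"
    "tlift A (cofree_comod A C M) N P \<phi> t = tlift A (tright A M C) N P \<phi> t"
proof -
  have r: "tensor_relations A (cofree_comod A C M) N = tensor_relations A (tright A M C) N"
    by (rule tensor_relations_cong) simp_all
  show "telem A (cofree_comod A C M) N = telem A (tright A M C) N"
    "tgroup A (cofree_comod A C M) N = tgroup A (tright A M C) N"
    "tlift A (cofree_comod A C M) N P \<phi> t = tlift A (tright A M C) N P \<phi> t"
    using telem_cong[OF _ _ r] tensor_group_cong(2)[OF _ _ r] tlift_module_cong[OF _ _ r] by simp_all
qed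

lemma tlift_to_cofree [simp]: "tlift A M N (cofree_comod A C M') \<phi> t = tlift A M N (tgroup A M' C) \<phi> t"
  by (simp add: tensor_lift_def hom_def)

locale cofree = C: is_coring A C + right_module A M
  for A :: "('a, 'p) ring_scheme" (structure) and C :: "('a, 'c, 'q) coring_scheme"
    and M :: "('a, 'm, 's) right_mod_scheme"
begin

sublocale MC: tensor_prod A M C ..

sublocale MCr: right_module A "tright A M C" by (rule MC.tright_module)

sublocale T: tensor_prod A "tright A M C" C ..

sublocale E: trilin A M C C "tgroup A (tright A M C) C"
  "%x y z. telem A (tright A M C) C (telem A M C x y) z"
  by (rule trilin_elem_left) unfold_locales

lemma coact_cofree_elem:
  assumes "m ::: M" "c ::: C"
  shows "coact (cofree_comod A C M) (telem A M C m c)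
    = tlift A C C (tgroup A (tright A M C) C)
        (%u v. telem A (tright A M C) C (telem A M C m u) v) (cop C c)"
  unfolding cofree_comod_simps using assms by (subst bal.lift_elem[OF C.bal_cop_right[OF E.trilin_axioms]]) simp_all

lemma coact_cofree_hom: "coact (cofree_comod A C M) \<in> right_hom A (tright A M C) (tright A (tright A M C) C)"
proof (rule right_homI)
  note b = C.bal_cop_right[OF E.trilin_axioms]
  show "coact (cofree_comod A C M) t ::: (tright A (tright A M C) C)"
    if "t ::: (tright A M C)" for t
    using that bal.lift_closed[OF b] by simp
  show "coact (cofree_comod A C M) (s \<oplus>[tright A M C] t)
    = coact (cofree_comod A C M) s \<oplus>[tright A (tright A M C) C] coact (cofree_comod A C M) t"
    if "s ::: (tright A M C)" "t ::: (tright A M C)" for s t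
    using that bal.lift_add[OF b] by simp
  fix t a assume t: "t ::: (tright A M C)" and a: "a ::: A"
  interpret TT: right_module A "tright A (tright A M C) C" by (rule T.tright_module)
  have ra: "(%s. s \<triangleleft>[tright A (tright A M C) C] a) \<in> add_hom (tgroup A (tright A M C) C) (tgroup A (tright A M C) C)"
    by (rule add_homI) (use TT.ract_closed TT.ract_add_left a in simp_all)
  have "coact (cofree_comod A C M) (t \<triangleleft>[tright A M C] a)
    = tlift A M C (tgroup A (tright A M C) C)
         (%m c. tlift A C C (tgroup A (tright A M C) C)
           (%u v. telem A (tright A M C) C (telem A M C m u) v) (cop C (c \<triangleleft>[C] a))) t"
    using t a by (simp add: bal_lift_ract[OF b])
  also have "... = tlift A M C (tgroup A (tright A M C) C)
         (%m c. tlift A C C (tgroup A (tright A M C) C)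
           (%u v. telem A (tright A M C) C (telem A M C m u) v) (cop C c) \<triangleleft>[tright A (tright A M C) C] a) t"
    by (rule lift_cong)
       (simp add: C.lift_cop_ract[OF E.bal_23] a bal.lift_additive[OF E.bal_23 ra T.tensor_abelian_group C.cop_closed]
          T.ract_telem MC.telem_closed)
  also have "... = coact (cofree_comod A C M) t \<triangleleft>[tright A (tright A M C) C] a"
    using t by (simp add: bal.lift_additive[OF b ra T.tensor_abelian_group])
  finally show "coact (cofree_comod A C M) (t \<triangleleft>[tright A M C] a)
    = coact (cofree_comod A C M) t \<triangleleft>[tright A (tright A M C) C] a" .
qed

lemma lift_coact_cofree_elem:
  assumes "bal A (tright A M C) C P \<phi>" "m ::: M" "c ::: C"
  shows "tlift A (tright A M C) C P \<phi> (coact (cofree_comod A C M) (telem A M C m c))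
    = tlift A C C P (%u v. \<phi> (telem A M C m u) v) (cop C c)"
proof -
  interpret bal A "tright A M C" C P \<phi> by fact
  show ?thesis
    unfolding coact_cofree_elem[OF assms(2,3)]
    by (subst bal.lift_additive[OF E.bal_23[OF assms(2)] lift_hom P.abelian_group_axioms C.cop_closed[OF assms(3)]])
       (simp add: lift_elem assms MC.telem_closed)
qed

text \<open>Both axioms are additive in the element of \<open>M \<otimes>\<^sub>A C\<close>. On
  \<open>m \<otimes> c\<close> they become coassociativity and the right counit law of
  \<open>C\<close> applied to \<open>c\<close>.\<close>

lemma cofree_right_comodule: "right_comodule A C (cofree_comod A C M)"
proof (rule right_comoduleI)
  interpret CCb: bimodule A "tbimod A C C" by (rule C.CC.tensor_bimodule)
  interpret D: trilin A "tright A M C" C C "tgroup A (tright A M C) (tbimod A C C)"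
    "%x y z. telem A (tright A M C) (tbimod A C C) x (telem A C C y z)"
    by (rule trilin_elem_right) unfold_locales
  show "right_module A (cofree_comod A C M)"
    using MCr.ract_closed MCr.ract_add_left MCr.ract_add_right MCr.ract_assoc MCr.ract_one
    by (intro right_moduleI) (simp_all add: C.ring_axioms abelian_group_transfer[OF MC.tensor_abelian_group])
  show "coact (cofree_comod A C M) \<in> right_hom A (cofree_comod A C M) (tright A (cofree_comod A C M) C)"
  proof -
    have "tright A (cofree_comod A C M) C = tright A (tright A M C) C"
      by (simp add: tensor_right_def[of A "cofree_comod A C M"] tensor_right_def[of A "tright A M C"])
    then show ?thesis
      using coact_cofree_hom by (simp add: right_hom_def hom_def)
  qed
  let ?co = "coact (cofree_comod A C M)"
  have cc: "?co s ::: (tgroup A (tright A M C) C)" if "s ::: (tgroup A M C)" for s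
    using right_homD(2)[OF coact_cofree_hom] that by simp
  have ca: "?co (s \<oplus>[tgroup A M C] t) = ?co s \<oplus>[tgroup A (tright A M C) C] ?co t"
    if "s ::: (tgroup A M C)" "t ::: (tgroup A M C)" for s t
    using right_homD(3)[OF coact_cofree_hom] that by simp
  let ?T = "tgroup A (tright A M C) (tbimod A C C)"
  let ?l = "tlift A (tright A M C) C ?T"
  let ?e = "%u v c. telem A (tright A M C) (tbimod A C C) u (telem A C C v c)"
  have b1: "bal A (tright A M C) C ?T (%s c. ?l (%u v. ?e u v c) (?co s))"
    using bal.bal_compose[OF D.bal_left coact_cofree_hom id_left_hom MCr.right_module_axioms C.bimodule_axioms] by simp
  have b2: "bal A (tright A M C) C ?T (%s c. tlift A C C ?T (?e s) (cop C c))"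
    by (rule C.bal_cop_right[OF D.trilin_axioms])
  fix t assume "t ::: (cofree_comod A C M)"
  then have t: "t ::: (tgroup A M C)" by simp
  have "?l (%s c. ?l (%u v. ?e u v c) (?co s)) (?co t) = ?l (%s c. tlift A C C ?T (?e s) (cop C c)) (?co t)"
    using t
  proof (induction rule: MC.tensor_induct)
    case (elem m c)
    have tri: "trilin A C C C ?T (%x y z. ?e (telem A M C m x) y z)"
      by (rule trilin_compose[OF D.trilin_axioms _ C.right_module_axioms id_left_hom C.bimodule_axioms, simplified], rule right_homI)
         (use elem in "simp_all add: MC.telem_closed MC.telem_add_right MC.ract_telem")
    show ?case
      using elem C.cop_coassoc[OF tri, of c]
      by (simp only: lift_coact_cofree_elem[OF b1] lift_coact_cofree_elem[OF b2] lift_coact_cofree_elem[OF D.bal_12] cong: tlift_cong)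
  qed (simp only: ca cc bal.lift_add[OF b1] bal.lift_add[OF b2])
  then show "tlift A (cofree_comod A C M) C (tgroup A (cofree_comod A C M) (tbimod A C C))
        (%y c. tlift A (cofree_comod A C M) C (tgroup A (cofree_comod A C M) (tbimod A C C))
          (%u v. telem A (cofree_comod A C M) (tbimod A C C) u (telem A C C v c)) (?co y)) (?co t)
      = tlift A (cofree_comod A C M) C (tgroup A (cofree_comod A C M) (tbimod A C C))
        (%y c. tlift A C C (tgroup A (cofree_comod A C M) (tbimod A C C))
          (%u v. telem A (cofree_comod A C M) (tbimod A C C) y (telem A C C u v)) (cop C c)) (?co t)"
    by (simp only: tensor_cofree)
  have b3: "bal A (tright A M C) C (tgroup A M C) (%y c. y \<triangleleft>[tright A M C] cou C c)"
    using MCr.ract_closed MCr.ract_add_left MCr.ract_add_right MCr.ract_assoc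
    by (intro balI) (simp_all add: MCr.right_module_axioms C.bimodule_axioms MC.tensor_abelian_group C.cou_closed C.cou_add C.cou_lact)
  have "tlift A (tright A M C) C (tgroup A M C) (%y c. y \<triangleleft>[tright A M C] cou C c) (?co t) = t"
    using t
  proof (induction rule: MC.tensor_induct)
    case (elem m c)
    have "telem A M C m \<in> add_hom C (tgroup A M C)"
      by (rule add_homI) (use elem in "simp_all add: MC.telem_closed MC.telem_add_right")
    from C.cop_counit_right[OF this MC.tensor_abelian_group elem(2)] show ?case
      using elem by (simp only: lift_coact_cofree_elem[OF b3] MC.ract_telem C.cou_closed cong: tlift_cong)
  qed (simp only: ca cc bal.lift_add[OF b3])
  then show "tlift A (cofree_comod A C M) C (cofree_comod A C M) (%y c. y \<triangleleft>[cofree_comod A C M] cou C c) (?co t) = t"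
    by (simp only: tensor_cofree tlift_to_cofree cofree_comod_simps(4))
qed (rule C.is_coring_axioms)

end

text \<open>A split idempotent endomorphism \<open>j \<circ> p\<close> of a comodule \<open>N\<close> has an image; it may be taken on any set
  onto which \<open>N\<close> is mapped with the fibres of the idempotent.\<close>

definition retract_mod :: "('a, 'n, 's) right_mod_scheme => ('n => 'u) => ('u => 'n) => ('a, 'u) right_mod" where
  "retract_mod N p j = \<lparr>carrier = p ` carrier N, monoid.mult = undefined, one = undefined,
     ring.zero = p \<zero>[N], add = (%x y. p (j x \<oplus>[N] j y)), ract = (%x a. p (j x \<triangleleft>[N] a))\<rparr>"

definition retract_comod ::
    "('a, 'p) ring_scheme => ('a, 'c, 'q) coring_scheme => ('a, 'n, 'c, 's) comod_scheme
      => ('n => 'u) => ('u => 'n) => ('a, 'u, 'c) comod" where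
  "retract_comod A C N p j = right_mod.extend (retract_mod N p j)
     \<lparr>coact = (%x. tensor_map A N C (retract_mod N p j) C p id (coact N (j x)))\<rparr>"

lemma retract_mod_simps:
  fixes N :: "('a, 'n, 's) right_mod_scheme"
  shows "carrier (retract_mod N p j) = p ` carrier N"
    "x \<oplus>[retract_mod N p j] y = p (j x \<oplus>[N] j y)"
    "\<zero>[retract_mod N p j] = p \<zero>[N]"
    "x \<triangleleft>[retract_mod N p j] a = p (j x \<triangleleft>[N] a)"
  by (simp_all add: retract_mod_def)

lemma retract_comod_simps [simp]:
  fixes N :: "('a, 'n, 'c, 's) comod_scheme"
  shows "carrier (retract_comod A C N p j) = carrier (retract_mod N p j)"
    "add (retract_comod A C N p j) = add (retract_mod N p j)"
    "ring.zero (retract_comod A C N p j) = ring.zero (retract_mod N p j)"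
    "ract (retract_comod A C N p j) = ract (retract_mod N p j)"
  by (simp_all add: retract_comod_def right_mod.extend_def retract_mod_def)

lemma coact_retract_comod:
  "coact (retract_comod A C N p j) x = tensor_map A N C (retract_mod N p j) C p id (coact N (j x))"
  by (simp add: retract_comod_def right_mod.extend_def retract_mod_def)

lemma tensor_retract [simp]:
  fixes C :: "('a, 'c, 'q) coring_scheme"
  shows "telem A (retract_comod A C N' p j) N = telem A (retract_mod N' p j) N"
    "tgroup A (retract_comod A C N' p j) N = tgroup A (retract_mod N' p j) N"
    "tlift A (retract_comod A C N' p j) N P \<phi> t = tlift A (retract_mod N' p j) N P \<phi> t"
proof -
  have r: "tensor_relations A (retract_comod A C N' p j) N = tensor_relations A (retract_mod N' p j) N"
    by (rule tensor_relations_cong) simp_all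
  show "telem A (retract_comod A C N' p j) N = telem A (retract_mod N' p j) N"
    "tgroup A (retract_comod A C N' p j) N = tgroup A (retract_mod N' p j) N"
    "tlift A (retract_comod A C N' p j) N P \<phi> t = tlift A (retract_mod N' p j) N P \<phi> t"
    using telem_cong[OF _ _ r] tensor_group_cong(2)[OF _ _ r] tlift_module_cong[OF _ _ r] by simp_all
qed

lemma tlift_to_retract [simp]: "tlift A M N (retract_comod A C N' p j) \<phi> t = tlift A M N (retract_mod N' p j) \<phi> t"
  by (simp add: tensor_lift_def hom_def)

lemma tright_retract: "tright A (retract_comod A C N p j) C = tright A (retract_mod N p j) C"
  by (simp add: tensor_right_def)

text \<open>Only the composite \<open>j \<circ> p\<close> is required to be linear. The operations
  on the image are defined through it, and \<open>p\<close> and \<open>j\<close> then turn out to be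
  linear for them.\<close>

locale split_endo = right_module A N
  for A :: "('a, 'p) ring_scheme" (structure) and N :: "('a, 'n, 's) right_mod_scheme" +
  fixes p :: "'n => 'u" and j :: "'u => 'n"
  assumes split_hom: "(%n. j (p n)) \<in> right_hom A N N"
    and p_j_p: "n ::: N ==> p (j (p n)) = p n"
begin

lemmas jp = right_homD[OF split_hom]

lemma retract_add: "[|m ::: N; n ::: N|] ==> p m \<oplus>[retract_mod N p j] p n = p (m \<oplus>[N] n)"
  using jp(3)[of m n] p_j_p[of "m \<oplus>[N] n"] by (simp add: retract_mod_simps)

lemma retract_ract: "[|n ::: N; a ::: A|] ==> p n \<triangleleft>[retract_mod N p j] a = p (n \<triangleleft>[N] a)"
  using jp(4)[of n a] p_j_p[of "n \<triangleleft>[N] a"] by (simp add: ract_closed retract_mod_simps)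

lemma p_closed: "n ::: N ==> p n ::: (retract_mod N p j)"
  by (simp add: retract_mod_simps)

lemma retract_right_module: "right_module A (retract_mod N p j)"
proof (rule right_moduleI)
  note r = retract_add retract_ract retract_mod_simps(1,3)
  show "abelian_group (retract_mod N p j)"
  proof (rule abelian_groupI)
    fix x assume "x ::: (retract_mod N p j)"
    then obtain n where n: "n ::: N" "x = p n" by (auto simp: r)
    show "\<exists>y\<in>carrier (retract_mod N p j). y \<oplus>[retract_mod N p j] x = \<zero>[retract_mod N p j]"
      using n retract_add[of "\<ominus>\<^bsub>N\<^esub> n" n] by (intro bexI[of _ "p (\<ominus>\<^bsub>N\<^esub> n)"]) (simp_all add: M.l_neg r)
  qed (auto simp: M.a_ac r)
qed (auto simp: ring_axioms ract_closed ract_add_left ract_add_right ract_assoc ract_one retract_add retract_ract retract_mod_simps(1,3))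

lemma p_hom: "p \<in> right_hom A N (retract_mod N p j)"
  by (rule right_homI) (simp_all add: retract_add retract_ract p_closed)

lemma j_hom: "j \<in> right_hom A (retract_mod N p j) N"
  by (rule right_homI) (auto simp: retract_add retract_ract retract_mod_simps(1) jp ract_closed)

end

locale split_comod_endo = C: is_coring A C + right_comodule A C N + split_endo A N p j
  for A :: "('a, 'p) ring_scheme" (structure) and C :: "('a, 'c, 'q) coring_scheme"
    and N :: "('a, 'n, 'c, 's) comod_scheme" and p :: "'n => 'u" and j :: "'u => 'n" +
  assumes split_comod_hom: "(%n. j (p n)) \<in> comod_hom A C N N"
begin

sublocale coring_comodule A C N ..

sublocale Q: right_module A "retract_mod N p j" by (rule retract_right_module)

sublocale QC: tensor_prod A "retract_mod N p j" C ..

lemma p_bal: "bal A (retract_mod N p j) C P \<phi> ==> bal A N C P (%x y. \<phi> (p x) y)"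
  using bal.bal_compose[OF _ p_hom id_left_hom right_module_axioms C.bimodule_axioms] by simp

text \<open>The coaction of the image at \<open>p n\<close> is \<open>(p \<otimes> C)\<close>
  applied to the coaction of \<open>N\<close> at \<open>j (p n)\<close>. Colinearity of
  \<open>j \<circ> p\<close> moves the endomorphism into the first factor, where \<open>p\<close>
  absorbs it.\<close>

lemma lift_coact_retract:
  assumes "bal A (retract_mod N p j) C P \<phi>" "n ::: N"
  shows "tlift A (retract_mod N p j) C P \<phi> (coact (retract_comod A C N p j) (p n))
    = tlift A N C P (%x y. \<phi> (p x) y) (coact N n)"
proof -
  have "tlift A (retract_mod N p j) C P \<phi> (coact (retract_comod A C N p j) (p n))
    = tlift A N C P (%x y. \<phi> (p x) y) (coact N (j (p n)))"
    using lift_tensor_map[OF assms(1) p_hom id_left_hom MC.tensor_prod_axioms co_closed[OF jp(2)[OF assms(2)]]]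
    by (simp add: coact_retract_comod)
  also have "... = tlift A N C P (%x y. \<phi> (p (j (p x))) y) (coact N n)"
    by (rule lift_coact_comod_hom[OF split_comod_hom p_bal[OF assms(1)] right_module_axioms assms(2) co_closed[OF assms(2)]])
  finally show ?thesis by (simp add: p_j_p)
qed

lemma coact_retract:
  assumes "n ::: N"
  shows "coact (retract_comod A C N p j) (p n) = tensor_map A N C (retract_mod N p j) C p id (coact N n)"
proof -
  have "coact (retract_comod A C N p j) (p n) ::: (tgroup A (retract_mod N p j) C)"
    using hom_carrier_add[OF tensor_map_hom[OF QC.tensor_prod_axioms p_hom id_left_hom MC.tensor_prod_axioms]
        co_closed[OF jp(2)[OF assms]]] by (simp add: coact_retract_comod)
  from QC.lift_telem[OF this] lift_coact_retract[OF QC.telem_bal assms]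
  show ?thesis by (simp add: tensor_map_def)
qed

lemma tensor_map_p_ract:
  assumes "t ::: (tgroup A N C)" "a ::: A"
  shows "tensor_map A N C (retract_mod N p j) C p id (t \<triangleleft>[tright A N C] a)
    = tensor_map A N C (retract_mod N p j) C p id t \<triangleleft>[tright A (retract_mod N p j) C] a"
proof -
  interpret TN: right_module A "tright A N C" by (rule MC.tright_module)
  interpret TQ: right_module A "tright A (retract_mod N p j) C" by (rule QC.tright_module)
  note tm = tensor_map_hom[OF QC.tensor_prod_axioms p_hom id_left_hom MC.tensor_prod_axioms]
  show ?thesis
    using assms(1)
  proof (induction rule: MC.tensor_induct)
    case (elem x y)
    have "tensor_map A N C (retract_mod N p j) C p id (telem A N C x z) = telem A (retract_mod N p j) C (p x) z"
      if "z ::: C" for z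
      using tensor_map_elem[OF QC.tensor_prod_axioms p_hom id_left_hom MC.tensor_prod_axioms elem(1) that] by simp
    then show ?case
      using assms(2) elem by (simp only: MC.ract_telem C.ract_closed QC.ract_telem p_closed)
  next
    case (add s t)
    then show ?case
      using assms(2) TN.ract_add_left[of s t a] TQ.ract_add_left TN.ract_closed
      by (simp add: hom_add[OF tm[unfolded id_def]] hom_carrier_add[OF tm[unfolded id_def]])
  qed
qed

lemma coact_retract_right_hom:
  "coact (retract_comod A C N p j) \<in> right_hom A (retract_mod N p j) (tright A (retract_mod N p j) C)"
proof (rule right_homI)
  note tm = tensor_map_hom[OF QC.tensor_prod_axioms p_hom id_left_hom MC.tensor_prod_axioms]
  let ?co = "coact (retract_comod A C N p j)"
  let ?Q = "retract_mod N p j"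
  fix x assume "x ::: ?Q"
  then obtain n where n: "n ::: N" "x = p n" by (auto simp: retract_mod_simps)
  show "?co x ::: (tright A ?Q C)"
    using n hom_carrier_add[OF tm co_closed[OF n(1)]] by (simp add: coact_retract)
  show "?co (x \<triangleleft>[?Q] a) = ?co x \<triangleleft>[tright A ?Q C] a" if a: "a ::: A" for a
    unfolding n(2) retract_ract[OF n(1) a] coact_retract[OF n(1)] coact_retract[OF ract_closed[OF n(1) a]]
      co_ract[OF n(1) a] by (rule tensor_map_p_ract[OF co_closed[OF n(1)] a])
  fix y assume "y ::: ?Q"
  then obtain m where m: "m ::: N" "y = p m" by (auto simp: retract_mod_simps)
  show "?co (x \<oplus>[?Q] y) = ?co x \<oplus>[tright A ?Q C] ?co y"
    unfolding n(2) m(2) retract_add[OF n(1) m(1)] coact_retract[OF n(1)] coact_retract[OF m(1)]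
      coact_retract[OF M.add.m_closed[OF n(1) m(1)]] co_add[OF n(1) m(1)] tright_simps
    by (rule hom_add[OF tm co_closed[OF n(1)] co_closed[OF m(1)]])
qed

text \<open>By \<open>lift_coact_retract\<close> a Sweedler sum at \<open>p n\<close> is one at
  \<open>n\<close> with \<open>p\<close> inserted, and \<open>p\<close> is onto; so the axioms are
  inherited from \<open>N\<close>.\<close>

lemma retract_right_comodule: "right_comodule A C (retract_comod A C N p j)"
proof (rule right_comoduleI)
  interpret CCb: bimodule A "tbimod A C C" by (rule C.CC.tensor_bimodule)
  let ?Q = "retract_mod N p j"
  let ?co = "coact (retract_comod A C N p j)"
  interpret D: trilin A ?Q C C "tgroup A ?Q (tbimod A C C)"
    "%x y z. telem A ?Q (tbimod A C C) x (telem A C C y z)"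
    by (rule trilin_elem_right) unfold_locales
  show "right_module A (retract_comod A C N p j)"
    using Q.ract_closed Q.ract_add_left Q.ract_add_right Q.ract_assoc Q.ract_one
    by (intro right_moduleI) (simp_all add: C.ring_axioms abelian_group_transfer[OF Q.M.abelian_group_axioms])
  show "?co \<in> right_hom A (retract_comod A C N p j) (tright A (retract_comod A C N p j) C)"
    using coact_retract_right_hom by (simp add: tright_retract right_hom_def hom_def)
  let ?T = "tgroup A ?Q (tbimod A C C)"
  let ?l = "tlift A ?Q C ?T"
  let ?e = "%u v c. telem A ?Q (tbimod A C C) u (telem A C C v c)"
  have b1: "bal A ?Q C ?T (%s c. ?l (%u v. ?e u v c) (?co s))"
    using bal.bal_compose[OF D.bal_left coact_retract_right_hom id_left_hom Q.right_module_axioms C.bimodule_axioms]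
    by simp
  have b2: "bal A ?Q C ?T (%s c. tlift A C C ?T (?e s) (cop C c))"
    by (rule C.bal_cop_right[OF D.trilin_axioms])
  fix x assume "x ::: (retract_comod A C N p j)"
  then obtain n where n: "n ::: N" "x = p n" by (auto simp: retract_mod_simps)
  have tri: "trilin A N C C ?T (%x y z. ?e (p x) y z)"
    using trilin_compose[OF D.trilin_axioms p_hom right_module_axioms id_left_hom C.bimodule_axioms] by simp
  have "?l (%s c. ?l (%u v. ?e u v c) (?co s)) (?co x) = ?l (%s c. tlift A C C ?T (?e s) (cop C c)) (?co x)"
    using n(1) co_coassoc[OF tri n(1)]
    by (simp only: n(2) lift_coact_retract[OF b1] lift_coact_retract[OF b2] lift_coact_retract[OF D.bal_12] cong: tlift_cong)
  then show "tlift A (retract_comod A C N p j) C (tgroup A (retract_comod A C N p j) (tbimod A C C))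
        (%y c. tlift A (retract_comod A C N p j) C (tgroup A (retract_comod A C N p j) (tbimod A C C))
          (%u v. telem A (retract_comod A C N p j) (tbimod A C C) u (telem A C C v c)) (?co y)) (?co x)
      = tlift A (retract_comod A C N p j) C (tgroup A (retract_comod A C N p j) (tbimod A C C))
        (%y c. tlift A C C (tgroup A (retract_comod A C N p j) (tbimod A C C))
          (%u v. telem A (retract_comod A C N p j) (tbimod A C C) y (telem A C C u v)) (cop C c)) (?co x)"
    by (simp only: tensor_retract cong: tlift_cong)
  have b3: "bal A ?Q C ?Q (%y c. y \<triangleleft>[?Q] cou C c)"
    by (intro balI)
       (simp_all add: Q.right_module_axioms C.bimodule_axioms Q.M.abelian_group_axioms C.cou_closed C.cou_add C.cou_lact
          Q.ract_closed Q.ract_add_left Q.ract_add_right Q.ract_assoc)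
  have "tlift A ?Q C ?Q (%y c. y \<triangleleft>[?Q] cou C c) (?co x) = tlift A N C ?Q (%y c. p (y \<triangleleft>[N] cou C c)) (coact N n)"
    using n by (simp add: lift_coact_retract[OF b3] retract_ract C.cou_closed)
  also have "... = p n"
    by (rule co_counit[OF right_homD(1)[OF p_hom] Q.M.abelian_group_axioms n(1)])
  finally show "tlift A (retract_comod A C N p j) C (retract_comod A C N p j) (%y c. y \<triangleleft>[retract_comod A C N p j] cou C c) (?co x) = x"
    using n(2) by simp
qed (rule C.is_coring_axioms)

lemma p_comod_hom: "p \<in> comod_hom A C N (retract_comod A C N p j)"
proof (rule comod_homI)
  show "p \<in> right_hom A N (retract_comod A C N p j)"
    using p_hom by (simp add: right_hom_def hom_def)
qed (simp add: coact_retract tensor_map_def)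

lemma j_comod_hom: "j \<in> comod_hom A C (retract_comod A C N p j) N"
proof (rule comod_homI)
  show "j \<in> right_hom A (retract_comod A C N p j) N"
    using j_hom by (simp add: right_hom_def hom_def)
  fix x assume "x ::: (retract_comod A C N p j)"
  then obtain n where n: "n ::: N" "x = p n" by (auto simp: retract_mod_simps)
  have b: "bal A (retract_mod N p j) C (tgroup A N C) (%y c. telem A N C (j y) c)"
    using bal.bal_compose[OF MC.telem_bal j_hom id_left_hom Q.right_module_axioms C.bimodule_axioms] by simp
  show "tlift A (retract_comod A C N p j) C (tgroup A N C) (%y c. telem A N C (j y) c)
    (coact (retract_comod A C N p j) x) = coact N (j x)"
    using comod_homD(2)[OF split_comod_hom n(1)]
    by (simp add: n lift_coact_retract[OF b])
qed

end

section \<open>Cointegrals and coseparability\<close>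

lemma regular_bicomod_simps [simp]:
  fixes C :: "('a, 'c, 'q) coring_scheme"
  shows "carrier (regular_bicomod C) = carrier C" "add (regular_bicomod C) = add C"
    "ract (regular_bicomod C) = ract C" "lact (regular_bicomod C) = lact C"
    "lcoact (regular_bicomod C) = cop C" "rcoact (regular_bicomod C) = cop C"
  by (simp_all add: regular_bicomod_def)

lemma tensor_bicomod_simps [simp]:
  fixes C :: "('a, 'c, 'q) coring_scheme"
  shows "carrier (tensor_bicomod A C) = carrier (tgroup A C C)" "add (tensor_bicomod A C) = add (tgroup A C C)"
    "ract (tensor_bicomod A C) = ract (tright A C C)" "lact (tensor_bicomod A C) = lact (tbimod A C C)"
  by (simp_all add: tensor_bicomod_def bimod.extend_def tensor_bimod_def right_mod.extend_def tensor_right_def ring.extend_def tensor_add_group_def)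

lemma tensor_bicomod_coact:
  "lcoact (tensor_bicomod A C) t = tensor_assoc A C C C (tensor_map A C C (tright A C C) C (cop C) id t)"
  "rcoact (tensor_bicomod A C) t = tensor_assoc_inv A C C C (tensor_map A C C C (tbimod A C C) id (cop C) t)"
  by (simp_all add: tensor_bicomod_def bimod.extend_def)

lemma tensor_regular_bicomod_1 [simp]:
  fixes C :: "('a, 'c, 'q) coring_scheme"
  shows "telem A (regular_bicomod C) N = telem A (C) N"
    "tgroup A (regular_bicomod C) N = tgroup A (C) N"
    "tlift A (regular_bicomod C) N P \<phi> t = tlift A (C) N P \<phi> t"
proof -
  have r: "tensor_relations A (regular_bicomod C) N = tensor_relations A (C) N"
    by (rule tensor_relations_cong) simp_all
  show "telem A (regular_bicomod C) N = telem A (C) N"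
    "tgroup A (regular_bicomod C) N = tgroup A (C) N"
    "tlift A (regular_bicomod C) N P \<phi> t = tlift A (C) N P \<phi> t"
    using telem_cong[OF _ _ r] tensor_group_cong(2)[OF _ _ r] tlift_module_cong[OF _ _ r] by simp_all
qed

lemma tensor_regular_bicomod_2 [simp]:
  fixes C :: "('a, 'c, 'q) coring_scheme"
  shows "telem A N (regular_bicomod C) = telem A N (C)"
    "tgroup A N (regular_bicomod C) = tgroup A N (C)"
    "tlift A N (regular_bicomod C) P \<phi> t = tlift A N (C) P \<phi> t"
proof -
  have r: "tensor_relations A N (regular_bicomod C) = tensor_relations A N (C)"
    by (rule tensor_relations_cong) simp_all
  show "telem A N (regular_bicomod C) = telem A N (C)"
    "tgroup A N (regular_bicomod C) = tgroup A N (C)"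
    "tlift A N (regular_bicomod C) P \<phi> t = tlift A N (C) P \<phi> t"
    using telem_cong[OF _ _ r] tensor_group_cong(2)[OF _ _ r] tlift_module_cong[OF _ _ r] by simp_all
qed

lemma tensor_tensor_bicomod_1 [simp]:
  fixes C :: "('a, 'c, 'q) coring_scheme"
  shows "telem A (tensor_bicomod A C) N = telem A (tright A C C) N"
    "tgroup A (tensor_bicomod A C) N = tgroup A (tright A C C) N"
    "tlift A (tensor_bicomod A C) N P \<phi> t = tlift A (tright A C C) N P \<phi> t"
proof -
  have r: "tensor_relations A (tensor_bicomod A C) N = tensor_relations A (tright A C C) N"
    by (rule tensor_relations_cong) simp_all
  show "telem A (tensor_bicomod A C) N = telem A (tright A C C) N"
    "tgroup A (tensor_bicomod A C) N = tgroup A (tright A C C) N"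
    "tlift A (tensor_bicomod A C) N P \<phi> t = tlift A (tright A C C) N P \<phi> t"
    using telem_cong[OF _ _ r] tensor_group_cong(2)[OF _ _ r] tlift_module_cong[OF _ _ r] by simp_all
qed

lemma tensor_tensor_bicomod_2 [simp]:
  fixes C :: "('a, 'c, 'q) coring_scheme"
  shows "telem A N (tensor_bicomod A C) = telem A N (tbimod A C C)"
    "tgroup A N (tensor_bicomod A C) = tgroup A N (tbimod A C C)"
    "tlift A N (tensor_bicomod A C) P \<phi> t = tlift A N (tbimod A C C) P \<phi> t"
proof -
  have r: "tensor_relations A N (tensor_bicomod A C) = tensor_relations A N (tbimod A C C)"
    by (rule tensor_relations_cong) simp_all
  show "telem A N (tensor_bicomod A C) = telem A N (tbimod A C C)"
    "tgroup A N (tensor_bicomod A C) = tgroup A N (tbimod A C C)"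
    "tlift A N (tensor_bicomod A C) P \<phi> t = tlift A N (tbimod A C C) P \<phi> t"
    using telem_cong[OF _ _ r] tensor_group_cong(2)[OF _ _ r] tlift_module_cong[OF _ _ r] by simp_all
qed


lemma lift_lift_tensor_assoc_inv:
  assumes "trilin A M N K P \<phi>" "t ::: (tgroup A M (tbimod A N K))"
  shows "tlift A (tright A M N) K P (%s z. tlift A M N P (%x y. \<phi> x y z) s) (tensor_assoc_inv A M N K t)
    = tlift A M (tbimod A N K) P (%x s. tlift A N K P (\<phi> x) s) t"
proof -
  interpret trilin A M N K P \<phi> by fact
  have "tensor_assoc_inv A M N K t ::: (tgroup A (tright A M N) K)"
    using hom_carrier_add[OF tensor_assoc_inv_hom[OF right_module_axioms N.bimodule_axioms K.bimodule_axioms]] assms(2) .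
  from lift_lift_tensor_assoc[OF assms(1) this] show ?thesis
    by (simp add: tensor_assoc_assoc_inv[OF right_module_axioms N.bimodule_axioms K.bimodule_axioms assms(2)])
qed

text \<open>The bimodule map \<open>\<delta> : C \<otimes>\<^sub>A C \<rightarrow> A\<close> of the
  characterization of coseparable corings is given as a balanced function of two arguments, which
  saves a lift in every formula.\<close>

locale cointegral = is_coring A C
  for A :: "('a, 'p) ring_scheme" (structure) and C :: "('a, 'c, 'q) coring_scheme" +
  fixes \<delta> :: "'c => 'c => 'a"
  assumes \<delta>_bal: "bal A C C A \<delta>"
    and \<delta>_lact: "[|x ::: C; y ::: C; a ::: A|] ==> \<delta> (a \<triangleright>[C] x) y = a \<otimes> \<delta> x y"
    and \<delta>_ract: "[|x ::: C; y ::: C; a ::: A|] ==> \<delta> x (y \<triangleleft>[C] a) = \<delta> x y \<otimes> a"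
    and \<delta>_cop: "c ::: C ==> tlift A C C A \<delta> (cop C c) = cou C c"
    and \<delta>_colinear: "[|x ::: C; y ::: C|] ==>
      tlift A C C C (%u v. u \<triangleleft>[C] \<delta> v y) (cop C x) = tlift A C C C (%u v. \<delta> x u \<triangleright>[C] v) (cop C y)"
begin

sublocale \<delta>: bal A C C A \<delta> by (rule \<delta>_bal)

lemmas \<delta>_rules = \<delta>.bal_closed \<delta>.bal_add_left \<delta>.bal_add_right \<delta>.bal_balanced \<delta>_lact \<delta>_ract

lemma ract_hom: "a ::: A ==> (%x. x \<triangleleft>[C] a) \<in> add_hom C C"
  by (rule add_homI) (simp_all add: ract_closed ract_add_left)

lemma lact_hom: "a ::: A ==> (%x. a \<triangleright>[C] x) \<in> add_hom C C"
  by (rule add_homI) (simp_all add: lact_closed lact_add_right)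

lemma trilin_\<delta>_left: "trilin A C C C C (%x y z. x \<triangleleft>[C] \<delta> y z)"
  by (rule trilinI)
     (simp_all add: right_module_axioms bimodule_axioms M.abelian_group_axioms \<delta>_rules ract_closed ract_add_left
       ract_add_right ract_assoc)

lemma trilin_\<delta>_right: "trilin A C C C C (%x y z. \<delta> x y \<triangleright>[C] z)"
  by (rule trilinI)
     (simp_all add: right_module_axioms bimodule_axioms M.abelian_group_axioms \<delta>_rules lact_closed lact_add_left
       lact_add_right lact_assoc)

text \<open>The retraction of the coproduct on elementary tensors. It has two expressions,
  \<open>x\<^sub>1 \<delta>(x\<^sub>2, y)\<close> and
  \<open>\<delta>(x, y\<^sub>1) y\<^sub>2\<close>, equal by \<open>\<delta>_colinear\<close>: the
  first shows left colinearity, the second right colinearity.\<close>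

definition cosplit :: "'c => 'c => 'c" where
  "cosplit x y = tlift A C C C (%u v. u \<triangleleft>[C] \<delta> v y) (cop C x)"

lemma cosplit_right: "[|x ::: C; y ::: C|] ==> cosplit x y = tlift A C C C (%u v. \<delta> x u \<triangleright>[C] v) (cop C y)"
  by (simp add: cosplit_def \<delta>_colinear)

lemma cosplit_bal: "bal A C C C cosplit"
  using bal_cop_left[OF trilin_\<delta>_left] unfolding cosplit_def .

lemma cosplit_lact: "[|x ::: C; y ::: C; a ::: A|] ==> cosplit (a \<triangleright>[C] x) y = a \<triangleright>[C] cosplit x y"
  unfolding cosplit_def
  using lift_cop_lact[OF trilin.bal_12[OF trilin_\<delta>_left], of y x a]
    bal.lift_additive[OF trilin.bal_12[OF trilin_\<delta>_left] lact_hom M.abelian_group_axioms cop_closed, of y a x]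
  by (simp add: lact_ract \<delta>_rules)

lemma cosplit_ract: "[|x ::: C; y ::: C; a ::: A|] ==> cosplit x (y \<triangleleft>[C] a) = cosplit x y \<triangleleft>[C] a"
  unfolding cosplit_def
  using bal.lift_additive[OF trilin.bal_12[OF trilin_\<delta>_left] ract_hom M.abelian_group_axioms cop_closed, of y a x]
  by (simp add: ract_assoc \<delta>_rules)

text \<open>\<open>c\<^sub>1 \<delta>(c\<^sub>2, c\<^sub>3) = c\<^sub>1 \<epsilon>(c\<^sub>2) =
  c\<close>, by coassociativity, \<open>\<delta>_cop\<close> and the counit law.\<close>

lemma cosplit_cop:
  assumes "c ::: C"
  shows "tlift A C C C cosplit (cop C c) = c"
proof -
  have "tlift A C C C cosplit (cop C c) = tlift A C C C (%x y. tlift A C C C (%u v. u \<triangleleft>[C] \<delta> v y) (cop C x)) (cop C c)"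
    by (simp add: cosplit_def)
  also have "... = tlift A C C C (%x y. tlift A C C C (%u v. x \<triangleleft>[C] \<delta> u v) (cop C y)) (cop C c)"
    by (rule cop_coassoc[OF trilin_\<delta>_left assms])
  also have "... = tlift A C C C (%x y. x \<triangleleft>[C] cou C y) (cop C c)"
  proof (rule lift_cong)
    fix x y assume xy: "x ::: C" "y ::: C"
    have "(%a. x \<triangleleft>[C] a) \<in> add_hom A C"
      by (rule add_homI) (use xy in "simp_all add: ract_closed ract_add_right")
    from \<delta>.lift_additive[OF this M.abelian_group_axioms cop_closed[OF xy(2)]]
    show "tlift A C C C (%u v. x \<triangleleft>[C] \<delta> u v) (cop C y) = x \<triangleleft>[C] cou C y"
      by (simp add: \<delta>_cop xy)
  qed
  also have "... = c" by (rule right_counital[OF assms])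
  finally show ?thesis .
qed

text \<open>From the first expression: \<open>\<Delta>(x\<^sub>1 \<delta>(x\<^sub>2, y)) = x\<^sub>1
  \<otimes> x\<^sub>2 \<delta>(x\<^sub>3, y)\<close>, because \<Delta> is right linear.\<close>

lemma cop_cosplit_left:
  assumes "x ::: C" "y ::: C"
  shows "cop C (cosplit x y) = tlift A C C (tgroup A C C) (%u v. telem A C C u (cosplit v y)) (cop C x)"
proof -
  let ?T = "tgroup A C C"
  have tri: "trilin A C C C ?T (%u v w. telem A C C u (v \<triangleleft>[C] \<delta> w y))"
    by (rule trilinI)
       (simp_all add: right_module_axioms bimodule_axioms CC.tensor_abelian_group \<delta>_rules ract_closed ract_add_left
         ract_add_right ract_assoc CC.telem_closed CC.telem_add_left CC.telem_add_right
         CC.telem_balanced lact_ract lact_closed assms)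
  have "cop C (cosplit x y) = tlift A C C ?T (%u v. cop C (u \<triangleleft>[C] \<delta> v y)) (cop C x)"
    unfolding cosplit_def
    using bal.lift_additive[OF trilin.bal_12[OF trilin_\<delta>_left] right_homD(1)[OF cop_right_hom] _ cop_closed] assms
      CC.tensor_abelian_group abelian_group_transfer[OF CC.tensor_abelian_group, of "tbimod A C C"] by simp
  also have "... = tlift A C C ?T (%z w. tlift A C C ?T (%u v. telem A C C u (v \<triangleleft>[C] \<delta> w y)) (cop C z)) (cop C x)"
  proof (rule lift_cong)
    fix z w assume zw: "z ::: C" "w ::: C"
    have "cop C (z \<triangleleft>[C] \<delta> w y) = tlift A C C ?T (telem A C C) (cop C (z \<triangleleft>[C] \<delta> w y))"
      using zw assms by (simp add: CC.lift_telem cop_closed ract_closed \<delta>_rules)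
    then show "cop C (z \<triangleleft>[C] \<delta> w y) = tlift A C C ?T (%u v. telem A C C u (v \<triangleleft>[C] \<delta> w y)) (cop C z)"
      using zw assms by (simp add: lift_cop_ract[OF CC.telem_bal] \<delta>_rules)
  qed
  also have "... = tlift A C C ?T (%u z. tlift A C C ?T (%v w. telem A C C u (v \<triangleleft>[C] \<delta> w y)) (cop C z)) (cop C x)"
    by (rule cop_coassoc[OF tri assms(1)])
  also have "... = tlift A C C ?T (%u v. telem A C C u (cosplit v y)) (cop C x)"
    unfolding cosplit_def
    by (rule lift_cong)
       (simp add: CC.telem_lift_right[OF trilin.bal_12[OF trilin_\<delta>_left] cop_closed] assms)
  finally show ?thesis .
qed

text \<open>From the second expression: \<open>\<Delta>(\<delta>(x, y\<^sub>1) y\<^sub>2) =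
  \<delta>(x, y\<^sub>1) y\<^sub>2 \<otimes> y\<^sub>3\<close>, because \<Delta> is left
  linear.\<close>

lemma cop_cosplit_right:
  assumes "x ::: C" "y ::: C"
  shows "cop C (cosplit x y) = tlift A C C (tgroup A C C) (%u v. telem A C C (cosplit x u) v) (cop C y)"
proof -
  let ?T = "tgroup A C C"
  have tri: "trilin A C C C ?T (%u v w. telem A C C (\<delta> x u \<triangleright>[C] v) w)"
    by (rule trilinI)
       (simp_all add: right_module_axioms bimodule_axioms CC.tensor_abelian_group \<delta>_rules lact_closed lact_add_left
         lact_add_right lact_assoc CC.telem_closed CC.telem_add_left CC.telem_add_right
         CC.telem_balanced[symmetric] lact_ract ract_closed assms)
  have "cop C (cosplit x y) = tlift A C C ?T (%u v. cop C (\<delta> x u \<triangleright>[C] v)) (cop C y)"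
    unfolding cosplit_right[OF assms]
    using bal.lift_additive[OF trilin.bal_23[OF trilin_\<delta>_right] right_homD(1)[OF cop_right_hom] _ cop_closed] assms
      CC.tensor_abelian_group abelian_group_transfer[OF CC.tensor_abelian_group, of "tbimod A C C"] by simp
  also have "... = tlift A C C ?T (%w z. tlift A C C ?T (%u v. telem A C C (\<delta> x w \<triangleright>[C] u) v) (cop C z)) (cop C y)"
  proof (rule lift_cong)
    fix w z assume zw: "w ::: C" "z ::: C"
    have "cop C (\<delta> x w \<triangleright>[C] z) = tlift A C C ?T (telem A C C) (cop C (\<delta> x w \<triangleright>[C] z))"
      using zw assms by (simp add: CC.lift_telem cop_closed lact_closed \<delta>_rules)
    then show "cop C (\<delta> x w \<triangleright>[C] z) = tlift A C C ?T (%u v. telem A C C (\<delta> x w \<triangleright>[C] u) v) (cop C z)"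
      using zw assms by (simp add: lift_cop_lact[OF CC.telem_bal] \<delta>_rules)
  qed
  also have "... = tlift A C C ?T (%z w. tlift A C C ?T (%u v. telem A C C (\<delta> x u \<triangleright>[C] v) w) (cop C z)) (cop C y)"
    by (rule cop_coassoc[OF tri assms(2), symmetric])
  also have "... = tlift A C C ?T (%u v. telem A C C (cosplit x u) v) (cop C y)"
    by (rule lift_cong)
       (simp add: cosplit_right CC.telem_lift_left[OF trilin.bal_23[OF trilin_\<delta>_right] cop_closed] assms)
  finally show ?thesis .
qed

text \<open>The bicolinear retraction is the lift of \<open>cosplit\<close>. That the coproduct is
  itself bicolinear, as the definition of \<open>coseparable\<close> asks, is coassociativity read
  through the associator and its inverse.\<close>

theorem cointegral_coseparable: "coseparable A C"
proof -
  let ?T = "tgroup A C C"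
  let ?\<pi> = "tlift A C C C cosplit"
  interpret CCr: right_module A "tright A C C" by (rule CC.tright_module)
  interpret CCb: bimodule A "tbimod A C C" by (rule CC.tensor_bimodule)
  interpret T1: tensor_prod A "tright A C C" C ..
  interpret T2: tensor_prod A C "tbimod A C C" ..
  note cosp = bal.lift_closed[OF cosplit_bal] bal.lift_add[OF cosplit_bal]
  have cr: "cop C \<in> right_hom A C (tright A C C)" using cop_right_hom by simp
  have 1: "cop C \<in> bicomod_hom A C (regular_bicomod C) (tensor_bicomod A C)"
  proof -
    have "cop C \<in> bimod_hom A (regular_bicomod C) (tensor_bicomod A C)"
      using right_homD[OF cop_right_hom] left_homD[OF cop_left_hom] unfolding bimod_hom_iff
      by (intro conjI right_homI left_homI) simp_all
    moreover have "tensor_map A C C (tbimod A C C) C (cop C) id (cop C c) ::: (tgroup A (tright A C C) C)"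
      if "c ::: C" for c
      using hom_carrier_add[OF tensor_map_hom[OF T1.tensor_prod_axioms cr id_left_hom CC.tensor_prod_axioms] cop_closed[OF that]]
      by simp
    ultimately show ?thesis
      using tensor_assoc_inv_assoc[OF right_module_axioms bimodule_axioms bimodule_axioms]
        coassociative[symmetric, unfolded tensor_map_def]
      by (simp add: bicomod_hom_def tensor_bicomod_coact tensor_map_def)
  qed
  have \<pi>_right: "?\<pi> \<in> right_hom A (tright A C C) C"
    by (rule right_homI)
       (use bal.lift_additive[OF cosplit_bal ract_hom M.abelian_group_axioms] in
         \<open>simp_all add: cosp bal_lift_ract[OF cosplit_bal] cosplit_ract\<close>)
  have \<pi>_left: "?\<pi> \<in> left_hom A (tbimod A C C) C"
    by (rule left_homI)
       (use bal.lift_additive[OF cosplit_bal lact_hom M.abelian_group_axioms] in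
         \<open>simp_all add: cosp bal_lift_lact[OF cosplit_bal bimodule_axioms] cosplit_lact\<close>)
  have tri1: "trilin A C C C ?T (%u v w. telem A C C u (cosplit v w))"
    by (rule trilinI)
       (simp_all add: right_module_axioms bimodule_axioms CC.tensor_abelian_group balD[OF cosplit_bal]
          CC.telem_closed CC.telem_add_left CC.telem_add_right CC.telem_balanced cosplit_lact)
  have tri2: "trilin A C C C ?T (%u v w. telem A C C (cosplit u v) w)"
    by (rule trilinI)
       (simp_all add: right_module_axioms bimodule_axioms CC.tensor_abelian_group balD[OF cosplit_bal]
          CC.telem_closed CC.telem_add_left CC.telem_add_right CC.telem_balanced[symmetric] cosplit_ract)
  have tm1: "tensor_map A C C (tright A C C) C (cop C) id t ::: (tgroup A (tright A C C) C)"
    if "t ::: ?T" for t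
    using hom_carrier_add[OF tensor_map_hom[OF T1.tensor_prod_axioms cr id_left_hom CC.tensor_prod_axioms] that] .
  have tm2: "tensor_map A C C C (tbimod A C C) id (cop C) t ::: (tgroup A C (tbimod A C C))"
    if "t ::: ?T" for t
    using hom_carrier_add[OF tensor_map_hom[OF T2.tensor_prod_axioms id_right_hom cop_left_hom CC.tensor_prod_axioms] that] .
  have cop\<pi>: "(%t. cop C (?\<pi> t)) \<in> add_hom ?T ?T"
    by (rule add_homI) (simp_all add: cop_closed cop_add cosp)
  \<comment> \<open>Left colinearity of the retraction. Once the associator in the left coaction is
    absorbed, both sides are lifts of one balanced map, compared by
    \<open>cop_cosplit_left\<close>.\<close>
  have 2: "tlift A C (tbimod A C C) ?T (%u s. telem A C C u (?\<pi> s))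
      (tensor_assoc A C C C (tensor_map A C C (tright A C C) C (cop C) id t)) = cop C (?\<pi> t)" if t: "t ::: ?T" for t
  proof -
    have "tlift A C (tbimod A C C) ?T (%u s. telem A C C u (?\<pi> s))
      (tensor_assoc A C C C (tensor_map A C C (tright A C C) C (cop C) id t))
      = tlift A C (tbimod A C C) ?T (%u s. tlift A C C ?T (%v w. telem A C C u (cosplit v w)) s)
      (tensor_assoc A C C C (tensor_map A C C (tright A C C) C (cop C) id t))"
      by (rule lift_cong) (simp add: CC.telem_lift_right[OF cosplit_bal])
    also have "... = tlift A C C ?T (%x y. tlift A C C ?T (%u v. telem A C C u (cosplit v y)) (cop C x)) t"
      using lift_tensor_map[OF trilin.bal_left[OF tri1] cr id_left_hom CC.tensor_prod_axioms t]
      by (simp add: lift_lift_tensor_assoc[OF tri1 tm1[OF t]] del: id_apply) simp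
    also have "... = tlift A C C ?T (%x y. cop C (cosplit x y)) t"
      by (rule lift_cong) (simp add: cop_cosplit_left)
    also have "... = cop C (?\<pi> t)"
      by (rule bal.lift_additive[OF cosplit_bal _ CC.tensor_abelian_group t, symmetric], rule add_homI)
         (simp_all add: cop_closed cop_add)
    finally show ?thesis .
  qed
  have 3: "tlift A (tright A C C) C ?T (%s v. telem A C C (?\<pi> s) v)
      (tensor_assoc_inv A C C C (tensor_map A C C C (tbimod A C C) id (cop C) t)) = cop C (?\<pi> t)" if t: "t ::: ?T" for t
  proof -
    have "tlift A (tright A C C) C ?T (%s v. telem A C C (?\<pi> s) v)
      (tensor_assoc_inv A C C C (tensor_map A C C C (tbimod A C C) id (cop C) t))
      = tlift A (tright A C C) C ?T (%s w. tlift A C C ?T (%u v. telem A C C (cosplit u v) w) s)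
      (tensor_assoc_inv A C C C (tensor_map A C C C (tbimod A C C) id (cop C) t))"
      by (rule lift_cong) (simp add: CC.telem_lift_left[OF cosplit_bal])
    also have "... = tlift A C C ?T (%x y. tlift A C C ?T (%u v. telem A C C (cosplit x u) v) (cop C y)) t"
      using lift_tensor_map[OF trilin.bal_right[OF tri2] id_right_hom cop_left_hom CC.tensor_prod_axioms t]
      by (simp add: lift_lift_tensor_assoc_inv[OF tri2 tm2[OF t]] del: id_apply) simp
    also have "... = tlift A C C ?T (%x y. cop C (cosplit x y)) t"
      by (rule lift_cong) (simp add: cop_cosplit_right)
    also have "... = cop C (?\<pi> t)"
      by (rule bal.lift_additive[OF cosplit_bal _ CC.tensor_abelian_group t, symmetric], rule add_homI)
         (simp_all add: cop_closed cop_add)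
    finally show ?thesis .
  qed
  have "?\<pi> \<in> bicomod_hom A C (tensor_bicomod A C) (regular_bicomod C)"
  proof -
    have "?\<pi> \<in> bimod_hom A (tensor_bicomod A C) (regular_bicomod C)"
      using right_homD[OF \<pi>_right] left_homD[OF \<pi>_left] unfolding bimod_hom_iff
      by (intro conjI right_homI left_homI) simp_all
    then show ?thesis
      using 2 3 by (simp add: bicomod_hom_def tensor_bicomod_coact tensor_map_def[of _ "tensor_bicomod A C"] tensor_map_def[of _ _ "tensor_bicomod A C"])
  qed
  with 1 show ?thesis
    unfolding coseparable_def by (blast intro: cosplit_cop)
qed

end

section \<open>Equivalences of categories\<close>

text \<open>These conditions ask for one preimage object at a time, so they can be checked without
  organizing transported structures into a functor.\<close>

locale ff_es_functor = is_functor \<C> \<D> F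
  for \<C> :: "('o, 'm) category" and \<D> :: "('p, 'n) category" and F :: "('o, 'm, 'p, 'n) functr" +
  assumes faithful: "[|X \<in> Ob \<C>; Y \<in> Ob \<C>; f \<in> Ar \<C> X Y; g \<in> Ar \<C> X Y; Far F X Y f = Far F X Y g|] ==> f = g"
    and full: "[|X \<in> Ob \<C>; Y \<in> Ob \<C>; h \<in> Ar \<D> (Fob F X) (Fob F Y)|] ==> \<exists>f\<in>Ar \<C> X Y. Far F X Y f = h"
    and ess_surj: "Z \<in> Ob \<D> ==> \<exists>X\<in>Ob \<C>. isos \<D> (Fob F X) Z \<noteq> {}"
begin

text \<open>The quasi-inverse \<open>G\<close> is made by choice: an object \<open>G_ob Z\<close>,
  an isomorphism \<open>cnt Z\<close> from its image to \<open>Z\<close> with inverse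
  \<open>cnt' Z\<close>, and on arrows the preimage \<open>pre\<close> of the conjugate
  \<open>cjg\<close> by these isomorphisms.\<close>

definition "G_ob Z = (SOME X. X \<in> Ob \<C> \<and> isos \<D> (Fob F X) Z \<noteq> {})"
definition "cnt Z = (SOME e. e \<in> isos \<D> (Fob F (G_ob Z)) Z)"
definition "cnt' Z = (SOME e. e \<in> Ar \<D> Z (Fob F (G_ob Z)) \<and>
  Cmp \<D> (Fob F (G_ob Z)) Z (Fob F (G_ob Z)) e (cnt Z) = Idn \<D> (Fob F (G_ob Z)) \<and>
  Cmp \<D> Z (Fob F (G_ob Z)) Z (cnt Z) e = Idn \<D> Z)"
definition "pre X Y h = (SOME f. f \<in> Ar \<C> X Y \<and> Far F X Y f = h)"
definition "cjg Z W f = Cmp \<D> (Fob F (G_ob Z)) W (Fob F (G_ob W)) (cnt' W) (Cmp \<D> (Fob F (G_ob Z)) Z W f (cnt Z))"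
definition "G = \<lparr>Fob = G_ob, Far = (%Z W f. pre (G_ob Z) (G_ob W) (cjg Z W f))\<rparr>"

lemma G_ob: "Z \<in> Ob \<D> ==> G_ob Z \<in> Ob \<C>" and cnt_iso: "Z \<in> Ob \<D> ==> cnt Z \<in> isos \<D> (Fob F (G_ob Z)) Z"
proof -
  assume Z: "Z \<in> Ob \<D>"
  have "\<exists>X. X \<in> Ob \<C> \<and> isos \<D> (Fob F X) Z \<noteq> {}"
    using ess_surj[OF Z] by blast
  from someI_ex[OF this, folded G_ob_def] show "G_ob Z \<in> Ob \<C>" "cnt Z \<in> isos \<D> (Fob F (G_ob Z)) Z"
    unfolding cnt_def some_in_eq by simp_all
qed

lemma cnt_Ar: "Z \<in> Ob \<D> ==> cnt Z \<in> Ar \<D> (Fob F (G_ob Z)) Z"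
  using cnt_iso by (auto simp: isos_def)

lemma cnt':
  assumes "Z \<in> Ob \<D>"
  shows "cnt' Z \<in> Ar \<D> Z (Fob F (G_ob Z))"
    "Cmp \<D> (Fob F (G_ob Z)) Z (Fob F (G_ob Z)) (cnt' Z) (cnt Z) = Idn \<D> (Fob F (G_ob Z))"
    "Cmp \<D> Z (Fob F (G_ob Z)) Z (cnt Z) (cnt' Z) = Idn \<D> Z"
proof -
  have "\<exists>e. e \<in> Ar \<D> Z (Fob F (G_ob Z)) \<and>
    Cmp \<D> (Fob F (G_ob Z)) Z (Fob F (G_ob Z)) e (cnt Z) = Idn \<D> (Fob F (G_ob Z)) \<and>
    Cmp \<D> Z (Fob F (G_ob Z)) Z (cnt Z) e = Idn \<D> Z"
    using cnt_iso[OF assms] unfolding isos_def by blast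
  from someI_ex[OF this, folded cnt'_def]
  show "cnt' Z \<in> Ar \<D> Z (Fob F (G_ob Z))"
    "Cmp \<D> (Fob F (G_ob Z)) Z (Fob F (G_ob Z)) (cnt' Z) (cnt Z) = Idn \<D> (Fob F (G_ob Z))"
    "Cmp \<D> Z (Fob F (G_ob Z)) Z (cnt Z) (cnt' Z) = Idn \<D> Z" by blast+
qed

lemma pre:
  assumes "X \<in> Ob \<C>" "Y \<in> Ob \<C>" "h \<in> Ar \<D> (Fob F X) (Fob F Y)"
  shows "pre X Y h \<in> Ar \<C> X Y" "Far F X Y (pre X Y h) = h"
proof -
  have "\<exists>f. f \<in> Ar \<C> X Y \<and> Far F X Y f = h" using full[OF assms] by blast
  from someI_ex[OF this, folded pre_def] show "pre X Y h \<in> Ar \<C> X Y" "Far F X Y (pre X Y h) = h" by auto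
qed

lemma cjg_Ar: "[|Z \<in> Ob \<D>; W \<in> Ob \<D>; f \<in> Ar \<D> Z W|] ==> cjg Z W f \<in> Ar \<D> (Fob F (G_ob Z)) (Fob F (G_ob W))"
  unfolding cjg_def
  using target.Cmp_Ar[OF _ _ _ target.Cmp_Ar cnt'(1), of "Fob F (G_ob Z)" W Z "cnt Z" f] cnt_Ar Fob_Ob G_ob by blast

text \<open>Naturality of the isomorphisms \<open>cnt\<close>; it follows on cancelling
  \<open>cnt W\<close> against the \<open>cnt' W\<close> in the definition of
  \<open>cjg\<close>.\<close>

lemma cnt_cjg:
  assumes "Z \<in> Ob \<D>" "W \<in> Ob \<D>" "f \<in> Ar \<D> Z W"
  shows "Cmp \<D> (Fob F (G_ob Z)) (Fob F (G_ob W)) W (cnt W) (cjg Z W f) = Cmp \<D> (Fob F (G_ob Z)) Z W f (cnt Z)"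
proof -
  note o = assms(1,2) Fob_Ob[OF G_ob[OF assms(1)]] Fob_Ob[OF G_ob[OF assms(2)]]
  have k: "Cmp \<D> (Fob F (G_ob Z)) Z W f (cnt Z) \<in> Ar \<D> (Fob F (G_ob Z)) W"
    by (rule target.Cmp_Ar[OF o(3,1,2) cnt_Ar[OF o(1)] assms(3)])
  show ?thesis
    unfolding cjg_def target.Cmp_assoc[OF o(3,2,4,2) k cnt'(1)[OF o(2)] cnt_Ar[OF o(2)]] cnt'(3)[OF o(2)]
    by (rule target.Cmp_Idn_left[OF o(3,2) k])
qed

lemma cjg_Cmp:
  assumes "X \<in> Ob \<D>" "Y \<in> Ob \<D>" "Z \<in> Ob \<D>" "f \<in> Ar \<D> X Y" "g \<in> Ar \<D> Y Z"
  shows "cjg X Z (Cmp \<D> X Y Z g f) = Cmp \<D> (Fob F (G_ob X)) (Fob F (G_ob Y)) (Fob F (G_ob Z)) (cjg Y Z g) (cjg X Y f)"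
proof -
  note o = assms(1-3)
  note p = Fob_Ob[OF G_ob[OF assms(1)]] Fob_Ob[OF G_ob[OF assms(2)]] Fob_Ob[OF G_ob[OF assms(3)]]
  have gc: "Cmp \<D> (Fob F (G_ob Y)) Y Z g (cnt Y) \<in> Ar \<D> (Fob F (G_ob Y)) Z"
    by (rule target.Cmp_Ar[OF p(2) o(2,3) cnt_Ar[OF o(2)] assms(5)])
  have "Cmp \<D> (Fob F (G_ob X)) (Fob F (G_ob Y)) (Fob F (G_ob Z)) (cjg Y Z g) (cjg X Y f)
    = Cmp \<D> (Fob F (G_ob X)) Z (Fob F (G_ob Z)) (cnt' Z)
        (Cmp \<D> (Fob F (G_ob X)) (Fob F (G_ob Y)) Z (Cmp \<D> (Fob F (G_ob Y)) Y Z g (cnt Y)) (cjg X Y f))"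
    unfolding cjg_def[of Y Z]
    by (rule target.Cmp_assoc[OF p(1,2) o(3) p(3) cjg_Ar[OF o(1,2) assms(4)] gc cnt'(1)[OF o(3)], symmetric])
  also have "Cmp \<D> (Fob F (G_ob X)) (Fob F (G_ob Y)) Z (Cmp \<D> (Fob F (G_ob Y)) Y Z g (cnt Y)) (cjg X Y f)
    = Cmp \<D> (Fob F (G_ob X)) X Z (Cmp \<D> X Y Z g f) (cnt X)"
    unfolding target.Cmp_assoc[OF p(1,2) o(2,3) cjg_Ar[OF o(1,2) assms(4)] cnt_Ar[OF o(2)] assms(5), symmetric]
      cnt_cjg[OF o(1,2) assms(4)]
    by (rule target.Cmp_assoc[OF p(1) o cnt_Ar[OF o(1)] assms(4,5)])
  finally show ?thesis by (simp add: cjg_def)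
qed

lemma cjg_Idn: "Z \<in> Ob \<D> ==> cjg Z Z (Idn \<D> Z) = Idn \<D> (Fob F (G_ob Z))"
  unfolding cjg_def using target.Cmp_Idn_left[OF Fob_Ob[OF G_ob] _ cnt_Ar] cnt'(2) by metis

text \<open>Faithfulness of \<open>F\<close> allows the functor laws to be checked after applying
  \<open>F\<close>, where they become those of \<open>cjg\<close>.\<close>

lemma G_functor: "is_functor \<D> \<C> G"
proof (rule is_functor.intro[OF target.is_category_axioms source.is_category_axioms], rule is_functor_axioms.intro)
  fix X assume X: "X \<in> Ob \<D>"
  show "Fob G X \<in> Ob \<C>" using G_ob[OF X] by (simp add: G_def)
  note o = G_ob[OF X] Fob_Ob[OF G_ob[OF X]]
  note p = pre[OF o(1) o(1) target.Idn_Ar[OF o(2)]]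
  have "pre (G_ob X) (G_ob X) (Idn \<D> (Fob F (G_ob X))) = Idn \<C> (G_ob X)"
    by (rule faithful[OF o(1) o(1) p(1) source.Idn_Ar[OF o(1)]]) (simp add: p(2) Far_Idn[OF o(1)])
  then show "Far G X X (Idn \<D> X) = Idn \<C> (Fob G X)"
    by (simp add: G_def cjg_Idn[OF X])
next
  fix X Y f assume "X \<in> Ob \<D>" "Y \<in> Ob \<D>" "f \<in> Ar \<D> X Y"
  then show "Far G X Y f \<in> Ar \<C> (Fob G X) (Fob G Y)"
    by (simp add: G_def pre G_ob cjg_Ar)
next
  fix X Y Z f g assume o: "X \<in> Ob \<D>" "Y \<in> Ob \<D>" "Z \<in> Ob \<D>" and f: "f \<in> Ar \<D> X Y" and g: "g \<in> Ar \<D> Y Z"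
  note q = G_ob[OF o(1)] G_ob[OF o(2)] G_ob[OF o(3)]
  note p1 = pre[OF q(1,2) cjg_Ar[OF o(1,2) f]] and p2 = pre[OF q(2,3) cjg_Ar[OF o(2,3) g]]
    and p3 = pre[OF q(1,3) cjg_Ar[OF o(1,3) target.Cmp_Ar[OF o f g]]]
  have "pre (G_ob X) (G_ob Z) (cjg X Z (Cmp \<D> X Y Z g f))
    = Cmp \<C> (G_ob X) (G_ob Y) (G_ob Z) (pre (G_ob Y) (G_ob Z) (cjg Y Z g)) (pre (G_ob X) (G_ob Y) (cjg X Y f))"
    by (rule faithful[OF q(1,3) p3(1) source.Cmp_Ar[OF q p1(1) p2(1)]])
       (simp only: Far_Cmp[OF q p1(1) p2(1)] p1(2) p2(2) p3(2), rule cjg_Cmp[OF o f g])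
  then show "Far G X Z (Cmp \<D> X Y Z g f) = Cmp \<C> (Fob G X) (Fob G Y) (Fob G Z) (Far G Y Z g) (Far G X Y f)"
    by (simp add: G_def)
qed

lemma unit_iso:
  assumes X: "X \<in> Ob \<C>"
  shows "pre (G_ob (Fob F X)) X (cnt (Fob F X)) \<in> isos \<C> (G_ob (Fob F X)) X"
proof -
  note o = Fob_Ob[OF X] G_ob[OF Fob_Ob[OF X]]
  note e = pre[OF o(2) X cnt_Ar[OF o(1)]] pre[OF X o(2) cnt'(1)[OF o(1)]]
  let ?Z = "Fob F X" and ?GZ = "G_ob (Fob F X)"
  have "Cmp \<C> ?GZ X ?GZ (pre X ?GZ (cnt' ?Z)) (pre ?GZ X (cnt ?Z)) = Idn \<C> ?GZ"
    by (rule faithful[OF o(2) o(2) source.Cmp_Ar[OF o(2) X o(2) e(1) e(3)] source.Idn_Ar[OF o(2)]])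
       (simp only: Far_Cmp[OF o(2) X o(2) e(1) e(3)] e(2,4) Far_Idn[OF o(2)] cnt'(2)[OF o(1)])
  moreover have "Cmp \<C> X ?GZ X (pre ?GZ X (cnt ?Z)) (pre X ?GZ (cnt' ?Z)) = Idn \<C> X"
    by (rule faithful[OF X X source.Cmp_Ar[OF X o(2) X e(3) e(1)] source.Idn_Ar[OF X]])
       (simp only: Far_Cmp[OF X o(2) X e(3) e(1)] e(2,4) Far_Idn[OF X] cnt'(3)[OF o(1)])
  ultimately show ?thesis
    using e(1,3) by (auto simp: isos_def)
qed

text \<open>Lets a functor be reversed within the class, as needed when two categories are compared
  through a common target.\<close>

theorem G_ff_es: "ff_es_functor \<D> \<C> G"
proof (rule ff_es_functor.intro[OF G_functor], rule ff_es_functor_axioms.intro)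
  \<comment> \<open>An arrow is recovered from its composite with \<open>cnt Z\<close> by composing
    with the inverse \<open>cnt' Z\<close>; so the conjugate determines the arrow.\<close>
  have can: "f = Cmp \<D> Z (Fob F (G_ob Z)) W (Cmp \<D> (Fob F (G_ob Z)) Z W f (cnt Z)) (cnt' Z)"
    if "Z \<in> Ob \<D>" "W \<in> Ob \<D>" "f \<in> Ar \<D> Z W" for Z W f
    by (rule target.Cmp_assoc[OF that(1) Fob_Ob[OF G_ob[OF that(1)]] that(1,2) cnt'(1)[OF that(1)] cnt_Ar[OF that(1)] that(3),
      unfolded cnt'(3)[OF that(1)] target.Cmp_Idn_right[OF that]])
  fix X Y f g assume o: "X \<in> Ob \<D>" "Y \<in> Ob \<D>" and fg: "f \<in> Ar \<D> X Y" "g \<in> Ar \<D> X Y" "Far G X Y f = Far G X Y g"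
  have e: "pre (G_ob X) (G_ob Y) (cjg X Y f) = pre (G_ob X) (G_ob Y) (cjg X Y g)"
    using fg(3) unfolding G_def functr.simps .
  note p = pre(2)[OF G_ob[OF o(1)] G_ob[OF o(2)]]
  from trans[OF p[OF cjg_Ar[OF o fg(1)], unfolded e, symmetric] p[OF cjg_Ar[OF o fg(2)]]] have "cjg X Y f = cjg X Y g" .
  then have "Cmp \<D> (Fob F (G_ob X)) X Y f (cnt X) = Cmp \<D> (Fob F (G_ob X)) X Y g (cnt X)"
    by (simp only: cnt_cjg[OF o fg(1), symmetric] cnt_cjg[OF o fg(2), symmetric])
  from trans[OF can[OF o fg(1), unfolded this] can[OF o fg(2), symmetric]] show "f = g" .
next
  fix X Y h assume o: "X \<in> Ob \<D>" "Y \<in> Ob \<D>" and "h \<in> Ar \<C> (Fob G X) (Fob G Y)"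
  then have h: "h \<in> Ar \<C> (G_ob X) (G_ob Y)" by (simp add: G_def)
  note p = Fob_Ob[OF G_ob[OF o(1)]] Fob_Ob[OF G_ob[OF o(2)]]
  let ?h = "Far F (G_ob X) (G_ob Y) h"
  have Fh: "?h \<in> Ar \<D> (Fob F (G_ob X)) (Fob F (G_ob Y))" by (rule Far_Ar[OF G_ob[OF o(1)] G_ob[OF o(2)] h])
  let ?k = "Cmp \<D> (Fob F (G_ob X)) (Fob F (G_ob Y)) Y (cnt Y) ?h"
  let ?f = "Cmp \<D> X (Fob F (G_ob X)) Y ?k (cnt' X)"
  have k: "?k \<in> Ar \<D> (Fob F (G_ob X)) Y" by (rule target.Cmp_Ar[OF p o(2) Fh cnt_Ar[OF o(2)]])
  have f: "?f \<in> Ar \<D> X Y" by (rule target.Cmp_Ar[OF o(1) p(1) o(2) cnt'(1)[OF o(1)] k])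
  have "Cmp \<D> (Fob F (G_ob X)) X Y ?f (cnt X) = ?k"
    using target.Cmp_assoc[OF p(1) o(1) p(1) o(2) cnt_Ar[OF o(1)] cnt'(1)[OF o(1)] k] cnt'(2)[OF o(1)]
      target.Cmp_Idn_right[OF p(1) o(2) k] by simp
  then have "cjg X Y ?f = ?h"
    using target.Cmp_assoc[OF p o(2) p(2) Fh cnt_Ar[OF o(2)] cnt'(1)[OF o(2)]] cnt'(2)[OF o(2)]
      target.Cmp_Idn_left[OF p Fh] by (simp add: cjg_def)
  then have "Far G X Y ?f = h"
    using faithful[OF G_ob[OF o(1)] G_ob[OF o(2)] pre(1)[OF G_ob[OF o(1)] G_ob[OF o(2)] Fh] h]
      pre(2)[OF G_ob[OF o(1)] G_ob[OF o(2)] Fh] by (simp add: G_def)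
  then show "\<exists>f\<in>Ar \<D> X Y. Far G X Y f = h" using f by blast
next
  fix Z assume "Z \<in> Ob \<C>"
  then show "\<exists>X\<in>Ob \<D>. isos \<C> (Fob G X) Z \<noteq> {}"
    using unit_iso[of Z] by (intro bexI[of _ "Fob F Z"]) (auto simp: G_def Fob_Ob)
qed

theorem equivalence: "is_equivalence \<C> \<D> F"
  unfolding is_equivalence_def
proof (intro conjI exI[of _ G])
  show "is_functor \<C> \<D> F" by (rule is_functor_axioms)
  show "is_functor \<D> \<C> G" by (rule G_functor)
  show "naturally_isomorphic \<D> \<D> (comp_functor F G) id_functor"
    unfolding naturally_isomorphic_def
    by (intro exI[of _ cnt])
       (simp add: comp_functor_def id_functor_def G_def cnt_iso pre G_ob cjg_Ar cnt_cjg)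
  show "naturally_isomorphic \<C> \<C> (comp_functor G F) id_functor"
    unfolding naturally_isomorphic_def
  proof (intro exI[of _ "%X. pre (G_ob (Fob F X)) X (cnt (Fob F X))"] conjI ballI)
    fix X assume X: "X \<in> Ob \<C>"
    note o = Fob_Ob[OF X] G_ob[OF Fob_Ob[OF X]]
    note e = pre[OF o(2) X cnt_Ar[OF o(1)]] pre[OF X o(2) cnt'(1)[OF o(1)]]
    show "pre (G_ob (Fob F X)) X (cnt (Fob F X)) \<in> isos \<C> (Fob (comp_functor G F) X) (Fob id_functor X)"
      using unit_iso[OF X] by (simp add: comp_functor_def id_functor_def G_def)
    fix Y f assume Y: "Y \<in> Ob \<C>" and f: "f \<in> Ar \<C> X Y"
    note o' = Fob_Ob[OF Y] G_ob[OF Fob_Ob[OF Y]]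
    note e' = pre[OF o'(2) Y cnt_Ar[OF o'(1)]]
    note Ff = Far_Ar[OF X Y f]
    note c = pre[OF o(2) o'(2) cjg_Ar[OF o(1) o'(1) Ff]]
    show "Cmp \<C> (Fob (comp_functor G F) X) (Fob (comp_functor G F) Y) (Fob id_functor Y)
          (pre (G_ob (Fob F Y)) Y (cnt (Fob F Y))) (Far (comp_functor G F) X Y f)
        = Cmp \<C> (Fob (comp_functor G F) X) (Fob id_functor X) (Fob id_functor Y) (Far id_functor X Y f)
          (pre (G_ob (Fob F X)) X (cnt (Fob F X)))"
    \<comment> \<open>After applying \<open>F\<close>, naturality of the unit is the naturality
      \<open>cnt_cjg\<close> of the counit at the arrow \<open>F f\<close>.\<close>
    proof (rule faithful[of "G_ob (Fob F X)" Y])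
      show "Cmp \<C> (Fob (comp_functor G F) X) (Fob (comp_functor G F) Y) (Fob id_functor Y)
          (pre (G_ob (Fob F Y)) Y (cnt (Fob F Y))) (Far (comp_functor G F) X Y f) \<in> Ar \<C> (G_ob (Fob F X)) Y"
        using source.Cmp_Ar[OF o(2) o'(2) Y c(1) e'(1)] by (simp add: comp_functor_def id_functor_def G_def)
      show "Cmp \<C> (Fob (comp_functor G F) X) (Fob id_functor X) (Fob id_functor Y) (Far id_functor X Y f)
          (pre (G_ob (Fob F X)) X (cnt (Fob F X))) \<in> Ar \<C> (G_ob (Fob F X)) Y"
        using source.Cmp_Ar[OF o(2) X Y e(1) f] by (simp add: comp_functor_def id_functor_def G_def)
      show "Far F (G_ob (Fob F X)) Y (Cmp \<C> (Fob (comp_functor G F) X) (Fob (comp_functor G F) Y) (Fob id_functor Y)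
          (pre (G_ob (Fob F Y)) Y (cnt (Fob F Y))) (Far (comp_functor G F) X Y f))
        = Far F (G_ob (Fob F X)) Y (Cmp \<C> (Fob (comp_functor G F) X) (Fob id_functor X) (Fob id_functor Y) (Far id_functor X Y f)
          (pre (G_ob (Fob F X)) X (cnt (Fob F X))))"
        using Far_Cmp[OF o(2) o'(2) Y c(1) e'(1)] Far_Cmp[OF o(2) X Y e(1) f] c e e' cnt_cjg[OF o(1) o'(1) Ff]
        by (simp add: comp_functor_def id_functor_def G_def)
    qed (use o Y in auto)
  qed
qed

end

section \<open>Composition of equivalences\<close>

lemma Far_isos:
  assumes "is_functor \<C> \<D> F" "X \<in> Ob \<C>" "Y \<in> Ob \<C>" "f \<in> isos \<C> X Y"
  shows "Far F X Y f \<in> isos \<D> (Fob F X) (Fob F Y)"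
proof -
  interpret is_functor \<C> \<D> F by fact
  obtain g where f: "f \<in> Ar \<C> X Y" and g: "g \<in> Ar \<C> Y X" "Cmp \<C> X Y X g f = Idn \<C> X" "Cmp \<C> Y X Y f g = Idn \<C> Y"
    using assms(4) by (auto simp: isos_def)
  have "Cmp \<D> (Fob F X) (Fob F Y) (Fob F X) (Far F Y X g) (Far F X Y f) = Idn \<D> (Fob F X)"
    "Cmp \<D> (Fob F Y) (Fob F X) (Fob F Y) (Far F X Y f) (Far F Y X g) = Idn \<D> (Fob F Y)"
    using Far_Cmp[OF assms(2,3,2) f g(1)] Far_Cmp[OF assms(3,2,3) g(1) f] g(2,3) Far_Idn[OF assms(2)] Far_Idn[OF assms(3)]
    by simp_all
  then show ?thesis
    using Far_Ar[OF assms(2,3) f] Far_Ar[OF assms(3,2) g(1)] by (auto simp: isos_def)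
qed

lemma isos_trans:
  assumes "is_category \<C>" "X \<in> Ob \<C>" "Y \<in> Ob \<C>" "Z \<in> Ob \<C>" "f \<in> isos \<C> X Y" "g \<in> isos \<C> Y Z"
  shows "Cmp \<C> X Y Z g f \<in> isos \<C> X Z"
proof -
  interpret is_category \<C> by fact
  obtain f' where f: "f \<in> Ar \<C> X Y" "f' \<in> Ar \<C> Y X" "Cmp \<C> X Y X f' f = Idn \<C> X" "Cmp \<C> Y X Y f f' = Idn \<C> Y"
    using assms(5) by (auto simp: isos_def)
  obtain g' where g: "g \<in> Ar \<C> Y Z" "g' \<in> Ar \<C> Z Y" "Cmp \<C> Y Z Y g' g = Idn \<C> Y" "Cmp \<C> Z Y Z g g' = Idn \<C> Z"
    using assms(6) by (auto simp: isos_def)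
  note o = assms(2-4)
  have gf: "Cmp \<C> X Y Z g f \<in> Ar \<C> X Z" and fg: "Cmp \<C> Z Y X f' g' \<in> Ar \<C> Z X"
    by (rule Cmp_Ar[OF o f(1) g(1)], rule Cmp_Ar[OF o(3,2,1) g(2) f(2)])
  have "Cmp \<C> X Z X (Cmp \<C> Z Y X f' g') (Cmp \<C> X Y Z g f) = Cmp \<C> X Y X f' (Cmp \<C> X Z Y g' (Cmp \<C> X Y Z g f))"
    by (rule Cmp_assoc[OF o(1,3,2,1) gf g(2) f(2), symmetric])
  also have "Cmp \<C> X Z Y g' (Cmp \<C> X Y Z g f) = f"
    by (simp add: Cmp_assoc[OF o o(2) f(1) g(1,2)] g(3) Cmp_Idn_left[OF o(1,2) f(1)])
  finally have 1: "Cmp \<C> X Z X (Cmp \<C> Z Y X f' g') (Cmp \<C> X Y Z g f) = Idn \<C> X" by (simp add: f(3))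
  have "Cmp \<C> Z X Z (Cmp \<C> X Y Z g f) (Cmp \<C> Z Y X f' g') = Cmp \<C> Z Y Z g (Cmp \<C> Z X Y f (Cmp \<C> Z Y X f' g'))"
    by (rule Cmp_assoc[OF o(3,1,2,3) fg f(1) g(1), symmetric])
  also have "Cmp \<C> Z X Y f (Cmp \<C> Z Y X f' g') = g'"
    by (simp add: Cmp_assoc[OF o(3,2,1,2) g(2) f(2,1)] f(4) Cmp_Idn_left[OF o(3,2) g(2)])
  finally have 2: "Cmp \<C> Z X Z (Cmp \<C> X Y Z g f) (Cmp \<C> Z Y X f' g') = Idn \<C> Z" by (simp add: g(4))
  show ?thesis using gf fg 1 2 by (auto simp: isos_def)
qed

lemma comp_ff_es:
  assumes "ff_es_functor \<C> \<D> F" "ff_es_functor \<D> \<E> G"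
  shows "ff_es_functor \<C> \<E> (comp_functor G F)"
proof -
  interpret F: ff_es_functor \<C> \<D> F by fact
  interpret G: ff_es_functor \<D> \<E> G by fact
  show ?thesis
  proof (intro ff_es_functor.intro is_functor.intro F.source.is_category_axioms G.target.is_category_axioms)
    show "is_functor_axioms \<C> \<E> (comp_functor G F)"
      by (rule is_functor_axioms.intro)
         (simp_all add: comp_functor_def F.Fob_Ob G.Fob_Ob F.Far_Ar G.Far_Ar F.Far_Idn G.Far_Idn F.Far_Cmp G.Far_Cmp)
    show "ff_es_functor_axioms \<C> \<E> (comp_functor G F)"
    proof (rule ff_es_functor_axioms.intro)
      fix X Y f g assume o: "X \<in> Ob \<C>" "Y \<in> Ob \<C>" and fg: "f \<in> Ar \<C> X Y" "g \<in> Ar \<C> X Y"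
        and eq: "Far (comp_functor G F) X Y f = Far (comp_functor G F) X Y g"
      have "Far F X Y f = Far F X Y g"
        by (rule G.faithful[OF F.Fob_Ob[OF o(1)] F.Fob_Ob[OF o(2)] F.Far_Ar[OF o fg(1)] F.Far_Ar[OF o fg(2)]])
           (use eq in "simp add: comp_functor_def")
      then show "f = g" by (rule F.faithful[OF o fg])
    next
      fix X Y h assume o: "X \<in> Ob \<C>" "Y \<in> Ob \<C>" and h: "h \<in> Ar \<E> (Fob (comp_functor G F) X) (Fob (comp_functor G F) Y)"
      then obtain k where k: "k \<in> Ar \<D> (Fob F X) (Fob F Y)" "Far G (Fob F X) (Fob F Y) k = h"
        using G.full[OF F.Fob_Ob[OF o(1)] F.Fob_Ob[OF o(2)], of h] by (auto simp: comp_functor_def)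
      then show "\<exists>f\<in>Ar \<C> X Y. Far (comp_functor G F) X Y f = h"
        using F.full[OF o k(1)] by (auto simp: comp_functor_def)
    next
      fix Z assume Z: "Z \<in> Ob \<E>"
      obtain Y g where Y: "Y \<in> Ob \<D>" "g \<in> isos \<E> (Fob G Y) Z" using G.ess_surj[OF Z] by blast
      obtain X f where X: "X \<in> Ob \<C>" "f \<in> isos \<D> (Fob F X) Y" using F.ess_surj[OF Y(1)] by blast
      have "Cmp \<E> (Fob G (Fob F X)) (Fob G Y) Z g (Far G (Fob F X) Y f) \<in> isos \<E> (Fob G (Fob F X)) Z"
        by (rule isos_trans[OF G.target.is_category_axioms G.Fob_Ob[OF F.Fob_Ob[OF X(1)]] G.Fob_Ob[OF Y(1)] Z
            Far_isos[OF G.is_functor_axioms F.Fob_Ob[OF X(1)] Y(1) X(2)] Y(2)])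
      then show "\<exists>X\<in>Ob \<C>. isos \<E> (Fob (comp_functor G F) X) Z \<noteq> {}"
        using X(1) by (auto simp: comp_functor_def)
    qed
  qed
qed

text \<open>\<open>F\<close> is followed by the quasi-inverse of \<open>G\<close>, which is again
  full, faithful and essentially surjective.\<close>

theorem equivalent_via:
  assumes "ff_es_functor \<C> \<E> F" "ff_es_functor \<D> \<E> G"
  shows "equivalent_categories \<C> \<D>"
  using ff_es_functor.equivalence[OF comp_ff_es[OF assms(1) ff_es_functor.G_ff_es[OF assms(2)]]]
  unfolding equivalent_categories_def by blast

section \<open>Modules of the monad \<open>[C, -]\<close>\<close>

lemma hom_module_simps [simp]:
  fixes M :: "('a, 'm, 's) right_mod_scheme"
  shows "carrier (hom_module A C M) = right_hom A C M \<inter> extensional (carrier C)"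
    "ring.zero (hom_module A C M) = (\<lambda>c\<in>carrier C. \<zero>[M])"
    "f \<oplus>[hom_module A C M] g = (\<lambda>c\<in>carrier C. f c \<oplus>[M] g c)"
    "f \<triangleleft>[hom_module A C M] a = (\<lambda>c\<in>carrier C. f (a \<triangleright>[C] c))"
  by (simp_all add: hom_module_def)

text \<open>Covers two modules at once: the set \<open>S\<close> will be all of
  \<open>Hom\<^sub>A(C, M)\<close>, giving the free module of the monad, or the colinear maps
  \<open>Hom\<^sup>C(C, M)\<close>.\<close>

definition sub_hom_em ::
    "('a, 'p) ring_scheme => ('a, 'c, 'q) coring_scheme => ('a, 'm, 's) right_mod_scheme
      => ('c => 'm) set => ('a, 'c => 'm, 'c) em_mod" where
  "sub_hom_em A C M S = right_mod.extend ((hom_module A C M) \<lparr>carrier := S\<rparr>) \<lparr>alg = monad_mult A C M\<rparr>"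

lemma sub_hom_em_simps [simp]:
  fixes M :: "('a, 'm, 's) right_mod_scheme"
  shows "carrier (sub_hom_em A C M S) = S"
    "ring.zero (sub_hom_em A C M S) = (\<lambda>c\<in>carrier C. \<zero>[M])"
    "f \<oplus>[sub_hom_em A C M S] g = (\<lambda>c\<in>carrier C. f c \<oplus>[M] g c)"
    "f \<triangleleft>[sub_hom_em A C M S] a = (\<lambda>c\<in>carrier C. f (a \<triangleright>[C] c))"
    "alg (sub_hom_em A C M S) = monad_mult A C M"
  by (simp_all add: sub_hom_em_def hom_module_def right_mod.extend_def)

locale sub_hom = C: is_coring A C + M: right_module A M
  for A :: "('a, 'p) ring_scheme" (structure) and C :: "('a, 'c, 'q) coring_scheme"
    and M :: "('a, 'm, 's) right_mod_scheme" +
  fixes S :: "('c => 'm) set"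
  assumes S_sub: "S \<subseteq> carrier (hom_module A C M)"
    and S_zero: "(\<lambda>c\<in>carrier C. \<zero>[M]) \<in> S"
    and S_add: "[|f \<in> S; g \<in> S|] ==> (\<lambda>c\<in>carrier C. f c \<oplus>[M] g c) \<in> S"
    and S_ract: "[|f \<in> S; a ::: A|] ==> (\<lambda>c\<in>carrier C. f (a \<triangleright>[C] c)) \<in> S"
    and S_mult: "F ::: (hom_module A C (sub_hom_em A C M S)) ==> monad_mult A C M F \<in> S"
begin

abbreviation X where "X \<equiv> sub_hom_em A C M S"

lemma S_hom: "f \<in> S ==> f \<in> right_hom A C M" and S_ext: "f \<in> S ==> f \<in> extensional (carrier C)"
  using S_sub by auto

lemma S_rules:
  assumes "f \<in> S"
  shows "c ::: C ==> f c ::: M"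
    and "[|c ::: C; d ::: C|] ==> f (c \<oplus>[C] d) = f c \<oplus>[M] f d"
    and "[|c ::: C; a ::: A|] ==> f (c \<triangleleft>[C] a) = f c \<triangleleft>[M] a"
  using right_homD[OF S_hom[OF assms]] by simp_all

lemma S_eqI: "[|f \<in> extensional (carrier C); g \<in> S; \<And>c. c ::: C ==> f c = g c|] ==> f = g"
  by (rule extensionalityI[OF _ S_ext]) auto

text \<open>\<open>S\<close> is not assumed to be closed under negation: the negative of
  \<open>f\<close> is \<open>f\<close> acted on by -1, that is c \<mapsto> f((-1) c).\<close>

lemma X_abelian_group: "abelian_group X"
proof (rule abelian_groupI)
  fix f assume f: "f ::: X"
  then have fS: "f \<in> S" by simp
  have neg1: "f (\<ominus>\<^bsub>A\<^esub> \<one> \<triangleright>[C] c) \<oplus>[M] f c = \<zero>[M]" if c: "c ::: C" for c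
  proof -
    have "(\<ominus>\<^bsub>A\<^esub> \<one> \<triangleright>[C] c) \<oplus>[C] c = (\<ominus>\<^bsub>A\<^esub> \<one> \<oplus>[A] \<one>) \<triangleright>[C] c"
      by (subst C.lact_add_left[OF c]) (simp_all add: C.lact_one c)
    also have "... = \<zero>[A] \<triangleright>[C] c" by (simp add: C.l_neg)
    also have "... = \<zero>[C]"
    proof -
      have "\<zero>[A] \<triangleright>[C] c \<oplus>[C] \<zero>[A] \<triangleright>[C] c = \<zero>[A] \<triangleright>[C] c"
        by (subst C.lact_add_left[symmetric]) (simp_all add: c)
      then show ?thesis using C.lact_closed[OF c, of "\<zero>[A]"] by (simp add: C.M.add.r_cancel_one)
    qed
    finally show ?thesis
      using S_rules(2)[OF fS, of "\<ominus>\<^bsub>A\<^esub> \<one> \<triangleright>[C] c" c] c hom_zero[OF right_homD(1)[OF S_hom[OF fS]] C.M.abelian_group_axioms M.M.abelian_group_axioms]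
      by (simp add: C.lact_closed)
  qed
  show "\<exists>y\<in>carrier X. y \<oplus>[X] f = \<zero>[X]"
    by (rule bexI[of _ "\<lambda>c\<in>carrier C. f (\<ominus>\<^bsub>A\<^esub> \<one> \<triangleright>[C] c)"])
       (use fS neg1 in "simp_all add: S_ract cong: restrict_cong")
  show "\<zero>[X] \<oplus>[X] f = f"
    by (rule S_eqI[OF _ fS]) (use fS in "simp_all add: S_rules")
qed (auto simp: S_zero S_add S_rules M.M.a_ac)

lemma X_right_module: "right_module A X"
proof (rule right_moduleI)
  fix f assume f: "f ::: X"
  then have fS: "f \<in> S" by simp
  show "f \<triangleleft>[X] \<one> = f"
    by (rule S_eqI[OF _ fS]) (use fS in "simp_all add: C.lact_one")
qed (auto simp: C.ring_axioms X_abelian_group S_ract C.lact_closed C.lact_add_left C.lact_assoc S_rules)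

lemma eval_hom: "c ::: C ==> (%f. f c) \<in> add_hom X M"
  by (rule add_homI) (auto simp: S_rules)

lemma F_rules:
  assumes F: "F \<in> right_hom A C X" and c: "c ::: C"
  shows "F c \<in> S" "d ::: C ==> F (c \<oplus>[C] d) = (\<lambda>e\<in>carrier C. F c e \<oplus>[M] F d e)"
    "a ::: A ==> F (c \<triangleleft>[C] a) = (\<lambda>e\<in>carrier C. F c (a \<triangleright>[C] e))"
  using right_homD[OF F] c by simp_all

lemma F_bal: "F \<in> right_hom A C X ==> bal A C C M F"
  by (rule balI) (simp_all add: C.right_module_axioms C.bimodule_axioms M.M.abelian_group_axioms F_rules S_rules C.lact_closed)

text \<open>The structure map sends \<open>F\<close> to
  \<open>c \<mapsto> F(c\<^sub>1)(c\<^sub>2)\<close>. Evaluated at \<open>c\<close>, the unit law is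
  the left counit law of \<open>C\<close>, and the associativity law is coassociativity applied to
  the trilinear map \<open>F\<close>.\<close>

theorem sub_hom_em_module: "em_module A C X"
proof (intro em_module.intro em_module_axioms.intro X_right_module)
  show "alg X \<in> right_hom A (hom_module A C X) X"
  proof (rule right_homI)
    fix F assume F: "F ::: (hom_module A C X)"
    then have FH: "F \<in> right_hom A C X" by simp
    show "alg X F ::: X" using S_mult[OF F] by simp
    show "alg X (F \<triangleleft>[hom_module A C X] a) = alg X F \<triangleleft>[X] a" if a: "a ::: A" for a
      using a by (auto simp: monad_mult_def C.lact_closed C.lift_cop_lact[OF F_bal[OF FH]] cong: restrict_cong)
    fix G assume G: "G ::: (hom_module A C X)"
    then have GH: "G \<in> right_hom A C X" by simp
    show "alg X (F \<oplus>[hom_module A C X] G) = alg X F \<oplus>[X] alg X G"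
      by (auto simp: monad_mult_def bal.lift_sum[OF F_bal[OF FH] F_bal[OF GH] C.cop_closed] cong: restrict_cong)
  qed
  fix f assume "f ::: X"
  then have f: "f \<in> S" by simp
  show "alg X (monad_unit C X f) = f"
  proof (rule S_eqI[OF _ f])
    fix c assume c: "c ::: C"
    from C.cop_counit_left[OF right_homD(1)[OF S_hom[OF f]] M.M.abelian_group_axioms c] c
    show "alg X (monad_unit C X f) c = f c"
      by (simp add: monad_mult_def monad_unit_def)
  qed (simp add: monad_mult_def)
next
  fix F assume F: "F ::: (hom_module A C (hom_module A C X))"
  then have FH: "F \<in> right_hom A C (hom_module A C X)" by simp
  have Fx: "F x \<in> right_hom A C X" "F x \<in> extensional (carrier C)" if "x ::: C" for x
    using right_homD(2)[OF FH that] by simp_all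
  have Fadd: "F (x \<oplus>[C] y) = (\<lambda>c\<in>carrier C. F x c \<oplus>[X] F y c)" if "x ::: C" "y ::: C" for x y
    using right_homD(3)[OF FH that] by simp
  have Fract: "F (x \<triangleleft>[C] a) = (\<lambda>c\<in>carrier C. F x (a \<triangleright>[C] c))" if "x ::: C" "a ::: A" for x a
    using right_homD(4)[OF FH that] by simp
  have tri: "trilin A C C C M F"
    by (rule trilinI)
       (simp_all add: C.right_module_axioms C.bimodule_axioms M.M.abelian_group_axioms F_rules[OF Fx(1)] S_rules[OF F_rules(1)[OF Fx(1)]]
         Fadd Fract C.lact_closed)
  have balX: "bal A C C X F"
    by (rule balI)
       (simp_all add: C.right_module_axioms C.bimodule_axioms X_abelian_group F_rules[OF Fx(1)] Fadd Fract C.lact_closed)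
  show "alg X (monad_map A C (hom_module A C X) (alg X) F) = alg X (monad_mult A C X F)"
    unfolding sub_hom_em_simps monad_mult_def[of A C M]
  proof (rule restrict_ext)
    fix c assume c: "c ::: C"
    have "tlift A C C M (%x y. monad_mult A C X F x y) (cop C c)
      = tlift A C C M (%x y. tlift A C C M (%u v. F u v y) (cop C x)) (cop C c)"
      by (rule lift_cong)
         (simp add: monad_mult_def bal.lift_additive[OF balX eval_hom M.M.abelian_group_axioms C.cop_closed])
    also have "... = tlift A C C M (%x y. tlift A C C M (F x) (cop C y)) (cop C c)"
      by (rule C.cop_coassoc[OF tri c])
    also have "... = tlift A C C M (%x y. monad_map A C (hom_module A C X) (%F. \<lambda>c\<in>carrier C. tlift A C C M (%x y. F x y) (cop C c)) F x y) (cop C c)"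
      by (rule lift_cong)
         (use F in "simp add: monad_map_def compose_def")
    finally show "tlift A C C M (%x y. monad_map A C (hom_module A C X) (%F. \<lambda>c\<in>carrier C. tlift A C C M (%x y. F x y) (cop C c)) F x y) (cop C c)
      = tlift A C C M (%x y. monad_mult A C X F x y) (cop C c)" by simp
  qed
qed

end

section \<open>Categories of sets with structure\<close>

lemma concrete_category:
  assumes id: "\<And>X. X \<in> B ==> (\<lambda>x\<in>U X. x) \<in> S X X"
    and comp: "\<And>X Y Z f g. [|X \<in> B; Y \<in> B; Z \<in> B; f \<in> S X Y; g \<in> S Y Z|] ==> compose (U X) g f \<in> S X Z"
    and maps: "\<And>X Y f. [|X \<in> B; Y \<in> B; f \<in> S X Y|] ==> f \<in> U X \<rightarrow> U Y"
  shows "is_category \<lparr>Ob = B, Ar = (%X Y. S X Y \<inter> extensional (U X)), Idn = (%X. \<lambda>x\<in>U X. x),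
    Cmp = (%X Y Z g f. compose (U X) g f)\<rparr>"
proof (rule is_category.intro; simp; (elim conjE)?)
  fix X Y f assume o: "X \<in> B" "Y \<in> B" and f: "f \<in> S X Y" "f \<in> extensional (U X)"
  show "compose (U X) f (\<lambda>x\<in>U X. x) = f"
    by (rule extensionalityI[of _ "U X"]) (use f in "auto simp: compose_def")
  show "compose (U X) (\<lambda>x\<in>U Y. x) f = f"
    by (rule extensionalityI[of _ "U X"]) (use f maps[OF o f(1)] in "auto simp: compose_def")
next
  fix W X Y Z f g h assume o: "W \<in> B" "X \<in> B" "Y \<in> B" "Z \<in> B"
    and f: "f \<in> S W X" and g: "g \<in> S X Y" and h: "h \<in> S Y Z"
  show "compose (U W) h (compose (U W) g f) = compose (U W) (compose (U X) h g) f"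
    using maps[OF o(1,2) f] by (auto simp: compose_def fun_eq_iff)
qed (auto simp: id intro: comp)

lemma concrete_isos:
  assumes "f \<in> S X Y" "f \<in> extensional (U X)" "g \<in> S Y X" "g \<in> extensional (U Y)"
    and "\<And>x. x \<in> U X ==> g (f x) = x" "\<And>y. y \<in> U Y ==> f (g y) = y"
  shows "f \<in> isos \<lparr>Ob = B, Ar = (%X Y. S X Y \<inter> extensional (U X)), Idn = (%X. \<lambda>x\<in>U X. x),
    Cmp = (%X Y Z g f. compose (U X) g f)\<rparr> X Y"
  using assms by (auto simp: isos_def compose_def cong: restrict_cong intro!: bexI[of _ g])

text \<open>Being a homomorphism concerns values on the carrier only, so it survives restriction to
  the carrier. Morphisms have to be restricted, since they are extensional functions.\<close>

lemma right_hom_cong: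
  assumes "f \<in> right_hom A M N" "right_module A M" "\<And>x. x ::: M ==> g x = f x"
  shows "g \<in> right_hom A M N"
proof -
  interpret right_module A M by fact
  show ?thesis
    by (rule right_homI) (simp_all add: assms(3) right_homD[OF assms(1)] M.add.m_closed ract_closed)
qed

lemma right_hom_comp: "[|f \<in> right_hom A M N; g \<in> right_hom A N P|] ==> (%x. g (f x)) \<in> right_hom A M P"
  by (rule right_homI) (simp_all add: right_homD)

lemma right_hom_compose:
  "[|f \<in> right_hom A M N; g \<in> right_hom A N P; right_module A M|] ==> compose (carrier M) g f \<in> right_hom A M P"
  by (rule right_hom_cong[OF right_hom_comp[of f A M N g P]]) (simp_all add: compose_def)

lemma right_hom_id: "right_module A M ==> (\<lambda>x\<in>carrier M. x) \<in> right_hom A M M"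
  by (rule right_hom_cong[OF id_right_hom]) simp_all

lemma right_hom_inverse:
  assumes "f \<in> right_hom A M N" "right_module A M" "right_module A N"
    "\<And>y. y ::: N ==> g y ::: M" "\<And>x. x ::: M ==> g (f x) = x" "\<And>y. y ::: N ==> f (g y) = y"
  shows "g \<in> right_hom A N M"
proof -
  interpret M: right_module A M by fact
  interpret N: right_module A N by fact
  note f = right_homD[OF assms(1)]
  show ?thesis
  proof (rule right_homI)
    fix x y assume xy: "x ::: N" "y ::: N"
    have "g (x \<oplus>[N] y) = g (f (g x \<oplus>[M] g y))" using xy by (simp add: f assms(4,6))
    then show "g (x \<oplus>[N] y) = g x \<oplus>[M] g y" using xy by (simp add: assms(4,5))
  next
    fix x a assume xa: "x ::: N" "a ::: A"
    have "g (x \<triangleleft>[N] a) = g (f (g x \<triangleleft>[M] a))" using xa by (simp add: f assms(4,6))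
    then show "g (x \<triangleleft>[N] a) = g x \<triangleleft>[M] a" using xa by (simp add: assms(4,5) M.ract_closed)
  qed (rule assms(4))
qed

lemma comod_hom_cong:
  assumes "f \<in> comod_hom A C M N" "right_module A M" "\<And>x. x ::: M ==> g x = f x"
  shows "g \<in> comod_hom A C M N"
proof (rule comod_homI)
  show "g \<in> right_hom A M N" by (rule right_hom_cong[OF comod_homD(1)[OF assms(1)] assms(2,3)])
qed (simp add: assms(3) comod_homD(2)[OF assms(1)])

lemma em_homI:
  assumes "g \<in> right_hom A M N"
    "\<And>f. f ::: (hom_module A C M) ==> g (alg M f) = alg N (\<lambda>c\<in>carrier C. g (f c))"
  shows "g \<in> em_hom A C M N"
  using assms by (simp add: em_hom_def monad_map_def compose_def)

lemma em_homD:
  assumes "g \<in> em_hom A C M N"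
  shows "g \<in> right_hom A M N"
    "f ::: (hom_module A C M) ==> g (alg M f) = alg N (\<lambda>c\<in>carrier C. g (f c))"
  using assms by (simp_all add: em_hom_def monad_map_def compose_def)

lemma em_alg_closed: "[|em_module A C M; f ::: (hom_module A C M)|] ==> alg M f ::: M"
  using right_homD(2)[OF em_module.alg_hom] by metis

lemma em_hom_compose:
  assumes "f \<in> em_hom A C M N" "g \<in> em_hom A C N P" "em_module A C M" "bimodule A C"
  shows "compose (carrier M) g f \<in> em_hom A C M P"
proof (rule em_homI)
  interpret M: em_module A C M by fact
  interpret C: bimodule A C by fact
  show "compose (carrier M) g f \<in> right_hom A M P"
    by (rule right_hom_compose[OF em_homD(1)[OF assms(1)] em_homD(1)[OF assms(2)] M.right_module_axioms])
  fix k assume k: "k ::: (hom_module A C M)"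
  then have kM: "k \<in> right_hom A C M" by simp
  have fk: "(\<lambda>c\<in>carrier C. f (k c)) ::: (hom_module A C N)"
    using right_hom_cong[OF right_hom_comp[OF kM em_homD(1)[OF assms(1)]] C.right_module_axioms] by simp
  show "compose (carrier M) g f (alg M k) = alg P (\<lambda>c\<in>carrier C. compose (carrier M) g f (k c))"
    using em_homD(2)[OF assms(1) k] em_homD(2)[OF assms(2) fk] em_alg_closed[OF assms(3) k] right_homD(2)[OF kM]
    by (simp add: compose_def cong: restrict_cong)
qed

lemma em_hom_id: "em_module A C M ==> bimodule A C ==> (\<lambda>x\<in>carrier M. x) \<in> em_hom A C M M"
proof (rule em_homI)
  assume "em_module A C M" "bimodule A C"
  then interpret M: em_module A C M by simp
  interpret C: bimodule A C by fact
  show "(\<lambda>x\<in>carrier M. x) \<in> right_hom A M M"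
    by (rule right_hom_id[OF M.right_module_axioms])
  fix k assume k: "k ::: (hom_module A C M)"
  then have kM: "k \<in> right_hom A C M" "k \<in> extensional (carrier C)" by auto
  have "(\<lambda>c\<in>carrier C. (\<lambda>x\<in>carrier M. x) (k c)) = k"
    by (rule extensionalityI[of _ "carrier C"]) (use kM in "simp_all add: right_homD(2)")
  then show "(\<lambda>x\<in>carrier M. x) (alg M k) = alg M (\<lambda>c\<in>carrier C. (\<lambda>x\<in>carrier M. x) (k c))"
    using em_alg_closed[OF \<open>em_module A C M\<close> k] by simp
qed

lemma em_hom_inverse:
  assumes "f \<in> em_hom A C M N" "em_module A C M" "em_module A C N" "bimodule A C"
    and g: "\<And>y. y ::: N ==> g y ::: M" "\<And>x. x ::: M ==> g (f x) = x" "\<And>y. y ::: N ==> f (g y) = y"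
  shows "g \<in> em_hom A C N M"
proof -
  interpret M: em_module A C M by fact
  interpret N: em_module A C N by fact
  interpret C: bimodule A C by fact
  have gr: "g \<in> right_hom A N M"
    by (rule right_hom_inverse[OF em_homD(1)[OF assms(1)] M.right_module_axioms N.right_module_axioms g])
  show ?thesis
  proof (rule em_homI[OF gr])
    fix k assume k: "k ::: (hom_module A C N)"
    then have kN: "k \<in> right_hom A C N" "k \<in> extensional (carrier C)" by auto
    have gk: "(\<lambda>c\<in>carrier C. g (k c)) ::: (hom_module A C M)"
      using right_hom_cong[OF right_hom_comp[OF kN(1) gr] C.right_module_axioms] by simp
    have "(\<lambda>c\<in>carrier C. f ((\<lambda>c\<in>carrier C. g (k c)) c)) = k"
      by (rule extensionalityI[of _ "carrier C"]) (use kN in "simp_all add: right_homD(2) g")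
    then have "g (alg N k) = g (f (alg M (\<lambda>c\<in>carrier C. g (k c))))"
      using em_homD(2)[OF assms(1) gk] by simp
    then show "g (alg N k) = alg M (\<lambda>c\<in>carrier C. g (k c))"
      using g(2)[OF em_alg_closed[OF assms(2) gk]] by simp
  qed
qed

lemma em_category: "bimodule A C ==> is_category (em_category A C)"
  unfolding em_category_def
  by (rule concrete_category)
     (auto simp: em_hom_id em_hom_compose dest: right_homD(2)[OF em_homD(1)])

lemma comod_category:
  fixes A :: "('a, 'p) ring_scheme" and C :: "('a, 'c, 'q) coring_scheme"
  assumes "is_coring A C"
  shows "is_category (comod_category A C :: (('a, 'u, 'c) comod, 'u => 'u) category)"
  unfolding comod_category_def
proof (rule concrete_category)
  interpret C: is_coring A C by fact
  fix X :: "('a, 'u, 'c) comod" assume "X \<in> {M. right_comodule A C M}"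
  then interpret X: right_comodule A C X by simp
  interpret X: coring_comodule A C X ..
  show "(\<lambda>x\<in>carrier X. x) \<in> comod_hom A C X X"
    by (rule comod_homI[OF right_hom_id[OF X.right_module_axioms]])
       (simp add: X.MC.lift_telem[OF X.co_closed])
  fix Y Z :: "('a, 'u, 'c) comod" and f g
  assume "Y \<in> {M. right_comodule A C M}" "Z \<in> {M. right_comodule A C M}"
  then interpret Y: right_comodule A C Y + Z: right_comodule A C Z by simp_all
  interpret Y: coring_comodule A C Y ..
  interpret Z: coring_comodule A C Z ..
  assume fg: "f \<in> comod_hom A C X Y" "g \<in> comod_hom A C Y Z"
  show "compose (carrier X) g f \<in> comod_hom A C X Z"
    by (rule comod_hom_cong[OF comod_hom_compose[OF fg X.right_module_axioms Y.MC.tensor_prod_axioms Z.MC.tensor_prod_axioms X.co_closed] X.right_module_axioms])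
       (simp_all add: compose_def)
qed (auto dest: right_homD(2)[OF comod_homD(1)])

section \<open>Interchange of independent Sweedler sums\<close>

context bal
begin

lemma bal_lift_param:
  assumes "\<And>x y. [|x ::: M; y ::: N|] ==> bal B K L Q (%u v. \<psi> x y u v)"
    and "\<And>u v. [|u ::: K; v ::: L|] ==> bal A M N Q (%x y. \<psi> x y u v)"
    and t: "t ::: (tgroup A M N)"
  shows "bal B K L Q (%u v. tlift A M N Q (%x y. \<psi> x y u v) t)"
proof -
  interpret \<psi>: bal B K L Q "%u v. \<psi> \<zero>[M] \<zero>[N] u v" by (rule assms(1)) simp_all
  note b = balD[OF assms(1)]
  show ?thesis
    by (rule balI)
       (simp_all add: \<psi>.right_module_axioms \<psi>.N.bimodule_axioms \<psi>.P.abelian_group_axioms t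
          bal.lift_closed[OF assms(2)] b bal.lift_sum[OF assms(2) assms(2) t, symmetric])
qed

end

text \<open>A Fubini rule: both sides are additive in \<open>t\<close>, and on an elementary tensor
  \<open>t\<close> both are the sum over \<open>s\<close> alone.\<close>

lemma lift_swap:
  assumes "tensor_prod A M N"
    and b1: "\<And>x y. [|x ::: M; y ::: N|] ==> bal B K L Q (%u v. \<psi> x y u v)"
    and b2: "\<And>u v. [|u ::: K; v ::: L|] ==> bal A M N Q (%x y. \<psi> x y u v)"
    and t: "t ::: (tgroup A M N)" and s: "s ::: (tgroup B K L)"
  shows "tlift A M N Q (%x y. tlift B K L Q (%u v. \<psi> x y u v) s) t
    = tlift B K L Q (%u v. tlift A M N Q (%x y. \<psi> x y u v) t) s"
proof -
  interpret MN: tensor_prod A M N by fact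
  interpret \<psi>: bal B K L Q "%u v. \<psi> \<zero>[M] \<zero>[N] u v" by (rule b1) simp_all
  interpret \<psi>2: bal A M N Q "%x y. \<psi> x y \<zero>[K] \<zero>[L]" by (rule b2) simp_all
  have p: "bal B K L Q (%u v. tlift A M N Q (%x y. \<psi> x y u v) t)"
    if "t ::: (tgroup A M N)" for t
    by (rule \<psi>2.bal_lift_param[OF b1 b2 that])
  have b: "bal A M N Q (%x y. tlift B K L Q (%u v. \<psi> x y u v) s)"
    by (rule \<psi>.bal_lift_param[OF b2 b1 s])
  show ?thesis
  proof (rule bal.lift_unique[OF b _ _ t])
    show "(%t. tlift B K L Q (%u v. tlift A M N Q (%x y. \<psi> x y u v) t) s)
      \<in> add_hom (tgroup A M N) Q"
    proof (rule add_homI)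
      fix t t' assume tt: "t ::: (tgroup A M N)" "t' ::: (tgroup A M N)"
      show "tlift B K L Q (%u v. tlift A M N Q (%x y. \<psi> x y u v) (t \<oplus>[tgroup A M N] t')) s
        = tlift B K L Q (%u v. tlift A M N Q (%x y. \<psi> x y u v) t) s \<oplus>[Q]
          tlift B K L Q (%u v. tlift A M N Q (%x y. \<psi> x y u v) t') s"
        by (simp add: bal.lift_add[OF b2] tt bal.lift_sum[OF p[OF tt(1)] p[OF tt(2)] s, symmetric])
    qed (rule bal.lift_closed[OF p s])
  qed (simp add: bal.lift_elem[OF b2])
qed

section \<open>The functor \<open>Hom\<^sup>C(C, -)\<close>\<close>

context coring_comodule
begin

definition chom :: "('c => 'm) set" where
  "chom = comod_hom A C (regular_comod C) M \<inter> extensional (carrier C)"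

lemma chom_iff:
  "f \<in> chom \<longleftrightarrow> f \<in> right_hom A C M \<and> f \<in> extensional (carrier C) \<and>
    (\<forall>c\<in>carrier C. tlift A C C (tgroup A M C) (%x y. telem A M C (f x) y) (cop C c) = coact M (f c))"
proof -
  have "right_hom A (regular_comod C) M = right_hom A C M" by (simp add: right_hom_def hom_def)
  then show ?thesis by (auto simp: chom_def comod_hom_def tensor_map_def)
qed

lemma bal_hom_elem: "f \<in> right_hom A C M ==> bal A C C (tgroup A M C) (%x y. telem A M C (f x) y)"
  using bal.bal_compose[OF MC.telem_bal _ id_left_hom C.right_module_axioms C.bimodule_axioms] by simp

lemma comod_hom_em_eq: "comod_hom_em A C M = sub_hom_em A C M chom"
  by (simp add: comod_hom_em_def sub_hom_em_def chom_def)

text \<open>The closure condition with content is the last one: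
  \<open>c \<mapsto> F(c\<^sub>1)(c\<^sub>2)\<close> is colinear because every \<open>F(x)\<close>
  is colinear and the coproduct is coassociative.\<close>

lemma chom_sub_hom: "sub_hom A C M chom"
proof (intro sub_hom.intro sub_hom_axioms.intro C.is_coring_axioms right_module_axioms)
  let ?T = "tgroup A M C"
  interpret T: abelian_group ?T by (rule MC.tensor_abelian_group)
  note H = C.right_module_axioms
  show "chom \<subseteq> carrier (hom_module A C M)" by (auto simp: chom_iff)
  show "(\<lambda>c\<in>carrier C. \<zero>[M]) \<in> chom"
  proof -
    have z: "telem A M C \<zero>[M] c = \<zero>[?T]" if "c ::: C" for c
    proof -
      have "(%x. telem A M C x c) \<in> add_hom M ?T"
        by (rule add_homI) (use that in "simp_all add: MC.telem_closed MC.telem_add_left")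
      from hom_zero[OF this M.abelian_group_axioms T.abelian_group_axioms] show ?thesis .
    qed
    have zr: "(%c. \<zero>[M]) \<in> right_hom A C M"
    proof (rule right_homI)
      fix a assume a: "a ::: A"
      have "(%x. x \<triangleleft>[M] a) \<in> add_hom M M"
        by (rule add_homI) (use a in "simp_all add: ract_closed ract_add_left")
      from hom_zero[OF this M.abelian_group_axioms M.abelian_group_axioms] show "\<zero>[M] = \<zero>[M] \<triangleleft>[M] a" by simp
    qed simp_all
    have "tlift A C C ?T (%x y. telem A M C \<zero>[M] y) (cop C c) = \<zero>[?T]" if "c ::: C" for c
      by (rule bal.lift_unique[OF bal_hom_elem[OF zr] _ _ C.cop_closed[OF that]], rule add_homI) (simp_all add: z)
    moreover have "coact M \<zero>[M] = \<zero>[?T]"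
      using hom_zero[OF right_homD(1)[OF coact_hom] M.abelian_group_axioms] abelian_group_transfer[OF MC.tensor_abelian_group, of "tright A M C"] by simp
    ultimately show ?thesis
      using right_hom_cong[OF zr H] by (simp add: chom_iff)
  qed
  fix f assume f: "f \<in> chom"
  then have fr: "f \<in> right_hom A C M" and fc: "\<And>c. c ::: C ==> tlift A C C ?T (%x y. telem A M C (f x) y) (cop C c) = coact M (f c)"
    by (auto simp: chom_iff)
  note fD = right_homD[OF fr]
  show "(\<lambda>c\<in>carrier C. f (a \<triangleright>[C] c)) \<in> chom" if a: "a ::: A" for a
  proof -
    have "(\<lambda>c\<in>carrier C. f (a \<triangleright>[C] c)) \<in> right_hom A C M"
      by (rule right_homI) (use a in "simp_all add: fD C.lact_closed C.lact_add_right C.lact_ract[symmetric] C.ract_closed")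
    moreover have "tlift A C C ?T (%x y. telem A M C (f (a \<triangleright>[C] x)) y) (cop C c) = coact M (f (a \<triangleright>[C] c))" if c: "c ::: C" for c
      using fc[of "a \<triangleright>[C] c"] C.lift_cop_lact[OF bal_hom_elem[OF fr] c a] a c by (simp add: C.lact_closed)
    ultimately show ?thesis by (simp add: chom_iff)
  qed
  fix g assume g: "g \<in> chom"
  then have gr: "g \<in> right_hom A C M" and gc: "\<And>c. c ::: C ==> tlift A C C ?T (%x y. telem A M C (g x) y) (cop C c) = coact M (g c)"
    by (auto simp: chom_iff)
  note gD = right_homD[OF gr]
  show "(\<lambda>c\<in>carrier C. f c \<oplus>[M] g c) \<in> chom"
  proof -
    have "(\<lambda>c\<in>carrier C. f c \<oplus>[M] g c) \<in> right_hom A C M"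
      by (rule right_homI) (simp_all add: fD gD M.a_ac C.ract_closed ract_add_left)
    then show ?thesis
      by (simp add: chom_iff MC.telem_add_left fD gD bal.lift_sum[OF bal_hom_elem[OF fr] bal_hom_elem[OF gr] C.cop_closed] fc gc co_add)
  qed
next
  let ?T = "tgroup A M C"
  fix F assume "F ::: (hom_module A C (sub_hom_em A C M chom))"
  then have F: "F \<in> right_hom A C (sub_hom_em A C M chom)" by simp
  have Fc: "F x \<in> right_hom A C M" if "x ::: C" for x
    using right_homD(2)[OF F that] by (simp add: chom_iff)
  note FD = right_homD[OF F, simplified] right_homD[OF Fc]
  have b: "bal A C C M F"
    by (rule balI) (simp_all add: C.right_module_axioms C.bimodule_axioms M.abelian_group_axioms FD C.lact_closed)
  have rh: "monad_mult A C M F \<in> right_hom A C M"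
  proof (rule right_homI)
    fix c a assume c: "c ::: C" and a: "a ::: A"
    have "(%m. m \<triangleleft>[M] a) \<in> add_hom M M"
      by (rule add_homI) (use a in "simp_all add: ract_closed ract_add_left")
    from bal.lift_additive[OF b this M.abelian_group_axioms C.cop_closed[OF c]]
    show "monad_mult A C M F (c \<triangleleft>[C] a) = monad_mult A C M F c \<triangleleft>[M] a"
      using c a by (simp add: monad_mult_def C.ract_closed C.lift_cop_ract[OF b] FD)
  qed (simp_all add: monad_mult_def C.lift_cop_closed[OF b] C.lift_cop_add[OF b])
  have tri: "trilin A C C C ?T (%x y z. telem A M C (F x y) z)"
    by (rule trilinI)
       (simp_all add: C.right_module_axioms C.bimodule_axioms MC.tensor_abelian_group FD C.lact_closed
          MC.telem_closed MC.telem_add_left MC.telem_add_right MC.telem_balanced)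
  have "tlift A C C ?T (%x y. telem A M C (monad_mult A C M F x) y) (cop C c) = coact M (monad_mult A C M F c)"
    if c: "c ::: C" for c
  proof -
    have "coact M (monad_mult A C M F c) = tlift A C C ?T (%x y. coact M (F x y)) (cop C c)"
      using c bal.lift_additive[OF b right_homD(1)[OF coact_hom] _ C.cop_closed[OF c]]
        abelian_group_transfer[OF MC.tensor_abelian_group, of "tright A M C"] by (simp add: monad_mult_def)
    also have "... = tlift A C C ?T (%x y. tlift A C C ?T (%u v. telem A M C (F x u) v) (cop C y)) (cop C c)"
      by (rule lift_cong) (use FD(1,2) in "simp add: chom_iff")
    also have "... = tlift A C C ?T (%x y. tlift A C C ?T (%u v. telem A M C (F u v) y) (cop C x)) (cop C c)"
      by (rule C.cop_coassoc[OF tri c, symmetric])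
    also have "... = tlift A C C ?T (%x y. telem A M C (monad_mult A C M F x) y) (cop C c)"
      by (rule lift_cong)
         (simp add: monad_mult_def MC.telem_lift_left[OF b C.cop_closed])
    finally show ?thesis by simp
  qed
  then show "monad_mult A C M F \<in> chom"
    using rh by (simp add: chom_iff) (simp add: monad_mult_def)
qed

lemma comod_hom_em_module: "em_module A C (comod_hom_em A C M)"
  unfolding comod_hom_em_eq by (rule sub_hom.sub_hom_em_module[OF chom_sub_hom])

end

section \<open>The free modules \<open>Hom\<^sub>A(C, M)\<close>\<close>

locale coring_module = C: is_coring A C + M: right_module A M
  for A :: "('a, 'p) ring_scheme" (structure) and C :: "('a, 'c, 'q) coring_scheme"
    and M :: "('a, 'm, 's) right_mod_scheme"
begin

lemma hom_module_bal:
  assumes "F \<in> right_hom A C (hom_module A C M)"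
  shows "bal A C C M F"
proof -
  have FD: "F c \<in> right_hom A C M" if "c ::: C" for c using right_homD(2)[OF assms that] by simp
  show ?thesis
    using right_homD(3,4)[OF assms] right_homD[OF FD]
    by (intro balI) (simp_all add: C.right_module_axioms C.bimodule_axioms M.M.abelian_group_axioms C.lact_closed)
qed

lemma monad_mult_closed:
  assumes "F \<in> right_hom A C (hom_module A C M)"
  shows "monad_mult A C M F ::: (hom_module A C M)"
proof -
  note b = hom_module_bal[OF assms]
  have FD: "F c \<in> right_hom A C M" if "c ::: C" for c using right_homD(2)[OF assms that] by simp
  have "monad_mult A C M F \<in> right_hom A C M"
  proof (rule right_homI)
    fix c a assume c: "c ::: C" and a: "a ::: A"
    have "(%m. m \<triangleleft>[M] a) \<in> add_hom M M"
      by (rule add_homI) (use a in "simp_all add: M.ract_closed M.ract_add_left")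
    from bal.lift_additive[OF b this M.M.abelian_group_axioms C.cop_closed[OF c]]
    show "monad_mult A C M F (c \<triangleleft>[C] a) = monad_mult A C M F c \<triangleleft>[M] a"
      using c a by (simp add: monad_mult_def C.ract_closed C.lift_cop_ract[OF b] right_homD[OF FD])
  qed (simp_all add: monad_mult_def C.lift_cop_closed[OF b] C.lift_cop_add[OF b])
  then show ?thesis by (simp add: monad_mult_def)
qed

lemma hom_module_sub_hom: "sub_hom A C M (carrier (hom_module A C M))"
proof (intro sub_hom.intro sub_hom_axioms.intro C.is_coring_axioms M.right_module_axioms)
  have z: "\<zero>[M] \<triangleleft>[M] a = \<zero>[M]" if "a ::: A" for a
  proof -
    have "(%x. x \<triangleleft>[M] a) \<in> add_hom M M"
      by (rule add_homI) (use that in "simp_all add: M.ract_closed M.ract_add_left")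
    from hom_zero[OF this M.M.abelian_group_axioms M.M.abelian_group_axioms] show ?thesis .
  qed
  show "(\<lambda>c\<in>carrier C. \<zero>[M]) ::: (hom_module A C M)"
    by (auto intro!: right_homI simp: z C.ract_closed)
  show "monad_mult A C M F ::: (hom_module A C M)"
    if "F ::: (hom_module A C (sub_hom_em A C M (carrier (hom_module A C M))))" for F
    using that by (intro monad_mult_closed) (simp add: right_hom_def hom_def)
qed (auto intro!: right_homI simp: right_homD C.ract_closed C.lact_closed C.lact_add_right C.lact_ract[symmetric]
      M.ract_add_left M.M.a_ac)

lemma hom_module_abelian_group: "abelian_group (hom_module A C M)"
proof -
  have "add (hom_module A C M) = add (sub_hom_em A C M (carrier (hom_module A C M)))"
    by (intro ext) simp
  then show ?thesis
    by (intro abelian_group_transfer[OF sub_hom.X_abelian_group[OF hom_module_sub_hom]]) simp_all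
qed

lemma hom_module_eval: "c ::: C ==> (%f. f c) \<in> add_hom (hom_module A C M) M"
  by (rule add_homI) (auto simp: right_homD)

end

subsection \<open>Full faithfulness\<close>

locale cointegral_comodule = cointegral A C \<delta> + M: right_comodule A C M
  for A :: "('a, 'p) ring_scheme" (structure) and C :: "('a, 'c, 'q) coring_scheme" and \<delta>
    and M :: "('a, 'm, 'c, 's) comod_scheme"
begin

sublocale M: coring_comodule A C M ..

text \<open>\<open>act m : C \<rightarrow> M\<close> is the image of \<open>m\<close> under \<open>M \<rightarrow> Hom\<^sup>C(C, M \<otimes> C) \<rightarrow> Hom\<^sup>C(C, M)\<close>, induced by the
  colinear retraction \<open>m \<otimes> d \<mapsto> m\<^sub>0 \<delta>(m\<^sub>1, d)\<close> of the coaction.\<close>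

definition act :: "'m => 'c => 'm" where
  "act m = (\<lambda>d\<in>carrier C. tlift A M C M (%u v. u \<triangleleft>[M] \<delta> v d) (coact M m))"

lemma tri_act: "trilin A M C C M (%u v d. u \<triangleleft>[M] \<delta> v d)"
  by (rule trilinI)
     (simp_all add: M.right_module_axioms bimodule_axioms M.M.abelian_group_axioms \<delta>_rules M.ract_closed M.ract_add_left
       M.ract_add_right M.ract_assoc)

lemma act_bal: "bal A M C M act"
  by (rule bal_cong[OF M.bal_coact[OF tri_act]]) (simp add: act_def)

lemma ract_hom_M: "a ::: A ==> (%m. m \<triangleleft>[M] a) \<in> add_hom M M"
  by (rule add_homI) (simp_all add: M.ract_closed M.ract_add_left)

lemma act_ract:
  assumes "m ::: M" "d ::: C" "a ::: A"
  shows "act m (d \<triangleleft>[C] a) = act m d \<triangleleft>[M] a"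
  using assms bal.lift_additive[OF trilin.bal_12[OF tri_act] ract_hom_M M.M.abelian_group_axioms M.co_closed, of d a m]
  by (simp add: act_def ract_closed M.ract_assoc \<delta>_rules)

lemma act_right_hom: "m ::: M ==> act m \<in> right_hom A C M"
  using balD[OF act_bal] by (intro right_homI) (simp_all add: act_ract)

text \<open>\<open>m\<^sub>0 \<delta>(m\<^sub>1, m\<^sub>2) = m\<^sub>0 \<epsilon>(m\<^sub>1) =
  m\<close>: the retraction splits the coaction.\<close>

lemma act_lift:
  assumes "m ::: M"
  shows "tlift A M C M act (coact M m) = m"
proof -
  have "tlift A M C M act (coact M m)
    = tlift A M C M (%x y. tlift A M C M (%u v. u \<triangleleft>[M] \<delta> v y) (coact M x)) (coact M m)"
    by (simp add: act_def)
  also have "... = tlift A M C M (%x y. tlift A C C M (%u v. x \<triangleleft>[M] \<delta> u v) (cop C y)) (coact M m)"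
    by (rule M.co_coassoc[OF tri_act assms])
  also have "... = tlift A M C M (%x y. x \<triangleleft>[M] cou C y) (coact M m)"
  proof (rule lift_cong)
    fix x y assume xy: "x ::: M" "y ::: C"
    have "(%a. x \<triangleleft>[M] a) \<in> add_hom A M"
      by (rule add_homI) (use xy in "simp_all add: M.ract_closed M.ract_add_right")
    from \<delta>.lift_additive[OF this M.M.abelian_group_axioms cop_closed[OF xy(2)]]
    show "tlift A C C M (%u v. x \<triangleleft>[M] \<delta> u v) (cop C y) = x \<triangleleft>[M] cou C y"
      by (simp add: \<delta>_cop xy)
  qed
  also have "... = m" by (rule M.coact_counital[OF assms])
  finally show ?thesis .
qed

text \<open>The coaction of \<open>m\<^sub>0 \<delta>(m\<^sub>1, d)\<close> is
  \<open>m\<^sub>0 \<otimes> m\<^sub>1 \<delta>(m\<^sub>2, d)\<close>, which equals \<open>m\<^sub>0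
  \<otimes> \<delta>(m\<^sub>1, d\<^sub>1) d\<^sub>2 = m\<^sub>0 \<delta>(m\<^sub>1, d\<^sub>1)
  \<otimes> d\<^sub>2\<close> by the identity \<open>\<delta>_colinear\<close>.\<close>

lemma act_chom:
  assumes m: "m ::: M"
  shows "act m \<in> M.chom"
proof -
  let ?T = "tgroup A M C"
  have "tlift A C C ?T (%x y. telem A M C (act m x) y) (cop C d) = coact M (act m d)" if d: "d ::: C" for d
  proof -
    have tri: "trilin A M C C ?T (%u w v. telem A M C u (w \<triangleleft>[C] \<delta> v d))"
      by (rule trilinI)
         (simp_all add: M.right_module_axioms bimodule_axioms M.MC.tensor_abelian_group \<delta>_rules d ract_closed lact_closed
           ract_add_left ract_add_right ract_assoc lact_ract M.MC.telem_closed M.MC.telem_add_left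
           M.MC.telem_add_right M.MC.telem_balanced)
    have "coact M (act m d) = tlift A M C ?T (%u v. coact M (u \<triangleleft>[M] \<delta> v d)) (coact M m)"
      using d bal.lift_additive[OF trilin.bal_12[OF tri_act d] right_homD(1)[OF M.coact_hom] _ M.co_closed[OF m]]
        abelian_group_transfer[OF M.MC.tensor_abelian_group, of "tright A M C"] by (simp add: act_def)
    also have "... = tlift A M C ?T (%u v. tlift A M C ?T (%x w. telem A M C x (w \<triangleleft>[C] \<delta> v d)) (coact M u)) (coact M m)"
    proof (rule lift_cong)
      fix u v assume uv: "u ::: M" "v ::: C"
      then have \<delta>vd: "\<delta> v d ::: A" using d by (simp add: \<delta>_rules)
      have "coact M (u \<triangleleft>[M] \<delta> v d) = tlift A M C ?T (telem A M C) (coact M (u \<triangleleft>[M] \<delta> v d))"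
        using M.MC.lift_telem[OF M.co_closed[OF M.ract_closed[OF uv(1) \<delta>vd]]] by simp
      then show "coact M (u \<triangleleft>[M] \<delta> v d) = tlift A M C ?T (%x w. telem A M C x (w \<triangleleft>[C] \<delta> v d)) (coact M u)"
        using M.lift_co_ract[OF M.MC.telem_bal uv(1) \<delta>vd] by simp
    qed
    also have "... = tlift A M C ?T (%u z. tlift A C C ?T (%w v. telem A M C u (w \<triangleleft>[C] \<delta> v d)) (cop C z)) (coact M m)"
      by (rule M.co_coassoc[OF tri m])
    also have "... = tlift A M C ?T (%u z. telem A M C u (cosplit z d)) (coact M m)"
      unfolding cosplit_def
      by (rule lift_cong)
         (simp add: M.MC.telem_lift_right[OF trilin.bal_12[OF trilin_\<delta>_left d] cop_closed])
    \<comment> \<open>Here the second expression of \<open>cosplit\<close> is used; the value of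
      \<open>\<delta>\<close>, now to the left of \<open>d\<^sub>2\<close>, crosses the tensor
      sign.\<close>
    also have "... = tlift A M C ?T (%u z. tlift A C C ?T (%x y. telem A M C (u \<triangleleft>[M] \<delta> z x) y) (cop C d)) (coact M m)"
      by (rule lift_cong)
         (simp add: cosplit_right d M.MC.telem_lift_right[OF trilin.bal_23[OF trilin_\<delta>_right] cop_closed]
           M.MC.telem_balanced \<delta>_rules)
    \<comment> \<open>The sums over the coaction of \<open>m\<close> and over the coproduct of
      \<open>d\<close> are independent and may be exchanged.\<close>
    also have "... = tlift A C C ?T (%x y. tlift A M C ?T (%u z. telem A M C (u \<triangleleft>[M] \<delta> z x) y) (coact M m)) (cop C d)"
    proof (rule lift_swap[OF M.MC.tensor_prod_axioms _ _ M.co_closed[OF m] cop_closed[OF d]])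
      show "bal A C C ?T (%x y. telem A M C (u \<triangleleft>[M] \<delta> z x) y)" if "u ::: M" "z ::: C" for u z
        by (rule M.bal_hom_elem, rule right_homI)
           (use that in "simp_all add: \<delta>_rules M.ract_closed M.ract_add_right M.ract_assoc")
      show "bal A M C ?T (%u z. telem A M C (u \<triangleleft>[M] \<delta> z x) y)" if "x ::: C" "y ::: C" for x y
        by (rule bal.bal_additive[OF trilin.bal_12[OF tri_act that(1)] _ M.MC.tensor_abelian_group], rule add_homI)
           (use that in "simp_all add: M.MC.telem_closed M.MC.telem_add_left")
    qed
    also have "... = tlift A C C ?T (%x y. telem A M C (act m x) y) (cop C d)"
      by (rule lift_cong)
         (simp add: act_def M.MC.telem_lift_left[OF trilin.bal_12[OF tri_act] M.co_closed[OF m]])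
    finally show ?thesis by simp
  qed
  then show ?thesis
    using act_right_hom[OF m] by (simp add: M.chom_iff) (simp add: act_def)
qed

lemma act_ract_left:
  assumes "m ::: M" "a ::: A"
  shows "act (m \<triangleleft>[M] a) = (\<lambda>c\<in>carrier C. act m (a \<triangleright>[C] c))"
  by (rule extensionalityI[of _ "carrier C"]) (use assms balD(4)[OF act_bal] in "simp_all, simp add: act_def")

lemma act_add_left:
  assumes "m ::: M" "n ::: M"
  shows "act (m \<oplus>[M] n) = (\<lambda>c\<in>carrier C. act m c \<oplus>[M] act n c)"
  by (rule extensionalityI[of _ "carrier C"]) (use assms balD(2)[OF act_bal] in "simp_all, simp add: act_def")

text \<open>Since \<open>m = act m\<^sub>0 m\<^sub>1\<close>, a comodule is generated by the images of the comodule maps from \<open>C\<close>.\<close>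

lemma comod_hom_eqI:
  assumes "g \<in> right_hom A M N" "g' \<in> right_hom A M N" "abelian_group N"
    and "\<And>f c. [|f \<in> M.chom; c ::: C|] ==> g (f c) = g' (f c)" "m ::: M"
  shows "g m = g' m"
proof -
  have "g (tlift A M C M act (coact M m)) = g' (tlift A M C M act (coact M m))"
    using bal.lift_additive[OF act_bal right_homD(1)[OF assms(1)] assms(3) M.co_closed[OF assms(5)]]
      bal.lift_additive[OF act_bal right_homD(1)[OF assms(2)] assms(3) M.co_closed[OF assms(5)]]
    by (simp add: assms(4)[OF act_chom])
  then show ?thesis by (simp add: act_lift assms(5))
qed

text \<open>If \<open>h\<close> is composition with \<open>g\<close>, then \<open>g(m) = g(act
  m\<^sub>0 m\<^sub>1) = h(act m\<^sub>0)(m\<^sub>1)\<close> by \<open>act_lift\<close>. The right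
  side makes sense for every \<open>h\<close> and is taken as definition of
  \<open>g\<close>.\<close>

lemma chom_extension:
  fixes N :: "('a, 'n, 'c, 't) comod_scheme"
  assumes N: "right_comodule A C N" and h: "h \<in> em_hom A C (comod_hom_em A C M) (comod_hom_em A C N)"
  shows "\<exists>g\<in>comod_hom A C M N. \<forall>f\<in>M.chom. h f = compose (carrier C) g f"
proof -
  interpret N: right_comodule A C N by fact
  interpret N: coring_comodule A C N ..
  note e = M.comod_hom_em_eq N.comod_hom_em_eq
  have hr: "h \<in> right_hom A (sub_hom_em A C M M.chom) (sub_hom_em A C N N.chom)"
    using em_homD(1)[OF h] by (simp add: e)
  note hD = right_homD[OF hr, simplified]
  have hc: "h f \<in> right_hom A C N" if "f \<in> M.chom" for f
    using hD(2)[OF that] by (simp add: N.chom_iff)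
  note hcD = right_homD[OF hc]
  define \<psi> where "\<psi> u v = h (act u) v" for u v
  have b: "bal A M C N \<psi>"
    unfolding \<psi>_def
    by (rule balI)
       (simp_all add: M.right_module_axioms bimodule_axioms N.M.abelian_group_axioms hcD act_chom act_add_left act_ract_left
          hD(3,4) lact_closed)
  have \<psi>_ract: "\<psi> u (v \<triangleleft>[C] a) = \<psi> u v \<triangleleft>[N] a" if "u ::: M" "v ::: C" "a ::: A" for u v a
    using that by (simp add: \<psi>_def hcD act_chom)
  define g where "g m = tlift A M C N \<psi> (coact M m)" for m
  have nr: "(%m. m \<triangleleft>[N] a) \<in> add_hom N N" if "a ::: A" for a
    by (rule add_homI) (use that in "simp_all add: N.ract_closed N.ract_add_left")
  have gr: "g \<in> right_hom A M N"
    by (rule right_homI)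
       (simp_all add: g_def bal.lift_closed[OF b] M.co_closed M.co_add bal.lift_add[OF b] M.lift_co_ract[OF b] \<psi>_ract
          bal.lift_additive[OF b nr N.M.abelian_group_axioms])
  let ?T = "tgroup A N C"
  have tri: "trilin A M C C ?T (%u v w. telem A N C (\<psi> u v) w)"
    by (rule trilinI)
       (simp_all add: M.right_module_axioms bimodule_axioms N.MC.tensor_abelian_group balD[OF b] \<psi>_ract[symmetric] N.MC.telem_closed
          N.MC.telem_add_left N.MC.telem_add_right N.MC.telem_balanced[symmetric])
  have "g \<in> comod_hom A C M N"
  proof (rule comod_homI[OF gr])
    fix m assume m: "m ::: M"
    have "coact N (g m) = tlift A M C ?T (%u v. coact N (\<psi> u v)) (coact M m)"
      using bal.lift_additive[OF b right_homD(1)[OF N.coact_hom] _ M.co_closed[OF m]]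
        abelian_group_transfer[OF N.MC.tensor_abelian_group, of "tright A N C"] by (simp add: g_def)
    also have "... = tlift A M C ?T (%u v. tlift A C C ?T (%x y. telem A N C (\<psi> u x) y) (cop C v)) (coact M m)"
      by (rule lift_cong) (use hD(2)[OF act_chom] in "simp add: \<psi>_def N.chom_iff")
    also have "... = tlift A M C ?T (%u y. tlift A M C ?T (%v x. telem A N C (\<psi> v x) y) (coact M u)) (coact M m)"
      by (rule M.co_coassoc[OF tri m, symmetric])
    also have "... = tlift A M C ?T (%u y. telem A N C (g u) y) (coact M m)"
      by (rule lift_cong) (simp add: g_def N.MC.telem_lift_left[OF b M.co_closed])
    finally show "tlift A M C ?T (%u y. telem A N C (g u) y) (coact M m) = coact N (g m)" by simp
  qed
  moreover have "h f = compose (carrier C) g f" if f: "f \<in> M.chom" for f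
  proof (rule extensionalityI[of _ "carrier C"])
    show "h f \<in> extensional (carrier C)" using hD(2)[OF f] by (simp add: N.chom_iff)
    have fr: "f \<in> right_hom A C M" using f by (simp add: M.chom_iff)
    note fD = right_homD[OF fr]
    \<comment> \<open>\<open>\<Phi>\<close> is an element of
      \<open>Hom\<^sub>A(C, Hom\<^sup>C(C, M))\<close> which the structure map sends to
      \<open>f\<close>. As \<open>h\<close> respects structure maps, its value at \<open>f\<close>
      is determined by its values at the maps \<open>act (f x)\<close>.\<close>
    define \<Phi> where "\<Phi> = (\<lambda>x\<in>carrier C. act (f x))"
    have \<Phi>: "\<Phi> ::: (hom_module A C (comod_hom_em A C M))"
      by (auto simp: \<Phi>_def e act_chom fD act_add_left act_ract_left ract_closed cong: restrict_cong intro!: right_homI)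
    have lf: "tlift A C C P (%x y. \<phi> (f x) y) (cop C c) = tlift A M C P \<phi> (coact M (f c))"
      if "c ::: C" "bal A M C P \<phi>" for P :: "('x, 'y) ring_scheme" and \<phi> c
    proof -
      have "f \<in> comod_hom A C (regular_comod C) M" using f by (simp add: M.chom_def)
      from lift_coact_comod_hom[OF this that(2) regular_right_module] that(1) cop_closed[OF that(1)] show ?thesis by simp
    qed
    have "monad_mult A C M \<Phi> = f"
    proof (rule extensionalityI[of _ "carrier C"])
      fix c assume c: "c ::: C"
      have "tlift A C C M (%x y. act (f x) y) (cop C c) = f c"
        using lf[OF c act_bal] act_lift[OF fD(2)[OF c]] by simp
      then show "monad_mult A C M \<Phi> c = f c" using c by (simp add: monad_mult_def \<Phi>_def)
    qed (use f in "simp_all add: monad_mult_def M.chom_iff")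
    then have hf: "h f = monad_mult A C N (\<lambda>c\<in>carrier C. h (\<Phi> c))"
      using em_homD(2)[OF h \<Phi>] by (simp add: e)
    fix c assume c: "c ::: C"
    have "h f c = tlift A C C N (%x y. \<psi> (f x) y) (cop C c)"
      using c by (simp add: hf monad_mult_def \<psi>_def \<Phi>_def)
    also have "... = g (f c)" using lf[OF c b] by (simp add: g_def)
    finally show "h f c = compose (carrier C) g f c" using c by (simp add: compose_def)
  qed (simp add: compose_def)
  ultimately show ?thesis by blast
qed

end

subsection \<open>Essential surjectivity\<close>

locale cointegral_em = cointegral A C \<delta> + M: em_module A C M
  for A :: "('a, 'p) ring_scheme" (structure) and C :: "('a, 'c, 'q) coring_scheme" and \<delta>
    and M :: "('a, 'm, 'c, 's) em_mod_scheme"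
begin

sublocale M: coring_module A C M ..

sublocale F: cofree A C M ..

lemma alg_closed: "f ::: (hom_module A C M) ==> alg M f ::: M"
  by (rule right_homD(2)[OF M.alg_hom])

lemma alg_ract: "[|f ::: (hom_module A C M); a ::: A|] ==> alg M f \<triangleleft>[M] a = alg M (\<lambda>c\<in>carrier C. f (a \<triangleright>[C] c))"
  using right_homD(4)[OF M.alg_hom] by simp

lemma alg_add: "[|f ::: (hom_module A C M); g ::: (hom_module A C M)|]
    ==> alg M (\<lambda>c\<in>carrier C. f c \<oplus>[M] g c) = alg M f \<oplus>[M] alg M g"
  using right_homD(3)[OF M.alg_hom] by simp

lemma alg_alg: "F ::: (hom_module A C (hom_module A C M)) ==>
    alg M (\<lambda>c\<in>carrier C. alg M (F c)) = alg M (\<lambda>c\<in>carrier C. tlift A C C M F (cop C c))"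
  using M.alg_mult[of F] by (simp add: monad_map_def monad_mult_def compose_def)

lemma alg_counit: "x ::: M ==> alg M (\<lambda>c\<in>carrier C. x \<triangleleft>[M] cou C c) = x"
  using M.alg_unit[of x] by (simp add: monad_unit_def)

text \<open>The structure map is additive, and a Sweedler sum in \<open>Hom\<^sub>A(C, M)\<close> is
  computed pointwise by evaluation.\<close>

lemma alg_lift:
  assumes "bal A K L (hom_module A C M) \<phi>" "t ::: (tgroup A K L)"
  shows "tlift A K L M (%x y. alg M (\<phi> x y)) t = alg M (\<lambda>c\<in>carrier C. tlift A K L M (%x y. \<phi> x y c) t)"
proof -
  have "tlift A K L (hom_module A C M) \<phi> t = (\<lambda>c\<in>carrier C. tlift A K L M (%x y. \<phi> x y c) t)"
  proof (rule extensionalityI[of _ "carrier C"])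
    show "tlift A K L (hom_module A C M) \<phi> t \<in> extensional (carrier C)"
      using bal.lift_closed[OF assms] by simp
  qed (simp_all add: bal.lift_additive[OF assms(1) M.hom_module_eval M.M.abelian_group_axioms assms(2)])
  then show ?thesis
    using bal.lift_additive[OF assms(1) right_homD(1)[OF M.alg_hom] M.M.abelian_group_axioms assms(2)] by simp
qed

definition \<mu> :: "'m => 'c => 'c => 'm" where "\<mu> m c = (\<lambda>d\<in>carrier C. m \<triangleleft>[M] \<delta> c d)"

text \<open>When \<open>M\<close> is \<open>Hom\<^sup>C(C, Q)\<close>, the identity
  \<open>\<delta>_colinear\<close> turns \<open>e f c\<close> into \<open>act (f c)\<close>. So
  \<open>e\<close> plays the part of the evaluation f \<otimes> c \<mapsto> f(c), brought back into
  \<open>M\<close> by \<open>act\<close>.\<close>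

definition e :: "'m => 'c => 'm" where "e m c = alg M (\<mu> m c)"

lemma \<mu>_closed: "[|m ::: M; c ::: C|] ==> \<mu> m c ::: (hom_module A C M)"
  by (auto simp: \<mu>_def \<delta>_rules M.ract_closed M.ract_add_right M.ract_assoc ract_closed intro!: right_homI)

lemma \<mu>_bal: "bal A M C (hom_module A C M) \<mu>"
  by (rule balI)
     (use \<mu>_closed in "simp_all add: M.right_module_axioms bimodule_axioms M.hom_module_abelian_group \<mu>_def \<delta>_rules
       M.ract_add_left M.ract_add_right M.ract_assoc cong: restrict_cong")

lemma \<mu>_ract: "[|m ::: M; c ::: C; a ::: A|]
    ==> \<mu> m (c \<triangleleft>[C] a) = (\<lambda>d\<in>carrier C. \<mu> m c (a \<triangleright>[C] d))"
  by (simp add: \<mu>_def \<delta>_rules lact_closed cong: restrict_cong)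

lemma e_bal: "bal A M C M e"
  unfolding e_def by (rule bal.bal_additive[OF \<mu>_bal right_homD(1)[OF M.alg_hom] M.M.abelian_group_axioms])

lemmas e_rules = balD[OF e_bal]

lemma e_ract: "[|m ::: M; c ::: C; a ::: A|] ==> e m (c \<triangleleft>[C] a) = e m c \<triangleleft>[M] a"
  by (simp add: e_def alg_ract[OF \<mu>_closed] \<mu>_ract)

lemma e_right_hom: "m ::: M ==> e m \<in> right_hom A C M"
  by (rule right_homI) (simp_all add: e_rules e_ract)

text \<open>\<open>\<alpha>(c \<mapsto> \<alpha>(m \<delta>(c, -))) = \<alpha>(c \<mapsto> m
  \<delta>(c\<^sub>1, c\<^sub>2)) = \<alpha>(c \<mapsto> m \<epsilon>(c)) = m\<close>, by the
  associativity law, \<open>\<delta>_cop\<close> and the unit law.\<close>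

lemma alg_e: "m ::: M ==> alg M (\<lambda>c\<in>carrier C. e m c) = m"
proof -
  assume m: "m ::: M"
  let ?F = "\<lambda>c\<in>carrier C. \<mu> m c"
  have F: "?F ::: (hom_module A C (hom_module A C M))"
    using m balD[OF \<mu>_bal] by (auto intro!: right_homI simp: \<mu>_ract ract_closed)
  have "(\<lambda>c\<in>carrier C. tlift A C C M ?F (cop C c)) = (\<lambda>c\<in>carrier C. m \<triangleleft>[M] cou C c)"
  proof (rule restrict_ext)
    fix c assume c: "c ::: C"
    have "(%a. m \<triangleleft>[M] a) \<in> add_hom A M"
      by (rule add_homI) (use m in "simp_all add: M.ract_closed M.ract_add_right")
    from \<delta>.lift_additive[OF this M.M.abelian_group_axioms cop_closed[OF c]]
    show "tlift A C C M ?F (cop C c) = m \<triangleleft>[M] cou C c"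
      by (simp add: \<delta>_cop c \<mu>_def)
  qed
  then show ?thesis
    using alg_alg[OF F] alg_counit[OF m] by (simp add: e_def cong: restrict_cong)
qed

text \<open>\<open>e(\<alpha>(f) \<otimes> c) = e(f(c\<^sub>1) \<otimes> c\<^sub>2)\<close>.\<close>

lemma e_alg:
  assumes f: "f ::: (hom_module A C M)" and c: "c ::: C"
  shows "e (alg M f) c = tlift A C C M (%x y. e (f x) y) (cop C c)"
proof -
  have fr: "f \<in> right_hom A C M" using f by simp
  note fD = right_homD[OF fr]
  \<comment> \<open>\<open>F d\<close> is \<open>f\<close> acted on by \<open>\<delta> c d\<close>,
    so that \<open>alg M (F d)\<close> is \<open>alg M f\<close> times \<open>\<delta> c d\<close>
    and the associativity law of the module applies to \<open>F\<close>.\<close>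
  define F where "F = (\<lambda>d\<in>carrier C. \<lambda>d'\<in>carrier C. f (\<delta> c d \<triangleright>[C] d'))"
  have F: "F ::: (hom_module A C (hom_module A C M))"
    using c by (auto simp: F_def \<delta>_rules lact_closed ract_closed fD lact_add_left lact_add_right lact_assoc lact_ract[symmetric]
        cong: restrict_cong intro!: right_homI)
  have bf: "bal A C C (hom_module A C M) (%x y. \<mu> (f x) y)"
    using bal.bal_compose[OF \<mu>_bal fr id_left_hom right_module_axioms bimodule_axioms] by simp
  have "e (alg M f) c = alg M (\<lambda>d\<in>carrier C. alg M (F d))"
    using c by (simp add: e_def \<mu>_def alg_ract[OF f] \<delta>_rules F_def cong: restrict_cong)
  also have "... = alg M (\<lambda>d\<in>carrier C. tlift A C C M (%x y. f (\<delta> c x \<triangleright>[C] y)) (cop C d))"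
    unfolding alg_alg[OF F] by (simp add: F_def cong: restrict_cong)
  also have "... = alg M (\<lambda>d\<in>carrier C. tlift A C C M (%x y. \<mu> (f x) y d) (cop C c))"
  proof (rule arg_cong[of _ _ "alg M"], rule restrict_ext)
    fix d assume d: "d ::: C"
    \<comment> \<open>The heart of the lemma: both summations are \<open>f\<close> applied to one
      element \<open>cosplit c d\<close>, written in its two ways.\<close>
    have "tlift A C C M (%x y. f (\<delta> c x \<triangleright>[C] y)) (cop C d) = f (cosplit c d)"
      using bal.lift_additive[OF trilin.bal_23[OF trilin_\<delta>_right] fD(1) M.M.abelian_group_axioms cop_closed[OF d]] c d
      by (simp add: cosplit_right)
    also have "... = tlift A C C M (%x y. f (x \<triangleleft>[C] \<delta> y d)) (cop C c)"
      using bal.lift_additive[OF trilin.bal_12[OF trilin_\<delta>_left] fD(1) M.M.abelian_group_axioms cop_closed[OF c]] c d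
      by (simp add: cosplit_def)
    finally show "tlift A C C M (%x y. f (\<delta> c x \<triangleright>[C] y)) (cop C d) = tlift A C C M (%x y. \<mu> (f x) y d) (cop C c)"
      using d by (simp add: fD \<delta>_rules \<mu>_def)
  qed
  also have "... = tlift A C C M (%x y. e (f x) y) (cop C c)"
    by (simp add: alg_lift[OF bf cop_closed[OF c], symmetric] e_def)
  finally show ?thesis .
qed

text \<open>This makes \<open>E\<close> idempotent. With \<open>e_alg\<close> for the map
  \<open>m \<delta>(c\<^sub>1, -)\<close> the left side becomes \<open>e(m \<delta>(c\<^sub>1,
  c\<^sub>2) \<otimes> c\<^sub>3) = e(m \<otimes> \<epsilon>(c\<^sub>1) c\<^sub>2)\<close>.\<close>

lemma e_e:
  assumes m: "m ::: M" and c: "c ::: C"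
  shows "tlift A C C M (%x y. e (e m x) y) (cop C c) = e m c"
proof -
  have tri: "trilin A C C C M (%x v w. e (m \<triangleleft>[M] \<delta> x v) w)"
    by (rule trilinI)
       (simp_all add: m right_module_axioms bimodule_axioms M.M.abelian_group_axioms e_rules \<delta>_rules M.ract_closed
          M.ract_add_right M.ract_assoc lact_closed lact_add_left lact_add_right)
  have "tlift A C C M (%x y. e (e m x) y) (cop C c)
    = tlift A C C M (%x y. tlift A C C M (%v w. e (m \<triangleleft>[M] \<delta> x v) w) (cop C y)) (cop C c)"
    by (rule lift_cong) (simp add: e_def[of m] e_alg[OF \<mu>_closed] m, simp add: \<mu>_def)
  also have "... = tlift A C C M (%p w. tlift A C C M (%x v. e (m \<triangleleft>[M] \<delta> x v) w) (cop C p)) (cop C c)"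
    by (rule cop_coassoc[OF tri c, symmetric])
  also have "... = tlift A C C M (%p w. e m (cou C p \<triangleright>[C] w)) (cop C c)"
  proof (rule lift_cong)
    fix p w assume pw: "p ::: C" "w ::: C"
    have "(%a. e (m \<triangleleft>[M] a) w) \<in> add_hom A M"
      by (rule add_homI) (use m pw in "simp_all add: M.ract_closed M.ract_add_right e_rules lact_closed lact_add_left")
    from \<delta>.lift_additive[OF this M.M.abelian_group_axioms cop_closed[OF pw(1)]]
    show "tlift A C C M (%x v. e (m \<triangleleft>[M] \<delta> x v) w) (cop C p) = e m (cou C p \<triangleright>[C] w)"
      using m pw by (simp add: \<delta>_cop e_rules cou_closed lact_closed)
  qed
  also have "... = e m c"
    by (rule cop_counit_left[OF right_homD(1)[OF e_right_hom[OF m]] M.M.abelian_group_axioms c])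
  finally show ?thesis .
qed

abbreviation T where "T \<equiv> tgroup A M C"

text \<open>The idempotent endomorphism \<open>m \<otimes> c \<mapsto> e(m \<otimes> c\<^sub>1) \<otimes> c\<^sub>2\<close> of the cofree comodule \<open>M \<otimes>\<^sub>A C\<close>.\<close>

definition E0 :: "'m => 'c => ('m, 'c) tensor" where
  "E0 m c = tlift A C C T (%x y. telem A M C (e m x) y) (cop C c)"

definition E :: "('m, 'c) tensor => ('m, 'c) tensor" where "E = tlift A M C T E0"

lemma tri_e: "trilin A M C C T (%m x y. telem A M C (e m x) y)"
  by (rule trilinI)
     (simp_all add: M.right_module_axioms bimodule_axioms F.MC.tensor_abelian_group e_rules e_ract F.MC.telem_closed
        F.MC.telem_add_left F.MC.telem_add_right F.MC.telem_balanced)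

lemma E0_bal: "bal A M C T E0"
  unfolding E0_def by (rule bal_cop_right[OF tri_e])

lemma E_elem: "[|m ::: M; c ::: C|] ==> E (telem A M C m c) = E0 m c"
  by (simp add: E_def bal.lift_elem[OF E0_bal])

lemma E_add_hom: "E \<in> add_hom T T"
  unfolding E_def by (rule bal.lift_hom[OF E0_bal])

lemma E_lift:
  assumes "bal A K L T \<phi>" "t ::: (tgroup A K L)"
  shows "E (tlift A K L T \<phi> t) = tlift A K L T (%x y. E (\<phi> x y)) t"
  by (rule bal.lift_additive[OF assms(1) E_add_hom F.MC.tensor_abelian_group assms(2)])

text \<open>\<open>E\<close> is the map into the cofree comodule that corresponds to the linear map
  \<open>e\<close>, and its colinearity is coassociativity of \<open>C\<close>.\<close>

lemma E_comod_hom: "E \<in> comod_hom A C (cofree_comod A C M) (cofree_comod A C M)"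
proof (rule comod_homI)
  let ?N = "cofree_comod A C M" and ?TT = "tgroup A (tright A M C) C"
  have rh: "(%t. t \<triangleleft>[tright A M C] a) \<in> add_hom T T" if "a ::: A" for a
    by (rule add_homI) (use F.MCr.ract_closed F.MCr.ract_add_left that in simp_all)
  have E0_ract: "E0 m (c \<triangleleft>[C] a) = E0 m c \<triangleleft>[tright A M C] a"
    if "m ::: M" "c ::: C" "a ::: A" for m c a
    using that unfolding E0_def
    by (simp add: lift_cop_ract[OF trilin.bal_23[OF tri_e]] F.MC.ract_telem e_rules
        bal.lift_additive[OF trilin.bal_23[OF tri_e] rh F.MC.tensor_abelian_group cop_closed])
  show Er: "E \<in> right_hom A ?N ?N"
  proof (rule right_homI)
    fix t a assume "t ::: ?N" "a ::: A"
    then show "E (t \<triangleleft>[?N] a) = E t \<triangleleft>[?N] a"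
      by (simp add: E_def bal_lift_ract[OF E0_bal] E0_ract bal.lift_additive[OF E0_bal rh F.MC.tensor_abelian_group])
  qed (simp_all add: E_def bal.lift_closed[OF E0_bal] bal.lift_add[OF E0_bal])
  have Er': "E \<in> right_hom A (tright A M C) (tright A M C)"
    using Er by (simp add: right_hom_def hom_def)
  have b: "bal A (tright A M C) C ?TT (%t c. telem A (tright A M C) C (E t) c)"
    using bal.bal_compose[OF F.T.telem_bal Er' id_left_hom F.MCr.right_module_axioms bimodule_axioms] by simp
  have co: "coact ?N \<in> add_hom T ?TT"
    by (rule add_homI) (use right_homD(2,3)[OF F.coact_cofree_hom] in "simp_all del: cofree_comod_simps(5)")
  have h1: "(%t. coact ?N (E t)) \<in> add_hom T ?TT"
    by (rule add_homI) (simp_all add: hom_add[OF co] hom_add[OF E_add_hom] hom_carrier_add[OF co] hom_carrier_add[OF E_add_hom] del: cofree_comod_simps)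
  have h2: "(%t. tlift A (tright A M C) C ?TT (%t c. telem A (tright A M C) C (E t) c) (coact ?N t))
      \<in> add_hom T ?TT"
    by (rule add_homI) (simp_all add: hom_add[OF co] hom_carrier_add[OF co] bal.lift_add[OF b] bal.lift_closed[OF b] del: cofree_comod_simps)
  fix t assume "t ::: ?N"
  then have t: "t ::: T" by simp
  have "tlift A (tright A M C) C ?TT (%t c. telem A (tright A M C) C (E t) c) (coact ?N t) = coact ?N (E t)"
  proof (rule F.MC.tensor_hom_eq[OF h2 h1 _ t])
    fix m c assume mc: "m ::: M" "c ::: C"
    let ?q = "%x u v. telem A (tright A M C) C (telem A M C (e m x) u) v"
    have tri: "trilin A C C C ?TT ?q"
      using trilin_compose[OF F.E.trilin_axioms e_right_hom[OF mc(1)] right_module_axioms id_left_hom bimodule_axioms] by simp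
    have "tlift A (tright A M C) C ?TT (%t c. telem A (tright A M C) C (E t) c) (coact ?N (telem A M C m c))
      = tlift A C C ?TT (%z v. telem A (tright A M C) C (E0 m z) v) (cop C c)"
      unfolding F.lift_coact_cofree_elem[OF b mc] using mc by (simp add: E_elem)
    also have "... = tlift A C C ?TT (%z v. tlift A C C ?TT (%x u. ?q x u v) (cop C z)) (cop C c)"
    proof (rule lift_cong)
      fix z v assume zv: "z ::: C" "v ::: C"
      have "bal A C C (tright A M C) (%x y. telem A M C (e m x) y)"
        using trilin.bal_23[OF tri_e mc(1)] F.MCr.M.abelian_group_axioms
        by (intro balI) (simp_all add: right_module_axioms bimodule_axioms balD[OF trilin.bal_23[OF tri_e mc(1)]])
      from F.T.telem_lift_left[OF this cop_closed[OF zv(1)] zv(2)]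
      show "telem A (tright A M C) C (E0 m z) v = tlift A C C ?TT (%x u. ?q x u v) (cop C z)"
        by (simp add: E0_def)
    qed
    also have "... = tlift A C C ?TT (%x y. tlift A C C ?TT (?q x) (cop C y)) (cop C c)"
      by (rule cop_coassoc[OF tri mc(2)])
    also have "... = tlift A C C ?TT (%x y. coact ?N (telem A M C (e m x) y)) (cop C c)"
      by (rule lift_cong) (simp add: F.coact_cofree_elem e_rules mc del: cofree_comod_simps)
    also have "... = coact ?N (E (telem A M C m c))"
      using bal.lift_additive[OF trilin.bal_23[OF tri_e mc(1)] co F.T.tensor_abelian_group cop_closed[OF mc(2)]]
      by (simp add: E_elem mc E0_def del: cofree_comod_simps)
    finally show "tlift A (tright A M C) C ?TT (%t c. telem A (tright A M C) C (E t) c) (coact ?N (telem A M C m c))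
      = coact ?N (E (telem A M C m c))" .
  qed
  then show "tlift A ?N C (tgroup A ?N C) (%y c. telem A ?N C (E y) c) (coact ?N t) = coact ?N (E t)"
    by (simp del: cofree_comod_simps)
qed

text \<open>Coassociativity collects the inner sum
  \<open>e(f(c\<^sub>1) \<otimes> c\<^sub>2)\<close> in the first tensor factor, which is the sum
  that \<open>e_e\<close> and \<open>e_alg\<close> evaluate.\<close>

lemma lift_E0:
  assumes f: "f \<in> right_hom A C M" and c: "c ::: C"
  shows "tlift A C C T (%x y. E0 (f x) y) (cop C c)
    = tlift A C C T (%z y. telem A M C (tlift A C C M (%u v. e (f u) v) (cop C z)) y) (cop C c)"
proof -
  have tri: "trilin A C C C T (%x u v. telem A M C (e (f x) u) v)"
    using trilin_compose[OF tri_e f right_module_axioms id_left_hom bimodule_axioms] by simp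
  have bf: "bal A C C M (%x y. e (f x) y)"
    using bal.bal_compose[OF e_bal f id_left_hom right_module_axioms bimodule_axioms] by simp
  have "tlift A C C T (%x y. E0 (f x) y) (cop C c)
    = tlift A C C T (%x y. tlift A C C T (%u v. telem A M C (e (f x) u) v) (cop C y)) (cop C c)"
    by (simp add: E0_def)
  also have "... = tlift A C C T (%z v. tlift A C C T (%x u. telem A M C (e (f x) u) v) (cop C z)) (cop C c)"
    by (rule cop_coassoc[OF tri c, symmetric])
  also have "... = tlift A C C T (%z y. telem A M C (tlift A C C M (%u v. e (f u) v) (cop C z)) y) (cop C c)"
    by (rule lift_cong) (simp add: F.MC.telem_lift_left[OF bf cop_closed])
  finally show ?thesis .
qed

lemma E_E: "t ::: T ==> E (E t) = E t"
proof (rule F.MC.tensor_hom_eq[OF _ E_add_hom])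
  show "(%t. E (E t)) \<in> add_hom T T"
    by (rule add_homI) (simp_all add: hom_add[OF E_add_hom] hom_carrier_add[OF E_add_hom])
  fix m c assume mc: "m ::: M" "c ::: C"
  have "E (E (telem A M C m c)) = tlift A C C T (%x y. E0 (e m x) y) (cop C c)"
    using mc by (simp add: E_elem E0_def[of m] E_lift[OF trilin.bal_23[OF tri_e] cop_closed] e_rules)
  also have "... = E0 m c"
    using mc by (simp add: lift_E0[OF e_right_hom] e_e E0_def[of m])
  finally show "E (E (telem A M C m c)) = E (telem A M C m c)"
    using mc by (simp add: E_elem)
qed

definition counit_map :: "('m, 'c) tensor => 'm" where
  "counit_map = tlift A M C M (%m c. m \<triangleleft>[M] cou C c)"

lemma counit_map_bal: "bal A M C M (%m c. m \<triangleleft>[M] cou C c)"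
  by (rule balI)
     (simp_all add: M.right_module_axioms bimodule_axioms M.M.abelian_group_axioms cou_closed cou_add cou_lact
        M.ract_closed M.ract_add_left M.ract_add_right M.ract_assoc)

lemma counit_map_hom: "counit_map \<in> right_hom A (tright A M C) M"
proof (rule right_homI)
  fix t a assume t: "t ::: (tright A M C)" and a: "a ::: A"
  have "(%m. m \<triangleleft>[M] a) \<in> add_hom M M"
    by (rule add_homI) (use a in "simp_all add: M.ract_closed M.ract_add_left")
  from bal.lift_additive[OF counit_map_bal this M.M.abelian_group_axioms] t a
  show "counit_map (t \<triangleleft>[tright A M C] a) = counit_map t \<triangleleft>[M] a"
    by (simp add: counit_map_def bal_lift_ract[OF counit_map_bal] cou_ract M.ract_assoc cou_closed)
qed (simp_all add: counit_map_def bal.lift_closed[OF counit_map_bal] bal.lift_add[OF counit_map_bal])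

lemma counit_map_elem: "[|m ::: M; c ::: C|] ==> counit_map (telem A M C m c) = m \<triangleleft>[M] cou C c"
  by (simp add: counit_map_def bal.lift_elem[OF counit_map_bal])

lemma counit_map_E0:
  assumes "m ::: M" "c ::: C"
  shows "counit_map (E0 m c) = e m c"
proof -
  have "counit_map (E0 m c) = tlift A C C M (%x y. e m (x \<triangleleft>[C] cou C y)) (cop C c)"
    using assms bal.lift_additive[OF trilin.bal_23[OF tri_e assms(1)] bal.lift_hom[OF counit_map_bal, folded counit_map_def]
        M.M.abelian_group_axioms cop_closed[OF assms(2)]] by (simp add: E0_def counit_map_elem e_rules e_ract cou_closed)
  also have "... = e m c"
    by (rule cop_counit_right[OF right_homD(1)[OF e_right_hom[OF assms(1)]] M.M.abelian_group_axioms assms(2)])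
  finally show ?thesis .
qed

text \<open>Hence a colinear map into \<open>M \<otimes>\<^sub>A C\<close> is determined by its
  composite with \<open>M \<otimes> \<epsilon>\<close>, which is how preimages are found in the
  essential surjectivity proof.\<close>

lemma cofree_counit:
  assumes "t ::: T"
  shows "tlift A (tright A M C) C T (%s c. telem A M C (counit_map s) c) (coact (cofree_comod A C M) t) = t"
proof -
  have b: "bal A (tright A M C) C T (%s c. telem A M C (counit_map s) c)"
    using bal.bal_compose[OF F.MC.telem_bal counit_map_hom id_left_hom F.MCr.right_module_axioms bimodule_axioms] by simp
  have co: "coact (cofree_comod A C M) \<in> add_hom T (tgroup A (tright A M C) C)"
    by (rule add_homI) (use right_homD(2,3)[OF F.coact_cofree_hom] in "simp_all del: cofree_comod_simps(5)")
  have h: "(%t. tlift A (tright A M C) C T (%s c. telem A M C (counit_map s) c) (coact (cofree_comod A C M) t))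
      \<in> add_hom T T"
    by (rule add_homI) (simp_all add: hom_add[OF co] hom_carrier_add[OF co] bal.lift_add[OF b] bal.lift_closed[OF b] del: cofree_comod_simps)
  show ?thesis
  proof (rule F.MC.tensor_hom_eq[OF h _ _ assms, of "%t. t"])
    show "(%t. t) \<in> add_hom T T" by (rule add_homI) simp_all
    fix m c assume mc: "m ::: M" "c ::: C"
    have h: "telem A M C m \<in> add_hom C T"
      by (rule add_homI) (use mc in "simp_all add: F.MC.telem_closed F.MC.telem_add_right")
    have "tlift A C C T (%u v. telem A M C (m \<triangleleft>[M] cou C u) v) (cop C c) = telem A M C m c"
      using cop_counit_left[OF h F.MC.tensor_abelian_group mc(2)] mc by (simp add: F.MC.telem_balanced cou_closed)
    then show "tlift A (tright A M C) C T (%s c. telem A M C (counit_map s) c)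
      (coact (cofree_comod A C M) (telem A M C m c)) = telem A M C m c"
      unfolding F.lift_coact_cofree_elem[OF b mc] using mc by (simp add: counit_map_elem)
  qed
qed

text \<open>\<open>Q\<close> is the image of \<open>E\<close>, placed in the universe by
  \<open>\<iota>\<close>, and the comparison map sends \<open>m\<close> to the colinear map c
  \<mapsto> E(m \<otimes> c). The structure map of \<open>M\<close> yields both its injectivity and
  the preimages.\<close>

theorem comod_hom_em_ess_surj:
  fixes \<iota> :: "('m, 'c) tensor => 'u"
  assumes inj: "inj_on \<iota> (carrier T)"
  shows "\<exists>(Q :: ('a, 'u, 'c) comod) \<theta>. right_comodule A C Q \<and>
    \<theta> \<in> em_hom A C M (comod_hom_em A C Q) \<and> bij_betw \<theta> (carrier M) (carrier (comod_hom_em A C Q))"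
proof -
  let ?N = "cofree_comod A C M"
  \<comment> \<open>The composite \<open>j \<circ> p\<close> is the idempotent \<open>E\<close>,
    while \<open>p\<close> takes values in the universe, so the image of \<open>E\<close> becomes a
    comodule on a set of elements of \<open>'u\<close>.\<close>
  define p where "p t = \<iota> (E t)" for t
  define j where "j = inv_into (carrier T) \<iota>"
  have Ecl: "E t ::: T" if "t ::: T" for t by (rule hom_carrier_add[OF E_add_hom that])
  have j\<iota>: "j (\<iota> t) = t" if "t ::: T" for t using inv_into_f_f[OF inj that] by (simp add: j_def)
  have jp: "j (p t) = E t" if "t ::: T" for t using that by (simp add: p_def j\<iota> Ecl)
  interpret N: right_comodule A C ?N by (rule F.cofree_right_comodule)
  interpret S: split_comod_endo A C ?N p j
  proof (intro split_comod_endo.intro split_comod_endo_axioms.intro split_endo.intro split_endo_axioms.intro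
      is_coring_axioms N.right_comodule_axioms N.right_module_axioms)
    show "(%n. j (p n)) \<in> comod_hom A C ?N ?N"
      by (rule comod_hom_cong[OF E_comod_hom N.right_module_axioms]) (simp add: jp)
    then show "(%n. j (p n)) \<in> right_hom A ?N ?N" by (rule comod_homD(1))
    show "p (j (p n)) = p n" if "n ::: ?N" for n
      using that by (simp add: jp) (simp add: p_def E_E)
  qed
  define Q where "Q = retract_comod A C ?N p j"
  interpret Q: right_comodule A C Q unfolding Q_def by (rule S.retract_right_comodule)
  interpret Q: coring_comodule A C Q ..
  have pD: "p \<in> comod_hom A C ?N Q" and jD: "j \<in> comod_hom A C Q ?N"
    unfolding Q_def by (rule S.p_comod_hom S.j_comod_hom)+
  have pr: "p t ::: Q" "s ::: T ==> p (t \<oplus>[T] s) = p t \<oplus>[Q] p s"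
    "a ::: A ==> p (t \<triangleleft>[tright A M C] a) = p t \<triangleleft>[Q] a" if "t ::: T" for t s a
    using right_homD[OF comod_homD(1)[OF pD]] that by simp_all
  have ph: "p \<in> add_hom T Q" by (rule add_homI) (simp_all add: pr)
  define \<theta> where "\<theta> m = (\<lambda>c\<in>carrier C. p (telem A M C m c))" for m
  have \<theta>_closed: "\<theta> m \<in> Q.chom" if m: "m ::: M" for m
  proof -
    have "telem A M C m \<in> comod_hom A C (regular_comod C) ?N"
      by (rule comod_homI, rule right_homI)
         (use m in "simp_all add: F.MC.telem_closed F.MC.telem_add_right F.MC.ract_telem
            F.coact_cofree_elem del: cofree_comod_simps(5)")
    from comod_hom_compose[OF this pD regular_right_module _ Q.MC.tensor_prod_axioms] cop_closed
    have "(%c. p (telem A M C m c)) \<in> comod_hom A C (regular_comod C) Q"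
      by (simp add: S.MC.tensor_prod_axioms)
    then have "\<theta> m \<in> comod_hom A C (regular_comod C) Q"
      by (rule comod_hom_cong[OF _ regular_right_module]) (simp add: \<theta>_def)
    then show ?thesis by (simp add: Q.chom_def \<theta>_def)
  qed
  have \<theta>r: "\<theta> \<in> right_hom A M (comod_hom_em A C Q)"
    by (rule right_homI)
       (simp_all add: Q.comod_hom_em_eq \<theta>_closed, simp_all add: \<theta>_def F.MC.telem_add_left F.MC.telem_balanced
         pr F.MC.telem_closed lact_closed cong: restrict_cong)
  \<comment> \<open>\<open>E\<close> identifies \<open>\<alpha>(f) \<otimes> c\<close> with
    \<open>f(c\<^sub>1) \<otimes> c\<^sub>2\<close>. This relation is what makes the comparison map
    respect the structure maps.\<close>
  have E\<alpha>: "E (telem A M C (alg M f) c) = tlift A C C T (%x y. E0 (f x) y) (cop C c)"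
    if "f ::: (hom_module A C M)" "c ::: C" for f c
    using that lift_E0[of f c] by (simp add: E_elem alg_closed E0_def[of "alg M f"] e_alg)
  have \<theta>em: "\<theta> \<in> em_hom A C M (comod_hom_em A C Q)"
  proof (rule em_homI[OF \<theta>r])
    fix f assume f: "f ::: (hom_module A C M)"
    then have fr: "f \<in> right_hom A C M" by simp
    have bf: "bal A C C T (%x y. telem A M C (f x) y)"
      using bal.bal_compose[OF F.MC.telem_bal fr id_left_hom right_module_axioms bimodule_axioms] by simp
    show "\<theta> (alg M f) = alg (comod_hom_em A C Q) (\<lambda>c\<in>carrier C. \<theta> (f c))"
      unfolding Q.comod_hom_em_eq sub_hom_em_simps monad_mult_def \<theta>_def[of "alg M f"]
    proof (rule restrict_ext)
      fix c assume c: "c ::: C"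
      have "p (telem A M C (alg M f) c) = \<iota> (E (tlift A C C T (%x y. telem A M C (f x) y) (cop C c)))"
        using f c right_homD(2)[OF fr] by (simp add: p_def E\<alpha> E_lift[OF bf cop_closed] E_elem)
      also have "... = tlift A C C Q (%x y. p (telem A M C (f x) y)) (cop C c)"
        using bal.lift_additive[OF bf ph Q.M.abelian_group_axioms cop_closed[OF c]] by (simp add: p_def)
      finally show "p (telem A M C (alg M f) c) = tlift A C C Q (%x y. (\<lambda>c\<in>carrier C. \<theta> (f c)) x y) (cop C c)"
        by (simp add: \<theta>_def)
    qed
  qed
  \<comment> \<open>Applying \<open>M \<otimes> \<epsilon>\<close> to E(m \<otimes> c) gives
    \<open>e m c\<close>, and \<open>alg_e\<close> recovers \<open>m\<close> from the map
    \<open>e m\<close>.\<close>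
  have inj\<theta>: "alg M (\<lambda>c\<in>carrier C. counit_map (j (\<theta> m c))) = m" if m: "m ::: M" for m
    using alg_e[OF m] m by (simp add: \<theta>_def jp F.MC.telem_closed E_elem counit_map_E0 cong: restrict_cong)
  have surj\<theta>: "\<exists>m\<in>carrier M. \<theta> m = \<phi>" if \<phi>: "\<phi> \<in> Q.chom" for \<phi>
  proof (rule bexI)
    \<comment> \<open>Seen in \<open>M \<otimes>\<^sub>A C\<close>, a colinear map
      \<open>\<phi>\<close> is \<open>c \<mapsto> f(c\<^sub>1) \<otimes> c\<^sub>2\<close> with
      \<open>f\<close> its composite with the counit. Its values are fixed by \<open>E\<close>, so
      it is the image of \<alpha>(f).\<close>
    define f where "f = (\<lambda>c\<in>carrier C. counit_map (j (\<phi> c)))"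
    define \<psi> where "\<psi> c = j (\<phi> c)" for c
    have \<phi>h: "\<phi> \<in> comod_hom A C (regular_comod C) Q" and \<phi>r: "\<phi> \<in> right_hom A C Q" and \<phi>e: "\<phi> \<in> extensional (carrier C)"
      using \<phi> by (auto simp: Q.chom_def) (use \<phi> in "simp add: Q.chom_iff")
    have \<psi>h: "\<psi> \<in> comod_hom A C (regular_comod C) ?N"
      unfolding \<psi>_def using comod_hom_compose[OF \<phi>h jD regular_right_module Q.MC.tensor_prod_axioms S.MC.tensor_prod_axioms] cop_closed by simp
    have \<psi>r: "\<psi> \<in> right_hom A C (tright A M C)"
      using comod_homD(1)[OF \<psi>h] by (simp add: right_hom_def hom_def)
    have \<psi>c: "\<psi> c ::: T" if "c ::: C" for c using right_homD(2)[OF \<psi>r that] by simp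
    have fr: "f \<in> right_hom A C M"
      by (rule right_hom_cong[OF right_hom_comp[OF \<psi>r counit_map_hom] right_module_axioms]) (simp add: f_def \<psi>_def)
    then have fh: "f ::: (hom_module A C M)" by (simp add: f_def)
    have \<psi>_eq: "\<psi> c = tlift A C C T (%x y. telem A M C (f x) y) (cop C c)" if c: "c ::: C" for c
    proof -
      have b: "bal A ?N C T (%s c. telem A M C (counit_map s) c)"
      proof -
        have "counit_map \<in> right_hom A ?N M" using counit_map_hom by (simp add: right_hom_def hom_def)
        from bal.bal_compose[OF F.MC.telem_bal this id_left_hom N.right_module_axioms bimodule_axioms] show ?thesis by simp
      qed
      have "\<psi> c = tlift A ?N C T (%s c. telem A M C (counit_map s) c) (coact ?N (\<psi> c))"
        using cofree_counit[OF \<psi>c[OF c]] by (simp del: cofree_comod_simps)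
      also have "... = tlift A C C T (%x y. telem A M C (counit_map (\<psi> x)) y) (cop C c)"
        using lift_coact_comod_hom[OF \<psi>h b regular_right_module] c cop_closed[OF c] by (simp del: cofree_comod_simps)
      finally show ?thesis by (simp add: f_def \<psi>_def)
    qed
    show "alg M f ::: M" by (rule alg_closed[OF fh])
    show "\<theta> (alg M f) = \<phi>"
    proof (rule extensionalityI[of _ "carrier C"])
      fix c assume c: "c ::: C"
      have \<phi>c: "\<phi> c ::: Q" by (rule right_homD(2)[OF \<phi>r c])
      then obtain t where t: "t ::: T" "\<phi> c = p t" by (auto simp: Q_def retract_mod_simps)
      have bf: "bal A C C T (%x y. telem A M C (f x) y)"
        using bal.bal_compose[OF F.MC.telem_bal fr id_left_hom right_module_axioms bimodule_axioms] by simp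
      have "E (telem A M C (alg M f) c) = E (\<psi> c)"
        using c right_homD(2)[OF fr] by (simp add: E\<alpha>[OF fh] \<psi>_eq E_lift[OF bf cop_closed] E_elem)
      also have "... = \<psi> c" using t by (simp add: \<psi>_def jp E_E)
      finally have "p (telem A M C (alg M f) c) = \<iota> (j (\<phi> c))" by (simp add: p_def \<psi>_def)
      also have "... = \<phi> c" using t by (simp add: jp) (simp add: p_def)
      finally show "\<theta> (alg M f) c = \<phi> c" using c by (simp add: \<theta>_def)
    qed (use \<phi>e in "simp_all add: \<theta>_def")
  qed
  have "bij_betw \<theta> (carrier M) (carrier (comod_hom_em A C Q))"
    unfolding Q.comod_hom_em_eq sub_hom_em_simps
  proof (rule bij_betwI')
    show "\<theta> x = \<theta> y \<longleftrightarrow> x = y" if "x ::: M" "y ::: M" for x y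
      using inj\<theta>[OF that(1)] inj\<theta>[OF that(2)] by metis
    show "\<exists>x\<in>carrier M. y = \<theta> x" if "y \<in> Q.chom" for y using surj\<theta>[OF that] by metis
  qed (rule \<theta>_closed)
  with \<theta>em Q.right_comodule_axioms show ?thesis by blast
qed

end

subsection \<open>Sizes\<close>

lemma (in tensor_prod) tensor_trivial:
  assumes "carrier M \<subseteq> {\<zero>[M]} \<or> carrier N \<subseteq> {\<zero>[N]}" "t ::: (tgroup A M N)"
  shows "t = \<zero>[tgroup A M N]"
proof -
  interpret T: abelian_group "tgroup A M N" by (rule tensor_abelian_group)
  show ?thesis
    using assms(2)
  proof (induction rule: tensor_induct)
    case (elem x y)
    have "(%x. telem A M N x y) \<in> add_hom M (tgroup A M N)"
      by (rule add_homI) (use elem in "simp_all add: telem_closed telem_add_left")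
    note l = hom_zero[OF this M.abelian_group_axioms T.abelian_group_axioms]
    have "(%y. telem A M N x y) \<in> add_hom N (tgroup A M N)"
      by (rule add_homI) (use elem in "simp_all add: telem_closed telem_add_right")
    note r = hom_zero[OF this N.M.abelian_group_axioms T.abelian_group_axioms]
    show ?case using assms(1) elem l r by auto
  qed simp
qed

text \<open>Indicator functions with values \<open>a\<close> and \<open>b\<close> embed the index
  type. Families with one value at \<open>i\<close> and another elsewhere encode pairs, so the
  square of the universe embeds into it; a finite set with at least two elements is smaller than its
  square.\<close>

lemma closed_under_families_infinite:
  fixes a b :: 'u and i j :: 'i
  assumes "closed_under_families TYPE('i) TYPE('u)" "a \<noteq> b" "i \<noteq> j"
  shows "infinite (UNIV :: 'u set)" and "\<exists>f :: 'i => 'u. inj f"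
proof -
  obtain e :: "('i => 'u) => 'u" where e: "inj e"
    using assms(1) by (auto simp: closed_under_families_def)
  show "\<exists>f :: 'i => 'u. inj f"
  proof (rule exI[of _ "%k. e (%l. if l = k then a else b)"], rule injI)
    fix x y :: 'i assume "e (%l. if l = x then a else b) = e (%l. if l = y then a else b)"
    with e have "(%l. if l = x then a else b) = (%l. if l = y then a else b)" by (simp only: inj_eq)
    from fun_cong[OF this, of x] show "x = y" using assms(2) by (simp split: if_splits)
  qed
  show "infinite (UNIV :: 'u set)"
  proof
    assume fin: "finite (UNIV :: 'u set)"
    define f where "f p = e (%l. if l = i then fst p else snd p)" for p :: "'u \<times> 'u"
    have "inj f"
    proof (rule injI)
      fix p q assume "f p = f q"
      then have *: "(%l. if l = i then fst p else snd p) = (%l. if l = i then fst q else snd q)"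
        unfolding f_def by (rule injD[OF e])
      from fun_cong[OF *, of i] fun_cong[OF *, of j] assms(3) show "p = q"
        by (simp add: prod_eq_iff split: if_splits)
    qed
    then have "card (UNIV :: ('u \<times> 'u) set) \<le> card (UNIV :: 'u set)"
      by (rule card_inj_on_le) (use fin in auto)
    moreover have "card (UNIV :: ('u \<times> 'u) set) = card (UNIV :: 'u set) * card (UNIV :: 'u set)"
      using card_cartesian_product[of "UNIV :: 'u set" "UNIV :: 'u set"] by simp
    moreover have "2 \<le> card (UNIV :: 'u set)"
      using card_mono[OF fin, of "{a, b}"] assms(2) by simp
    ultimately have "2 * card (UNIV :: 'u set) \<le> card (UNIV :: 'u set)"
      by (metis mult_le_mono1 order_trans)
    with \<open>2 \<le> card (UNIV :: 'u set)\<close> show False by linarith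
  qed
qed

text \<open>A representative of each class embeds a tensor product into finite formal sums, and these form a
  set of the same size as the index set if that is infinite.\<close>

lemma tensor_embedding:
  fixes A :: "('a, 'p) ring_scheme" and M :: "('a, 'm, 'q) right_mod_scheme" and N :: "('a, 'i, 's) bimod_scheme"
  assumes "closed_under_families TYPE('i) TYPE('u)" "inj (g :: 'm => 'u)" "right_module A M" "bimodule A N"
  shows "\<exists>\<iota> :: ('m, 'i) tensor => 'u. inj_on \<iota> (carrier (tgroup A M N))"
proof -
  interpret right_module A M by fact
  interpret N: bimodule A N by fact
  interpret tensor_prod A M N ..
  show ?thesis
  \<comment> \<open>A tensor product with a zero factor is a single point and embeds anywhere.
    Otherwise both types have two distinct elements, and the universe is infinite.\<close>
  proof (cases "carrier M \<subseteq> {\<zero>[M]} \<or> carrier N \<subseteq> {\<zero>[N]}")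
    case True
    then show ?thesis
      by (intro exI inj_onI) (metis tensor_trivial)
  next
    case False
    then obtain x y where xy: "x ::: M" "x \<noteq> \<zero>[M]" "y ::: N" "y \<noteq> \<zero>[N]" by auto
    have "g x \<noteq> g \<zero>[M]" using assms(2) xy by (simp add: inj_eq)
    note c = closed_under_families_infinite[OF assms(1) this xy(4)]
    obtain f :: "'i => 'u" where f: "inj f" using c(2) by blast
    have "(UNIV :: 'u set) \<times> (UNIV :: 'u set) \<lesssim> (UNIV :: 'u set)"
      by (rule eqpoll_imp_lepoll) (unfold eqpoll_iff_card_of_ordIso, rule card_of_Times_same_infinite[OF c(1)])
    then obtain k :: "'u \<times> 'u => 'u" where k: "inj k" by (auto simp: lepoll_def)
    define h where "h p = k (g (fst p), f (snd p))" for p :: "'m \<times> 'i"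
    have h: "inj h"
      by (rule injI) (simp add: h_def inj_eq[OF k] inj_eq[OF assms(2)] inj_eq[OF f] prod_eq_iff)
    have "carrier (free_Abelian_group (UNIV :: ('m \<times> 'i) set)) \<approx> carrier (free_Abelian_group (range h))"
      by (intro iso_imp_eqpoll_carrier) (simp add: isomorphic_free_Abelian_groups inj_on_image_eqpoll_self[OF h] eqpoll_sym)
    also have "carrier (free_Abelian_group (range h)) \<lesssim> carrier (free_Abelian_group (UNIV :: 'u set))"
      by (rule subset_imp_lepoll) auto
    also have "... \<approx> (UNIV :: 'u set)"
      by (rule eqpoll_free_Abelian_group_infinite[OF c(1)])
    finally obtain l :: "('m \<times> 'i \<Rightarrow>\<^sub>0 int) => 'u" where l: "inj_on l (carrier (free_Abelian_group UNIV))"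
      by (auto simp: lepoll_def)
    have rep: "(SOME u. u \<in> t) \<in> t" if t: "t ::: (tgroup A M N)" for t
    proof -
      obtain u where "u ::: (free_Abelian_group (carrier M \<times> carrier N))"
        "t = tensor_relations A M N #>\<^bsub>free_Abelian_group (carrier M \<times> carrier N)\<^esub> u"
        using t by (auto simp: tensor_add_group_def tensor_group_def carrier_FactGroup)
      then have "u \<in> t"
        using group.rcos_self[OF group_free_Abelian_group _ normal_imp_subgroup[OF relations_normal]] by simp
      then show ?thesis by (rule someI)
    qed
    have "inj_on (%t. l (SOME u. u \<in> t)) (carrier (tgroup A M N))"
    proof (rule inj_onI)
      fix s t assume st: "s ::: (tgroup A M N)" "t ::: (tgroup A M N)"
        and eq: "l (SOME u. u \<in> s) = l (SOME u. u \<in> t)"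
      have "(SOME u. u \<in> s) = (SOME u. u \<in> t)"
        by (rule inj_onD[OF l eq]) simp_all
      then have "s \<inter> t \<noteq> {}" using rep[OF st(1)] rep[OF st(2)] by auto
      moreover have "s \<in> rcosets\<^bsub>free_Abelian_group (carrier M \<times> carrier N)\<^esub> tensor_relations A M N"
        "t \<in> rcosets\<^bsub>free_Abelian_group (carrier M \<times> carrier N)\<^esub> tensor_relations A M N"
        using st by (simp_all add: tensor_add_group_def tensor_group_def FactGroup_def)
      ultimately show "s = t"
        using group.rcos_disjoint[OF group_free_Abelian_group normal_imp_subgroup[OF relations_normal]]
        by (auto simp: pairwise_def disjnt_def)
    qed
    then show ?thesis by blast
  qed
qed

subsection \<open>The equivalence for a coring with a cointegral\<close>

context coring_comodule
begin

lemma compose_chom: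
  fixes N :: "('a, 'n, 'c, 't) comod_scheme"
  assumes N: "right_comodule A C N" and g: "g \<in> comod_hom A C M N" and f: "f \<in> chom"
  shows "compose (carrier C) g f \<in> coring_comodule.chom A C N"
proof -
  interpret N: right_comodule A C N by fact
  interpret N: coring_comodule A C N ..
  have "f \<in> comod_hom A C (regular_comod C) M" using f by (simp add: chom_def)
  from comod_hom_compose[OF this g C.regular_right_module MC.tensor_prod_axioms N.MC.tensor_prod_axioms] C.cop_closed
  have "(%x. g (f x)) \<in> comod_hom A C (regular_comod C) N" by simp
  then have "compose (carrier C) g f \<in> comod_hom A C (regular_comod C) N"
    by (rule comod_hom_cong[OF _ C.regular_right_module]) (simp add: compose_def)
  then show ?thesis by (simp add: N.chom_def compose_def)
qed

text \<open>Compatibility with the structure maps is additivity of \<open>g\<close>, which passes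
  into the Sweedler sum \<open>F(c\<^sub>1)(c\<^sub>2)\<close>.\<close>

lemma comod_hom_em_map:
  fixes N :: "('a, 'n, 'c, 't) comod_scheme"
  assumes N: "right_comodule A C N" and g: "g \<in> comod_hom A C M N"
  shows "(\<lambda>f\<in>chom. compose (carrier C) g f) \<in> em_hom A C (comod_hom_em A C M) (comod_hom_em A C N)"
proof (rule em_homI)
  interpret N: right_comodule A C N by fact
  interpret N: coring_comodule A C N ..
  interpret S: sub_hom A C M chom by (rule chom_sub_hom)
  note gD = right_homD[OF comod_homD(1)[OF g]]
  note cg = compose_chom[OF N g]
  show gr: "(\<lambda>f\<in>chom. compose (carrier C) g f) \<in> right_hom A (comod_hom_em A C M) (comod_hom_em A C N)"
    unfolding comod_hom_em_eq N.comod_hom_em_eq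
    by (rule right_homI)
       (auto simp: cg cg[unfolded compose_def] S.S_add S.S_ract S.S_rules gD compose_def C.lact_closed cong: restrict_cong)
  fix F assume F: "F ::: (hom_module A C (comod_hom_em A C M))"
  then have FH: "F \<in> right_hom A C (sub_hom_em A C M chom)" by (simp add: comod_hom_em_eq)
  have "monad_mult A C M F \<in> chom"
    by (rule S.S_mult) (use F in "simp add: comod_hom_em_eq")
  moreover have "compose (carrier C) g (monad_mult A C M F) = monad_mult A C N (\<lambda>c\<in>carrier C. (\<lambda>f\<in>chom. compose (carrier C) g f) (F c))"
    using bal.lift_additive[OF S.F_bal[OF FH] gD(1) N.M.abelian_group_axioms C.cop_closed] S.F_rules(1)[OF FH]
    by (auto simp: monad_mult_def compose_def cong: restrict_cong)
  ultimately show "(\<lambda>f\<in>chom. compose (carrier C) g f) (alg (comod_hom_em A C M) F)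
    = alg (comod_hom_em A C N) (\<lambda>c\<in>carrier C. (\<lambda>f\<in>chom. compose (carrier C) g f) (F c))"
    by (simp add: comod_hom_em_eq N.comod_hom_em_eq)
qed

end

theorem cointegral_equivalence:
  fixes A :: "('a, 'p) ring_scheme" and C :: "('a, 'c, 'q) coring_scheme"
  assumes "cointegral A C \<delta>" and closed: "closed_under_families TYPE('c) TYPE('u)"
  shows "is_equivalence (comod_category A C :: (('a, 'u, 'c) comod, 'u => 'u) category)
    (em_category A C) (comod_hom_functor A C)"
proof (rule ff_es_functor.equivalence, intro ff_es_functor.intro is_functor.intro)
  interpret cointegral A C \<delta> by fact
  let ?\<C> = "comod_category A C :: (('a, 'u, 'c) comod, 'u => 'u) category"
  let ?\<D> = "em_category A C :: (('a, 'c => 'u, 'c) em_mod, ('c => 'u) => 'c => 'u) category"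
  let ?F = "comod_hom_functor A C :: (('a, 'u, 'c) comod, 'u => 'u, ('a, 'c => 'u, 'c) em_mod, ('c => 'u) => ('c => 'u)) functr"
  show "is_category ?\<C>" by (rule comod_category) (rule is_coring_axioms)
  show "is_category ?\<D>" by (rule em_category) (rule bimodule_axioms)
  have cc: "cointegral_comodule A C \<delta> M" if "M \<in> Ob ?\<C>" for M
    using that cointegral_axioms by (simp add: comod_category_def cointegral_comodule_def)
  have cm: "coring_comodule A C M" "right_comodule A C M" if "M \<in> Ob ?\<C>" for M
    using that is_coring_axioms by (simp_all add: comod_category_def coring_comodule_def)
  have ArC: "g \<in> Ar ?\<C> M N \<longleftrightarrow> g \<in> comod_hom A C M N \<and> g \<in> extensional (carrier M)" for g M N
    by (simp add: comod_category_def)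
  have ArD: "g \<in> Ar ?\<D> M N \<longleftrightarrow> g \<in> em_hom A C M N \<and> g \<in> extensional (carrier M)" for g M N
    by (simp add: em_category_def)
  have car: "carrier (comod_hom_em A C M) = coring_comodule.chom A C M" if "M \<in> Ob ?\<C>" for M
    using coring_comodule.comod_hom_em_eq[OF cm(1)[OF that]] by simp
  have maps: "f c ::: M" "f \<in> extensional (carrier C)" if "M \<in> Ob ?\<C>" "f \<in> coring_comodule.chom A C M" "c ::: C" for M f c
    using that(2,3) right_homD(2)[of f A C M] by (simp_all add: coring_comodule.chom_iff[OF cm(1)[OF that(1)]])
  have FarF: "Far ?F M N g = (\<lambda>f\<in>coring_comodule.chom A C M. compose (carrier C) g f)" if "M \<in> Ob ?\<C>" for M N g
    by (simp add: comod_hom_functor_def car[OF that])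
  have Fob: "Fob ?F M = comod_hom_em A C M" for M by (simp add: comod_hom_functor_def)
  show "is_functor_axioms ?\<C> ?\<D> ?F"
  proof (rule is_functor_axioms.intro)
    fix X assume X: "X \<in> Ob ?\<C>"
    show "Fob ?F X \<in> Ob ?\<D>"
      using coring_comodule.comod_hom_em_module[OF cm(1)[OF X]] by (simp add: Fob em_category_def)
    show "Far ?F X X (Idn ?\<C> X) = Idn ?\<D> (Fob ?F X)"
      unfolding FarF[OF X] Fob
    proof -
      have "(\<lambda>f\<in>coring_comodule.chom A C X. compose (carrier C) (\<lambda>x\<in>carrier X. x) f) = (\<lambda>f\<in>coring_comodule.chom A C X. f)"
      proof (rule restrict_ext)
        fix f assume f: "f \<in> coring_comodule.chom A C X"
        then have "f \<in> extensional (carrier C)" by (simp add: coring_comodule.chom_iff[OF cm(1)[OF X]])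
        then show "compose (carrier C) (\<lambda>x\<in>carrier X. x) f = f"
          by (intro extensionalityI[of _ "carrier C"]) (use maps(1)[OF X f] in "simp_all add: compose_def")
      qed
      then show "(\<lambda>f\<in>coring_comodule.chom A C X. compose (carrier C) (Idn ?\<C> X) f) = Idn ?\<D> (comod_hom_em A C X)"
        by (simp add: comod_category_def em_category_def car[OF X])
    qed
  next
    fix X Y g assume o: "X \<in> Ob ?\<C>" "Y \<in> Ob ?\<C>" and g: "g \<in> Ar ?\<C> X Y"
    show "Far ?F X Y g \<in> Ar ?\<D> (Fob ?F X) (Fob ?F Y)"
      using coring_comodule.comod_hom_em_map[OF cm(1)[OF o(1)] cm(2)[OF o(2)]] g
      by (simp add: Fob FarF[OF o(1)] ArC ArD car[OF o(1)])
  next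
    fix X Y Z f g assume o: "X \<in> Ob ?\<C>" "Y \<in> Ob ?\<C>" "Z \<in> Ob ?\<C>" and fg: "f \<in> Ar ?\<C> X Y" "g \<in> Ar ?\<C> Y Z"
    have "compose (carrier C) f k \<in> coring_comodule.chom A C Y" if "k \<in> coring_comodule.chom A C X" for k
      by (rule coring_comodule.compose_chom[OF cm(1)[OF o(1)] cm(2)[OF o(2)] _ that]) (use fg in "simp add: ArC")
    then show "Far ?F X Z (Cmp ?\<C> X Y Z g f) = Cmp ?\<D> (Fob ?F X) (Fob ?F Y) (Fob ?F Z) (Far ?F Y Z g) (Far ?F X Y f)"
      unfolding FarF[OF o(1)] FarF[OF o(2)] Fob em_category_def comod_category_def category.simps car[OF o(1)]
      using maps(1)[OF o(1)]
      by (auto simp: compose_def cong: restrict_cong)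
  qed
  show "ff_es_functor_axioms ?\<C> ?\<D> ?F"
  proof (rule ff_es_functor_axioms.intro)
    fix X Y f g assume o: "X \<in> Ob ?\<C>" "Y \<in> Ob ?\<C>" and fg: "f \<in> Ar ?\<C> X Y" "g \<in> Ar ?\<C> X Y"
      and eq: "Far ?F X Y f = Far ?F X Y g"
    interpret X: cointegral_comodule A C \<delta> X by (rule cc[OF o(1)])
    interpret Y: cointegral_comodule A C \<delta> Y by (rule cc[OF o(2)])
    have k: "f (k c) = g (k c)" if "k \<in> X.M.chom" "c ::: C" for k c
    proof -
      have "compose (carrier C) f k = compose (carrier C) g k"
        using fun_cong[OF eq, of k] that(1) by (simp add: FarF[OF o(1)])
      from fun_cong[OF this, of c] show ?thesis using that(2) by (simp add: compose_def)
    qed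
    show "f = g"
    proof (rule extensionalityI[of _ "carrier X"])
      show "f x = g x" if "x ::: X" for x
        by (rule X.comod_hom_eqI[OF _ _ Y.M.M.abelian_group_axioms k that]) (use fg in "auto simp: ArC dest: comod_homD(1)")
    qed (use fg in "simp_all add: ArC")
  next
    fix X Y h assume o: "X \<in> Ob ?\<C>" "Y \<in> Ob ?\<C>" and h: "h \<in> Ar ?\<D> (Fob ?F X) (Fob ?F Y)"
    interpret X: cointegral_comodule A C \<delta> X by (rule cc[OF o(1)])
    from h have hh: "h \<in> em_hom A C (comod_hom_em A C X) (comod_hom_em A C Y)" "h \<in> extensional X.M.chom"
      by (simp_all add: ArD Fob car[OF o(1)])
    from X.chom_extension[OF cm(2)[OF o(2)] hh(1)]
    obtain g where g: "g \<in> comod_hom A C X Y" "\<And>f. f \<in> X.M.chom ==> h f = compose (carrier C) g f" by blast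
    show "\<exists>f\<in>Ar ?\<C> X Y. Far ?F X Y f = h"
    proof
      show "restrict g (carrier X) \<in> Ar ?\<C> X Y"
        using comod_hom_cong[OF g(1) X.M.right_module_axioms, of "restrict g (carrier X)"] by (simp add: ArC)
      show "Far ?F X Y (restrict g (carrier X)) = h"
        unfolding FarF[OF o(1)]
        by (rule extensionalityI[OF restrict_extensional hh(2)])
           (use maps(1)[OF o(1)] in "simp add: g(2) compose_def cong: restrict_cong")
    qed
  next
    fix Z assume Z: "Z \<in> Ob ?\<D>"
    then have em: "em_module A C Z" by (simp add: em_category_def)
    interpret Z: em_module A C Z by (rule em)
    interpret Z: cointegral_em A C \<delta> Z ..
    \<comment> \<open>\<open>Z\<close> is a structure on functions from \<open>'c\<close> to
      \<open>'u\<close>. The embedding of this function type into \<open>'u\<close> is what allows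
      the tensor product of \<open>Z\<close> with the coring, and with it the comodule sought, to be
      placed in \<open>'u\<close>.\<close>
    obtain e :: "('c => 'u) => 'u" where e: "inj e"
      using closed by (auto simp: closed_under_families_def)
    from tensor_embedding[OF closed e Z.right_module_axioms bimodule_axioms]
    obtain \<iota> :: "('c => 'u, 'c) tensor => 'u" where "inj_on \<iota> (carrier (tgroup A Z C))" by blast
    from Z.comod_hom_em_ess_surj[OF this]
    obtain Q :: "('a, 'u, 'c) comod" and \<theta> where Q: "right_comodule A C Q"
      and \<theta>: "\<theta> \<in> em_hom A C Z (comod_hom_em A C Q)" "bij_betw \<theta> (carrier Z) (carrier (comod_hom_em A C Q))" by blast
    have QC: "Q \<in> Ob ?\<C>" using Q by (simp add: comod_category_def)
    have FQ: "em_module A C (comod_hom_em A C Q)" by (rule coring_comodule.comod_hom_em_module[OF cm(1)[OF QC]])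
    define \<kappa> where "\<kappa> = restrict (inv_into (carrier Z) \<theta>) (carrier (comod_hom_em A C Q))"
    have k1: "\<kappa> y ::: Z" "\<theta> (\<kappa> y) = y" if "y ::: (comod_hom_em A C Q)" for y
      using that \<theta>(2) by (auto simp: \<kappa>_def bij_betw_def inv_into_into f_inv_into_f)
    have k2: "\<kappa> (\<theta> x) = x" if "x ::: Z" for x
      using that \<theta>(2) bij_betwE[OF \<theta>(2)] by (auto simp: \<kappa>_def bij_betw_def)
    have kem: "\<kappa> \<in> em_hom A C (comod_hom_em A C Q) Z"
    proof (rule em_hom_inverse[OF \<theta>(1) em FQ bimodule_axioms])
    qed (use k1 k2 in simp_all)
    have th: "restrict \<theta> (carrier Z) \<in> em_hom A C Z (comod_hom_em A C Q)"
    proof (rule em_hom_inverse[OF kem FQ em bimodule_axioms])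
      fix x assume x: "x ::: Z"
      show "restrict \<theta> (carrier Z) x ::: (comod_hom_em A C Q)"
        using bij_betwE[OF \<theta>(2)] x by simp
      show "\<kappa> (restrict \<theta> (carrier Z) x) = x" using k2 x by simp
    next
      fix y assume "y ::: (comod_hom_em A C Q)"
      then show "restrict \<theta> (carrier Z) (\<kappa> y) = y" using k1 by simp
    qed
    have "\<kappa> \<in> isos ?\<D> (Fob ?F Q) Z"
      unfolding em_category_def Fob
      by (rule concrete_isos[where U=carrier and g="restrict \<theta> (carrier Z)"]) (use kem th k1 k2 in "simp_all add: \<kappa>_def")
    then show "\<exists>X\<in>Ob ?\<C>. isos ?\<D> (Fob ?F X) Z \<noteq> {}" using QC by blast
  qed
qed

section \<open>Bialgebras\<close>

lemma trilin_compose3: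
  assumes "trilin A M N K P \<phi>" "f \<in> right_hom A M' M" "right_module A M'" "g \<in> right_hom A N' N" "g \<in> left_hom A N' N" "bimodule A N'"
    "h \<in> left_hom A K' K" "bimodule A K'"
  shows "trilin A M' N' K' P (%x y z. \<phi> (f x) (g y) (h z))"
proof -
  interpret trilin A M N K P \<phi> by fact
  show ?thesis
    by (rule trilinI)
       (simp_all add: assms P.abelian_group_axioms tri_closed tri_add_1 tri_add_2 tri_add_3
         tri_balanced_1 tri_balanced_2 right_homD[OF assms(2)] right_homD(2,3)[OF assms(4)] left_homD(4)[OF assms(5)]
         right_homD(4)[OF assms(4)] left_homD[OF assms(7)])
qed

lemma under_coalgebra_simps [simp]:
  fixes H :: "('r, 'h, 'z) bialgebra_scheme"
  shows "carrier (under_coalgebra H) = carrier H" "add (under_coalgebra H) = add H"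
    "ring.zero (under_coalgebra H) = ring.zero H" "x \<triangleleft>[under_coalgebra H] r = r \<odot>[H] x" "r \<triangleright>[under_coalgebra H] x = r \<odot>[H] x"
    "cop (under_coalgebra H) = comult H" "cou (under_coalgebra H) = counit H"
  by (simp_all add: under_coalgebra_def)

lemma restrict_scalars_simps [simp]:
  fixes M :: "('h, 'm, 's) right_mod_scheme"
  shows "carrier (restrict_scalars H M) = carrier M" "add (restrict_scalars H M) = add M"
    "ring.zero (restrict_scalars H M) = ring.zero M" "x \<triangleleft>[restrict_scalars H M] r = x \<triangleleft>[M] (r \<odot>[H] \<one>[H])"
  by (simp_all add: restrict_scalars_def)

lemma regular_bimod_simps [simp]:
  fixes A :: "('a, 'p) ring_scheme"
  shows "carrier (regular_bimod A) = carrier A" "add (regular_bimod A) = add A"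
    "ring.zero (regular_bimod A) = ring.zero A" "x \<triangleleft>[regular_bimod A] y = x \<otimes>[A] y" "x \<triangleright>[regular_bimod A] y = x \<otimes>[A] y"
  by (simp_all add: regular_bimod_def)

lemma tlift_to_under [simp]:
  "tlift A M N (under_coalgebra H) \<phi> t = tlift A M N H \<phi> t"
  by (simp add: tensor_lift_def hom_def)

context is_bialgebra
begin

abbreviation "HR \<equiv> under_coalgebra H"
abbreviation "te \<equiv> telem R (under_coalgebra H) (under_coalgebra H)"
abbreviation "HH \<equiv> tgroup R (under_coalgebra H) (under_coalgebra H)"
abbreviation "lift P \<phi> \<equiv> tlift R (under_coalgebra H) (under_coalgebra H) P \<phi>"
abbreviation "bil P \<phi> \<equiv> bal R (under_coalgebra H) (under_coalgebra H) P \<phi>"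

sublocale co: is_coring R HR by (rule coalgebra)

lemma H_abelian: "abelian_group H" by (rule H.is_abelian_group)

lemma H_zero: "\<zero>[H] ::: H"
  using H_abelian by (simp add: abelian_group_def abelian_monoid.zero_closed)

lemma smult_one_mult: "[|r ::: R; x ::: H|] ==> (r \<odot>[H] \<one>[H]) \<otimes>[H] x = r \<odot>[H] x"
  and mult_smult_one: "[|r ::: R; x ::: H|] ==> x \<otimes>[H] (r \<odot>[H] \<one>[H]) = r \<odot>[H] x"
  by (simp_all add: smult_mult_left smult_mult_right)

lemma comult_closed: "b ::: H ==> comult H b ::: HH"
  using co.cop_closed[of b] by simp

lemma counit_closed: "b ::: H ==> counit H b ::: R"
  using co.cou_closed[of b] by simp

lemma lift_closed: "[|bil P \<phi>; b ::: H|] ==> lift P \<phi> (comult H b) ::: P"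
  using co.lift_cop_closed[of P \<phi> b] by simp

lemma lift_add: "[|bil P \<phi>; a ::: H; b ::: H|]
    ==> lift P \<phi> (comult H (a \<oplus>[H] b)) = lift P \<phi> (comult H a) \<oplus>[P] lift P \<phi> (comult H b)"
  using co.lift_cop_add[of P \<phi> a b] by simp

lemma lift_smult: "[|bil P \<phi>; b ::: H; r ::: R|]
    ==> lift P \<phi> (comult H (r \<odot>[H] b)) = lift P (%x y. \<phi> (r \<odot>[H] x) y) (comult H b)"
  using co.lift_cop_lact[of P \<phi> b r] by simp

lemma coassoc: "[|trilin R HR HR HR P \<phi>; b ::: H|]
    ==> lift P (%y c. lift P (%u v. \<phi> u v c) (comult H y)) (comult H b) = lift P (%y c. lift P (\<phi> y) (comult H c)) (comult H b)"
  using co.cop_coassoc[of P \<phi> b] by simp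

lemma counit_left: "[|h \<in> add_hom H P; abelian_group P; b ::: H|]
    ==> lift P (%x y. h (counit H x \<odot>[H] y)) (comult H b) = h b"
  using co.cop_counit_left[of h P b] by (simp add: hom_def)

lemma counit_right: "[|h \<in> add_hom H P; abelian_group P; b ::: H|]
    ==> lift P (%x y. h (counit H y \<odot>[H] x)) (comult H b) = h b"
  using co.cop_counit_right[of h P b] by (simp add: hom_def)

lemma counit_rules:
  "[|a ::: H; b ::: H|] ==> counit H (a \<oplus>[H] b) = counit H a \<oplus>[R] counit H b"
  "[|a ::: H; r ::: R|] ==> counit H (r \<odot>[H] a) = r \<otimes>[R] counit H a"
  using co.cou_add[of a b] co.cou_lact[of a r] by simp_all

lemma bilI:
  assumes "abelian_group P"
    and "\<And>x y. [|x ::: H; y ::: H|] ==> \<phi> x y ::: P"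
    and "\<And>x x' y. [|x ::: H; x' ::: H; y ::: H|] ==> \<phi> (x \<oplus>[H] x') y = \<phi> x y \<oplus>[P] \<phi> x' y"
    and "\<And>x y y'. [|x ::: H; y ::: H; y' ::: H|] ==> \<phi> x (y \<oplus>[H] y') = \<phi> x y \<oplus>[P] \<phi> x y'"
    and "\<And>x a y. [|x ::: H; a ::: R; y ::: H|] ==> \<phi> (a \<odot>[H] x) y = \<phi> x (a \<odot>[H] y)"
  shows "bil P \<phi>"
  by (rule balI) (simp_all add: assms co.right_module_axioms co.bimodule_axioms)

lemma bilD:
  assumes "bil P \<phi>"
  shows "abelian_group P"
    and "[|x ::: H; y ::: H|] ==> \<phi> x y ::: P"
    and "[|x ::: H; x' ::: H; y ::: H|] ==> \<phi> (x \<oplus>[H] x') y = \<phi> x y \<oplus>[P] \<phi> x' y"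
    and "[|x ::: H; y ::: H; y' ::: H|] ==> \<phi> x (y \<oplus>[H] y') = \<phi> x y \<oplus>[P] \<phi> x y'"
    and "[|x ::: H; a ::: R; y ::: H|] ==> \<phi> (a \<odot>[H] x) y = \<phi> x (a \<odot>[H] y)"
proof -
  interpret bal R HR HR P \<phi> by fact
  show "abelian_group P" by (rule P.abelian_group_axioms)
  show "[|x ::: H; y ::: H|] ==> \<phi> x y ::: P"
    and "[|x ::: H; x' ::: H; y ::: H|] ==> \<phi> (x \<oplus>[H] x') y = \<phi> x y \<oplus>[P] \<phi> x' y"
    and "[|x ::: H; y ::: H; y' ::: H|] ==> \<phi> x (y \<oplus>[H] y') = \<phi> x y \<oplus>[P] \<phi> x y'"
    and "[|x ::: H; a ::: R; y ::: H|] ==> \<phi> (a \<odot>[H] x) y = \<phi> x (a \<odot>[H] y)"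
    using bal_closed[of x y] bal_add_left[of x x' y] bal_add_right[of x y y'] bal_balanced[of x a y] by simp_all
qed

lemma triI:
  assumes "abelian_group P"
    and "\<And>x y z. [|x ::: H; y ::: H; z ::: H|] ==> \<phi> x y z ::: P"
    and "\<And>x x' y z. [|x ::: H; x' ::: H; y ::: H; z ::: H|]
      ==> \<phi> (x \<oplus>[H] x') y z = \<phi> x y z \<oplus>[P] \<phi> x' y z"
    and "\<And>x y y' z. [|x ::: H; y ::: H; y' ::: H; z ::: H|]
      ==> \<phi> x (y \<oplus>[H] y') z = \<phi> x y z \<oplus>[P] \<phi> x y' z"
    and "\<And>x y z z'. [|x ::: H; y ::: H; z ::: H; z' ::: H|]
      ==> \<phi> x y (z \<oplus>[H] z') = \<phi> x y z \<oplus>[P] \<phi> x y z'"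
    and "\<And>x a y z. [|x ::: H; a ::: R; y ::: H; z ::: H|] ==> \<phi> (a \<odot>[H] x) y z = \<phi> x (a \<odot>[H] y) z"
    and "\<And>x y a z. [|x ::: H; y ::: H; a ::: R; z ::: H|] ==> \<phi> x (a \<odot>[H] y) z = \<phi> x y (a \<odot>[H] z)"
  shows "trilin R HR HR HR P \<phi>"
  by (rule trilinI) (simp_all add: assms co.right_module_axioms co.bimodule_axioms)

lemma lift_additive: "[|bil P \<phi>; h \<in> add_hom P P'; abelian_group P'; b ::: H|]
    ==> h (lift P \<phi> (comult H b)) = lift P' (%x y. h (\<phi> x y)) (comult H b)"
  by (rule bal.lift_additive) (simp_all add: comult_closed)

lemma te_closed: "[|a ::: H; b ::: H|] ==> te a b ::: HH"
  and te_add_left: "[|a ::: H; a' ::: H; b ::: H|] ==> te (a \<oplus>[H] a') b = te a b \<oplus>[HH] te a' b"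
  and te_add_right: "[|a ::: H; b ::: H; b' ::: H|] ==> te a (b \<oplus>[H] b') = te a b \<oplus>[HH] te a b'"
  and te_balanced: "[|a ::: H; r ::: R; b ::: H|] ==> te (r \<odot>[H] a) b = te a (r \<odot>[H] b)"
  using co.CC.telem_closed[of a b] co.CC.telem_add_left[of a a' b] co.CC.telem_add_right[of a b b']
    co.CC.telem_balanced[of a r b] by simp_all

lemmas te_rules = te_closed te_add_left te_add_right te_balanced

lemma HH_abelian: "abelian_group HH" by (rule co.CC.tensor_abelian_group)

end

subsection \<open>The diagonal action on \<open>M \<otimes>\<^sub>R H\<close>\<close>

locale bialgebra_module = is_bialgebra R H + M: right_module H M
  for R :: "('r, 'p) ring_scheme" (structure) and H :: "('r, 'h, 'z) bialgebra_scheme"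
    and M :: "('h, 'm, 's) right_mod_scheme"
begin

abbreviation "MR \<equiv> restrict_scalars H M"
abbreviation "tm \<equiv> telem R (restrict_scalars H M) (under_coalgebra H)"
abbreviation "MH \<equiv> tgroup R (restrict_scalars H M) (under_coalgebra H)"
abbreviation "act t u \<equiv> tensor_act R H M t u"

lemma MR_module: "right_module R MR"
proof (rule right_moduleI)
  show "abelian_group MR" by (rule abelian_group_transfer[OF M.M.abelian_group_axioms]) simp_all
  show "x \<triangleleft>[MR] (a \<otimes>[R] b) = (x \<triangleleft>[MR] a) \<triangleleft>[MR] b" if "x ::: MR" "a ::: R" "b ::: R" for x a b
    using that M.ract_assoc[of x "a \<odot>[H] \<one>[H]" "b \<odot>[H] \<one>[H]"] by (simp add: mult_smult_one smult_assoc1[symmetric] R.m_comm)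
qed (simp_all add: R.ring_axioms M.ract_closed M.ract_add_left M.ract_add_right M.ract_one smult_l_distr)

sublocale MR: right_module R MR by (rule MR_module)

sublocale T: tensor_prod R MR HR ..

lemma tm_closed: "[|m ::: M; b ::: H|] ==> tm m b ::: MH"
  and tm_add_left: "[|m ::: M; m' ::: M; b ::: H|] ==> tm (m \<oplus>[M] m') b = tm m b \<oplus>[MH] tm m' b"
  and tm_add_right: "[|m ::: M; b ::: H; b' ::: H|] ==> tm m (b \<oplus>[H] b') = tm m b \<oplus>[MH] tm m b'"
  and tm_balanced: "[|m ::: M; r ::: R; b ::: H|] ==> tm (m \<triangleleft>[M] (r \<odot>[H] \<one>[H])) b = tm m (r \<odot>[H] b)"
  using T.telem_closed[of m b] T.telem_add_left[of m m' b] T.telem_add_right[of m b b']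
    T.telem_balanced[of m r b] by simp_all

lemmas tm_rules = tm_closed tm_add_left tm_add_right tm_balanced

text \<open>Scalars are central in \<open>H\<close>: r b = b (r 1). The companion below uses the
  other order, r b = (r 1) b.\<close>

lemma ract_smult: "[|m ::: M; r ::: R; b ::: H|] ==> m \<triangleleft>[M] (r \<odot>[H] b) = (m \<triangleleft>[M] b) \<triangleleft>[M] (r \<odot>[H] \<one>[H])"
  using M.ract_assoc[of m b "r \<odot>[H] \<one>[H]"] by (simp add: mult_smult_one)

lemma ract_smult_one: "[|m ::: M; r ::: R; b ::: H|] ==> (m \<triangleleft>[M] (r \<odot>[H] \<one>[H])) \<triangleleft>[M] b = m \<triangleleft>[M] (r \<odot>[H] b)"
  using M.ract_assoc[of m "r \<odot>[H] \<one>[H]" b] by (simp add: smult_one_mult)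

lemma tm_ract_smult: "[|m ::: M; r ::: R; b ::: H; k ::: H|]
    ==> tm (m \<triangleleft>[M] (r \<odot>[H] b)) k = tm (m \<triangleleft>[M] b) (r \<odot>[H] k)"
  by (simp only: ract_smult[of m r b] tm_balanced M.ract_closed)

lemma balMI:
  assumes "abelian_group P"
    and "\<And>x y. [|x ::: M; y ::: H|] ==> \<phi> x y ::: P"
    and "\<And>x x' y. [|x ::: M; x' ::: M; y ::: H|] ==> \<phi> (x \<oplus>[M] x') y = \<phi> x y \<oplus>[P] \<phi> x' y"
    and "\<And>x y y'. [|x ::: M; y ::: H; y' ::: H|] ==> \<phi> x (y \<oplus>[H] y') = \<phi> x y \<oplus>[P] \<phi> x y'"
    and "\<And>x a y. [|x ::: M; a ::: R; y ::: H|] ==> \<phi> (x \<triangleleft>[M] (a \<odot>[H] \<one>[H])) y = \<phi> x (a \<odot>[H] y)"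
  shows "bal R MR HR P \<phi>"
  by (rule balI) (simp_all add: assms MR_module co.bimodule_axioms)

lemma act_inner: "[|m ::: M; h ::: H|] ==> bil MH (%b b'. tm (m \<triangleleft>[M] b) (h \<otimes>[H] b'))"
  by (rule bilI)
     (simp_all add: T.tensor_abelian_group tm_rules M.ract_closed M.ract_add_right H.r_distr tm_ract_smult smult_mult_right)

lemma act_outer: "[|b ::: H; b' ::: H|] ==> bal R MR HR MH (%m h. tm (m \<triangleleft>[M] b) (h \<otimes>[H] b'))"
  by (rule balMI)
     (simp_all add: T.tensor_abelian_group tm_rules M.ract_closed M.ract_add_left H.l_distr ract_smult_one tm_ract_smult smult_mult_left)

lemma act_bal:
  assumes "u ::: HH"
  shows "bal R MR HR MH (%m h. lift MH (%b b'. tm (m \<triangleleft>[M] b) (h \<otimes>[H] b')) u)"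
  using bal.bal_lift_param[OF act_inner[OF M.M.zero_closed H_zero], of R MR HR MH "%b b' m h. tm (m \<triangleleft>[M] b) (h \<otimes>[H] b')" u]
    act_outer act_inner assms by simp

lemma act_def': "act t u = tlift R MR HR MH (%m h. lift MH (%b b'. tm (m \<triangleleft>[M] b) (h \<otimes>[H] b')) u) t"
  by (simp add: tensor_act_def Let_def)

lemma act_closed: "[|t ::: MH; u ::: HH|] ==> act t u ::: MH"
  unfolding act_def' by (rule bal.lift_closed[OF act_bal])

lemma act_add_left: "[|s ::: MH; t ::: MH; u ::: HH|] ==> act (s \<oplus>[MH] t) u = act s u \<oplus>[MH] act t u"
  unfolding act_def' by (rule bal.lift_add[OF act_bal])

lemma act_elem: "[|m ::: M; h ::: H; u ::: HH|]
    ==> act (tm m h) u = lift MH (%b b'. tm (m \<triangleleft>[M] b) (h \<otimes>[H] b')) u"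
  unfolding act_def' by (subst bal.lift_elem[OF act_bal]) simp_all

lemma act_elem_elem: "[|m ::: M; h ::: H; b ::: H; b' ::: H|]
    ==> act (tm m h) (te b b') = tm (m \<triangleleft>[M] b) (h \<otimes>[H] b')"
  by (simp add: act_elem te_closed bal.lift_elem[OF act_inner])

lemma act_hom_left: "u ::: HH ==> (%t. act t u) \<in> add_hom MH MH"
  by (rule add_homI) (simp_all add: act_closed act_add_left)

lemma act_add_right:
  assumes "t ::: MH" "u ::: HH" "v ::: HH"
  shows "act t (u \<oplus>[HH] v) = act t u \<oplus>[MH] act t v"
proof -
  interpret MH: abelian_group MH by (rule T.tensor_abelian_group)
  interpret HH: abelian_group HH by (rule HH_abelian)
  show ?thesis
    using assms(1)
    by (induction rule: T.tensor_induct)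
       (use assms(2,3) in "simp_all add: act_elem bal.lift_add[OF act_inner] act_add_left act_closed MH.a_ac")
qed

lemma lift_act_elem:
  assumes "bal R MR HR P \<psi>" "m ::: M" "h ::: H" "u ::: HH"
  shows "tlift R MR HR P \<psi> (act (tm m h) u) = lift P (%b b'. \<psi> (m \<triangleleft>[M] b) (h \<otimes>[H] b')) u"
proof -
  interpret bal R MR HR P \<psi> by fact
  show ?thesis
    using assms bal.lift_additive[OF act_inner lift_hom P.abelian_group_axioms, of m h u]
    by (simp add: act_elem lift_elem M.ract_closed)
qed

end

lemma regular_right_module: "ring A ==> right_module A (regular_bimod A)"
proof -
  assume "ring A"
  then interpret ring A .
  show ?thesis
    by (rule right_moduleI) (simp_all add: ring_axioms abelian_group_transfer[OF abelian_group_axioms] l_distr r_distr m_assoc)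
qed

section \<open>The regular module and multiplicativity of the coproduct\<close>

context is_bialgebra
begin

sublocale self: bialgebra_module R H "regular_bimod H"
  by (intro bialgebra_module.intro is_bialgebra_axioms regular_right_module H.ring_axioms)

text \<open>Since h (r 1) = r h, restricting the regular module gives back the scalar action of
  \<open>H\<close>. So the diagonal action for the regular module takes place on the tensor square
  that carries the coproduct.\<close>

lemma tensor_restrict_regular [simp]:
  "telem R (restrict_scalars H (regular_bimod H)) HR = te"
  "tgroup R (restrict_scalars H (regular_bimod H)) HR = HH"
  "tlift R (restrict_scalars H (regular_bimod H)) HR P \<phi> t = lift P \<phi> t"
proof -
  have r: "tensor_relations R (restrict_scalars H (regular_bimod H)) HR = tensor_relations R HR HR"
    by (rule tensor_relations_cong) (simp_all add: mult_smult_one)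
  show "telem R (restrict_scalars H (regular_bimod H)) HR = te"
    "tgroup R (restrict_scalars H (regular_bimod H)) HR = HH"
    "tlift R (restrict_scalars H (regular_bimod H)) HR P \<phi> t = lift P \<phi> t"
    using telem_cong[OF _ _ r] tensor_group_cong(2)[OF _ _ r] tlift_module_cong[OF _ _ r] by simp_all
qed

abbreviation "tact t u \<equiv> tensor_act R H (regular_bimod H) t u"

lemmas tact_rules = self.act_closed[simplified] self.act_add_left[simplified] self.act_add_right[simplified]
  self.act_elem_elem[simplified]

lemma bil_self: "bil P \<psi> ==> bal R (restrict_scalars H (regular_bimod H)) HR P \<psi>"
  using bilD[of P \<psi>] by (intro self.balMI) (simp_all add: mult_smult_one)

lemma lift_tact_elem:
  assumes "bil P \<psi>" "a ::: H" "b ::: H" "u ::: HH"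
  shows "lift P \<psi> (tact (te a b) u) = lift P (%x y. \<psi> (a \<otimes>[H] x) (b \<otimes>[H] y)) u"
  using self.lift_act_elem[OF bil_self[OF assms(1)]] assms(2-4) by simp

lemma bil_mult: "bil P \<psi> ==> a ::: H ==> b ::: H ==> bil P (%x y. \<psi> (a \<otimes>[H] x) (b \<otimes>[H] y))"
  by (rule bilI) (simp_all add: bilD H.r_distr smult_mult_right)

lemma bil_mult': "bil P \<psi> ==> a ::: H ==> b ::: H ==> bil P (%x y. \<psi> (x \<otimes>[H] a) (y \<otimes>[H] b))"
  by (rule bilI) (simp_all add: bilD H.l_distr smult_mult_left)

lemma bil_mult_lift:
  assumes "bil P \<psi>" "u ::: HH"
  shows "bil P (%a b. lift P (%x y. \<psi> (a \<otimes>[H] x) (b \<otimes>[H] y)) u)"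
  using bal.bal_lift_param[OF bil_mult[OF assms(1) H_zero H_zero], of R HR HR P "%x y a b. \<psi> (a \<otimes>[H] x) (b \<otimes>[H] y)" u]
    bil_mult[OF assms(1)] bil_mult'[OF assms(1)] assms(2) by simp

lemma lift_tact:
  assumes "bil P \<psi>" "t ::: HH" "u ::: HH"
  shows "lift P \<psi> (tact t u) = lift P (%a b. lift P (%x y. \<psi> (a \<otimes>[H] x) (b \<otimes>[H] y)) u) t"
proof -
  interpret P: abelian_group P using bilD(1)[OF assms(1)] .
  show ?thesis
    using assms(2)
    by (induction rule: co.CC.tensor_induct)
       (use assms in "simp_all add: lift_tact_elem bal.lift_elem[OF bil_mult_lift] bal.lift_add[OF bil_mult_lift] tact_rules
          bal.lift_add[OF assms(1)]")
qed

lemma lift_comult_mult: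
  assumes "bil P \<psi>" "a ::: H" "b ::: H"
  shows "lift P \<psi> (comult H (a \<otimes>[H] b))
    = lift P (%a1 a2. lift P (%b1 b2. \<psi> (a1 \<otimes>[H] b1) (a2 \<otimes>[H] b2)) (comult H b)) (comult H a)"
  by (simp add: assms comult_mult lift_tact comult_closed)

text \<open>The same rule with the sum over the coproduct of \<open>a\<close> inside, for the
  situations in which that sum is to be evaluated first.\<close>

lemma lift_comult_mult':
  assumes "bil P \<psi>" "a ::: H" "b ::: H"
  shows "lift P \<psi> (comult H (a \<otimes>[H] b))
    = lift P (%b1 b2. lift P (%a1 a2. \<psi> (a1 \<otimes>[H] b1) (a2 \<otimes>[H] b2)) (comult H a)) (comult H b)"
  unfolding lift_comult_mult[OF assms]
  by (rule lift_swap) (simp_all add: co.CC.tensor_prod_axioms comult_closed assms bil_mult bil_mult')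

lemma lift_comult_one: "bil P \<psi> ==> lift P \<psi> (comult H \<one>[H]) = \<psi> \<one>[H] \<one>[H]"
  by (simp add: comult_one bal.lift_elem)

end

context bialgebra_module
begin

lemma act_one: "t ::: MH ==> act t (comult H \<one>[H]) = t"
  by (induction rule: T.tensor_induct)
     (simp_all add: comult_one act_elem_elem M.ract_one act_add_left te_closed)

text \<open>The diagonal action is associative because the coproduct is multiplicative. For the
  regular module this is the right module law of the coring.\<close>

lemma act_mult:
  assumes "t ::: MH" "b ::: H" "c ::: H"
  shows "act t (comult H (b \<otimes>[H] c)) = act (act t (comult H b)) (comult H c)"
  using assms(1)
proof (induction rule: T.tensor_induct)
  case (elem m h)
  have "act (act (tm m h) (comult H b)) (comult H c) = lift MH (%x y. act (tm (m \<triangleleft>[M] x) (h \<otimes>[H] y)) (comult H c)) (comult H b)"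
    using elem assms lift_additive[OF act_inner act_hom_left T.tensor_abelian_group]
    by (simp add: act_elem comult_closed)
  also have "... = act (tm m h) (comult H (b \<otimes>[H] c))"
    using elem assms by (simp add: act_elem comult_closed M.ract_closed lift_comult_mult[OF act_inner] M.ract_assoc H.m_assoc)
  finally show ?case by simp
qed (use assms in "simp add: act_add_left comult_closed act_closed")

end

section \<open>The coring \<open>H \<otimes>\<^sub>R\<^sup>r H\<close>\<close>

context is_bialgebra
begin

abbreviation "C \<equiv> hopf_coring R H"

lemma smult_lcomm: "[|r ::: R; s ::: R; x ::: H|] ==> r \<odot>[H] (s \<odot>[H] x) = s \<odot>[H] (r \<odot>[H] x)"
  by (simp add: smult_assoc1[symmetric] R.m_comm)

lemma hopf_bimod_simps:
  "carrier (hopf_bimod R H) = carrier HH" "add (hopf_bimod R H) = add HH" "ring.zero (hopf_bimod R H) = ring.zero HH"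
  "t \<triangleleft>[hopf_bimod R H] c = tact t (comult H c)"
  "d \<triangleright>[hopf_bimod R H] t = lift HH (%x y. te (d \<otimes>[H] x) y) t"
  by (simp_all add: hopf_bimod_def Let_def ring.extend_def tensor_add_group_def tensor_map_def)

lemma hopf_coring_simps:
  "carrier C = carrier HH" "add C = add HH" "ring.zero C = ring.zero HH"
  "ract C = ract (hopf_bimod R H)" "lact C = lact (hopf_bimod R H)"
  "cou C = lift H (%a b. counit H b \<odot>[H] a)"
  by (simp_all add: hopf_coring_def Let_def bimod.extend_def hopf_bimod_def ring.extend_def tensor_add_group_def)

lemma C_induct [consumes 1, case_names elem add]:
  assumes "t ::: C" "\<And>x y. [|x ::: H; y ::: H|] ==> Q (te x y)"
    and "\<And>s t. [|s ::: C; t ::: C; Q s; Q t|] ==> Q (s \<oplus>[C] t)"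
  shows "Q t"
  using assms(1) unfolding hopf_coring_simps(1)
  by (induction rule: co.CC.tensor_induct) (use assms(2,3) in "simp_all add: hopf_coring_simps")

lemma C_abelian: "abelian_group C"
  by (rule abelian_group_transfer[OF HH_abelian]) (simp_all add: hopf_coring_simps)

lemma lift_to_C: "lift C \<phi> t = lift HH \<phi> t"
  by (simp add: tensor_lift_def hopf_coring_simps hom_def)

lemma liftC_hom: "bil P \<phi> ==> lift P \<phi> \<in> add_hom C P"
  using bal.lift_hom[of R HR HR P \<phi>] by (simp add: hopf_coring_simps hom_def)

lemma te_rules': "[|a ::: H; b ::: H|] ==> te a b ::: C"
  "[|a ::: H; a' ::: H; b ::: H|] ==> te (a \<oplus>[H] a') b = te a b \<oplus>[C] te a' b"
  "[|a ::: H; b ::: H; b' ::: H|] ==> te a (b \<oplus>[H] b') = te a b \<oplus>[C] te a b'"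
  "[|a ::: H; r ::: R; b ::: H|] ==> te (r \<odot>[H] a) b = te a (r \<odot>[H] b)"
  by (simp_all add: hopf_coring_simps te_rules)

lemma lift_te: "t ::: C ==> lift C te t = t"
  using co.CC.lift_telem[of t] by (simp add: lift_to_C hopf_coring_simps)

lemma ract_te: "[|a ::: H; b ::: H; c ::: H|]
    ==> te a b \<triangleleft>[C] c = lift C (%x y. te (a \<otimes>[H] x) (b \<otimes>[H] y)) (comult H c)"
  using self.act_elem[of a b "comult H c"] by (simp add: hopf_coring_simps hopf_bimod_simps lift_to_C comult_closed)

lemma bil_te_mult: "[|a ::: H; b ::: H|] ==> bil C (%x y. te (a \<otimes>[H] x) (b \<otimes>[H] y))"
  by (rule bilI) (simp_all add: C_abelian te_rules' H.r_distr smult_mult_right)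

lemma bil_te_left: "d ::: H ==> bil HH (%x y. te (d \<otimes>[H] x) y)"
  by (rule bilI) (simp_all add: HH_abelian te_rules H.r_distr smult_mult_right)

lemma lact_te: "[|a ::: H; b ::: H; d ::: H|] ==> d \<triangleright>[C] te a b = te (d \<otimes>[H] a) b"
  by (simp add: hopf_coring_simps hopf_bimod_simps bal.lift_elem[OF bil_te_left])

lemma hopf_bimodule: "bimodule H C"
proof (rule bimoduleI)
  interpret Ca: abelian_group C by (rule C_abelian)
  have ra: "(s \<oplus>[C] t) \<triangleleft>[C] a = s \<triangleleft>[C] a \<oplus>[C] t \<triangleleft>[C] a" and rc: "s \<triangleleft>[C] a ::: C"
    if "s ::: C" "t ::: C" "a ::: H" for s t a
    using that by (simp_all add: hopf_coring_simps hopf_bimod_simps tact_rules comult_closed)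
  have la: "d \<triangleright>[C] (s \<oplus>[C] t) = (d \<triangleright>[C] s) \<oplus>[C] (d \<triangleright>[C] t)" and lc: "d \<triangleright>[C] s ::: C"
    if "s ::: C" "t ::: C" "d ::: H" for s t d
    using that by (simp_all add: hopf_coring_simps hopf_bimod_simps bal.lift_add[OF bil_te_left] bal.lift_closed[OF bil_te_left])
  have lh: "(%s. d \<triangleright>[C] s) \<in> add_hom C C" if "d ::: H" for d
    by (rule add_homI) (use that la lc in simp_all)
  show "right_module H C"
  proof (rule right_moduleI)
    show "t \<triangleleft>[C] (a \<oplus>[H] b) = t \<triangleleft>[C] a \<oplus>[C] t \<triangleleft>[C] b" if "t ::: C" "a ::: H" "b ::: H" for t a b
      using that co.cop_add[of a b] by (simp add: hopf_coring_simps hopf_bimod_simps tact_rules comult_closed)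
    show "t \<triangleleft>[C] (a \<otimes>[H] b) = t \<triangleleft>[C] a \<triangleleft>[C] b" if "t ::: C" "a ::: H" "b ::: H" for t a b
      using that self.act_mult[of t a b] by (simp add: hopf_coring_simps hopf_bimod_simps)
    show "t \<triangleleft>[C] \<one>[H] = t" if "t ::: C" for t
      using that self.act_one[of t] by (simp add: hopf_coring_simps hopf_bimod_simps)
  qed (use ra rc in "simp_all add: H.ring_axioms C_abelian")
  fix t a b assume t: "t ::: C" and ab: "a ::: H" "b ::: H"
  show "(a \<oplus>[H] b) \<triangleright>[C] t = (a \<triangleright>[C] t) \<oplus>[C] (b \<triangleright>[C] t)"
    using t by (induction rule: C_induct) (use ab in "simp_all add: lact_te H.l_distr te_rules' la lc Ca.a_ac")
  show "(a \<otimes>[H] b) \<triangleright>[C] t = a \<triangleright>[C] b \<triangleright>[C] t"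
    using t by (induction rule: C_induct) (use ab in "simp_all add: lact_te H.m_assoc la lc")
  show "(a \<triangleright>[C] t) \<triangleleft>[C] b = a \<triangleright>[C] (t \<triangleleft>[C] b)"
    using t
  proof (induction rule: C_induct)
    case (elem x y)
    then show ?case
      using ab lift_additive[OF bil_te_mult lh C_abelian]
      by (simp add: lact_te ract_te H.m_assoc)
  qed (use ab in "simp add: la lc ra rc")
next
  fix t assume "t ::: C"
  then show "\<one>[H] \<triangleright>[C] t = t"
    by (simp add: hopf_coring_simps hopf_bimod_simps co.CC.lift_telem)
qed (simp_all add: hopf_coring_simps hopf_bimod_simps bal.lift_add[OF bil_te_left] bal.lift_closed[OF bil_te_left])

sublocale cb: bimodule H C by (rule hopf_bimodule)

sublocale CC: tensor_prod2 H C C ..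

abbreviation "tc \<equiv> telem H C C"
abbreviation "HCC \<equiv> tgroup H C C"

text \<open>The definition is phrased with the tensor square of \<open>hopf_bimod\<close>, which has
  the same actions as the coring and therefore the same tensor square.\<close>

lemma cop_hopf: "cop C t = lift HCC (%a b. lift HCC (%x y. tc (te a x) (te \<one>[H] y)) (comult H b)) t"
proof -
  have r: "tensor_relations H (hopf_bimod R H) (hopf_bimod R H) = tensor_relations H C C"
    by (rule tensor_relations_cong) (simp_all add: hopf_coring_simps hopf_bimod_simps)
  have c: "carrier (hopf_bimod R H) = carrier C" by (simp add: hopf_coring_simps hopf_bimod_simps)
  let ?B = "hopf_bimod R H"
  have "cop C t = lift (tgroup H ?B ?B) (%a b. lift (tgroup H ?B ?B)
      (%x y. telem H ?B ?B (te a x) (te \<one>[H] y)) (comult H b)) t"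
    by (simp add: hopf_coring_def Let_def bimod.extend_def)
  then show ?thesis
    unfolding telem_cong[OF c c r] tensor_group_cong(2)[OF c c r] .
qed

lemma te_ract_smult_one: "[|a ::: H; x ::: H; r ::: R|] ==> te a x \<triangleleft>[C] (r \<odot>[H] \<one>[H]) = te a (r \<odot>[H] x)"
proof -
  assume a: "a ::: H" and x: "x ::: H" and r: "r ::: R"
  have "bil C (%u v. te (a \<otimes>[H] (r \<odot>[H] u)) (x \<otimes>[H] v))"
    by (rule bilI) (use a x r in "simp_all add: C_abelian te_rules' H.r_distr smult_mult_right smult_r_distr smult_lcomm")
  from lift_comult_one[OF this] show "te a x \<triangleleft>[C] (r \<odot>[H] \<one>[H]) = te a (r \<odot>[H] x)"
    using a x r by (simp add: ract_te lift_smult[OF bil_te_mult] mult_smult_one te_rules')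
qed

text \<open>The delicate point is that scalars of \<open>R\<close> may pass from \<open>x\<close> to
  \<open>y\<close> although \<open>\<psi>\<close> is balanced over \<open>H\<close>: they travel as
  r 1, by (a \<otimes> x)(r 1) = a \<otimes> r x and (r 1)(1 \<otimes> y) = 1 \<otimes> r y.\<close>

lemma tri_q:
  assumes "bal H C C P \<psi>"
  shows "trilin R HR HR HR P (%a x y. \<psi> (te a x) (te \<one>[H] y))"
proof (rule triI)
  interpret \<psi>: bal H C C P \<psi> by fact
  show "abelian_group P" by (rule \<psi>.P.abelian_group_axioms)
  fix a x r y assume axy: "a ::: H" "x ::: H" "r ::: R" "y ::: H"
  have "\<psi> (te a (r \<odot>[H] x)) (te \<one>[H] y) = \<psi> (te a x \<triangleleft>[C] (r \<odot>[H] \<one>[H])) (te \<one>[H] y)"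
    using axy by (simp add: te_ract_smult_one)
  also have "... = \<psi> (te a x) ((r \<odot>[H] \<one>[H]) \<triangleright>[C] te \<one>[H] y)"
    by (rule \<psi>.bal_balanced) (use axy in "simp_all add: te_rules'")
  also have "... = \<psi> (te a x) (te \<one>[H] (r \<odot>[H] y))"
    using axy by (simp add: lact_te te_rules')
  finally show "\<psi> (te a (r \<odot>[H] x)) (te \<one>[H] y) = \<psi> (te a x) (te \<one>[H] (r \<odot>[H] y))" .
qed (simp_all add: te_rules' balD[OF assms])

lemma bil_tri_right: "trilin R HR HR HR P \<phi> ==> bil P (%a b. lift P (\<phi> a) (comult H b))"
  using co.bal_cop_right[of HR P \<phi>] by simp

lemma tri_bil_23: "trilin R HR HR HR P \<phi> ==> a ::: H ==> bil P (\<phi> a)"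
  using trilin.bal_23[of R HR HR HR P \<phi> a] by simp

lemma cop_te: "[|a ::: H; b ::: H|] ==> cop C (te a b) = lift HCC (%x y. tc (te a x) (te \<one>[H] y)) (comult H b)"
  by (simp add: cop_hopf bal.lift_elem[OF bil_tri_right[OF tri_q[OF CC.telem_bal]]])

lemma cop_add_hom: "cop C \<in> add_hom C HCC"
  using liftC_hom[OF bil_tri_right[OF tri_q[OF CC.telem_bal]]] unfolding cop_hopf[abs_def] .

lemma lift_cop_te:
  assumes "bal H C C P \<psi>" "a ::: H" "b ::: H"
  shows "tlift H C C P \<psi> (cop C (te a b)) = lift P (%x y. \<psi> (te a x) (te \<one>[H] y)) (comult H b)"
proof -
  interpret \<psi>: bal H C C P \<psi> by fact
  show ?thesis
    using lift_additive[OF tri_bil_23[OF tri_q[OF CC.telem_bal]] \<psi>.lift_hom \<psi>.P.abelian_group_axioms] assms(2,3)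
    by (simp add: cop_te \<psi>.lift_elem te_rules')
qed

lemma cou_te: "[|a ::: H; b ::: H|] ==> cou C (te a b) = counit H b \<odot>[H] a"
  and cou_add_hom: "cou C \<in> add_hom C H"
proof -
  have b: "bil H (%a b. counit H b \<odot>[H] a)"
    by (rule bilI) (simp_all add: H_abelian counit_closed counit_rules smult_r_distr smult_l_distr smult_assoc1[symmetric] R.m_comm)
  show "[|a ::: H; b ::: H|] ==> cou C (te a b) = counit H b \<odot>[H] a"
    by (simp add: hopf_coring_simps bal.lift_elem[OF b])
  show "cou C \<in> add_hom C H"
    unfolding hopf_coring_simps(6) by (rule liftC_hom[OF b])
qed

lemma CCr_module: "right_module H (tright H C C)" and CCb_bimodule: "bimodule H (tbimod H C C)"
  by (rule CC.tright_module CC.tensor_bimodule)+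

text \<open>The coproduct of (a \<otimes> b) c is \<open>(a c\<^sub>1 \<otimes> b\<^sub>1 c\<^sub>2)
  \<otimes>\<^sub>H (1 \<otimes> b\<^sub>2 c\<^sub>3)\<close>. Here the first factor is
  \<open>(a \<otimes> b\<^sub>1) c\<^sub>1\<close> after coassociativity, and moving
  \<open>c\<^sub>1\<close> across the tensor sign gives \<open>(a \<otimes> b\<^sub>1)
  \<otimes>\<^sub>H (1 \<otimes> b\<^sub>2) c\<close>.\<close>

lemma cop_te_ract:
  assumes a: "a ::: H" and b: "b ::: H" and c: "c ::: H"
  shows "cop C (te a b \<triangleleft>[C] c) = cop C (te a b) \<triangleleft>[tright H C C] c"
proof -
  interpret CCr: right_module H "tright H C C" by (rule CCr_module)
  let ?q = "%a x y. tc (te a x) (te \<one>[H] y)"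
  note q = tri_q[OF CC.telem_bal]
  have mr: "(%x. d \<otimes>[H] x) \<in> right_hom R HR HR" "(%x. d \<otimes>[H] x) \<in> left_hom R HR HR" if "d ::: H" for d
    using that by (auto intro!: right_homI left_homI simp: H.r_distr smult_mult_right)
  have tri: "trilin R HR HR HR HCC (%c1 x y. ?q (a \<otimes>[H] c1) (b1 \<otimes>[H] x) (b2 \<otimes>[H] y))"
    if "b1 ::: H" "b2 ::: H" for b1 b2
    by (rule trilin_compose3[OF q mr(1)[OF a] co.right_module_axioms mr[OF that(1)] co.bimodule_axioms mr(2)[OF that(2)] co.bimodule_axioms])
  have "cop C (te a b \<triangleleft>[C] c) = lift HCC (%c1 c2. cop C (te (a \<otimes>[H] c1) (b \<otimes>[H] c2))) (comult H c)"
    using a b c lift_additive[OF bil_te_mult cop_add_hom CC.tensor_abelian_group] by (simp add: ract_te)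
  also have "... = lift HCC (%c1 c2. lift HCC (%b1 b2. lift HCC (%x y. ?q (a \<otimes>[H] c1) (b1 \<otimes>[H] x) (b2 \<otimes>[H] y)) (comult H c2)) (comult H b)) (comult H c)"
    using a b by (simp add: cop_te lift_comult_mult[OF tri_bil_23[OF q]])
  \<comment> \<open>The two coproducts are independent; the sum over \<open>c\<close> is moved
    inside so that it can be treated for fixed parts of \<open>b\<close>.\<close>
  also have "... = lift HCC (%b1 b2. lift HCC (%c1 c2. lift HCC (%x y. ?q (a \<otimes>[H] c1) (b1 \<otimes>[H] x) (b2 \<otimes>[H] y)) (comult H c2)) (comult H c)) (comult H b)"
    by (rule lift_swap[OF co.CC.tensor_prod_axioms])
       (use a b c bil_mult_lift[OF tri_bil_23[OF q]] bil_tri_right[OF tri] in "simp_all add: comult_closed")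
  also have "... = lift HCC (%b1 b2. tc (te a b1) (te \<one>[H] b2) \<triangleleft>[tright H C C] c) (comult H b)"
  proof (rule lift_cong)
    fix b1 b2 assume "b1 ::: HR" "b2 ::: HR"
    then have b12: "b1 ::: H" "b2 ::: H" by simp_all
    have "lift HCC (%c1 c2. lift HCC (%x y. ?q (a \<otimes>[H] c1) (b1 \<otimes>[H] x) (b2 \<otimes>[H] y)) (comult H c2)) (comult H c)
      = lift HCC (%z y. lift HCC (%c1 x. tc (te (a \<otimes>[H] c1) (b1 \<otimes>[H] x)) (te \<one>[H] (b2 \<otimes>[H] y))) (comult H z)) (comult H c)"
      by (rule coassoc[OF tri[OF b12] c, symmetric])
    also have "... = lift HCC (%z y. tc (te a b1) (te z (b2 \<otimes>[H] y))) (comult H c)"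
    proof (rule lift_cong)
      fix z y assume "z ::: HR" "y ::: HR"
      then have zy: "z ::: H" "y ::: H" by simp_all
      have "lift HCC (%c1 x. tc (te (a \<otimes>[H] c1) (b1 \<otimes>[H] x)) (te \<one>[H] (b2 \<otimes>[H] y))) (comult H z)
        = tc (te a b1 \<triangleleft>[C] z) (te \<one>[H] (b2 \<otimes>[H] y))"
        using a b12 zy CC.telem_lift_left[OF bil_te_mult[OF a b12(1)] comult_closed[OF zy(1)]]
        by (simp add: ract_te te_rules')
      \<comment> \<open>Balancedness over \<open>H\<close> turns the diagonal right action on the
        first factor into left multiplication on the second.\<close>
      also have "... = tc (te a b1) (z \<triangleright>[C] te \<one>[H] (b2 \<otimes>[H] y))"
        by (rule CC.telem_balanced) (use a b12 zy in "simp_all add: te_rules'")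
      finally show "lift HCC (%c1 x. tc (te (a \<otimes>[H] c1) (b1 \<otimes>[H] x)) (te \<one>[H] (b2 \<otimes>[H] y))) (comult H z)
        = tc (te a b1) (te z (b2 \<otimes>[H] y))"
        using zy b12 by (simp add: lact_te)
    qed
    also have "... = tc (te a b1) (te \<one>[H] b2 \<triangleleft>[C] c)"
      using a b12 c CC.telem_lift_right[OF bil_te_mult[OF H.one_closed b12(2)] comult_closed[OF c]]
      by (simp add: ract_te te_rules')
    also have "... = tc (te a b1) (te \<one>[H] b2) \<triangleleft>[tright H C C] c"
      using a b12 c by (simp add: CC.ract_telem te_rules')
    finally show "lift HCC (%c1 c2. lift HCC (%x y. ?q (a \<otimes>[H] c1) (b1 \<otimes>[H] x) (b2 \<otimes>[H] y)) (comult H c2)) (comult H c)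
      = tc (te a b1) (te \<one>[H] b2) \<triangleleft>[tright H C C] c" .
  qed
  also have "... = cop C (te a b) \<triangleleft>[tright H C C] c"
  proof -
    have "(%t. t \<triangleleft>[tright H C C] c) \<in> add_hom HCC HCC"
      by (rule add_homI) (use CCr.ract_closed CCr.ract_add_left c in simp_all)
    from lift_additive[OF tri_bil_23[OF q a] this CC.tensor_abelian_group b] show ?thesis
      using a b by (simp add: cop_te)
  qed
  finally show ?thesis .
qed

lemma hopf_cop_hom: "cop C \<in> bimod_hom H C (tbimod H C C)"
  unfolding bimod_hom_iff
proof
  interpret CCr: right_module H "tright H C C" by (rule CCr_module)
  interpret CCb: bimodule H "tbimod H C C" by (rule CCb_bimodule)
  note ch = hom_add[OF cop_add_hom] hom_carrier_add[OF cop_add_hom]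
  show "cop C \<in> right_hom H C (tbimod H C C)"
  proof (rule right_homI)
    fix t c assume t: "t ::: C" and c: "c ::: H"
    show "cop C (t \<triangleleft>[C] c) = cop C t \<triangleleft>[tbimod H C C] c"
      unfolding tbimod_simps(6)
      using t
    proof (induction rule: C_induct)
      case (elem x y)
      then show ?case using c by (rule cop_te_ract)
    next
      case (add s t)
      then show ?case
        using c CCr.ract_add_left[of "cop C s" "cop C t" c] by (simp add: cb.ract_add_left cb.ract_closed ch)
    qed
  qed (use ch in simp_all)
  show "cop C \<in> left_hom H C (tbimod H C C)"
  proof (rule left_homI)
    fix t d assume t: "t ::: C" and d: "d ::: H"
    have lh: "(%s. d \<triangleright>[tbimod H C C] s) \<in> add_hom HCC HCC"
      by (rule add_homI) (use CCb.lact_closed CCb.lact_add_right d in simp_all)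
    show "cop C (d \<triangleright>[C] t) = d \<triangleright>[tbimod H C C] cop C t"
      using t
    proof (induction rule: C_induct)
      case (elem x y)
      then show ?case
        using d lift_additive[OF tri_bil_23[OF tri_q[OF CC.telem_bal]] lh CC.tensor_abelian_group]
        by (simp add: lact_te cop_te CC.lact_telem te_rules')
    next
      case (add s t)
      then show ?case
        using d CCb.lact_add_right[of "cop C s" "cop C t" d] by (simp add: cb.lact_add_right cb.lact_closed ch)
    qed
  qed (use ch in simp_all)
qed

text \<open>Right linearity is
  \<open>\<epsilon>(b c\<^sub>2) a c\<^sub>1 = \<epsilon>(b) a c\<close>, by multiplicativity of the
  counit and the counit law.\<close>

lemma hopf_cou_hom: "cou C \<in> bimod_hom H C (regular_bimod H)"
  unfolding bimod_hom_iff
proof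
  note ch = hom_add[OF cou_add_hom] hom_carrier_add[OF cou_add_hom]
  show "cou C \<in> right_hom H C (regular_bimod H)"
  proof (rule right_homI)
    fix t c assume t: "t ::: C" and c: "c ::: H"
    show "cou C (t \<triangleleft>[C] c) = cou C t \<triangleleft>[regular_bimod H] c"
      using t
    proof (induction rule: C_induct)
      case (elem a b)
      have h: "(%x. (counit H b \<odot>[H] a) \<otimes>[H] x) \<in> add_hom H H"
        by (rule add_homI) (use elem in "simp_all add: H.r_distr counit_closed")
      have "cou C (te a b \<triangleleft>[C] c) = lift H (%x y. (counit H b \<odot>[H] a) \<otimes>[H] (counit H y \<odot>[H] x)) (comult H c)"
        using elem c lift_additive[OF bil_te_mult cou_add_hom H_abelian]
        by (simp add: ract_te cou_te counit_mult smult_mult_left smult_mult_right counit_closed smult_assoc1 smult_lcomm)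
      also have "... = (counit H b \<odot>[H] a) \<otimes>[H] c"
        by (rule counit_right[OF h H_abelian c])
      finally show ?case using elem by (simp add: cou_te)
    qed (use c in "simp add: cb.ract_add_left cb.ract_closed ch H.l_distr")
  qed (use ch in simp_all)
  show "cou C \<in> left_hom H C (regular_bimod H)"
  proof (rule left_homI)
    fix t c assume t: "t ::: C" and c: "c ::: H"
    show "cou C (c \<triangleright>[C] t) = c \<triangleright>[regular_bimod H] cou C t"
      using t
      by (induction rule: C_induct)
         (use c in "simp_all add: lact_te cou_te smult_mult_right counit_closed cb.lact_add_right cb.lact_closed ch H.r_distr")
  qed (use ch in simp_all)
qed

text \<open>On a \<otimes> b the axioms reduce to those of the coalgebra \<open>H\<close> at
  \<open>b\<close>: both sides of coassociativity are \<open>(a \<otimes> b\<^sub>1) \<otimes> (1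
  \<otimes> b\<^sub>2) \<otimes> (1 \<otimes> b\<^sub>3)\<close>.\<close>

theorem hopf_is_coring: "is_coring H C"
proof (rule is_coringI[OF hopf_bimodule hopf_cop_hom hopf_cou_hom])
  let ?W = "tgroup H C (tbimod H C C)"
  let ?w = "%x y z. telem H C (tbimod H C C) x (telem H C C y z)"
  note ch = hom_add[OF cop_add_hom] hom_carrier_add[OF cop_add_hom]
  interpret w: trilin H C C C ?W ?w
    by (rule trilin_elem_right[OF cb.right_module_axioms hopf_bimodule hopf_bimodule])
  have cr: "cop C \<in> right_hom H C (tright H C C)" and cl: "cop C \<in> left_hom H C (tbimod H C C)"
    using hopf_cop_hom by (simp_all add: bimod_hom_iff)
  have b1: "bal H C C ?W (%s z. tlift H C C ?W (%u v. ?w u v z) (cop C s))"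
    using bal.bal_compose[OF w.bal_left cr id_left_hom cb.right_module_axioms hopf_bimodule] by simp
  have b2: "bal H C C ?W (%s z. tlift H C C ?W (?w s) (cop C z))"
    using bal.bal_compose[OF w.bal_right id_right_hom cl cb.right_module_axioms hopf_bimodule] by simp
  fix t assume "t ::: C"
  then show "tlift H C C ?W (%y c. tlift H C C ?W (%u v. ?w u v c) (cop C y)) (cop C t)
    = tlift H C C ?W (%y c. tlift H C C ?W (%u v. ?w y u v) (cop C c)) (cop C t)"
  proof (induction rule: C_induct)
    case (elem a b)
    have tri: "trilin R HR HR HR ?W (%x y z. ?w (te a x) (te \<one>[H] y) (te \<one>[H] z))"
    proof (rule triI)
      show "abelian_group ?W" by (rule w.P.abelian_group_axioms)
      show "?w (te a (r \<odot>[H] x)) (te \<one>[H] y) (te \<one>[H] z) = ?w (te a x) (te \<one>[H] (r \<odot>[H] y)) (te \<one>[H] z)"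
        if "x ::: H" "r ::: R" "y ::: H" "z ::: H" for x r y z
        using bilD(5)[OF tri_bil_23[OF tri_q[OF w.bal_12] elem(1)], of "te \<one>[H] z" x r y] that by (simp add: te_rules')
      show "?w (te a x) (te \<one>[H] (r \<odot>[H] y)) (te \<one>[H] z) = ?w (te a x) (te \<one>[H] y) (te \<one>[H] (r \<odot>[H] z))"
        if "x ::: H" "y ::: H" "r ::: R" "z ::: H" for x r y z
        using bilD(5)[OF tri_bil_23[OF tri_q[OF w.bal_23] H.one_closed], of "te a x" y r z] that elem by (simp add: te_rules')
    qed (simp_all add: elem te_rules' w.tri_closed w.tri_add_1 w.tri_add_2 w.tri_add_3)
    show ?case
      using elem coassoc[OF tri elem(2)]
      by (simp add: lift_cop_te[OF b1] lift_cop_te[OF b2] lift_cop_te[OF w.bal_12] lift_cop_te[OF w.bal_23] te_rules')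
  qed (simp add: ch bal.lift_add[OF b1] bal.lift_add[OF b2])
next
  note ch = hom_add[OF cop_add_hom] hom_carrier_add[OF cop_add_hom]
  note cD = right_homD[OF hopf_cou_hom[unfolded bimod_hom_iff, THEN conjunct1]] left_homD[OF hopf_cou_hom[unfolded bimod_hom_iff, THEN conjunct2]]
  have bl: "bal H C C C (%x y. cou C x \<triangleright>[C] y)"
    by (rule balI)
       (use cD in "simp_all add: cb.right_module_axioms hopf_bimodule C_abelian cb.lact_closed cb.lact_add_left cb.lact_add_right cb.lact_assoc")
  have br: "bal H C C C (%x y. x \<triangleleft>[C] cou C y)"
    by (rule balI)
       (use cD in "simp_all add: cb.right_module_axioms hopf_bimodule C_abelian cb.ract_closed cb.ract_add_left cb.ract_add_right cb.ract_assoc")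
  fix t assume t: "t ::: C"
  have th: "te a \<in> add_hom H C" if "a ::: H" for a
    by (rule add_homI) (use that in "simp_all add: te_rules'")
  show "tlift H C C C (%x y. cou C x \<triangleright>[C] y) (cop C t) = t"
    using t
  proof (induction rule: C_induct)
    case (elem a b)
    then show ?case
      using counit_left[OF th C_abelian, of a b]
      by (simp add: lift_cop_te[OF bl] cou_te lact_te counit_closed te_rules')
  qed (simp add: ch bal.lift_add[OF bl])
  show "tlift H C C C (%x y. x \<triangleleft>[C] cou C y) (cop C t) = t"
    using t
  proof (induction rule: C_induct)
    case (elem a b)
    then show ?case
      using counit_right[OF th C_abelian, of a b]
      by (simp add: lift_cop_te[OF br] cou_te te_ract_smult_one counit_closed)
  qed (simp add: ch bal.lift_add[OF br])
qed

end

section \<open>The antipode\<close>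

text \<open>Fixes one of the antipodes whose existence \<open>hopf_algebra\<close> asserts.\<close>

locale antipode = is_bialgebra R H
  for R :: "('r, 'p) ring_scheme" (structure) and H :: "('r, 'h, 'z) bialgebra_scheme" +
  fixes S :: "'h => 'h"
  assumes S: "is_antipode R H S"
begin

lemma S_hom: "S \<in> right_hom R HR HR"
  using S by (simp add: is_antipode_def Let_def)

lemma S_closed: "x ::: H ==> S x ::: H"
  and S_add: "[|x ::: H; y ::: H|] ==> S (x \<oplus>[H] y) = S x \<oplus>[H] S y"
  and S_smult: "[|x ::: H; r ::: R|] ==> S (r \<odot>[H] x) = r \<odot>[H] S x"
  using right_homD[OF S_hom] by simp_all

lemmas S_rules = S_closed S_add S_smult

lemma antipode_left: "b ::: H ==> lift H (%x y. S x \<otimes>[H] y) (comult H b) = counit H b \<odot>[H] \<one>[H]"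
  and antipode_right: "b ::: H ==> lift H (%x y. x \<otimes>[H] S y) (comult H b) = counit H b \<odot>[H] \<one>[H]"
  using S by (simp_all add: is_antipode_def Let_def)

lemmas H_rules = H.l_distr H.r_distr smult_mult_left smult_mult_right smult_r_distr S_rules

lemma bil_S_left: "bil H (%x y. S x \<otimes>[H] y)" and bil_S_right: "bil H (%x y. x \<otimes>[H] S y)"
  by (rule bilI; simp add: H_abelian H_rules)+

lemma S_one: "S \<one>[H] = \<one>[H]"
  using antipode_left[OF H.one_closed] lift_comult_one[OF bil_S_left] by (simp add: counit_one S_closed)

text \<open>Convolution with \<open>S\<close> on the left inverts convolution with the identity, for maps into any left
  \<open>H\<close>-module.\<close>

lemma convolution_cancel_left:
  assumes X: "abelian_group X"
    and act: "\<And>a x. [|a ::: H; x ::: X|] ==> act a x ::: X"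
      "\<And>a b x. [|a ::: H; b ::: H; x ::: X|] ==> act (a \<oplus>[H] b) x = act a x \<oplus>[X] act b x"
      "\<And>a x y. [|a ::: H; x ::: X; y ::: X|] ==> act a (x \<oplus>[X] y) = act a x \<oplus>[X] act a y"
      "\<And>a b x. [|a ::: H; b ::: H; x ::: X|] ==> act (a \<otimes>[H] b) x = act a (act b x)"
      "\<And>x. x ::: X ==> act \<one>[H] x = x"
    and f: "f \<in> add_hom H X"
    and act_f: "\<And>r a b. [|r ::: R; a ::: H; b ::: H|] ==> act (r \<odot>[H] a) (f b) = act a (f (r \<odot>[H] b))"
    and b: "b ::: H"
  shows "lift X (%u v. act (S u) (lift X (%x y. act x (f y)) (comult H v))) (comult H b) = f b"
proof -
  note fD = hom_add[OF f] hom_carrier_add[OF f]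
  have bi: "bil X (%x y. act x (f y))"
    by (rule bilI) (simp_all add: X act fD act_f)
  have tri: "trilin R HR HR HR X (%u x y. act (S u \<otimes>[H] x) (f y))"
    by (rule triI) (simp_all add: X act(1-3) fD H_rules act_f)
  have "lift X (%u v. act (S u) (lift X (%x y. act x (f y)) (comult H v))) (comult H b)
    = lift X (%u v. lift X (%x y. act (S u \<otimes>[H] x) (f y)) (comult H v)) (comult H b)"
  proof (rule lift_cong)
    fix u v assume "u ::: HR" "v ::: HR"
    then have uv: "u ::: H" "v ::: H" by simp_all
    have "(%x. act (S u) x) \<in> add_hom X X"
      by (rule add_homI) (use uv in "simp_all add: act S_closed")
    from lift_additive[OF bi this X uv(2)]
    show "act (S u) (lift X (%x y. act x (f y)) (comult H v)) = lift X (%x y. act (S u \<otimes>[H] x) (f y)) (comult H v)"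
      using uv by (simp add: act fD S_closed)
  qed
  also have "... = lift X (%z y. lift X (%u x. act (S u \<otimes>[H] x) (f y)) (comult H z)) (comult H b)"
    by (rule coassoc[OF tri b, symmetric])
  also have "... = lift X (%z y. f (counit H z \<odot>[H] y)) (comult H b)"
  proof (rule lift_cong)
    fix z y assume "z ::: HR" "y ::: HR"
    then have zy: "z ::: H" "y ::: H" by simp_all
    have "(%a. act a (f y)) \<in> add_hom H X"
      by (rule add_homI) (use zy in "simp_all add: act fD")
    from lift_additive[OF bil_S_left this X zy(1)]
    show "lift X (%u x. act (S u \<otimes>[H] x) (f y)) (comult H z) = f (counit H z \<odot>[H] y)"
      using zy by (simp add: antipode_left act_f counit_closed act fD)
  qed
  also have "... = f b" by (rule counit_left[OF f X b])
  finally show ?thesis .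
qed

text \<open>The mirror image of the preceding rule for maps from \<open>H\<close> to itself: the
  convolution of \<open>f\<close> with the identity, convolved with \<open>S\<close> on the right,
  is \<open>f\<close>.\<close>

lemma convolution_cancel_right:
  assumes f: "f \<in> add_hom H H"
    and fr: "\<And>r b. [|r ::: R; b ::: H|] ==> f (r \<odot>[H] b) = r \<odot>[H] f b"
    and b: "b ::: H"
  shows "lift H (%v u. lift H (%x y. f x \<otimes>[H] y) (comult H v) \<otimes>[H] S u) (comult H b) = f b"
proof -
  note fD = hom_add[OF f] hom_carrier_add[OF f]
  have bi: "bil H (%x y. f x \<otimes>[H] y)"
    by (rule bilI) (simp_all add: H_abelian fD H_rules fr)
  have tri: "trilin R HR HR HR H (%x y u. f x \<otimes>[H] (y \<otimes>[H] S u))"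
    by (rule triI) (simp_all add: H_abelian fD H_rules fr)
  have "lift H (%v u. lift H (%x y. f x \<otimes>[H] y) (comult H v) \<otimes>[H] S u) (comult H b)
    = lift H (%v u. lift H (%x y. f x \<otimes>[H] (y \<otimes>[H] S u)) (comult H v)) (comult H b)"
  proof (rule lift_cong)
    fix v u assume "v ::: HR" "u ::: HR"
    then have uv: "u ::: H" "v ::: H" by simp_all
    have "(%x. x \<otimes>[H] S u) \<in> add_hom H H"
      by (rule add_homI) (use uv in "simp_all add: H_rules")
    from lift_additive[OF bi this H_abelian uv(2)]
    show "lift H (%x y. f x \<otimes>[H] y) (comult H v) \<otimes>[H] S u = lift H (%x y. f x \<otimes>[H] (y \<otimes>[H] S u)) (comult H v)"
      using uv by (simp add: fD S_closed H.m_assoc)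
  qed
  also have "... = lift H (%x z. lift H (%y u. f x \<otimes>[H] (y \<otimes>[H] S u)) (comult H z)) (comult H b)"
    by (rule coassoc[OF tri b])
  also have "... = lift H (%x z. f (counit H z \<odot>[H] x)) (comult H b)"
  proof (rule lift_cong)
    fix x z assume "x ::: HR" "z ::: HR"
    then have zy: "z ::: H" "x ::: H" by simp_all
    have "(%a. f x \<otimes>[H] a) \<in> add_hom H H"
      by (rule add_homI) (use zy in "simp_all add: H_rules fD")
    from lift_additive[OF bil_S_right this H_abelian zy(1)]
    show "lift H (%y u. f x \<otimes>[H] (y \<otimes>[H] S u)) (comult H z) = f (counit H z \<odot>[H] x)"
      using zy by (simp add: antipode_right counit_closed fD fr mult_smult_one)
  qed
  also have "... = f b" by (rule counit_right[OF f H_abelian b])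
  finally show ?thesis .
qed

lemma lift_left_mult: "[|bil H \<phi>; a ::: H; b ::: H|] ==> a \<otimes>[H] lift H \<phi> (comult H b) = lift H (%x y. a \<otimes>[H] \<phi> x y) (comult H b)"
  by (rule lift_additive[OF _ _ H_abelian], assumption, rule add_homI) (simp_all add: H_rules)

lemma lift_right_mult: "[|bil H \<phi>; a ::: H; b ::: H|] ==> lift H \<phi> (comult H b) \<otimes>[H] a = lift H (%x y. \<phi> x y \<otimes>[H] a) (comult H b)"
  by (rule lift_additive[OF _ _ H_abelian, where h="%x. x \<otimes>[H] a"], assumption, rule add_homI) (simp_all add: H_rules)

lemma lift_smult_out: "[|bil H \<phi>; r ::: R; b ::: H|] ==> r \<odot>[H] lift H \<phi> (comult H b) = lift H (%x y. r \<odot>[H] \<phi> x y) (comult H b)"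
  by (rule lift_additive[OF _ _ H_abelian], assumption, rule add_homI) (simp_all add: H_rules)

lemma lift_sum': "[|bil P \<phi>; bil P \<psi>; b ::: H|]
    ==> lift P (%x y. \<phi> x y \<oplus>[P] \<psi> x y) (comult H b) = lift P \<phi> (comult H b) \<oplus>[P] lift P \<psi> (comult H b)"
  by (rule bal.lift_sum) (simp_all add: comult_closed)

text \<open>Obtained by cancellation rather than from antimultiplicativity of \<open>S\<close>. For
  \<open>f(v) = x\<^sub>1 S(v x\<^sub>2)\<close>, the antipode law at v x shows that the convolution
  of the identity with \<open>f\<close> is v \<mapsto> \<epsilon>(v x) 1. Convolving with
  \<open>S\<close> on the left recovers \<open>f\<close>.\<close>

lemma antipode_mult_right:
  assumes b: "b ::: H" and x: "x ::: H"
  shows "lift H (%x1 x2. x1 \<otimes>[H] S (b \<otimes>[H] x2)) (comult H x) = counit H x \<odot>[H] S b"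
proof -
  have bi: "bil H (%x1 x2. x1 \<otimes>[H] S (v \<otimes>[H] x2))" if "v ::: H" for v
    by (rule bilI) (use that in "simp_all add: H_abelian H_rules")
  define f where "f v = lift H (%x1 x2. x1 \<otimes>[H] S (v \<otimes>[H] x2)) (comult H x)" for v
  have f: "f \<in> add_hom H H"
    by (rule add_homI) (simp_all add: f_def lift_closed[OF bi] x H_rules lift_sum'[OF bi bi, symmetric])
  have fr: "f (r \<odot>[H] v) = r \<odot>[H] f v" if "r ::: R" "v ::: H" for r v
    using that x by (simp add: f_def lift_smult_out[OF bi] H_rules)
  note fD = hom_add[OF f] hom_carrier_add[OF f]
  have g: "lift H (%u w. u \<otimes>[H] f w) (comult H v) = counit H (v \<otimes>[H] x) \<odot>[H] \<one>[H]" if v: "v ::: H" for v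
    using antipode_right[of "v \<otimes>[H] x"] v x
    by (simp add: lift_comult_mult[OF bil_S_right] f_def lift_left_mult[OF bi] H.m_assoc S_closed)
  have "lift H (%u v. S u \<otimes>[H] lift H (%u w. u \<otimes>[H] f w) (comult H v)) (comult H b) = f b"
    by (rule convolution_cancel_left) (simp_all add: H_abelian H_rules H.m_assoc f fD fr b)
  moreover have "lift H (%u v. S u \<otimes>[H] lift H (%u w. u \<otimes>[H] f w) (comult H v)) (comult H b)
    = lift H (%u v. counit H x \<odot>[H] S (counit H v \<odot>[H] u)) (comult H b)"
    by (rule lift_cong)
       (simp add: g counit_mult counit_closed x S_rules smult_mult_right smult_assoc1 smult_lcomm)
  moreover have "... = counit H x \<odot>[H] S b"
    by (rule counit_right[OF _ H_abelian b, where h="%u. counit H x \<odot>[H] S u"], rule add_homI) (simp_all add: H_rules counit_closed x)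
  ultimately show ?thesis by (simp add: f_def)
qed

text \<open>The mirror argument: for \<open>f(v) = S(b\<^sub>1 v) b\<^sub>2\<close> the convolution
  of \<open>f\<close> with the identity is v \<mapsto> \<epsilon>(b v) 1, and \<open>S\<close> is
  cancelled on the right.\<close>

lemma antipode_mult_left:
  assumes b: "b ::: H" and a: "a ::: H"
  shows "lift H (%b1 b2. S (b1 \<otimes>[H] a) \<otimes>[H] b2) (comult H b) = counit H b \<odot>[H] S a"
proof -
  have bi: "bil H (%b1 b2. S (b1 \<otimes>[H] v) \<otimes>[H] b2)" if "v ::: H" for v
    by (rule bilI) (use that in "simp_all add: H_abelian H_rules")
  define f where "f v = lift H (%b1 b2. S (b1 \<otimes>[H] v) \<otimes>[H] b2) (comult H b)" for v
  have f: "f \<in> add_hom H H"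
    by (rule add_homI) (simp_all add: f_def lift_closed[OF bi] b H_rules lift_sum'[OF bi bi, symmetric])
  have fr: "f (r \<odot>[H] v) = r \<odot>[H] f v" if "r ::: R" "v ::: H" for r v
    using that b by (simp add: f_def lift_smult_out[OF bi] H_rules)
  note fD = hom_add[OF f] hom_carrier_add[OF f]
  have g: "lift H (%u w. f u \<otimes>[H] w) (comult H v) = counit H (b \<otimes>[H] v) \<odot>[H] \<one>[H]" if v: "v ::: H" for v
    using antipode_left[of "b \<otimes>[H] v"] v b
    by (simp add: lift_comult_mult'[OF bil_S_left] f_def lift_right_mult[OF bi] H.m_assoc S_closed)
  have "lift H (%v u. lift H (%x y. f x \<otimes>[H] y) (comult H v) \<otimes>[H] S u) (comult H a) = f a"
    by (rule convolution_cancel_right[OF f fr a])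
  moreover have "lift H (%v u. lift H (%x y. f x \<otimes>[H] y) (comult H v) \<otimes>[H] S u) (comult H a)
    = lift H (%v u. counit H b \<odot>[H] S (counit H v \<odot>[H] u)) (comult H a)"
    by (rule lift_cong)
       (simp add: g counit_mult counit_closed b S_rules smult_mult_left smult_assoc1 smult_lcomm)
  moreover have "... = counit H b \<odot>[H] S a"
    by (rule counit_left[OF _ H_abelian a, where h="%u. counit H b \<odot>[H] S u"], rule add_homI) (simp_all add: H_rules counit_closed b)
  ultimately show ?thesis by (simp add: f_def)
qed

lemma te_ract_smult: "[|a ::: H; x ::: H; r ::: R; c ::: H|] ==> te a x \<triangleleft>[C] (r \<odot>[H] c) = te a (r \<odot>[H] x) \<triangleleft>[C] c"
  using cb.ract_assoc[of "te a x" "r \<odot>[H] \<one>[H]" c] by (simp add: te_rules' te_ract_smult_one smult_one_mult)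

text \<open>\<open>S(b\<^sub>2)\<^sub>1 \<otimes> b\<^sub>1 S(b\<^sub>2)\<^sub>2 = S(b) \<otimes> 1\<close>.\<close>

lemma antipode_coaction:
  assumes b: "b ::: H"
  shows "lift C (%b1 b2. te \<one>[H] b1 \<triangleleft>[C] S b2) (comult H b) = te (S b) \<one>[H]"
proof -
  have tri: "trilin R HR HR HR C (%x b1 b2. te x b1 \<triangleleft>[C] S b2)"
    by (rule triI) (simp_all add: C_abelian te_rules' S_rules cb.ract_closed cb.ract_add_left cb.ract_add_right te_ract_smult)
  note bi = tri_bil_23[OF tri]
  define f where "f v = lift C (%b1 b2. te \<one>[H] b1 \<triangleleft>[C] S b2) (comult H v)" for v
  have f: "f \<in> add_hom H C"
    by (rule add_homI) (simp_all add: f_def lift_closed[OF bi] lift_add[OF bi])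
  note fD = hom_add[OF f] hom_carrier_add[OF f]
  have lh: "(%t. a \<triangleright>[C] t) \<in> add_hom C C" if "a ::: H" for a
    by (rule add_homI) (use that in "simp_all add: cb.lact_closed cb.lact_add_right")
  have af: "a \<triangleright>[C] f v = lift C (%b1 b2. te a b1 \<triangleleft>[C] S b2) (comult H v)" if "a ::: H" "v ::: H" for a v
    using that unfolding f_def lift_additive[OF bi[OF H.one_closed] lh[OF that(1)] C_abelian that(2)]
    by (simp add: cb.lact_ract[symmetric] te_rules' S_closed lact_te)
  have arf: "(r \<odot>[H] a) \<triangleright>[C] f v = a \<triangleright>[C] f (r \<odot>[H] v)" if "r ::: R" "a ::: H" "v ::: H" for r a v
    using that by (simp add: af lift_smult[OF bi] te_rules')
  \<comment> \<open>Convolving the identity with \<open>f\<close> gives \<open>(v\<^sub>1 \<otimes>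
    v\<^sub>2) S(v\<^sub>3) = \<Delta>(v\<^sub>1 S(v\<^sub>2)) = \<epsilon>(v) 1 \<otimes>
    1\<close>; the claim about \<open>f\<close> then follows by cancelling with
    \<open>S\<close>.\<close>
  have g: "lift C (%x y. x \<triangleright>[C] f y) (comult H v) = te (counit H v \<odot>[H] \<one>[H]) \<one>[H]" if v: "v ::: H" for v
  proof -
    have "lift C (%x y. x \<triangleright>[C] f y) (comult H v) = lift C (%x y. lift C (%b1 b2. te x b1 \<triangleleft>[C] S b2) (comult H y)) (comult H v)"
      by (rule lift_cong) (simp add: af)
    also have "... = lift C (%z w. lift C (%x y. te x y \<triangleleft>[C] S w) (comult H z)) (comult H v)"
      by (rule coassoc[OF tri v, symmetric])
    also have "... = lift C (%z w. comult H (z \<otimes>[H] S w)) (comult H v)"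
    proof (rule lift_cong)
      fix z w assume "z ::: HR" "w ::: HR"
      then have zw: "z ::: H" "w ::: H" by simp_all
      have "(%t. t \<triangleleft>[C] S w) \<in> add_hom C C"
        by (rule add_homI) (use zw in "simp_all add: cb.ract_closed cb.ract_add_left S_closed")
      moreover have "bil C te" by (rule bilI) (simp_all add: C_abelian te_rules')
      ultimately have "lift C (%x y. te x y \<triangleleft>[C] S w) (comult H z) = lift C te (comult H z) \<triangleleft>[C] S w"
        using lift_additive[of C te "%t. t \<triangleleft>[C] S w" C z] zw C_abelian by simp
      also have "... = comult H (z \<otimes>[H] S w)"
        using zw by (simp add: lift_te hopf_coring_simps comult_closed) (simp add: hopf_bimod_simps comult_mult S_closed)
      finally show "lift C (%x y. te x y \<triangleleft>[C] S w) (comult H z) = comult H (z \<otimes>[H] S w)" .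
    qed
    also have "... = comult H (counit H v \<odot>[H] \<one>[H])"
    proof -
      have "comult H \<in> add_hom H C"
        by (rule add_homI) (use co.cop_add in "simp_all add: hopf_coring_simps comult_closed")
      from lift_additive[OF bil_S_right this C_abelian v] antipode_right[OF v] show ?thesis by simp
    qed
    also have "... = te (counit H v \<odot>[H] \<one>[H]) \<one>[H]"
    proof -
      have bt: "bil C te" by (rule bilI) (simp_all add: C_abelian te_rules')
      have bt': "bil C (%x y. te (counit H v \<odot>[H] x) y)"
        by (rule bilI) (use v in "simp_all add: C_abelian te_rules' counit_closed smult_r_distr smult_lcomm")
      have "comult H (counit H v \<odot>[H] \<one>[H]) = lift C te (comult H (counit H v \<odot>[H] \<one>[H]))"
        using v by (simp add: lift_te hopf_coring_simps(1) comult_closed counit_closed)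
      then show ?thesis using v by (simp add: lift_smult[OF bt] counit_closed lift_comult_one[OF bt'])
    qed
    finally show ?thesis .
  qed
  have "lift C (%u v. S u \<triangleright>[C] lift C (%x y. x \<triangleright>[C] f y) (comult H v)) (comult H b) = f b"
    by (rule convolution_cancel_left)
       (simp_all add: C_abelian cb.lact_closed cb.lact_add_left cb.lact_add_right cb.lact_assoc cb.lact_one f arf b)
  moreover have "lift C (%u v. S u \<triangleright>[C] lift C (%x y. x \<triangleright>[C] f y) (comult H v)) (comult H b)
    = lift C (%u v. te (S (counit H v \<odot>[H] u)) \<one>[H]) (comult H b)"
    by (rule lift_cong) (simp add: g lact_te S_rules counit_closed mult_smult_one)
  moreover have "... = te (S b) \<one>[H]"
    by (rule counit_right[OF _ C_abelian b, where h="%u. te (S u) \<one>[H]"], rule add_homI) (simp_all add: te_rules' S_rules)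
  ultimately show ?thesis by (simp add: f_def)
qed

subsection \<open>The cointegral \<open>(a \<otimes> b) \<otimes> (c \<otimes> d) \<mapsto> \<epsilon>(c) a S(b) d\<close>\<close>

text \<open>The cointegral is the product of \<open>ell\<close> at the first argument and
  \<open>rho\<close> at the second. It is balanced over \<open>H\<close> because \<open>x\<close>
  acting from the right on the argument of \<open>ell\<close>, or from the left on that of
  \<open>rho\<close>, contributes only the scalar \<epsilon>(x).\<close>

definition ell :: "('h, 'h) tensor => 'h" where "ell = lift H (%a b. a \<otimes>[H] S b)"
definition rho :: "('h, 'h) tensor => 'h" where "rho = lift H (%c d. counit H c \<odot>[H] d)"

lemma bil_rho: "bil H (%c d. counit H c \<odot>[H] d)"
  by (rule bilI) (simp_all add: H_abelian counit_closed counit_rules smult_r_distr smult_l_distr smult_assoc1 smult_lcomm)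

lemma ell_hom: "ell \<in> add_hom C H"
  unfolding ell_def by (rule liftC_hom[OF bil_S_right])

lemma rho_hom: "rho \<in> add_hom C H"
  unfolding rho_def by (rule liftC_hom[OF bil_rho])

lemma ell_te: "[|a ::: H; b ::: H|] ==> ell (te a b) = a \<otimes>[H] S b"
  and rho_te: "[|a ::: H; b ::: H|] ==> rho (te a b) = counit H a \<odot>[H] b"
  by (simp_all add: ell_def rho_def bal.lift_elem[OF bil_S_right] bal.lift_elem[OF bil_rho])

lemmas ell_rho = hom_add[OF ell_hom] hom_carrier_add[OF ell_hom] hom_add[OF rho_hom] hom_carrier_add[OF rho_hom]

lemma rho_lact: "[|t ::: C; x ::: H|] ==> rho (x \<triangleright>[C] t) = counit H x \<odot>[H] rho t"
  by (induction rule: C_induct)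
     (simp_all add: lact_te rho_te counit_mult counit_closed smult_assoc1 cb.lact_add_right cb.lact_closed ell_rho smult_r_distr)

lemma ell_lact: "[|t ::: C; x ::: H|] ==> ell (x \<triangleright>[C] t) = x \<otimes>[H] ell t"
  by (induction rule: C_induct)
     (simp_all add: lact_te ell_te H.m_assoc S_closed cb.lact_add_right cb.lact_closed ell_rho H.r_distr)

text \<open>\<open>a x\<^sub>1 S(b x\<^sub>2) = \<epsilon>(x) a S(b)\<close>, which is
  \<open>antipode_mult_right\<close> multiplied by \<open>a\<close>.\<close>

lemma ell_ract:
  assumes "t ::: C" "x ::: H"
  shows "ell (t \<triangleleft>[C] x) = counit H x \<odot>[H] ell t"
  using assms(1)
proof (induction rule: C_induct)
  case (elem a b)
  have bi: "bil H (%x1 x2. x1 \<otimes>[H] S (b \<otimes>[H] x2))"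
    by (rule bilI) (use elem in "simp_all add: H_abelian H_rules")
  show ?case
    using elem assms(2) antipode_mult_right[OF elem(2) assms(2)] lift_left_mult[OF bi elem(1) assms(2)]
      lift_additive[OF bil_te_mult ell_hom H_abelian, of a b x]
    by (simp add: ract_te ell_te H.m_assoc S_closed smult_mult_right counit_closed)
qed (use assms(2) in "simp_all add: cb.ract_add_left cb.ract_closed ell_rho smult_r_distr counit_closed")

lemma rho_ract:
  assumes "t ::: C" "x ::: H"
  shows "rho (t \<triangleleft>[C] x) = rho t \<otimes>[H] x"
  using assms(1)
proof (induction rule: C_induct)
  case (elem a b)
  have h: "(%u. (counit H a \<odot>[H] b) \<otimes>[H] u) \<in> add_hom H H"
    by (rule add_homI) (use elem in "simp_all add: H.r_distr counit_closed")
  have "rho (te a b \<triangleleft>[C] x) = lift H (%u v. (counit H a \<odot>[H] b) \<otimes>[H] (counit H u \<odot>[H] v)) (comult H x)"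
    using elem assms(2) lift_additive[OF bil_te_mult rho_hom H_abelian, of a b x]
    by (simp add: ract_te rho_te counit_mult counit_closed smult_mult_left smult_mult_right smult_assoc1 smult_lcomm)
  also have "... = (counit H a \<odot>[H] b) \<otimes>[H] x"
    by (rule counit_left[OF h H_abelian assms(2)])
  finally show ?case using elem by (simp add: rho_te)
qed (use assms(2) in "simp_all add: cb.ract_add_left cb.ract_closed ell_rho H.l_distr")

theorem hopf_cointegral: "cointegral H C (%s t. ell s \<otimes>[H] rho t)"
proof (intro cointegral.intro cointegral_axioms.intro hopf_is_coring)
  interpret coC: is_coring H C by (rule hopf_is_coring)
  show b: "bal H C C H (%s t. ell s \<otimes>[H] rho t)"
    by (rule balI)
       (simp_all add: cb.right_module_axioms hopf_bimodule H_abelian ell_rho H.l_distr H.r_distr ell_ract rho_lact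
          smult_mult_left smult_mult_right counit_closed)
  show "ell (a \<triangleright>[C] x) \<otimes>[H] rho y = a \<otimes>[H] (ell x \<otimes>[H] rho y)" if "x ::: C" "y ::: C" "a ::: H" for x y a
    using that by (simp add: ell_lact ell_rho H.m_assoc)
  show "ell x \<otimes>[H] rho (y \<triangleleft>[C] a) = (ell x \<otimes>[H] rho y) \<otimes>[H] a" if "x ::: C" "y ::: C" "a ::: H" for x y a
    using that by (simp add: rho_ract ell_rho H.m_assoc)
  note ch = hom_add[OF cop_add_hom] hom_carrier_add[OF cop_add_hom] hom_add[OF cou_add_hom] hom_carrier_add[OF cou_add_hom]
  show "tlift H C C H (%s t. ell s \<otimes>[H] rho t) (cop C c) = cou C c" if "c ::: C" for c
    using that
  proof (induction rule: C_induct)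
    case (elem a x)
    \<comment> \<open>On the coproduct
      \<open>(a \<otimes> x\<^sub>1) \<otimes> (1 \<otimes> x\<^sub>2)\<close> the cointegral is
      \<open>a S(x\<^sub>1) x\<^sub>2 = \<epsilon>(x) a\<close>.\<close>
    have "lift H (%u v. (a \<otimes>[H] S u) \<otimes>[H] v) (comult H x) = counit H x \<odot>[H] a"
      using elem antipode_left[OF elem(2)] lift_left_mult[OF bil_S_left elem]
      by (simp add: H.m_assoc S_closed mult_smult_one counit_closed)
    then show ?case
      using elem by (simp add: lift_cop_te[OF b] cou_te ell_te rho_te counit_one)
  qed (simp add: ch bal.lift_add[OF b])
  fix x y assume x: "x ::: C" and y: "y ::: C"
  have b1: "bal H C C C (%u v. u \<triangleleft>[C] (ell v \<otimes>[H] rho y))"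
    by (rule balI)
       (use y in "simp_all add: cb.right_module_axioms hopf_bimodule C_abelian ell_rho cb.ract_closed cb.ract_add_left
          cb.ract_add_right H.l_distr ell_lact cb.ract_assoc[symmetric] H.m_assoc")
  have b2: "bal H C C C (%u v. (ell x \<otimes>[H] rho u) \<triangleright>[C] v)"
    by (rule balI)
       (use x in "simp_all add: cb.right_module_axioms hopf_bimodule C_abelian ell_rho cb.lact_closed cb.lact_add_left
          cb.lact_add_right H.r_distr rho_ract cb.lact_assoc[symmetric] H.m_assoc")
  \<comment> \<open>Both sides of the colinearity condition are shown to equal (ell x \<otimes> 1)
    acted on by rho y. For this side, with x = a \<otimes> b, the identity
    \<open>antipode_coaction\<close> evaluates
    \<open>(1 \<otimes> b\<^sub>1) S(b\<^sub>2)\<close>.\<close>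
  have "tlift H C C C (%u v. u \<triangleleft>[C] (ell v \<otimes>[H] rho y)) (cop C x) = te (ell x) \<one>[H] \<triangleleft>[C] rho y"
    using x
  proof (induction rule: C_induct)
    case (elem a b)
    have ry: "rho y ::: H" using y by (simp add: ell_rho)
    have h: "(%t. a \<triangleright>[C] (t \<triangleleft>[C] rho y)) \<in> add_hom C C"
      by (rule add_homI) (use elem ry in "simp_all add: cb.ract_closed cb.ract_add_left cb.lact_closed cb.lact_add_right")
    have bi: "bil C (%b1 b2. te \<one>[H] b1 \<triangleleft>[C] S b2)"
      by (rule bilI) (simp_all add: C_abelian te_rules' S_rules cb.ract_closed cb.ract_add_left cb.ract_add_right te_ract_smult)
    have "lift C (%u v. te a u \<triangleleft>[C] (S v \<otimes>[H] rho y)) (comult H b)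
      = lift C (%u v. a \<triangleright>[C] ((te \<one>[H] u \<triangleleft>[C] S v) \<triangleleft>[C] rho y)) (comult H b)"
      using elem ry by (simp add: cb.lact_ract[symmetric] te_rules' S_closed lact_te cb.ract_closed cb.ract_assoc)
    also have "... = a \<triangleright>[C] (te (S b) \<one>[H] \<triangleleft>[C] rho y)"
      using lift_additive[OF bi h C_abelian elem(2)] antipode_coaction[OF elem(2)] by simp
    also have "... = te (ell (te a b)) \<one>[H] \<triangleleft>[C] rho y"
      using elem ry by (simp add: cb.lact_ract[symmetric] te_rules' S_closed lact_te ell_te)
    finally show ?case
      using elem by (simp add: lift_cop_te[OF b1] ell_te S_closed)
  next
    case (add s t)
    then show ?case
      using y by (simp add: ch bal.lift_add[OF b1] ell_rho te_rules' cb.ract_add_left)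
  qed
  \<comment> \<open>With y = c \<otimes> d this half unfolds the diagonal action of \<epsilon>(c) d
    on ell x \<otimes> 1.\<close>
  also have "... = tlift H C C C (%u v. (ell x \<otimes>[H] rho u) \<triangleright>[C] v) (cop C y)"
    using y
  proof (induction rule: C_induct)
    case (elem c d)
    have ex: "ell x ::: H" using x by (simp add: ell_rho)
    have bt: "bil C (%u v. te (ell x \<otimes>[H] u) v)"
      by (rule bilI) (use ex in "simp_all add: C_abelian te_rules' H.r_distr smult_mult_right")
    have "te (ell x) \<one>[H] \<triangleleft>[C] (counit H c \<odot>[H] d) = lift C (%u v. te (ell x \<otimes>[H] (counit H c \<odot>[H] u)) v) (comult H d)"
      using elem ex by (simp add: ract_te counit_closed lift_smult[OF bt])
    then show ?case
      using elem ex by (simp add: lift_cop_te[OF b2] rho_te lact_te counit_closed)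
  next
    case (add s t)
    then show ?case
      using x by (simp add: ch bal.lift_add[OF b2] ell_rho te_rules' cb.ract_add_right)
  qed
  finally show "tlift H C C C (%u v. u \<triangleleft>[C] (ell v \<otimes>[H] rho y)) (cop C x)
    = tlift H C C C (%u v. (ell x \<otimes>[H] rho u) \<triangleright>[C] v) (cop C y)" .
qed

end

section \<open>Hopf modules\<close>

definition rmod_category :: "('r, 'p) ring_scheme => (('r, 'v) right_mod, 'v => 'v) category" where
  "rmod_category R = \<lparr>Ob = {N. right_module R N},
     Ar = (%M N. right_hom R M N \<inter> extensional (carrier M)),
     Idn = (%M. \<lambda>x\<in>carrier M. x),
     Cmp = (%M N P g f. compose (carrier M) g f)\<rparr>"

lemma rmod_category: "is_category (rmod_category R)"
  unfolding rmod_category_def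
  by (rule concrete_category) (auto simp: right_hom_id right_hom_compose dest: right_homD(2))

text \<open>The common frame for both kinds of Hopf modules: \<open>E X\<close> is the submodule of
  coinvariants or invariants, and the functor restricts maps to it. What has to be supplied is that
  linear maps between these submodules extend uniquely, and that every \<open>R\<close>-module is
  isomorphic to some \<open>E X\<close>.\<close>

lemma submodule_ff_es:
  fixes B :: "'o set" and S :: "'o => 'o => ('v => 'v) set" and U :: "'o => 'v set" and E :: "'o => ('r, 'v) right_mod"
  defines "\<C> \<equiv> \<lparr>Ob = B, Ar = (%X Y. S X Y \<inter> extensional (U X)), Idn = (%X. \<lambda>x\<in>U X. x),
    Cmp = (%X Y Z g f. compose (U X) g f)\<rparr>"
  assumes cat: "is_category \<C>"
    and cong: "\<And>X Y f g. [|X \<in> B; Y \<in> B; f \<in> S X Y; \<And>x. x \<in> U X ==> g x = f x|] ==> g \<in> S X Y"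
    and E: "\<And>X. X \<in> B ==> right_module R (E X)" "\<And>X. X \<in> B ==> carrier (E X) \<subseteq> U X"
    and hom: "\<And>X Y f. [|X \<in> B; Y \<in> B; f \<in> S X Y|] ==> f \<in> right_hom R (E X) (E Y)"
    and faithful: "\<And>X Y f g x. [|X \<in> B; Y \<in> B; f \<in> S X Y; g \<in> S X Y; \<And>x. x ::: (E X) ==> f x = g x; x \<in> U X|] ==> f x = g x"
    and full: "\<And>X Y h. [|X \<in> B; Y \<in> B; h \<in> right_hom R (E X) (E Y)|] ==> \<exists>f\<in>S X Y. \<forall>x\<in>carrier (E X). f x = h x"
    and surj: "\<And>N :: ('r, 'v) right_mod. right_module R N ==> \<exists>X\<in>B. \<exists>\<theta>\<in>right_hom R N (E X). bij_betw \<theta> (carrier N) (carrier (E X))"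
  shows "ff_es_functor \<C> (rmod_category R) \<lparr>Fob = E, Far = (%X Y f. restrict f (carrier (E X)))\<rparr>"
proof (intro ff_es_functor.intro is_functor.intro cat rmod_category)
  let ?F = "\<lparr>Fob = E, Far = (%X Y f. restrict f (carrier (E X)))\<rparr>"
  show "is_functor_axioms \<C> (rmod_category R) ?F"
  proof
    fix X Y f assume o: "X \<in> Ob \<C>" "Y \<in> Ob \<C>" and f: "f \<in> Ar \<C> X Y"
    then have "f \<in> right_hom R (E X) (E Y)" "right_module R (E X)" by (simp_all add: \<C>_def hom E)
    then show "Far ?F X Y f \<in> Ar (rmod_category R) (Fob ?F X) (Fob ?F Y)"
      using right_hom_cong[of f R "E X" "E Y" "restrict f (carrier (E X))"] by (simp add: rmod_category_def)
  next
    fix X Y Z f g assume "X \<in> Ob \<C>" "Y \<in> Ob \<C>" "Z \<in> Ob \<C>" "f \<in> Ar \<C> X Y" "g \<in> Ar \<C> Y Z"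
    then show "Far ?F X Z (Cmp \<C> X Y Z g f) = Cmp (rmod_category R) (Fob ?F X) (Fob ?F Y) (Fob ?F Z) (Far ?F Y Z g) (Far ?F X Y f)"
      using E(2)[of X] right_homD(2)[OF hom, of X Y f]
      by (auto simp: \<C>_def rmod_category_def compose_def restrict_def fun_eq_iff)
  qed (use E in "auto simp: \<C>_def rmod_category_def restrict_def fun_eq_iff")
  show "ff_es_functor_axioms \<C> (rmod_category R) ?F"
  proof
    fix X Y f g assume o: "X \<in> Ob \<C>" "Y \<in> Ob \<C>" and fg: "f \<in> Ar \<C> X Y" "g \<in> Ar \<C> X Y" "Far ?F X Y f = Far ?F X Y g"
    have e: "f x = g x" if "x ::: (E X)" for x
      using fun_cong[OF fg(3), of x] that by simp
    show "f = g"
      by (rule extensionalityI[of _ "U X"]) (use o fg(1,2) faithful[of X Y f g, OF _ _ _ _ e] in "simp_all add: \<C>_def")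
  next
    fix X Y h assume o: "X \<in> Ob \<C>" "Y \<in> Ob \<C>" and h: "h \<in> Ar (rmod_category R) (Fob ?F X) (Fob ?F Y)"
    then have hh: "h \<in> right_hom R (E X) (E Y)" "h \<in> extensional (carrier (E X))" and o': "X \<in> B" "Y \<in> B"
      by (simp_all add: rmod_category_def \<C>_def)
    from full[OF o' hh(1)] obtain f where f: "f \<in> S X Y" "\<And>x. x ::: (E X) ==> f x = h x" by blast
    have "restrict f (U X) \<in> Ar \<C> X Y"
      using cong[OF o' f(1)] by (simp add: \<C>_def)
    moreover have "Far ?F X Y (restrict f (U X)) = h"
      by (rule extensionalityI[OF _ hh(2)]) (use E(2)[OF o'(1)] f(2) in auto)
    ultimately show "\<exists>f\<in>Ar \<C> X Y. Far ?F X Y f = h" by blast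
  next
    fix N :: "('r, 'v) right_mod" assume "N \<in> Ob (rmod_category R)"
    then have N: "right_module R N" by (simp add: rmod_category_def)
    from surj[OF N] obtain X \<theta> where X: "X \<in> B" and \<theta>: "\<theta> \<in> right_hom R N (E X)" "bij_betw \<theta> (carrier N) (carrier (E X))"
      by blast
    let ?k = "inv_into (carrier N) \<theta>"
    have k: "?k y ::: N" "\<theta> (?k y) = y" if "y ::: (E X)" for y
      using that \<theta>(2) by (auto simp: bij_betw_def inv_into_into f_inv_into_f)
    have k2: "?k (\<theta> x) = x" if "x ::: N" for x
      using that \<theta>(2) by (simp add: bij_betw_def)
    have kr: "?k \<in> right_hom R (E X) N"
      by (rule right_hom_inverse[OF \<theta>(1) N E(1)[OF X]]) (use k k2 in simp_all)
    have "restrict ?k (carrier (E X)) \<in> isos (rmod_category R) (E X) N"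
      unfolding rmod_category_def
      by (rule concrete_isos[where U=carrier and g="restrict \<theta> (carrier N)"])
         (use right_hom_cong[OF kr E(1)[OF X]] right_hom_cong[OF \<theta>(1) N] k k2 right_homD(2)[OF \<theta>(1)] in simp_all)
    then show "\<exists>X\<in>Ob \<C>. isos (rmod_category R) (Fob ?F X) N \<noteq> {}"
      using X by (auto simp: \<C>_def)
  qed
qed

definition sub_module ::
    "('r, 'h, 'z) bialgebra_scheme => ('h, 'm, 's) right_mod_scheme => 'm set => ('r, 'm) right_mod" where
  "sub_module H M X = \<lparr>carrier = X, monoid.mult = undefined, one = undefined,
     ring.zero = ring.zero M, add = add M, ract = (%x r. x \<triangleleft>[M] (r \<odot>[H] \<one>[H]))\<rparr>"

lemma sub_module_simps [simp]:
  fixes M :: "('h, 'm, 's) right_mod_scheme"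
  shows "carrier (sub_module H M X) = X" "add (sub_module H M X) = add M" "ring.zero (sub_module H M X) = ring.zero M"
    "x \<triangleleft>[sub_module H M X] r = x \<triangleleft>[M] (r \<odot>[H] \<one>[H])"
  by (simp_all add: sub_module_def)

context bialgebra_module
begin

abbreviation "liftM P \<phi> t \<equiv> tlift R (restrict_scalars H M) (under_coalgebra H) P \<phi> t"
abbreviation "balM P \<phi> \<equiv> bal R (restrict_scalars H M) (under_coalgebra H) P \<phi>"

text \<open>Negatives come from the scalars, since -x is \<open>x\<close> acted on by (-1) 1;
  closure under negation is thus part of closure under the action.\<close>

lemma sub_module_right_module:
  assumes "X \<subseteq> carrier M" "\<zero>[M] \<in> X" "\<And>x y. [|x \<in> X; y \<in> X|] ==> x \<oplus>[M] y \<in> X"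
    and ract: "\<And>x r. [|x \<in> X; r ::: R|] ==> x \<triangleleft>[M] (r \<odot>[H] \<one>[H]) \<in> X"
  shows "right_module R (sub_module H M X)"
proof -
  have sub: "x \<in> X ==> x ::: M" for x using assms(1) by blast
  show ?thesis
  proof (rule right_moduleI)
    show "abelian_group (sub_module H M X)"
    proof (rule abelian_groupI)
      fix x assume "x ::: (sub_module H M X)"
      then have x: "x \<in> X" by simp
      have z: "x \<triangleleft>[MR] \<zero> = \<zero>[M]"
      proof -
        have "(%r. x \<triangleleft>[MR] r) \<in> add_hom R MR"
          by (rule add_homI) (use sub[OF x] MR.ract_closed[of x] MR.ract_add_right[of x] in simp_all)
        from hom_zero[OF this _ MR.M.abelian_group_axioms] show ?thesis by (simp add: R.is_abelian_group)
      qed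
      have "x \<triangleleft>[MR] (\<ominus> \<one>) \<oplus>[MR] x \<triangleleft>[MR] \<one> = x \<triangleleft>[MR] (\<ominus> \<one> \<oplus> \<one>)"
        using MR.ract_add_right[of x "\<ominus> \<one>" \<one>] sub[OF x] by simp
      then have "x \<triangleleft>[M] ((\<ominus> \<one>) \<odot>[H] \<one>[H]) \<oplus>[M] x = \<zero>[M]"
        using z MR.ract_one[of x] sub[OF x] by (simp add: R.l_neg)
      then show "\<exists>y\<in>carrier (sub_module H M X). y \<oplus>[sub_module H M X] x = \<zero>[sub_module H M X]"
        using ract[OF x, of "\<ominus> \<one>"] by auto
    qed (use assms(2,3) sub in "simp_all add: M.M.a_ac")
    fix x a b assume "x ::: (sub_module H M X)" "a ::: R" "b ::: R"
    then show "x \<triangleleft>[sub_module H M X] (a \<otimes> b) = (x \<triangleleft>[sub_module H M X] a) \<triangleleft>[sub_module H M X] b"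
      using MR.ract_assoc[of x a b] sub by simp
  qed (use ract sub in "simp_all add: R.ring_axioms M.ract_add_left M.ract_add_right M.ract_one smult_l_distr")
qed

lemma lift_act_bal:
  assumes "balM P \<psi>" "u ::: HH"
  shows "balM P (%m h. lift P (%x y. \<psi> (m \<triangleleft>[M] x) (h \<otimes>[H] y)) u)"
    and "[|m ::: M; h ::: H|] ==> bil P (%x y. \<psi> (m \<triangleleft>[M] x) (h \<otimes>[H] y))"
proof -
  interpret bal R MR HR P \<psi> by fact
  have \<psi>: "\<psi> m h ::: P" "\<psi> (m \<oplus>[M] m') h = \<psi> m h \<oplus>[P] \<psi> m' h" "\<psi> m (h \<oplus>[H] h') = \<psi> m h \<oplus>[P] \<psi> m h'"
    "r ::: R ==> \<psi> (m \<triangleleft>[M] (r \<odot>[H] \<one>[H])) h = \<psi> m (r \<odot>[H] h)"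
    if "m ::: M" "m' ::: M" "h ::: H" "h' ::: H" for m m' h h' r
    using that bal_closed[of m h] bal_add_left[of m m' h] bal_add_right[of m h h'] bal_balanced[of m r h] by simp_all
  have r: "\<psi> (m \<triangleleft>[M] (r \<odot>[H] x)) h = \<psi> (m \<triangleleft>[M] x) (r \<odot>[H] h)"
    if "m ::: M" "x ::: H" "r ::: R" "h ::: H" for m x r h
    using that by (simp only: ract_smult[of m r x] \<psi>(4)[OF M.ract_closed _ _ H.one_closed] M.ract_closed)
  show b: "bil P (%x y. \<psi> (m \<triangleleft>[M] x) (h \<otimes>[H] y))" if "m ::: M" "h ::: H" for m h
    by (rule bilI) (use that in "simp_all add: P.abelian_group_axioms \<psi> M.ract_closed M.ract_add_right H.r_distr r smult_mult_right")
  have b': "balM P (%m h. \<psi> (m \<triangleleft>[M] x) (h \<otimes>[H] y))" if "x ::: H" "y ::: H" for x y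
    by (rule balMI)
       (use that in "simp_all add: P.abelian_group_axioms \<psi> M.ract_closed M.ract_add_left H.l_distr ract_smult_one r smult_mult_left")
  show "balM P (%m h. lift P (%x y. \<psi> (m \<triangleleft>[M] x) (h \<otimes>[H] y)) u)"
    using bal.bal_lift_param[OF b[OF M.M.zero_closed H_zero], of R MR HR P "%x y m h. \<psi> (m \<triangleleft>[M] x) (h \<otimes>[H] y)" u]
      b b' assms(2) by simp
qed

lemma lift_act:
  assumes "balM P \<psi>" "t ::: MH" "u ::: HH"
  shows "liftM P \<psi> (act t u) = liftM P (%m h. lift P (%x y. \<psi> (m \<triangleleft>[M] x) (h \<otimes>[H] y)) u) t"
  using assms(2)
proof (induction rule: T.tensor_induct)
  case (elem m h)
  then show ?case
    using bal.lift_elem[OF lift_act_bal(1)[OF assms(1,3)], of m h] by (simp add: lift_act_elem[OF assms(1) _ _ assms(3)])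
qed (use assms in "simp add: act_add_left act_closed bal.lift_add[OF assms(1)] bal.lift_add[OF lift_act_bal(1)[OF assms(1,3)]]")

lemma act_lift: "[|t ::: MH; u ::: HH|] ==> liftM MH (%m h. act (tm m h) u) t = act t u"
  using T.lift_telem[of t] bal.lift_additive[OF T.telem_bal act_hom_left T.tensor_abelian_group, of u t] by simp

end

subsection \<open>Hopf modules and their coinvariants\<close>

lemma restrict_comod_simps [simp]:
  fixes M :: "('h, 'm, 'h) comod"
  shows "carrier (restrict_comod H M) = carrier M" "add (restrict_comod H M) = add M"
    "ring.zero (restrict_comod H M) = ring.zero M" "x \<triangleleft>[restrict_comod H M] r = x \<triangleleft>[M] (r \<odot>[H] \<one>[H])"
    "coact (restrict_comod H M) = coact M"
  by (simp_all add: restrict_comod_def right_mod.extend_def restrict_scalars_def)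

lemma tensor_restrict_comod [simp]:
  fixes M :: "('h, 'm, 'h) comod"
  shows "telem R (restrict_comod H M) N = telem R (restrict_scalars H M) N"
    "tgroup R (restrict_comod H M) N = tgroup R (restrict_scalars H M) N"
    "tlift R (restrict_comod H M) N P \<phi> t = tlift R (restrict_scalars H M) N P \<phi> t"
proof -
  have r: "tensor_relations R (restrict_comod H M) N = tensor_relations R (restrict_scalars H M) N"
    by (rule tensor_relations_cong) simp_all
  show "telem R (restrict_comod H M) N = telem R (restrict_scalars H M) N"
    "tgroup R (restrict_comod H M) N = tgroup R (restrict_scalars H M) N"
    "tlift R (restrict_comod H M) N P \<phi> t = tlift R (restrict_scalars H M) N P \<phi> t"
    using telem_cong[OF _ _ r] tensor_group_cong(2)[OF _ _ r] tlift_module_cong[OF _ _ r] by simp_all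
qed

lemma (in is_bialgebra) lift_comult_smult_one:
  assumes "bil P \<psi>" "r ::: R"
  shows "lift P \<psi> (comult H (r \<odot>[H] \<one>[H])) = \<psi> (r \<odot>[H] \<one>[H]) \<one>[H]"
proof -
  have "bil P (%x y. \<psi> (r \<odot>[H] x) y)"
    by (rule bilI) (use assms(2) in "simp_all add: bilD[OF assms(1)] smult_r_distr smult_lcomm")
  then show ?thesis
    using assms by (simp add: lift_smult lift_comult_one)
qed

locale antipode_hopf_module = antipode R H S + M: hopf_module R H M
  for R :: "('r, 'p) ring_scheme" (structure) and H :: "('r, 'h, 'z) bialgebra_scheme" and S
    and M :: "('h, 'm, 'h) comod"
begin

sublocale bialgebra_module R H M
  by (intro bialgebra_module.intro is_bialgebra_axioms M.right_module_axioms)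

sublocale cm: coring_comodule R HR "restrict_comod H M"
  by (intro coring_comodule.intro co.is_coring_axioms M.comodule)

lemma triMI:
  assumes "abelian_group P"
    and "\<And>x y z. [|x ::: M; y ::: H; z ::: H|] ==> \<phi> x y z ::: P"
    and "\<And>x x' y z. [|x ::: M; x' ::: M; y ::: H; z ::: H|]
      ==> \<phi> (x \<oplus>[M] x') y z = \<phi> x y z \<oplus>[P] \<phi> x' y z"
    and "\<And>x y y' z. [|x ::: M; y ::: H; y' ::: H; z ::: H|]
      ==> \<phi> x (y \<oplus>[H] y') z = \<phi> x y z \<oplus>[P] \<phi> x y' z"
    and "\<And>x y z z'. [|x ::: M; y ::: H; z ::: H; z' ::: H|]
      ==> \<phi> x y (z \<oplus>[H] z') = \<phi> x y z \<oplus>[P] \<phi> x y z'"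
    and "\<And>x a y z. [|x ::: M; a ::: R; y ::: H; z ::: H|] ==> \<phi> (x \<triangleleft>[M] (a \<odot>[H] \<one>[H])) y z = \<phi> x (a \<odot>[H] y) z"
    and "\<And>x y a z. [|x ::: M; y ::: H; a ::: R; z ::: H|] ==> \<phi> x (a \<odot>[H] y) z = \<phi> x y (a \<odot>[H] z)"
  shows "trilin R (restrict_comod H M) HR HR P \<phi>"
  by (rule trilinI) (simp_all add: assms cm.right_module_axioms co.bimodule_axioms)

lemma coact_closed: "m ::: M ==> coact M m ::: MH"
  using cm.co_closed[of m] by simp

lemma coact_add: "[|m ::: M; n ::: M|] ==> coact M (m \<oplus>[M] n) = coact M m \<oplus>[MH] coact M n"
  using cm.co_add[of m n] by simp

lemma coact_add_hom: "coact M \<in> add_hom M MH"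
  by (rule add_homI) (simp_all add: coact_closed coact_add)

lemma coact_coassoc: "[|trilin R (restrict_comod H M) HR HR P \<phi>; m ::: M|]
    ==> liftM P (%y c. liftM P (%u v. \<phi> u v c) (coact M y)) (coact M m) = liftM P (%y c. lift P (\<phi> y) (comult H c)) (coact M m)"
  using cm.co_coassoc[of P \<phi> m] by simp

lemma coact_counit: "[|h \<in> add_hom M P; abelian_group P; m ::: M|]
    ==> liftM P (%y c. h (y \<triangleleft>[M] (counit H c \<odot>[H] \<one>[H]))) (coact M m) = h m"
  using cm.co_counit[of h P m] by (simp add: hom_def)

lemma liftM_coact_ract: "[|balM P \<phi>; m ::: M; b ::: H|]
    ==> liftM P \<phi> (coact M (m \<triangleleft>[M] b)) = liftM P (%u v. lift P (%x y. \<phi> (u \<triangleleft>[M] x) (v \<otimes>[H] y)) (comult H b)) (coact M m)"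
  by (simp add: M.compatible lift_act coact_closed comult_closed)

lemma M_hom_left: "b ::: H ==> (%m. m \<triangleleft>[M] b) \<in> add_hom M M"
  and M_hom_right: "m ::: M ==> (%b. m \<triangleleft>[M] b) \<in> add_hom H M"
  by (rule add_homI; simp add: M.ract_closed M.ract_add_left M.ract_add_right)+

lemmas M_rules = M.ract_closed M.ract_add_left M.ract_add_right M.M.abelian_group_axioms

definition coinv :: "'m set" where
  "coinv = {m \<in> carrier M. coact M m = tm m \<one>[H]}"

text \<open>\<open>proj m = m\<^sub>0 S(m\<^sub>1)\<close> is the projection onto the coinvariants.\<close>

definition proj :: "'m => 'm" where
  "proj m = liftM M (%u v. u \<triangleleft>[M] S v) (coact M m)"

lemma proj_bal: "balM M (%u v. u \<triangleleft>[M] S v)"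
  by (rule balMI) (simp_all add: M_rules S_rules ract_smult_one)

lemma proj_closed: "m ::: M ==> proj m ::: M"
  and proj_add: "[|m ::: M; n ::: M|] ==> proj (m \<oplus>[M] n) = proj m \<oplus>[M] proj n"
  by (simp_all add: proj_def coact_add coact_closed bal.lift_closed[OF proj_bal] bal.lift_add[OF proj_bal])

lemma proj_coinvariant: "m \<in> coinv ==> proj m = m"
  using bal.lift_elem[OF proj_bal, of m "\<one>[H]"] by (simp add: proj_def coinv_def S_one M.ract_one)

text \<open>\<open>m\<^sub>0 b\<^sub>1 S(m\<^sub>1 b\<^sub>2) = m\<^sub>0 S(m\<^sub>1)
  \<epsilon>(b)\<close>, by \<open>antipode_mult_right\<close> inside the sum over the
  coaction.\<close>

lemma proj_ract:
  assumes m: "m ::: M" and b: "b ::: H"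
  shows "proj (m \<triangleleft>[M] b) = proj m \<triangleleft>[M] (counit H b \<odot>[H] \<one>[H])"
proof -
  have bi: "bil H (%x y. x \<otimes>[H] S (v \<otimes>[H] y))" if "v ::: H" for v
    by (rule bilI) (use that in "simp_all add: H_abelian H_rules")
  have "proj (m \<triangleleft>[M] b) = liftM M (%u v. lift M (%x y. (u \<triangleleft>[M] x) \<triangleleft>[M] S (v \<otimes>[H] y)) (comult H b)) (coact M m)"
    by (simp add: proj_def liftM_coact_ract[OF proj_bal m b])
  also have "... = liftM M (%u v. (u \<triangleleft>[M] S v) \<triangleleft>[M] (counit H b \<odot>[H] \<one>[H])) (coact M m)"
  proof (rule lift_cong)
    fix u v assume "u ::: MR" "v ::: HR"
    then have uv: "u ::: M" "v ::: H" by simp_all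
    have "lift M (%x y. (u \<triangleleft>[M] x) \<triangleleft>[M] S (v \<otimes>[H] y)) (comult H b)
      = lift M (%x y. u \<triangleleft>[M] (x \<otimes>[H] S (v \<otimes>[H] y))) (comult H b)"
      by (rule lift_cong) (use uv in "simp add: M.ract_assoc S_closed")
    also have "... = u \<triangleleft>[M] (counit H b \<odot>[H] S v)"
      using lift_additive[OF bi M_hom_right M.M.abelian_group_axioms b] uv by (simp add: antipode_mult_right b)
    finally show "lift M (%x y. (u \<triangleleft>[M] x) \<triangleleft>[M] S (v \<otimes>[H] y)) (comult H b) = (u \<triangleleft>[M] S v) \<triangleleft>[M] (counit H b \<odot>[H] \<one>[H])"
      using ract_smult[of u "counit H b" "S v"] uv b by (simp add: counit_closed S_closed)
  qed
  also have "... = proj m \<triangleleft>[M] (counit H b \<odot>[H] \<one>[H])"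
    using bal.lift_additive[OF proj_bal M_hom_left M.M.abelian_group_axioms coact_closed[OF m], of "counit H b \<odot>[H] \<one>[H]"] b
    by (simp add: proj_def counit_closed)
  finally show ?thesis .
qed

text \<open>\<open>m\<^sub>0 S(m\<^sub>1) m\<^sub>2 = m\<^sub>0 \<epsilon>(m\<^sub>1) = m\<close>.
  So every element is a sum of products of coinvariants with elements of \<open>H\<close>, the
  surjectivity half of the structure theorem for Hopf modules.\<close>

lemma proj_decomposition:
  assumes m: "m ::: M"
  shows "liftM M (%u v. proj u \<triangleleft>[M] v) (coact M m) = m"
proof -
  have tri: "trilin R (restrict_comod H M) HR HR M (%p q v. p \<triangleleft>[M] (S q \<otimes>[H] v))"
    by (rule triMI) (simp_all add: M_rules H_rules ract_smult_one)
  have "liftM M (%u v. proj u \<triangleleft>[M] v) (coact M m) = liftM M (%u v. liftM M (%p q. p \<triangleleft>[M] (S q \<otimes>[H] v)) (coact M u)) (coact M m)"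
  proof (rule lift_cong)
    fix u v assume "u ::: MR" "v ::: HR"
    then have uv: "u ::: M" "v ::: H" by simp_all
    have "proj u \<triangleleft>[M] v = liftM M (%p q. (p \<triangleleft>[M] S q) \<triangleleft>[M] v) (coact M u)"
      unfolding proj_def by (rule bal.lift_additive[OF proj_bal M_hom_left[OF uv(2)] M.M.abelian_group_axioms coact_closed[OF uv(1)]])
    then show "proj u \<triangleleft>[M] v = liftM M (%p q. p \<triangleleft>[M] (S q \<otimes>[H] v)) (coact M u)"
      using uv by (simp add: M.ract_assoc S_closed)
  qed
  also have "... = liftM M (%p z. lift M (%q v. p \<triangleleft>[M] (S q \<otimes>[H] v)) (comult H z)) (coact M m)"
    by (rule coact_coassoc[OF tri m])
  also have "... = liftM M (%p z. p \<triangleleft>[M] (counit H z \<odot>[H] \<one>[H])) (coact M m)"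
    by (rule lift_cong)
       (use lift_additive[OF bil_S_left M_hom_right M.M.abelian_group_axioms] in "simp add: antipode_left")
  also have "... = m"
    by (rule coact_counit[OF _ M.M.abelian_group_axioms m, where h="%x. x"], rule add_homI) simp_all
  finally show ?thesis .
qed

text \<open>The identity \<open>antipode_coaction\<close> is carried from
  \<open>H \<otimes>\<^sub>R H\<close> to \<open>M \<otimes>\<^sub>R H\<close> along a \<otimes> b
  \<mapsto> x a \<otimes> b, which respects the diagonal actions.\<close>

lemma antipode_coaction_module:
  assumes x: "x ::: M" and z: "z ::: H"
  shows "lift MH (%y v. act (tm x y) (comult H (S v))) (comult H z) = tm (x \<triangleleft>[M] S z) \<one>[H]"
proof -
  define \<Theta> where "\<Theta> t = lift MH (%a b. tm (x \<triangleleft>[M] a) b) t" for t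
  have b\<Theta>: "bil MH (%a b. tm (x \<triangleleft>[M] a) b)"
    by (rule bilI) (use x in "simp_all add: T.tensor_abelian_group tm_rules M_rules tm_ract_smult")
  have \<Theta>h: "\<Theta> \<in> add_hom C MH"
    unfolding \<Theta>_def
    by (rule add_homI) (simp_all add: bal.lift_closed[OF b\<Theta>] bal.lift_add[OF b\<Theta>] hopf_coring_simps hopf_bimod_simps)
  have bi: "bil C (%y v. te \<one>[H] y \<triangleleft>[C] S v)"
    by (rule bilI) (simp_all add: C_abelian te_rules' S_rules cb.ract_closed cb.ract_add_left cb.ract_add_right te_ract_smult)
  have "lift MH (%y v. act (tm x y) (comult H (S v))) (comult H z) = lift MH (%y v. \<Theta> (te \<one>[H] y \<triangleleft>[C] S v)) (comult H z)"
  proof (rule lift_cong)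
    fix y v assume "y ::: HR" "v ::: HR"
    then have yv: "y ::: H" "v ::: H" by simp_all
    have "te \<one>[H] y \<triangleleft>[C] S v = tact (te \<one>[H] y) (comult H (S v))"
      by (simp add: hopf_coring_simps hopf_bimod_simps)
    then show "act (tm x y) (comult H (S v)) = \<Theta> (te \<one>[H] y \<triangleleft>[C] S v)"
      using yv x by (simp add: \<Theta>_def lift_tact_elem[OF b\<Theta>] comult_closed S_closed act_elem)
  qed
  also have "... = \<Theta> (te (S z) \<one>[H])"
    using lift_additive[OF bi \<Theta>h T.tensor_abelian_group z] by (simp add: antipode_coaction z)
  also have "... = tm (x \<triangleleft>[M] S z) \<one>[H]"
    using bal.lift_elem[OF b\<Theta>, of "S z" "\<one>[H]"] z by (simp add: \<Theta>_def S_closed)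
  finally show ?thesis .
qed

text \<open>By compatibility the coaction of \<open>m\<^sub>0 S(m\<^sub>1)\<close> is
  \<open>(m\<^sub>0 \<otimes> m\<^sub>1) \<Delta>(S(m\<^sub>2))\<close>, and
  \<open>antipode_coaction_module\<close> reduces it to
  \<open>m\<^sub>0 S(m\<^sub>1) \<otimes> 1\<close>.\<close>

lemma proj_coinv:
  assumes m: "m ::: M"
  shows "proj m \<in> coinv"
proof -
  have cs: "comult H (S (x \<oplus>[H] y)) = comult H (S x) \<oplus>[HH] comult H (S y)" if "x ::: H" "y ::: H" for x y
    using that co.cop_add[of "S x" "S y"] by (simp add: S_rules)
  \<comment> \<open>Needed for balancedness in the last two places: a scalar passes from the tensor
    to the acting element as r 1, whose coproduct is r 1 \<otimes> 1.\<close>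
  have ar: "act (tm x (r \<odot>[H] y)) (comult H (S z)) = act (tm x y) (comult H (S (r \<odot>[H] z)))"
    if "x ::: M" "y ::: H" "z ::: H" "r ::: R" for x y z r
  proof -
    have "act (tm x y) (comult H (r \<odot>[H] S z)) = act (act (tm x y) (comult H (r \<odot>[H] \<one>[H]))) (comult H (S z))"
      using that act_mult[of "tm x y" "r \<odot>[H] \<one>[H]" "S z"] by (simp add: tm_closed S_closed smult_one_mult)
    also have "act (tm x y) (comult H (r \<odot>[H] \<one>[H])) = tm x (r \<odot>[H] y)"
      using that by (simp add: act_elem comult_closed lift_comult_smult_one[OF act_inner] tm_balanced mult_smult_one)
    finally show ?thesis using that by (simp add: S_rules)
  qed
  have tri: "trilin R (restrict_comod H M) HR HR MH (%x y v. act (tm x y) (comult H (S v)))"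
  proof (rule triMI)
    show "act (tm (x \<triangleleft>[M] (r \<odot>[H] \<one>[H])) y) (comult H (S z)) = act (tm x (r \<odot>[H] y)) (comult H (S z))"
      if "x ::: M" "y ::: H" "z ::: H" "r ::: R" for x y z r
      using that by (simp add: tm_balanced)
  qed (simp_all add: T.tensor_abelian_group tm_closed tm_add_left tm_add_right act_closed act_add_left act_add_right comult_closed S_closed cs ar)
  have "coact M (proj m) = liftM MH (%u v. coact M (u \<triangleleft>[M] S v)) (coact M m)"
    unfolding proj_def by (rule bal.lift_additive[OF proj_bal coact_add_hom T.tensor_abelian_group coact_closed[OF m]])
  also have "... = liftM MH (%u v. liftM MH (%x y. act (tm x y) (comult H (S v))) (coact M u)) (coact M m)"
    by (rule lift_cong) (simp add: M.compatible S_closed act_lift coact_closed comult_closed)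
  also have "... = liftM MH (%x z. lift MH (%y v. act (tm x y) (comult H (S v))) (comult H z)) (coact M m)"
    by (rule coact_coassoc[OF tri m])
  also have "... = liftM MH (%x z. tm (x \<triangleleft>[M] S z) \<one>[H]) (coact M m)"
    by (rule lift_cong) (simp add: antipode_coaction_module)
  also have "... = tm (proj m) \<one>[H]"
    unfolding proj_def
    by (rule bal.lift_additive[OF proj_bal _ T.tensor_abelian_group coact_closed[OF m], symmetric], rule add_homI)
       (simp_all add: tm_rules)
  finally show ?thesis using proj_closed[OF m] by (simp add: coinv_def)
qed

lemma coinv_closed: "x \<in> coinv ==> x ::: M" by (simp add: coinv_def)

lemma coinv_module: "right_module R (sub_module H M coinv)"
proof (rule sub_module_right_module)
  have t: "(%x. tm x \<one>[H]) \<in> add_hom M MH" by (rule add_homI) (simp_all add: tm_rules)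
  show "\<zero>[M] \<in> coinv"
    using hom_zero[OF coact_add_hom M.M.abelian_group_axioms T.tensor_abelian_group] hom_zero[OF t M.M.abelian_group_axioms T.tensor_abelian_group]
    by (simp add: coinv_def)
  show "x \<triangleleft>[M] (r \<odot>[H] \<one>[H]) \<in> coinv" if "x \<in> coinv" "r ::: R" for x r
  proof -
    have x: "x ::: M" "coact M x = tm x \<one>[H]" using that(1) by (simp_all add: coinv_def)
    have "coact M (x \<triangleleft>[M] (r \<odot>[H] \<one>[H])) = act (tm x \<one>[H]) (comult H (r \<odot>[H] \<one>[H]))"
      using x that(2) by (simp add: M.compatible)
    also have "... = tm (x \<triangleleft>[M] (r \<odot>[H] \<one>[H])) \<one>[H]"
      using x(1) that(2) lift_comult_smult_one[OF act_inner[OF x(1) H.one_closed] that(2)] by (simp add: act_elem comult_closed)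
    finally show ?thesis using x(1) that(2) by (simp add: coinv_def M.ract_closed)
  qed
  show "x \<oplus>[M] y \<in> coinv" if "x \<in> coinv" "y \<in> coinv" for x y
    using that by (simp add: coinv_def coact_add tm_add_left)
qed (auto simp: coinv_def)

end

section \<open>Maps of Hopf modules and coinvariants\<close>

lemma hopf_hom_coinv:
  assumes "antipode_hopf_module R H S M" "antipode_hopf_module R H S N"
    and f: "f \<in> right_hom H M N" "f \<in> comod_hom R (under_coalgebra H) (restrict_comod H M) (restrict_comod H N)"
  shows "f \<in> right_hom R (sub_module H M (antipode_hopf_module.coinv R H M)) (sub_module H N (antipode_hopf_module.coinv R H N))"
proof -
  interpret M: antipode_hopf_module R H S M by fact
  interpret N: antipode_hopf_module R H S N by fact
  note fD = right_homD[OF f(1)]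
  have b: "M.balM N.MH (%y c. N.tm (f y) c)"
    by (rule M.balMI) (simp_all add: N.T.tensor_abelian_group N.tm_rules fD)
  have "f x \<in> N.coinv" if x: "x \<in> M.coinv" for x
    using comod_homD(2)[OF f(2), of x] x bal.lift_elem[OF b, of x "\<one>[H]"] by (simp add: M.coinv_def N.coinv_def fD)
  then show ?thesis
    by (intro right_homI) (simp_all add: fD M.coinv_closed)
qed

text \<open>By \<open>proj_decomposition\<close> and linearity,
  \<open>f(m) = f(proj m\<^sub>0) m\<^sub>1\<close>, which involves only values at
  coinvariants.\<close>

lemma hopf_hom_eqI:
  assumes "antipode_hopf_module R H S M" "antipode_hopf_module R H S N"
    and "f \<in> right_hom H M N" "g \<in> right_hom H M N"
    and eq: "\<And>x. x \<in> antipode_hopf_module.coinv R H M ==> f x = g x" and m: "m ::: M"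
  shows "f m = g m"
proof -
  interpret M: antipode_hopf_module R H S M by fact
  interpret N: antipode_hopf_module R H S N by fact
  have b: "M.balM M (%u v. M.proj u \<triangleleft>[M] v)"
    by (rule M.balMI) (simp_all add: M.M_rules M.proj_closed M.proj_add M.proj_ract M.counit_rules M.ract_smult_one M.counit_one)
  have "h m = M.liftM N (%u v. h (M.proj u) \<triangleleft>[N] v) (coact M m)" if "h \<in> right_hom H M N" for h
    using bal.lift_additive[OF b right_homD(1)[OF that] N.M.M.abelian_group_axioms M.coact_closed[OF m]]
      right_homD(4)[OF that M.proj_closed]
    by (simp add: M.proj_decomposition m)
  from this[OF assms(3)] this[OF assms(4)] show ?thesis by (simp add: eq M.proj_coinv)
qed

text \<open>The decomposition forces \<open>f(m) = g(proj m\<^sub>0) m\<^sub>1\<close>. Linearity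
  follows from proj (u b) = \<epsilon>(b) proj u, colinearity from the coinvariance of the values of
  \<open>g\<close>.\<close>

lemma hopf_hom_extension:
  assumes "antipode_hopf_module R H S M" "antipode_hopf_module R H S N"
    and g: "g \<in> right_hom R (sub_module H M (antipode_hopf_module.coinv R H M)) (sub_module H N (antipode_hopf_module.coinv R H N))"
  shows "\<exists>f \<in> right_hom H M N \<inter> comod_hom R (under_coalgebra H) (restrict_comod H M) (restrict_comod H N).
    \<forall>x\<in>antipode_hopf_module.coinv R H M. f x = g x"
proof -
  interpret M: antipode_hopf_module R H S M by fact
  interpret N: antipode_hopf_module R H S N by fact
  note gD = right_homD[OF g, simplified]
  define k where "k u = g (M.proj u)" for u
  have kc: "k u \<in> N.coinv" if "u ::: M" for u using that by (simp add: k_def gD M.proj_coinv)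
  have k: "k u ::: N" if "u ::: M" for u using kc[OF that] by (simp add: N.coinv_closed)
  have ka: "k (u \<oplus>[M] v) = k u \<oplus>[N] k v" if "u ::: M" "v ::: M" for u v
    using that by (simp add: k_def gD M.proj_coinv M.proj_add)
  have kr: "k (u \<triangleleft>[M] b) = k u \<triangleleft>[N] (counit H b \<odot>[H] \<one>[H])" if "u ::: M" "b ::: H" for u b
    using that by (simp add: k_def gD M.proj_coinv M.proj_ract M.counit_closed)
  have b: "M.balM N (%u v. k u \<triangleleft>[N] v)"
    by (rule M.balMI) (simp_all add: N.M_rules k ka kr M.counit_rules N.ract_smult_one M.counit_one)
  define f where "f m = M.liftM N (%u v. k u \<triangleleft>[N] v) (coact M m)" for m
  have fc: "f m ::: N" if "m ::: M" for m
    using that by (simp add: f_def bal.lift_closed[OF b] M.coact_closed)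
  have fr: "f \<in> right_hom H M N"
  proof (rule right_homI)
    fix m c assume m: "m ::: M" and c: "c ::: H"
    have "f (m \<triangleleft>[M] c) = M.liftM N (%u v. M.lift N (%x y. k (u \<triangleleft>[M] x) \<triangleleft>[N] (v \<otimes>[H] y)) (comult H c)) (coact M m)"
      by (simp add: f_def M.liftM_coact_ract[OF b m c])
    also have "... = M.liftM N (%u v. (k u \<triangleleft>[N] v) \<triangleleft>[N] c) (coact M m)"
    proof (rule lift_cong)
      fix u v assume "u ::: M.MR" "v ::: M.HR"
      then have uv: "u ::: M" "v ::: H" by simp_all
      have "M.lift N (%x y. k (u \<triangleleft>[M] x) \<triangleleft>[N] (v \<otimes>[H] y)) (comult H c)
        = M.lift N (%x y. k u \<triangleleft>[N] (v \<otimes>[H] (counit H x \<odot>[H] y))) (comult H c)"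
        by (rule lift_cong)
           (use uv in "simp add: kr k M.counit_closed N.ract_smult_one M.smult_mult_right")
      also have "... = k u \<triangleleft>[N] (v \<otimes>[H] c)"
        by (rule M.counit_left[OF _ N.M.M.abelian_group_axioms c, where h="%y. k u \<triangleleft>[N] (v \<otimes>[H] y)"], rule add_homI)
           (use uv in "simp_all add: k N.M_rules M.H.r_distr")
      finally show "M.lift N (%x y. k (u \<triangleleft>[M] x) \<triangleleft>[N] (v \<otimes>[H] y)) (comult H c) = (k u \<triangleleft>[N] v) \<triangleleft>[N] c"
        using uv c by (simp add: N.M.ract_assoc k)
    qed
    also have "... = f m \<triangleleft>[N] c"
      unfolding f_def by (rule bal.lift_additive[OF b N.M_hom_left[OF c] N.M.M.abelian_group_axioms M.coact_closed[OF m], symmetric])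
    finally show "f (m \<triangleleft>[M] c) = f m \<triangleleft>[N] c" .
  qed (simp_all add: f_def M.coact_add M.coact_closed bal.lift_add[OF b] bal.lift_closed[OF b])
  have "f \<in> comod_hom R (under_coalgebra H) (restrict_comod H M) (restrict_comod H N)"
  proof (rule comod_homI)
    show "f \<in> right_hom R (restrict_comod H M) (restrict_comod H N)"
      using right_homD[OF fr] by (intro right_homI) simp_all
    fix m assume "m ::: (restrict_comod H M)"
    then have m: "m ::: M" by simp
    have tri: "trilin R (restrict_comod H M) M.HR M.HR N.MH (%u x y. N.tm (k u \<triangleleft>[N] x) y)"
      by (rule M.triMI)
         (simp_all add: N.T.tensor_abelian_group N.tm_rules N.M_rules k ka kr M.counit_rules M.counit_one N.ract_smult_one N.tm_ract_smult)
    have "coact N (f m) = M.liftM N.MH (%u v. coact N (k u \<triangleleft>[N] v)) (coact M m)"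
      unfolding f_def by (rule bal.lift_additive[OF b N.coact_add_hom N.T.tensor_abelian_group M.coact_closed[OF m]])
    also have "... = M.liftM N.MH (%u v. M.lift N.MH (%x y. N.tm (k u \<triangleleft>[N] x) y) (comult H v)) (coact M m)"
    proof (rule lift_cong)
      fix u v assume "u ::: M.MR" "v ::: M.HR"
      then have uv: "u ::: M" "v ::: H" by simp_all
      \<comment> \<open>As \<open>k u\<close> is coinvariant, compatibility makes the coaction of
        \<open>k u v\<close> equal to \<open>k u v\<^sub>1 \<otimes> v\<^sub>2\<close>, and
        coassociativity regroups the sum.\<close>
      have "coact N (k u) = N.tm (k u) \<one>[H]" using kc[OF uv(1)] by (simp add: N.coinv_def)
      then show "coact N (k u \<triangleleft>[N] v) = M.lift N.MH (%x y. N.tm (k u \<triangleleft>[N] x) y) (comult H v)"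
        using uv by (simp add: N.M.compatible k N.act_elem M.comult_closed)
    qed
    also have "... = M.liftM N.MH (%w y. M.liftM N.MH (%u x. N.tm (k u \<triangleleft>[N] x) y) (coact M w)) (coact M m)"
      by (rule M.coact_coassoc[OF tri m, symmetric])
    also have "... = M.liftM N.MH (%w y. N.tm (f w) y) (coact M m)"
    proof (rule lift_cong)
      fix w y assume "w ::: M.MR" "y ::: M.HR"
      then have wy: "w ::: M" "y ::: H" by simp_all
      have "(%n. N.tm n y) \<in> add_hom N N.MH"
        by (rule add_homI) (use wy in "simp_all add: N.tm_rules")
      from bal.lift_additive[OF b this N.T.tensor_abelian_group M.coact_closed[OF wy(1)]]
      show "M.liftM N.MH (%u x. N.tm (k u \<triangleleft>[N] x) y) (coact M w) = N.tm (f w) y" by (simp add: f_def)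
    qed
    finally show "tlift R (restrict_comod H M) M.HR (tgroup R (restrict_comod H N) M.HR)
        (%y c. telem R (restrict_comod H N) M.HR (f y) c) (coact (restrict_comod H M) m) = coact (restrict_comod H N) (f m)"
      by simp
  qed
  moreover have "f x = g x" if x: "x \<in> M.coinv" for x
    using x bal.lift_elem[OF b, of x "\<one>[H]"]
    by (simp add: f_def M.coinv_def k N.M.ract_one) (simp add: k_def M.proj_coinvariant[OF x])
  ultimately show ?thesis using fr by blast
qed

text \<open>Needed because the scalar action restricted from a transported \<open>H\<close>-action
  agrees with the one carried by the retract only on carriers, so the two structures are not equal
  as records.\<close>

lemma right_comodule_cong:
  assumes "right_comodule A C M" "is_coring A C" "carrier M' = carrier M" "add M' = add M" "ring.zero M' = ring.zero M"
    and ract: "\<And>x a. [|x ::: M; a ::: A|] ==> x \<triangleleft>[M'] a = x \<triangleleft>[M] a"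
    and "coact M' = coact M"
  shows "right_comodule A C M'"
proof -
  interpret right_comodule A C M by fact
  interpret coring_comodule A C M by (intro coring_comodule.intro assms)
  have r1: "tensor_relations A M' C = tensor_relations A M C"
    by (rule tensor_relations_cong) (use assms in simp_all)
  have r2: "tensor_relations A M' (tbimod A C C) = tensor_relations A M (tbimod A C C)"
    by (rule tensor_relations_cong) (use assms in simp_all)
  note e = telem_cong[OF assms(3) refl r1] tensor_group_cong(2)[OF assms(3) refl r1] tlift_module_cong[OF assms(3) refl r1]
    telem_cong[OF assms(3) refl r2] tensor_group_cong(2)[OF assms(3) refl r2]
  have tr: "tright A M' C = tright A M C" by (simp only: tensor_right_def e)
  show ?thesis
  proof (intro right_comodule.intro right_comodule_axioms.intro)
    show "right_module A M'"
      by (rule right_moduleI)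
         (use assms in "simp_all add: ring_axioms abelian_group_transfer[OF M.abelian_group_axioms] ract_closed ract_add_left ract_add_right ract_assoc ract_one")
    show "coact M' \<in> right_hom A M' (tright A M' C)"
      using right_homD[OF coact_hom] by (intro right_homI) (simp_all add: tr assms)
    fix x assume "x ::: M'"
    then have x: "x ::: M" by (simp add: assms)
    show "tensor_assoc A M' C C (tensor_map A M' C (tright A M' C) C (coact M') id (coact M' x))
      = tensor_map A M' C M' (tbimod A C C) id (cop C) (coact M' x)"
      using coact_coassociative[OF x] unfolding tensor_assoc_def tensor_map_def tr e assms(7) .
    have "tlift A M' C M' (%y c. y \<triangleleft>[M'] cou C c) (coact M' x) = tlift A M C M (%y c. y \<triangleleft>[M'] cou C c) (coact M x)"
      unfolding e assms(7) by (simp add: tensor_lift_def hom_def assms(3,4))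
    also have "... = tlift A M C M (%y c. y \<triangleleft>[M] cou C c) (coact M x)"
      by (rule lift_cong) (simp add: ract C.cou_closed)
    finally show "tlift A M' C M' (%y c. y \<triangleleft>[M'] cou C c) (coact M' x) = x"
      using coact_counital[OF x] by simp
  qed
qed

context antipode
begin

text \<open>The \<open>R\<close>-module \<open>N\<close> is the module of coinvariants of \<open>N \<otimes>\<^sub>R H\<close>, which is transported along \<open>\<iota>\<close>.\<close>

lemma hopf_ess_surj:
  fixes N :: "('r, 'n, 's) right_mod_scheme" and \<iota> :: "('n, 'h) tensor => 'v"
  assumes N: "right_module R N" and \<iota>: "inj_on \<iota> (carrier (tgroup R N HR))"
  shows "\<exists>Q :: ('h, 'v, 'h) comod. hopf_module R H Q \<and>
    (\<exists>\<theta>\<in>right_hom R N (sub_module H Q (antipode_hopf_module.coinv R H Q)).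
      bij_betw \<theta> (carrier N) (antipode_hopf_module.coinv R H Q))"
proof -
  interpret N: right_module R N by fact
  interpret F: cofree R HR N by (intro cofree.intro co.is_coring_axioms N)
  let ?T = "tgroup R N HR" and ?D = "cofree_comod R HR N"
  let ?e = "telem R N HR"
  note e = F.MC.telem_closed[simplified] F.MC.telem_add_left[simplified] F.MC.telem_add_right[simplified]
    F.MC.telem_balanced[simplified]
  interpret T: abelian_group ?T by (rule F.MC.tensor_abelian_group)
  interpret D: right_comodule R HR ?D by (rule F.cofree_right_comodule)
  interpret D: coring_comodule R HR ?D ..
  define j where "j = inv_into (carrier ?T) \<iota>"
  have j: "j (\<iota> t) = t" if "t ::: ?T" for t using that \<iota> by (simp add: j_def)
  \<comment> \<open>The retract construction with the identity as idempotent: its only effect is to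
    transport the cofree comodule along \<open>\<iota>\<close>.\<close>
  have "(%t. j (\<iota> t)) \<in> comod_hom R HR ?D ?D"
  proof (rule comod_hom_cong[OF _ D.right_module_axioms])
    show "(%t. t) \<in> comod_hom R HR ?D ?D"
      by (rule comod_homI) (use id_right_hom[unfolded id_def] D.MC.lift_telem[OF D.co_closed] in simp_all)
  qed (simp add: j)
  then interpret Q: split_comod_endo R HR ?D \<iota> j
    by (intro split_comod_endo.intro split_comod_endo_axioms.intro split_endo.intro split_endo_axioms.intro
        co.is_coring_axioms D.right_comodule_axioms D.right_module_axioms) (simp_all add: comod_homD(1) j)
  let ?Q0 = "retract_comod R HR ?D \<iota> j" and ?Qr = "retract_mod ?D \<iota> j"
  \<comment> \<open>The action of \<open>H\<close> on \<open>N \<otimes>\<^sub>R H\<close> by right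
    multiplication in the second factor; it is transported along \<open>\<iota>\<close> as
    well.\<close>
  define nb where "nb t b = tlift R N HR ?T (%n h. ?e n (h \<otimes>[H] b)) t" for t b
  have bnb: "bal R N HR ?T (%n h. ?e n (h \<otimes>[H] b))" if "b ::: H" for b
    by (rule balI)
       (use that in "simp_all add: N co.bimodule_axioms T.abelian_group_axioms e H.l_distr smult_mult_left")
  have nb: "nb t b ::: ?T" "nb (s \<oplus>[?T] t) b = nb s b \<oplus>[?T] nb t b"
    if "s ::: ?T" "t ::: ?T" "b ::: H" for s t b
    using that bal.lift_closed[OF bnb] bal.lift_add[OF bnb] by (simp_all add: nb_def)
  have nbe: "nb (?e n h) b = ?e n (h \<otimes>[H] b)" if "n ::: N" "h ::: H" "b ::: H" for n h b
    using that bal.lift_elem[OF bnb] by (simp add: nb_def)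
  define Nm :: "('h, ('n, 'h) tensor) right_mod" where
    "Nm = \<lparr>carrier = carrier ?T, monoid.mult = undefined, one = undefined, ring.zero = ring.zero ?T, add = add ?T, ract = nb\<rparr>"
  have Nm: "carrier Nm = carrier ?T" "add Nm = add ?T" "ring.zero Nm = ring.zero ?T" "ract Nm = nb"
    by (simp_all add: Nm_def)
  interpret Nm: right_module H Nm
  proof (rule right_moduleI)
    fix t a b assume "t ::: Nm" and ab: "a ::: H" "b ::: H"
    then have t: "t ::: ?T" by (simp add: Nm)
    then show "t \<triangleleft>[Nm] (a \<otimes>[H] b) = t \<triangleleft>[Nm] a \<triangleleft>[Nm] b"
      by (induction rule: F.MC.tensor_induct) (use ab in "simp_all add: Nm nbe nb H.m_assoc")
    from t show "t \<triangleleft>[Nm] (a \<oplus>[H] b) = t \<triangleleft>[Nm] a \<oplus>[Nm] t \<triangleleft>[Nm] b"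
      by (induction rule: F.MC.tensor_induct) (use ab in "simp_all add: Nm nbe nb H.r_distr e T.a_ac")
  next
    fix t assume "t ::: Nm"
    then have "t ::: ?T" by (simp add: Nm)
    then show "t \<triangleleft>[Nm] \<one>[H] = t"
      by (induction rule: F.MC.tensor_induct) (simp_all add: Nm nbe nb)
  qed (simp_all add: Nm nb H.ring_axioms abelian_group_transfer[OF T.abelian_group_axioms])
  interpret I: split_endo H Nm \<iota> j
    by (intro split_endo.intro split_endo_axioms.intro Nm.right_module_axioms
        right_hom_cong[OF id_right_hom[unfolded id_def] Nm.right_module_axioms]) (simp_all add: j Nm)
  define Q :: "('h, 'v, 'h) comod" where "Q = right_mod.extend (retract_mod Nm \<iota> j) \<lparr>coact = coact ?Q0\<rparr>"
  have Q: "carrier Q = carrier (retract_mod Nm \<iota> j)" "add Q = add (retract_mod Nm \<iota> j)" "ring.zero Q = ring.zero (retract_mod Nm \<iota> j)"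
    "ract Q = ract (retract_mod Nm \<iota> j)" "coact Q = coact ?Q0"
    by (simp_all add: Q_def right_mod.extend_def retract_mod_def)
  have Qc: "carrier Q = \<iota> ` carrier ?T" by (simp add: Q retract_mod_simps Nm)
  have ic: "\<iota> t ::: Q" if "t ::: ?T" for t using that by (simp add: Qc)
  have ia: "\<iota> s \<oplus>[Q] \<iota> t = \<iota> (s \<oplus>[?T] t)" if "s ::: ?T" "t ::: ?T" for s t
    using I.retract_add[of s t] that by (simp add: Q Nm)
  have ir: "\<iota> t \<triangleleft>[Q] b = \<iota> (nb t b)" if "t ::: ?T" "b ::: H" for t b
    using I.retract_ract[of t b] that by (simp add: Q Nm)
  have Qm: "right_module H Q"
  proof -
    interpret I': right_module H "retract_mod Nm \<iota> j" by (rule I.retract_right_module)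
    show ?thesis
      by (rule right_moduleI)
         (simp_all add: Q H.ring_axioms abelian_group_transfer[OF I'.M.abelian_group_axioms] I'.ract_closed I'.ract_add_left
            I'.ract_add_right I'.ract_assoc I'.ract_one)
  qed
  have nb_smult: "nb t (r \<odot>[H] \<one>[H]) = t \<triangleleft>[tright R N HR] r" if "t ::: ?T" "r ::: R" for t r
    unfolding nb_def ract_tright
    by (rule lift_cong) (use that in "simp add: mult_smult_one")
  \<comment> \<open>The transported \<open>H\<close>-module and the transported comodule are built
    separately. That they share one \<open>R\<close>-module structure has to be checked before they
    form a Hopf module.\<close>
  have agree: "x \<triangleleft>[Q] (r \<odot>[H] \<one>[H]) = x \<triangleleft>[?Qr] r" if "x ::: Q" "r ::: R" for x r
    using that by (auto simp: Qc ir nb_smult j retract_mod_simps)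
  have Qr: "carrier Q = carrier ?Qr" "add Q = add ?Qr" "ring.zero Q = ring.zero ?Qr"
    by (simp_all add: Qc retract_mod_simps) (simp_all add: Q retract_mod_def Nm)
  have Qcom: "right_comodule R HR (restrict_comod H Q)"
    by (rule right_comodule_cong[OF Q.retract_right_comodule co.is_coring_axioms])
       (use agree in "simp_all add: Qr, simp_all add: Q")
  have rel: "tensor_relations R (restrict_scalars H Q) HR = tensor_relations R ?Qr HR"
    by (rule tensor_relations_cong) (use agree in "simp_all add: Qr")
  have Qrc: "carrier (restrict_scalars H Q) = carrier ?Qr" by (simp add: Qr)
  note rels = telem_cong[OF Qrc refl rel] tensor_group_cong(2)[OF Qrc refl rel] tlift_module_cong[OF Qrc refl rel]
  interpret B: bialgebra_module R H Q
    by (intro bialgebra_module.intro is_bialgebra_axioms Qm)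
  have Kh: "(%t. coact Q (\<iota> t)) \<in> add_hom ?T B.MH"
    using right_homD(1)[OF right_hom_comp[OF Q.p_hom Q.coact_retract_right_hom]] by (simp add: Q(5) rels hom_def)
  have bil_K: "bil B.MH (%u v. B.tm (\<iota> (?e n u)) v)" if n: "n ::: N" for n
  proof (rule bilI)
    show "B.tm (\<iota> (?e n (r \<odot>[H] x))) y = B.tm (\<iota> (?e n x)) (r \<odot>[H] y)"
      if "x ::: H" "r ::: R" "y ::: H" for x r y
      using B.tm_balanced[of "\<iota> (?e n x)" r y] that n by (simp add: ic e ir nbe mult_smult_one)
  qed (use n in "simp_all add: B.T.tensor_abelian_group B.tm_closed B.tm_add_left B.tm_add_right ic e ia[symmetric]")
  have K: "coact Q (\<iota> (?e n h)) = lift B.MH (%u v. B.tm (\<iota> (?e n u)) v) (comult H h)"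
    if nh: "n ::: N" "h ::: H" for n h
  proof -
    have ph: "\<iota> \<in> right_hom R (tright R N HR) ?Qr" using Q.p_hom by (simp add: right_hom_def hom_def)
    have b: "bal R (tright R N HR) HR (tgroup R ?Qr HR) (%x y. telem R ?Qr HR (\<iota> x) (id y))"
      by (rule bal.bal_compose[OF Q.QC.telem_bal ph id_left_hom F.MCr.right_module_axioms co.bimodule_axioms])
    show ?thesis
      using F.lift_coact_cofree_elem[OF b, of n h] nh by (simp add: Q(5) Q.coact_retract e tensor_map_def rels)
  qed
  have hm: "hopf_module R H Q"
  proof (intro hopf_module.intro hopf_module_axioms.intro Qm Qcom)
    fix q b assume "q ::: Q" and b: "b ::: H"
    then obtain t where t: "t ::: ?T" "q = \<iota> t" by (auto simp: Qc)
    have "coact Q (\<iota> (nb t b)) = B.act (coact Q (\<iota> t)) (comult H b)"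
      using t(1)
    proof (induction rule: F.MC.tensor_induct)
      case (elem n h)
      then have nh: "n ::: N" "h ::: H" by simp_all
      have "B.act (coact Q (\<iota> (?e n h))) (comult H b) = lift B.MH (%u v. B.act (B.tm (\<iota> (?e n u)) v) (comult H b)) (comult H h)"
        using lift_additive[OF bil_K[OF nh(1)] B.act_hom_left[OF comult_closed[OF b]] B.T.tensor_abelian_group nh(2)] by (simp add: K nh)
      also have "... = lift B.MH (%u v. lift B.MH (%x y. B.tm (\<iota> (?e n (u \<otimes>[H] x))) (v \<otimes>[H] y)) (comult H b)) (comult H h)"
        using nh b by (simp add: B.act_elem ic e comult_closed ir nbe)
      also have "... = coact Q (\<iota> (nb (?e n h) b))"
        using nh b by (simp add: nbe K lift_comult_mult[OF bil_K])
      finally show ?case by simp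
    next
      case (add s t)
      then show ?case
        using b hom_add[OF Kh] hom_carrier_add[OF Kh] by (simp add: nb B.act_add_left comult_closed)
    qed
    then show "coact Q (q \<triangleleft>[Q] b) = B.act (coact Q q) (comult H b)"
      using t b by (simp add: ir)
  qed
  interpret W: antipode_hopf_module R H S Q
    by (intro antipode_hopf_module.intro antipode_axioms hm)
  \<comment> \<open>The map \<open>N \<otimes> \<epsilon>\<close>, which will invert
    \<open>\<theta>\<close> on the coinvariants.\<close>
  define ctm where "ctm t = tlift R N HR N (%n h. n \<triangleleft>[N] counit H h) t" for t
  have bctm: "bal R N HR N (%n h. n \<triangleleft>[N] counit H h)"
    by (rule balI)
       (simp_all add: N co.bimodule_axioms N.M.abelian_group_axioms counit_closed counit_rules N.ract_closed N.ract_add_left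
          N.ract_add_right N.ract_assoc)
  have ctm: "ctm t ::: N" "ctm (s \<oplus>[?T] t) = ctm s \<oplus>[N] ctm t" if "s ::: ?T" "t ::: ?T" for s t
    using that by (simp_all add: ctm_def bal.lift_closed[OF bctm] bal.lift_add[OF bctm])
  have ctme: "ctm (?e n h) = n \<triangleleft>[N] counit H h" if "n ::: N" "h ::: H" for n h
    using that bal.lift_elem[OF bctm] by (simp add: ctm_def)
  have ctmr: "ctm (nb t (r \<odot>[H] \<one>[H])) = ctm t \<triangleleft>[N] r" if "t ::: ?T" and r: "r ::: R" for t r
    using that(1)
    by (induction rule: F.MC.tensor_induct)
       (use r in "simp_all add: nbe ctme nb ctm N.ract_add_left mult_smult_one counit_rules N.ract_assoc[symmetric] counit_closed R.m_comm[of r]")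
  have b\<Psi>: "B.balM ?T (%q h. ?e (ctm (j q)) h)"
    by (rule B.balMI)
       (auto simp: T.abelian_group_axioms Qc ia ir j e ctm nb ctmr)
  \<comment> \<open>The counit law of the cofree comodule: applying the counit to the first
    component of the coaction restores the element.\<close>
  have \<Psi>: "B.liftM ?T (%q h. ?e (ctm (j q)) h) (coact Q (\<iota> t)) = t" if "t ::: ?T" for t
    using that
  proof (induction rule: F.MC.tensor_induct)
    case (elem n h)
    then have nh: "n ::: N" "h ::: H" by simp_all
    have "B.liftM ?T (%q h. ?e (ctm (j q)) h) (coact Q (\<iota> (?e n h)))
      = lift ?T (%u v. B.liftM ?T (%q h. ?e (ctm (j q)) h) (B.tm (\<iota> (?e n u)) v)) (comult H h)"
      unfolding K[OF nh] by (rule lift_additive[OF bil_K[OF nh(1)] bal.lift_hom[OF b\<Psi>] T.abelian_group_axioms nh(2)])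
    also have "... = lift ?T (%u v. ?e n (counit H u \<odot>[H] v)) (comult H h)"
      by (rule lift_cong)
         (use nh in "simp add: bal.lift_elem[OF b\<Psi>] ic e j ctme counit_closed")
    also have "... = ?e n h"
      by (rule counit_left[OF _ T.abelian_group_axioms nh(2)], rule add_homI) (use nh in "simp_all add: e")
    finally show ?case .
  next
    case (add s t)
    then show ?case
      using hom_add[OF Kh] hom_carrier_add[OF Kh] by (simp add: bal.lift_add[OF b\<Psi>])
  qed
  define \<theta> where "\<theta> n = \<iota> (?e n \<one>[H])" for n
  have \<theta>c: "\<theta> n \<in> W.coinv" if "n ::: N" for n
    using that lift_comult_one[OF bil_K[OF that]] by (simp add: W.coinv_def \<theta>_def ic e K)
  have "\<theta> \<in> right_hom R N (sub_module H Q W.coinv)"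
    by (rule right_homI) (use \<theta>c in "simp_all add: \<theta>_def ia ir e nbe")
  moreover have "bij_betw \<theta> (carrier N) W.coinv"
  proof (rule bij_betw_byWitness[where f'="%q. ctm (j q)"])
    show "\<forall>n\<in>carrier N. ctm (j (\<theta> n)) = n"
      by (simp add: \<theta>_def j e ctme counit_one N.ract_one)
    show "\<forall>q\<in>W.coinv. \<theta> (ctm (j q)) = q"
    proof
      fix q assume q: "q \<in> W.coinv"
      then obtain t where t: "t ::: ?T" "q = \<iota> t" by (auto simp: W.coinv_def Qc)
      have "coact Q (\<iota> t) = B.tm (\<iota> t) \<one>[H]" using q t by (simp add: W.coinv_def)
      \<comment> \<open>For a coinvariant the coaction has second component 1, so the counit
        identity exhibits \<open>t\<close> as n \<otimes> 1 with n = \<open>ctm t\<close>.\<close>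
      then have "?e (ctm t) \<one>[H] = t"
        using \<Psi>[OF t(1)] bal.lift_elem[OF b\<Psi>, of "\<iota> t" "\<one>[H]"] by (simp add: ic t j)
      then show "\<theta> (ctm (j q)) = q" by (simp add: \<theta>_def t j)
    qed
    show "\<theta> ` carrier N \<subseteq> W.coinv" using \<theta>c by blast
    show "(%q. ctm (j q)) ` W.coinv \<subseteq> carrier N"
      by (auto simp: W.coinv_def Qc j ctm)
  qed
  ultimately show ?thesis using hm by blast
qed

lemma hopf_module_antipode: "hopf_module R H M ==> antipode_hopf_module R H S M"
  by (intro antipode_hopf_module.intro antipode_axioms)

lemma hopf_module_category:
  "is_category (hopf_module_category R H :: (('h, 'v, 'h) comod, 'v => 'v) category)"
  unfolding hopf_module_category_def
proof (rule concrete_category)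
  fix X :: "('h, 'v, 'h) comod" assume "X \<in> {M. hopf_module R H M}"
  then interpret X: antipode_hopf_module R H S X by (simp add: hopf_module_antipode)
  have "(\<lambda>x\<in>carrier X. x) \<in> comod_hom R HR (restrict_comod H X) (restrict_comod H X)"
    using comod_category[OF co.is_coring_axioms, THEN is_category.Idn_Ar, of "restrict_comod H X"] X.M.comodule
    by (simp add: comod_category_def)
  then show "(\<lambda>x\<in>carrier X. x) \<in> right_hom H X X \<inter> comod_hom R HR (restrict_comod H X) (restrict_comod H X)"
    using right_hom_id[OF X.M.right_module_axioms] by simp
  fix Y Z :: "('h, 'v, 'h) comod" and f g
  assume "Y \<in> {M. hopf_module R H M}" "Z \<in> {M. hopf_module R H M}"
  then interpret Y: antipode_hopf_module R H S Y + Z: antipode_hopf_module R H S Z by (simp_all add: hopf_module_antipode)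
  assume f: "f \<in> right_hom H X Y \<inter> comod_hom R HR (restrict_comod H X) (restrict_comod H Y)"
    and g: "g \<in> right_hom H Y Z \<inter> comod_hom R HR (restrict_comod H Y) (restrict_comod H Z)"
  have "compose (carrier X) g f \<in> comod_hom R HR (restrict_comod H X) (restrict_comod H Z)"
    by (rule comod_hom_cong[OF comod_hom_compose[OF _ _ X.cm.right_module_axioms Y.cm.MC.tensor_prod_axioms
          Z.cm.MC.tensor_prod_axioms X.cm.co_closed] X.cm.right_module_axioms, of f g])
       (use f g in "simp_all add: compose_def")
  then show "compose (carrier X) g f \<in> right_hom H X Z \<inter> comod_hom R HR (restrict_comod H X) (restrict_comod H Z)"
    using right_hom_compose[of f H X Y g Z] f g X.M.right_module_axioms by simp
qed (auto dest: right_homD(2))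

theorem hopf_module_ff_es:
  assumes "closed_under_families TYPE('h) TYPE('v)"
  shows "ff_es_functor (hopf_module_category R H :: (('h, 'v, 'h) comod, 'v => 'v) category) (rmod_category R)
    \<lparr>Fob = (%M. sub_module H M (antipode_hopf_module.coinv R H M)),
     Far = (%M N f. restrict f (carrier (sub_module H M (antipode_hopf_module.coinv R H M))))\<rparr>"
  unfolding hopf_module_category_def
proof (rule submodule_ff_es[OF hopf_module_category[unfolded hopf_module_category_def]]; (unfold mem_Collect_eq)?)
  note a = hopf_module_antipode
  fix X :: "('h, 'v, 'h) comod" assume X: "hopf_module R H X"
  interpret X: antipode_hopf_module R H S X by (rule a[OF X])
  show "right_module R (sub_module H X X.coinv)" by (rule X.coinv_module)
  show "carrier (sub_module H X X.coinv) \<subseteq> carrier X" using X.coinv_closed by auto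
  fix Y :: "('h, 'v, 'h) comod" assume Y: "hopf_module R H Y"
  show "h \<in> right_hom R (sub_module H X X.coinv) (sub_module H Y (antipode_hopf_module.coinv R H Y)) ==>
      \<exists>f\<in>right_hom H X Y \<inter> comod_hom R HR (restrict_comod H X) (restrict_comod H Y).
         \<forall>x\<in>carrier (sub_module H X X.coinv). f x = h x" for h
    using hopf_hom_extension[OF a[OF X] a[OF Y]] by simp
  fix f assume f: "f \<in> right_hom H X Y \<inter> comod_hom R HR (restrict_comod H X) (restrict_comod H Y)"
  show "f \<in> right_hom R (sub_module H X X.coinv) (sub_module H Y (antipode_hopf_module.coinv R H Y))"
    using hopf_hom_coinv[OF a[OF X] a[OF Y]] f by simp
  show "g \<in> right_hom H X Y \<inter> comod_hom R HR (restrict_comod H X) (restrict_comod H Y)"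
    if "\<And>x. x ::: X ==> g x = f x" for g
    using right_hom_cong[of f H X Y g] comod_hom_cong[of f R HR "restrict_comod H X" "restrict_comod H Y" g]
      f that X.M.right_module_axioms X.cm.right_module_axioms by simp
  show "f x = g x"
    if "g \<in> right_hom H X Y \<inter> comod_hom R HR (restrict_comod H X) (restrict_comod H Y)"
      "\<And>x. x ::: (sub_module H X X.coinv) ==> f x = g x" "x ::: X" for g x
    by (rule hopf_hom_eqI[OF a[OF X] a[OF Y]]) (use f that in simp_all)
next
  fix N :: "('r, 'v) right_mod" assume N: "right_module R N"
  from tensor_embedding[OF assms inj_on_id[of UNIV] N co.bimodule_axioms]
  obtain \<iota> :: "('v, 'h) tensor => 'v" where "inj_on \<iota> (carrier (tgroup R N HR))" by blast
  from hopf_ess_surj[OF N this]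
  show "\<exists>X\<in>{M :: ('h, 'v, 'h) comod. hopf_module R H M}. \<exists>\<theta>\<in>right_hom R N (sub_module H X (antipode_hopf_module.coinv R H X)).
      bij_betw \<theta> (carrier N) (carrier (sub_module H X (antipode_hopf_module.coinv R H X)))"
    by simp
qed

end

subsection \<open>\<open>[H, -]\<close>-Hopf modules and their invariants\<close>

lemma restrict_em_simps [simp]:
  fixes M :: "('h, 'm, 'h) em_mod"
  shows "carrier (restrict_em H M) = carrier M" "add (restrict_em H M) = add M"
    "ring.zero (restrict_em H M) = ring.zero M" "x \<triangleleft>[restrict_em H M] r = x \<triangleleft>[M] (r \<odot>[H] \<one>[H])"
    "alg (restrict_em H M) = alg M"
  by (simp_all add: restrict_em_def right_mod.extend_def restrict_scalars_def)

lemma em_hom_cong: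
  assumes "f \<in> em_hom A C M N" "em_module A C M" "\<And>x. x ::: M ==> g x = f x"
  shows "g \<in> em_hom A C M N"
proof (rule em_homI)
  interpret M: em_module A C M by fact
  show "g \<in> right_hom A M N" by (rule right_hom_cong[OF em_homD(1)[OF assms(1)] M.right_module_axioms assms(3)])
  fix k assume k: "k ::: (hom_module A C M)"
  then have "k \<in> right_hom A C M" by simp
  from right_homD(2)[OF this] show "g (alg M k) = alg N (\<lambda>c\<in>carrier C. g (k c))"
    using em_homD(2)[OF assms(1) k] em_alg_closed[OF assms(2) k] by (simp add: assms(3) cong: restrict_cong)
qed

text \<open>\<open>\<epsilon>(b) = \<epsilon>(S(b\<^sub>1) b\<^sub>2) =
  \<epsilon>(S(\<epsilon>(b\<^sub>2) b\<^sub>1)) = \<epsilon>(S(b))\<close>, by multiplicativity of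
  the counit.\<close>

lemma (in antipode) counit_antipode:
  assumes b: "b ::: H"
  shows "counit H (S b) = counit H b"
proof -
  have ch: "counit H \<in> add_hom H R"
    by (rule add_homI) (simp_all add: counit_closed counit_rules)
  have csh: "(%x. counit H (S x)) \<in> add_hom H R"
    by (rule add_homI) (simp_all add: counit_closed counit_rules S_rules)
  have "counit H b = counit H (lift H (%x y. S x \<otimes>[H] y) (comult H b))"
    by (simp add: antipode_left b counit_rules counit_closed counit_one)
  also have "... = lift R (%x y. counit H (S x \<otimes>[H] y)) (comult H b)"
    by (rule lift_additive[OF bil_S_left ch R.is_abelian_group b])
  also have "... = lift R (%x y. counit H (S (counit H y \<odot>[H] x))) (comult H b)"
    by (rule lift_cong)
       (simp add: counit_mult S_rules counit_closed counit_rules R.m_comm)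
  also have "... = counit H (S b)"
    by (rule counit_right[OF csh R.is_abelian_group b])
  finally show ?thesis by simp
qed

locale antipode_hom_module = antipode R H S + M: hom_hopf_module R H M
  for R :: "('r, 'p) ring_scheme" (structure) and H :: "('r, 'h, 'z) bialgebra_scheme" and S
    and M :: "('h, 'm, 'h) em_mod"
begin

sublocale bialgebra_module R H M
  by (intro bialgebra_module.intro is_bialgebra_axioms M.right_module_axioms)

sublocale em: em_module R HR "restrict_em H M" by (rule M.em_module)

lemmas M_rules = M.ract_closed M.ract_add_left M.ract_add_right M.M.abelian_group_axioms

lemma M_hom_left: "b ::: H ==> (%m. m \<triangleleft>[M] b) \<in> add_hom M M"
  and M_hom_right: "m ::: M ==> (%b. m \<triangleleft>[M] b) \<in> add_hom H M"
  by (rule add_homI; simp add: M_rules)+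

definition homs :: "('h => 'm) set" where
  "homs = carrier (hom_module R HR (restrict_em H M))"

lemma homsI:
  assumes "\<And>x. x ::: H ==> f x ::: M"
    "\<And>x y. [|x ::: H; y ::: H|] ==> f (x \<oplus>[H] y) = f x \<oplus>[M] f y"
    "\<And>x r. [|x ::: H; r ::: R|] ==> f (r \<odot>[H] x) = f x \<triangleleft>[M] (r \<odot>[H] \<one>[H])"
  shows "(\<lambda>x\<in>carrier H. f x) \<in> homs"
  by (auto simp: homs_def assms intro!: right_homI)

lemma homsD:
  assumes "f \<in> homs"
  shows "x ::: H ==> f x ::: M"
    "[|x ::: H; y ::: H|] ==> f (x \<oplus>[H] y) = f x \<oplus>[M] f y"
    "[|x ::: H; r ::: R|] ==> f (r \<odot>[H] x) = f x \<triangleleft>[M] (r \<odot>[H] \<one>[H])"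
    "(\<lambda>x\<in>carrier H. f x) = f"
proof -
  have f: "f \<in> right_hom R HR (restrict_em H M)" "f \<in> extensional (carrier H)" using assms by (simp_all add: homs_def)
  show "x ::: H ==> f x ::: M"
    "[|x ::: H; y ::: H|] ==> f (x \<oplus>[H] y) = f x \<oplus>[M] f y"
    "[|x ::: H; r ::: R|] ==> f (r \<odot>[H] x) = f x \<triangleleft>[M] (r \<odot>[H] \<one>[H])"
    using right_homD(2-4)[OF f(1), of x] by simp_all
  show "(\<lambda>x\<in>carrier H. f x) = f" by (rule extensional_restrict[OF f(2)])
qed

lemma alg_closed: "f \<in> homs ==> alg M f ::: M"
  using right_homD(2)[OF em.alg_hom, of f] by (simp add: homs_def)

lemma alg_add: "[|f \<in> homs; g \<in> homs|] ==> alg M (\<lambda>x\<in>carrier H. f x \<oplus>[M] g x) = alg M f \<oplus>[M] alg M g"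
  using right_homD(3)[OF em.alg_hom, of f g] by (simp add: homs_def)

lemma alg_smult: "[|f \<in> homs; r ::: R|] ==> alg M (\<lambda>x\<in>carrier H. f (r \<odot>[H] x)) = alg M f \<triangleleft>[M] (r \<odot>[H] \<one>[H])"
  using right_homD(4)[OF em.alg_hom, of f r] by (simp add: homs_def)

lemma alg_unit: "m ::: M ==> alg M (\<lambda>b\<in>carrier H. m \<triangleleft>[M] (counit H b \<odot>[H] \<one>[H])) = m"
  using em.alg_unit[of m] by (simp add: monad_unit_def)

text \<open>The associativity law of the module for a map of two variables in curried form.
  Balancedness of \<open>\<phi>\<close> concerns moving scalars between the variables; the second
  hypothesis adds linearity in the second one, so that \<open>\<phi> x\<close> lies in
  \<open>Hom\<^sub>R(H, M)\<close>.\<close>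

lemma alg_mult:
  assumes b: "bil M \<phi>"
    and r: "\<And>x y r. [|x ::: H; y ::: H; r ::: R|] ==> \<phi> x (r \<odot>[H] y) = \<phi> x y \<triangleleft>[M] (r \<odot>[H] \<one>[H])"
  shows "alg M (\<lambda>x\<in>carrier H. alg M (\<lambda>y\<in>carrier H. \<phi> x y)) = alg M (\<lambda>c\<in>carrier H. lift M \<phi> (comult H c))"
proof -
  note bD = bilD[OF b]
  have h: "(\<lambda>y\<in>carrier H. \<phi> x y) \<in> homs" if "x ::: H" for x
    by (rule homsI) (use that in "simp_all add: bD r")
  define F where "F = (\<lambda>x\<in>carrier H. \<lambda>y\<in>carrier H. \<phi> x y)"
  have F: "F ::: (hom_module R HR (hom_module R HR (restrict_em H M)))"
    using h
    by (auto simp: F_def homs_def bD cong: restrict_cong intro!: right_homI)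
  have 1: "monad_map R HR (hom_module R HR (restrict_em H M)) (alg M) F = (\<lambda>x\<in>carrier H. alg M (\<lambda>y\<in>carrier H. \<phi> x y))"
    unfolding monad_map_def using F by (simp del: hom_module_simps) (simp add: compose_def F_def cong: restrict_cong)
  have 2: "monad_mult R HR (restrict_em H M) F = (\<lambda>c\<in>carrier H. lift M \<phi> (comult H c))"
    unfolding monad_mult_def under_coalgebra_simps
  proof (rule restrict_ext)
    fix c assume "c ::: H"
    have "lift (restrict_em H M) (%x y. F x y) (comult H c) = lift M (%x y. F x y) (comult H c)"
      by (simp add: tensor_lift_def hom_def)
    also have "... = lift M \<phi> (comult H c)"
      by (rule lift_cong) (simp add: F_def)
    finally show "lift (restrict_em H M) (%x y. F x y) (comult H c) = lift M \<phi> (comult H c)" .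
  qed
  show ?thesis using em.alg_mult[OF F] by (simp only: restrict_em_simps 1 2)
qed

lemma alg_ract: "[|f \<in> homs; b ::: H|] ==> alg M f \<triangleleft>[M] b
    = alg M (\<lambda>a\<in>carrier H. lift M (%x y. f (x \<otimes>[H] a) \<triangleleft>[M] y) (comult H b))"
  by (rule M.compatible) (simp_all add: homs_def)

definition invs :: "'m set" where
  "invs = {m \<in> carrier M. \<forall>b\<in>carrier H. m \<triangleleft>[M] b = m \<triangleleft>[M] (counit H b \<odot>[H] \<one>[H])}"

definition proj :: "'m => 'm" where
  "proj m = alg M (\<lambda>a\<in>carrier H. m \<triangleleft>[M] S a)"

lemma invs_closed: "m \<in> invs ==> m ::: M" by (simp add: invs_def)

lemma invs_ract: "[|m \<in> invs; b ::: H|] ==> m \<triangleleft>[M] b = m \<triangleleft>[M] (counit H b \<odot>[H] \<one>[H])"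
  by (simp add: invs_def)

lemma proj_homs: "m ::: M ==> (\<lambda>a\<in>carrier H. m \<triangleleft>[M] S a) \<in> homs"
  by (rule homsI) (simp_all add: M_rules S_rules, simp add: ract_smult[symmetric] S_closed)

lemma proj_closed: "m ::: M ==> proj m ::: M"
  unfolding proj_def by (rule alg_closed[OF proj_homs])

lemma proj_add: "[|m ::: M; n ::: M|] ==> proj (m \<oplus>[M] n) = proj m \<oplus>[M] proj n"
  unfolding proj_def alg_add[OF proj_homs proj_homs, symmetric]
  by (rule arg_cong[where f="alg M"], rule restrict_ext) (simp add: M_rules S_closed)

lemma proj_smult: "[|m ::: M; r ::: R|] ==> proj (m \<triangleleft>[M] (r \<odot>[H] \<one>[H])) = proj m \<triangleleft>[M] (r \<odot>[H] \<one>[H])"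
  unfolding proj_def alg_smult[OF proj_homs, symmetric]
  by (rule arg_cong[where f="alg M"], rule restrict_ext) (simp add: S_rules ract_smult_one)

lemma proj_ract_smult: "[|m ::: M; b ::: H; r ::: R|]
    ==> proj (m \<triangleleft>[M] (r \<odot>[H] b)) = proj (m \<triangleleft>[M] b) \<triangleleft>[M] (r \<odot>[H] \<one>[H])"
  by (simp only: ract_smult[of m r b] proj_smult M.ract_closed)

text \<open>Compatibility turns \<open>\<alpha>(m S(-)) b\<close> into
  \<open>\<alpha>(a \<mapsto> m S(b\<^sub>1 a) b\<^sub>2)\<close>, and
  \<open>antipode_mult_left\<close> evaluates the argument to \<epsilon>(b) m S(a).\<close>

lemma proj_invs:
  assumes m: "m ::: M"
  shows "proj m \<in> invs"
  unfolding invs_def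
proof (intro CollectI conjI ballI proj_closed[OF m])
  fix b assume b: "b ::: H"
  have bi: "bil H (%x y. S (x \<otimes>[H] a) \<otimes>[H] y)" if "a ::: H" for a
    by (rule bilI) (use that in "simp_all add: H_abelian H_rules")
  have "proj m \<triangleleft>[M] b = alg M (\<lambda>a\<in>carrier H. lift M (%x y. (\<lambda>a\<in>carrier H. m \<triangleleft>[M] S a) (x \<otimes>[H] a) \<triangleleft>[M] y) (comult H b))"
    unfolding proj_def by (rule alg_ract[OF proj_homs[OF m] b])
  also have "... = alg M (\<lambda>a\<in>carrier H. (\<lambda>a\<in>carrier H. m \<triangleleft>[M] S a) (counit H b \<odot>[H] a))"
  proof (rule arg_cong[where f="alg M"], rule restrict_ext)
    fix a assume a: "a ::: H"
    have "lift M (%x y. (\<lambda>a\<in>carrier H. m \<triangleleft>[M] S a) (x \<otimes>[H] a) \<triangleleft>[M] y) (comult H b)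
      = lift M (%x y. m \<triangleleft>[M] (S (x \<otimes>[H] a) \<otimes>[H] y)) (comult H b)"
      by (rule lift_cong) (use a m in "simp add: S_closed M.ract_assoc")
    also have "... = m \<triangleleft>[M] S (counit H b \<odot>[H] a)"
      using lift_additive[OF bi[OF a] M_hom_right[OF m] M.M.abelian_group_axioms b]
      by (simp add: antipode_mult_left a b S_rules counit_closed)
    finally show "lift M (%x y. (\<lambda>a\<in>carrier H. m \<triangleleft>[M] S a) (x \<otimes>[H] a) \<triangleleft>[M] y) (comult H b)
      = (\<lambda>a\<in>carrier H. m \<triangleleft>[M] S a) (counit H b \<odot>[H] a)"
      using a b by (simp add: counit_closed)
  qed
  also have "... = proj m \<triangleleft>[M] (counit H b \<odot>[H] \<one>[H])"
    unfolding proj_def by (rule alg_smult[OF proj_homs[OF m] counit_closed[OF b]])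
  finally show "proj m \<triangleleft>[M] b = proj m \<triangleleft>[M] (counit H b \<odot>[H] \<one>[H])" .
qed

text \<open>For invariant \<open>m\<close>, m S(a) = \<epsilon>(S(a)) m = \<epsilon>(a) m, and the
  unit law applies.\<close>

lemma proj_invariant:
  assumes m: "m \<in> invs"
  shows "proj m = m"
proof -
  have "proj m = alg M (\<lambda>b\<in>carrier H. m \<triangleleft>[M] (counit H b \<odot>[H] \<one>[H]))"
    unfolding proj_def
    by (rule arg_cong[where f="alg M"], rule restrict_ext) (subst invs_ract[OF m], simp_all add: S_closed counit_antipode)
  then show ?thesis using m by (simp add: alg_unit invs_closed)
qed

text \<open>\<open>\<alpha>(b \<mapsto> \<alpha>(a \<mapsto> m b S(a))) = \<alpha>(c \<mapsto> m
  c\<^sub>1 S(c\<^sub>2)) = \<alpha>(c \<mapsto> m \<epsilon>(c)) = m\<close>. So every element is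
  the structure map applied to a function with invariant values.\<close>

lemma proj_decomposition:
  assumes m: "m ::: M"
  shows "alg M (\<lambda>b\<in>carrier H. proj (m \<triangleleft>[M] b)) = m"
proof -
  have "alg M (\<lambda>b\<in>carrier H. proj (m \<triangleleft>[M] b)) = alg M (\<lambda>b\<in>carrier H. alg M (\<lambda>a\<in>carrier H. m \<triangleleft>[M] (b \<otimes>[H] S a)))"
    unfolding proj_def
    by (rule arg_cong[where f="alg M"], rule restrict_ext, rule arg_cong[where f="alg M"], rule restrict_ext)
       (simp add: m M.ract_assoc S_closed)
  also have "... = alg M (\<lambda>c\<in>carrier H. lift M (%b a. m \<triangleleft>[M] (b \<otimes>[H] S a)) (comult H c))"
  proof (rule alg_mult)
    show "bil M (%b a. m \<triangleleft>[M] (b \<otimes>[H] S a))"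
      by (rule bilI) (simp_all add: M_rules H_rules m)
  qed (simp add: H_rules ract_smult m)
  also have "... = alg M (\<lambda>c\<in>carrier H. m \<triangleleft>[M] (counit H c \<odot>[H] \<one>[H]))"
    by (rule arg_cong[where f="alg M"], rule restrict_ext)
       (use lift_additive[OF bil_S_right M_hom_right[OF m] M.M.abelian_group_axioms] in "simp add: antipode_right")
  also have "... = m" by (rule alg_unit[OF m])
  finally show ?thesis .
qed

text \<open>On functions with invariant values the compatibility condition simplifies: in
  \<open>k(b\<^sub>1 a) b\<^sub>2\<close> the factor \<open>b\<^sub>2\<close> acts by its counit,
  which is absorbed into \<open>b\<^sub>1\<close>. Thus such functions behave like
  \<open>Hom\<^sub>R(H, N)\<close> with its shift action.\<close>

lemma invs_alg_ract:
  assumes k: "k \<in> homs" "\<And>x. x ::: H ==> k x \<in> invs" and b: "b ::: H"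
  shows "alg M k \<triangleleft>[M] b = alg M (\<lambda>a\<in>carrier H. k (b \<otimes>[H] a))"
proof -
  have "lift M (%x y. k (x \<otimes>[H] a) \<triangleleft>[M] y) (comult H b) = k (b \<otimes>[H] a)" if a: "a ::: H" for a
  proof -
    have "lift M (%x y. k (x \<otimes>[H] a) \<triangleleft>[M] y) (comult H b) = lift M (%x y. k ((counit H y \<odot>[H] x) \<otimes>[H] a)) (comult H b)"
    proof (rule lift_cong)
      fix x y assume "x ::: HR" "y ::: HR"
      then have xy: "x ::: H" "y ::: H" by simp_all
      then show "k (x \<otimes>[H] a) \<triangleleft>[M] y = k ((counit H y \<odot>[H] x) \<otimes>[H] a)"
        using a invs_ract[OF k(2), of "x \<otimes>[H] a" y] by (simp add: smult_mult_left homsD[OF k(1)] counit_closed)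
    qed
    also have "... = k (b \<otimes>[H] a)"
      by (rule counit_right[OF _ M.M.abelian_group_axioms b, where h="%x. k (x \<otimes>[H] a)"], rule add_homI)
         (use a in "simp_all add: homsD[OF k(1)] H.l_distr")
    finally show ?thesis .
  qed
  then show ?thesis using alg_ract[OF k(1) b] by (simp cong: restrict_cong)
qed

lemma homs_shift: "[|k \<in> homs; b ::: H|] ==> (\<lambda>a\<in>carrier H. k (b \<otimes>[H] a)) \<in> homs"
  by (rule homsI) (simp_all add: homsD H.r_distr smult_mult_right)

text \<open>\<open>\<alpha>(a \<mapsto> \<alpha>(k) S(a)) = \<alpha>(a \<mapsto> \<alpha>(d
  \<mapsto> k(S(a) d))) = \<alpha>(c \<mapsto> k(S(c\<^sub>1) c\<^sub>2)) = \<alpha>(c \<mapsto>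
  \<epsilon>(c) k(1)) = k(1)\<close>. Applied to shifts of \<open>k\<close> it recovers every value
  of \<open>k\<close> from \<alpha>(k).\<close>

lemma proj_alg_invs:
  assumes k: "k \<in> homs" "\<And>x. x ::: H ==> k x \<in> invs"
  shows "proj (alg M k) = k \<one>[H]"
proof -
  note kD = homsD[OF k(1)]
  have kh: "k \<in> add_hom H M" by (rule add_homI) (simp_all add: kD)
  have "proj (alg M k) = alg M (\<lambda>a\<in>carrier H. alg M (\<lambda>d\<in>carrier H. k (S a \<otimes>[H] d)))"
    unfolding proj_def by (rule arg_cong[where f="alg M"], rule restrict_ext) (simp add: invs_alg_ract k S_closed)
  also have "... = alg M (\<lambda>c\<in>carrier H. lift M (%a d. k (S a \<otimes>[H] d)) (comult H c))"
  proof (rule alg_mult)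
    show "bil M (%a d. k (S a \<otimes>[H] d))"
      by (rule bilI) (simp_all add: M_rules H_rules kD(1,2))
  qed (simp add: smult_mult_right kD S_closed)
  also have "... = alg M (\<lambda>c\<in>carrier H. k \<one>[H] \<triangleleft>[M] (counit H c \<odot>[H] \<one>[H]))"
    by (rule arg_cong[where f="alg M"], rule restrict_ext)
       (use lift_additive[OF bil_S_left kh M.M.abelian_group_axioms] in "simp add: antipode_left kD(3) counit_closed")
  also have "... = k \<one>[H]" by (rule alg_unit) (simp add: kD)
  finally show ?thesis .
qed

lemma invs_lift:
  assumes "bil M \<phi>" "\<And>x y. [|x ::: H; y ::: H|] ==> \<phi> x y \<in> invs" "c ::: H"
  shows "lift M \<phi> (comult H c) \<in> invs"
  unfolding invs_def
proof (intro CollectI conjI ballI lift_closed[OF assms(1,3)])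
  fix b assume b: "b ::: H"
  have "lift M \<phi> (comult H c) \<triangleleft>[M] b = lift M (%x y. \<phi> x y \<triangleleft>[M] b) (comult H c)"
    by (rule lift_additive[OF assms(1) M_hom_left[OF b] M.M.abelian_group_axioms assms(3)])
  also have "... = lift M (%x y. \<phi> x y \<triangleleft>[M] (counit H b \<odot>[H] \<one>[H])) (comult H c)"
    by (rule lift_cong, rule invs_ract) (simp_all add: assms(2) b)
  also have "... = lift M \<phi> (comult H c) \<triangleleft>[M] (counit H b \<odot>[H] \<one>[H])"
    by (rule lift_additive[OF assms(1) M_hom_left _ assms(3), symmetric]) (simp_all add: M.M.abelian_group_axioms counit_closed b)
  finally show "lift M \<phi> (comult H c) \<triangleleft>[M] b = lift M \<phi> (comult H c) \<triangleleft>[M] (counit H b \<odot>[H] \<one>[H])" .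
qed

lemma bil_proj: "f \<in> homs ==> bil M (%x y. proj (f x \<triangleleft>[M] y))"
  by (rule bilI) (simp_all add: homsD M_rules proj_closed proj_add ract_smult_one)

text \<open>By \<open>proj_decomposition\<close>, \<open>\<alpha>(f) = \<alpha>(k)\<close> for the invariant valued \<open>k c = proj (f(c\<^sub>1) c\<^sub>2)\<close>, and
  \<open>proj (\<alpha>(k) c) = k c\<close>.\<close>

lemma proj_alg_ract:
  assumes f: "f \<in> homs" and c: "c ::: H"
  shows "proj (alg M f \<triangleleft>[M] c) = lift M (%x y. proj (f x \<triangleleft>[M] y)) (comult H c)"
proof -
  note fD = homsD[OF f] and b = bil_proj[OF f]
  note r = proj_ract_smult[OF fD(1)]
  define k where "k = (\<lambda>c\<in>carrier H. lift M (%x y. proj (f x \<triangleleft>[M] y)) (comult H c))"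
  have k: "k \<in> homs"
    unfolding k_def
  proof (rule homsI)
    fix x r assume xr: "x ::: H" "r ::: R"
    have "lift M (%p q. proj (f p \<triangleleft>[M] q)) (comult H (r \<odot>[H] x)) = lift M (%p q. proj (f p \<triangleleft>[M] q) \<triangleleft>[M] (r \<odot>[H] \<one>[H])) (comult H x)"
      unfolding lift_smult[OF b xr]
      by (rule lift_cong) (use xr in "simp add: fD(3) fD(1) ract_smult_one r")
    then show "lift M (%p q. proj (f p \<triangleleft>[M] q)) (comult H (r \<odot>[H] x)) = lift M (%p q. proj (f p \<triangleleft>[M] q)) (comult H x) \<triangleleft>[M] (r \<odot>[H] \<one>[H])"
      using lift_additive[OF b M_hom_left M.M.abelian_group_axioms xr(1)] xr by simp
  qed (simp_all add: lift_closed[OF b] lift_add[OF b])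
  have ki: "k x \<in> invs" if "x ::: H" for x
    using that invs_lift[OF b] by (simp add: k_def proj_invs M.ract_closed fD)
  \<comment> \<open>Each value of \<open>f\<close> is decomposed separately; the associativity law
    then merges the two applications of the structure map into one.\<close>
  have "alg M f = alg M (\<lambda>x\<in>carrier H. alg M (\<lambda>y\<in>carrier H. proj (f x \<triangleleft>[M] y)))"
    using fD(4) by (simp add: proj_decomposition fD(1) cong: restrict_cong)
  also have "... = alg M k"
    unfolding k_def by (rule alg_mult[OF b r])
  finally have "proj (alg M f \<triangleleft>[M] c) = proj (alg M (\<lambda>a\<in>carrier H. k (c \<otimes>[H] a)))"
    using invs_alg_ract[OF k ki c] by simp
  also have "... = k c"
    using proj_alg_invs[OF homs_shift[OF k c]] ki c by simp
  finally show ?thesis using c by (simp add: k_def)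
qed

lemma invs_module: "right_module R (sub_module H M invs)"
proof (rule sub_module_right_module)
  have z: "\<zero>[M] \<triangleleft>[M] b = \<zero>[M]" if "b ::: H" for b
    by (rule hom_zero[OF M_hom_left[OF that] M.M.abelian_group_axioms M.M.abelian_group_axioms])
  show "\<zero>[M] \<in> invs" by (simp add: invs_def z counit_closed)
  show "x \<triangleleft>[M] (r \<odot>[H] \<one>[H]) \<in> invs" if x: "x \<in> invs" and r: "r ::: R" for x r
  proof -
    have "proj (x \<triangleleft>[M] (r \<odot>[H] \<one>[H])) = x \<triangleleft>[M] (r \<odot>[H] \<one>[H])"
      using x r by (simp add: proj_smult invs_closed proj_invariant)
    then show ?thesis using proj_invs[of "x \<triangleleft>[M] (r \<odot>[H] \<one>[H])"] x r by (simp add: invs_closed M.ract_closed)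
  qed
  show "x \<oplus>[M] y \<in> invs" if "x \<in> invs" "y \<in> invs" for x y
    using that by (simp add: invs_def M.ract_add_left counit_closed)
qed (auto simp: invs_def)

end

section \<open>Maps of \<open>[H, -]\<close>-Hopf modules and invariants\<close>

lemma hom_hopf_hom_invs:
  assumes "antipode_hom_module R H S M" "antipode_hom_module R H S N" and f: "f \<in> right_hom H M N"
  shows "f \<in> right_hom R (sub_module H M (antipode_hom_module.invs H M)) (sub_module H N (antipode_hom_module.invs H N))"
proof -
  interpret M: antipode_hom_module R H S M by fact
  interpret N: antipode_hom_module R H S N by fact
  note fD = right_homD[OF f]
  have "f x \<in> N.invs" if x: "x \<in> M.invs" for x
    using x by (simp add: M.invs_def N.invs_def fD(2) fD(4)[symmetric] M.counit_closed)
  then show ?thesis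
    by (intro right_homI) (simp_all add: fD M.invs_closed)
qed

text \<open>By \<open>proj_decomposition\<close> a map compatible with the structure maps satisfies
  \<open>h(m) = \<alpha>(b \<mapsto> h(proj (m b)))\<close>, which involves only values at
  invariants.\<close>

lemma hom_hopf_hom_eqI:
  assumes "antipode_hom_module R H S M"
    and fg: "f \<in> em_hom R (under_coalgebra H) (restrict_em H M) (restrict_em H N)" "g \<in> em_hom R (under_coalgebra H) (restrict_em H M) (restrict_em H N)"
    and eq: "\<And>x. x \<in> antipode_hom_module.invs H M ==> f x = g x" and m: "m ::: M"
  shows "f m = g m"
proof -
  interpret M: antipode_hom_module R H S M by fact
  have k: "(\<lambda>b\<in>carrier H. M.proj (m \<triangleleft>[M] b)) \<in> M.homs"
    by (rule M.homsI) (use m in "simp_all add: M.M_rules M.proj_closed M.proj_add M.proj_ract_smult")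
  have "h m = alg N (\<lambda>b\<in>carrier H. h (M.proj (m \<triangleleft>[M] b)))"
    if "h \<in> em_hom R (under_coalgebra H) (restrict_em H M) (restrict_em H N)" for h
    using em_homD(2)[OF that k[unfolded M.homs_def]] by (simp add: M.proj_decomposition m cong: restrict_cong)
  from this[OF fg(1)] this[OF fg(2)] show ?thesis
    by (simp add: eq M.proj_invs M.M.ract_closed m cong: restrict_cong)
qed

text \<open>The decomposition forces f(m) to be the structure map of \<open>N\<close> at b \<mapsto>
  g(proj (m b)). Linearity is \<open>invs_alg_ract\<close>, since right multiplication of
  \<open>m\<close> by c shifts this function by c.\<close>

lemma hom_hopf_hom_extension:
  assumes "antipode_hom_module R H S M" "antipode_hom_module R H S N"
    and g: "g \<in> right_hom R (sub_module H M (antipode_hom_module.invs H M)) (sub_module H N (antipode_hom_module.invs H N))"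
  shows "\<exists>f \<in> right_hom H M N \<inter> em_hom R (under_coalgebra H) (restrict_em H M) (restrict_em H N).
    \<forall>x\<in>antipode_hom_module.invs H M. f x = g x"
proof -
  interpret M: antipode_hom_module R H S M by fact
  interpret N: antipode_hom_module R H S N by fact
  note gD = right_homD[OF g, simplified]
  define k where "k u = g (M.proj u)" for u
  have ki: "k u \<in> N.invs" if "u ::: M" for u using that by (simp add: k_def gD M.proj_invs)
  have k: "k u ::: N" if "u ::: M" for u using ki[OF that] by (simp add: N.invs_closed)
  have ka: "k (u \<oplus>[M] v) = k u \<oplus>[N] k v" if "u ::: M" "v ::: M" for u v
    using that by (simp add: k_def gD M.proj_invs M.proj_add)
  have kr: "k (u \<triangleleft>[M] (r \<odot>[H] \<one>[H])) = k u \<triangleleft>[N] (r \<odot>[H] \<one>[H])" if "u ::: M" "r ::: R" for u r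
    using that by (simp add: k_def gD M.proj_invs M.proj_smult)
  have kr': "k (u \<triangleleft>[M] (r \<odot>[H] b)) = k (u \<triangleleft>[M] b) \<triangleleft>[N] (r \<odot>[H] \<one>[H])"
    if "u ::: M" "b ::: H" "r ::: R" for u b r
    using that by (simp only: M.ract_smult[of u r b] kr M.M.ract_closed)
  have kh: "k \<in> add_hom M N" by (rule add_homI) (simp_all add: k ka)
  define \<kappa> where "\<kappa> m = (\<lambda>b\<in>carrier H. k (m \<triangleleft>[M] b))" for m
  have \<kappa>: "\<kappa> m \<in> N.homs" if "m ::: M" for m
    unfolding \<kappa>_def by (rule N.homsI) (use that in "simp_all add: M.M_rules k ka kr'")
  have \<kappa>i: "\<kappa> m x \<in> N.invs" if "m ::: M" "x ::: H" for m x
    using that by (simp add: \<kappa>_def ki M.M.ract_closed)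
  define f where "f m = alg N (\<kappa> m)" for m
  have fr: "f \<in> right_hom H M N"
  proof (rule right_homI)
    fix m c assume m: "m ::: M" and c: "c ::: H"
    have "\<kappa> (m \<triangleleft>[M] c) = (\<lambda>a\<in>carrier H. \<kappa> m (c \<otimes>[H] a))"
      unfolding \<kappa>_def by (rule restrict_ext) (simp add: m c M.M.ract_assoc)
    then show "f (m \<triangleleft>[M] c) = f m \<triangleleft>[N] c"
      using N.invs_alg_ract[OF \<kappa>[OF m] \<kappa>i[OF m] c] by (simp add: f_def)
  next
    fix m n assume mn: "m ::: M" "n ::: M"
    have "\<kappa> (m \<oplus>[M] n) = (\<lambda>x\<in>carrier H. \<kappa> m x \<oplus>[N] \<kappa> n x)"
      unfolding \<kappa>_def by (rule restrict_ext) (simp add: mn M.M_rules ka)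
    then show "f (m \<oplus>[M] n) = f m \<oplus>[N] f n"
      using N.alg_add[OF \<kappa>[OF mn(1)] \<kappa>[OF mn(2)]] by (simp add: f_def)
  qed (simp add: f_def N.alg_closed \<kappa>)
  have "f \<in> em_hom R (under_coalgebra H) (restrict_em H M) (restrict_em H N)"
  proof (rule em_homI)
    show "f \<in> right_hom R (restrict_em H M) (restrict_em H N)"
      using right_homD[OF fr] by (intro right_homI) simp_all
    fix h assume "h ::: (hom_module R (under_coalgebra H) (restrict_em H M))"
    then have h: "h \<in> M.homs" by (simp add: M.homs_def)
    note hD = M.homsD[OF h] and b = M.bil_proj[OF h]
    have kp: "k (M.lift M (%x y. M.proj (h x \<triangleleft>[M] y)) (comult H c)) = M.lift N (%x y. k (h x \<triangleleft>[M] y)) (comult H c)"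
      if c: "c ::: H" for c
    proof -
      have "k (M.proj u) = k u" if "u ::: M" for u
        using that by (simp add: k_def M.proj_invariant[OF M.proj_invs])
      then show ?thesis
        unfolding M.lift_additive[OF b kh N.M.M.abelian_group_axioms c]
        by (intro lift_cong) (simp add: hD M.M.ract_closed)
    qed
    \<comment> \<open>Compatibility with the structure maps rests on \<open>proj_alg_ract\<close>,
      which expresses the projection of \<alpha>(h) c through the values of \<open>h\<close>; the
      associativity law in \<open>N\<close> then splits the resulting sum.\<close>
    have "f (alg M h) = alg N (\<lambda>c\<in>carrier H. M.lift N (%x y. k (h x \<triangleleft>[M] y)) (comult H c))"
      unfolding f_def \<kappa>_def
    proof (rule arg_cong[where f="alg N"], rule restrict_ext)
      fix c assume c: "c ::: H"
      let ?l = "M.lift M (%x y. M.proj (h x \<triangleleft>[M] y)) (comult H c)"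
      have "?l \<in> M.invs" by (rule M.invs_lift[OF b _ c]) (simp add: M.proj_invs M.M.ract_closed hD)
      then have "k (alg M h \<triangleleft>[M] c) = k ?l"
        by (simp add: k_def M.proj_alg_ract[OF h c] M.proj_invariant)
      then show "k (alg M h \<triangleleft>[M] c) = M.lift N (%x y. k (h x \<triangleleft>[M] y)) (comult H c)"
        by (simp only: kp[OF c])
    qed
    also have "... = alg N (\<lambda>x\<in>carrier H. alg N (\<lambda>y\<in>carrier H. k (h x \<triangleleft>[M] y)))"
    proof (rule N.alg_mult[symmetric])
      show "M.bil N (%x y. k (h x \<triangleleft>[M] y))"
        by (rule M.bilI) (simp_all add: N.M_rules M.M_rules k ka hD M.ract_smult_one)
    qed (simp add: kr' hD)
    also have "... = alg N (\<lambda>x\<in>carrier H. f (h x))" by (simp add: f_def \<kappa>_def)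
    finally show "f (alg (restrict_em H M) h) = alg (restrict_em H N) (\<lambda>c\<in>carrier (under_coalgebra H). f (h c))"
      by simp
  qed
  moreover have "f x = g x" if x: "x \<in> M.invs" for x
  proof -
    have xc: "x ::: M" by (rule M.invs_closed[OF x])
    have "\<kappa> x = (\<lambda>b\<in>carrier H. k x \<triangleleft>[N] (counit H b \<odot>[H] \<one>[H]))"
      unfolding \<kappa>_def by (rule restrict_ext, subst M.invs_ract[OF x], assumption) (simp add: kr xc M.counit_closed)
    then show ?thesis using N.alg_unit[OF k[OF xc]] by (simp add: f_def) (simp add: k_def M.proj_invariant[OF x])
  qed
  ultimately show ?thesis using fr by blast
qed

text \<open>Transport of structure along a linear bijection \<open>\<theta>\<close> with inverse
  \<open>j\<close>. The structure map of \<open>Y\<close> is prescribed only on linear maps, where F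
  \<mapsto> j \<circ> F identifies the two Hom modules and carries one set of axioms to the
  other.\<close>

lemma em_module_transport:
  assumes X: "em_module A C X" and C: "is_coring A C" and Y: "right_module A Y"
    and \<theta>: "\<theta> \<in> right_hom A X Y" and j: "\<And>y. y ::: Y ==> j y ::: X" "\<And>x. x ::: X ==> j (\<theta> x) = x"
      "\<And>y. y ::: Y ==> \<theta> (j y) = y"
    and alg: "\<And>F. F ::: (hom_module A C Y) ==> alg Y F = \<theta> (alg X (\<lambda>c\<in>carrier C. j (F c)))"
  shows "em_module A C Y"
proof -
  interpret X: em_module A C X by fact
  interpret Y: right_module A Y by fact
  interpret C: is_coring A C by fact
  interpret CY: coring_module A C Y ..
  interpret CX: coring_module A C X ..
  note \<theta>D = right_homD[OF \<theta>]
  have jr: "j \<in> right_hom A Y X" by (rule right_hom_inverse[OF \<theta> X.right_module_axioms Y j])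
  note jD = right_homD[OF jr]
  define J where "J F = (\<lambda>c\<in>carrier C. j (F c))" for F
  have J: "J F ::: (hom_module A C X)" if "F ::: (hom_module A C Y)" for F
    using right_hom_cong[OF right_hom_comp[OF _ jr] C.right_module_axioms, of F "J F"] that by (simp add: J_def)
  have aY: "alg Y F = \<theta> (alg X (J F))" if "F ::: (hom_module A C Y)" for F
    using alg[OF that] by (simp only: J_def)
  note aX = right_homD[OF X.alg_hom]
  have Jadd: "J (F \<oplus>[hom_module A C Y] G) = J F \<oplus>[hom_module A C X] J G"
    if "F ::: (hom_module A C Y)" "G ::: (hom_module A C Y)" for F G
    using that right_homD(2)[of F A C Y] right_homD(2)[of G A C Y] by (simp add: J_def jD cong: restrict_cong)
  have Jr: "J (F \<triangleleft>[hom_module A C Y] a) = J F \<triangleleft>[hom_module A C X] a"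
    if "F ::: (hom_module A C Y)" "a ::: A" for F a
    using that by (auto simp: J_def C.lact_closed cong: restrict_cong)
  interpret HY: abelian_group "hom_module A C Y" by (rule CY.hom_module_abelian_group)
  have ract: "F \<triangleleft>[hom_module A C Y] a ::: (hom_module A C Y)" if "F ::: (hom_module A C Y)" "a ::: A" for F a
    using that by (auto intro!: right_homI simp: right_homD C.ract_closed C.lact_closed C.lact_add_right C.lact_ract[symmetric])
  show ?thesis
  proof (intro em_module.intro em_module_axioms.intro Y)
    show "alg Y \<in> right_hom A (hom_module A C Y) Y"
      by (rule right_homI) (use J in "simp_all add: aY HY.add.m_closed ract Jadd Jr aX \<theta>D del: hom_module_simps")
    fix y assume y: "y ::: Y"
    have u: "monad_unit C Y y ::: (hom_module A C Y)"
      using y by (auto intro!: right_homI simp: monad_unit_def C.cou_closed C.cou_add C.cou_ract C.ract_closed Y.ract_closed Y.ract_add_right Y.ract_assoc)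
    have "J (monad_unit C Y y) = monad_unit C X (j y)"
      unfolding J_def monad_unit_def by (rule restrict_ext) (simp add: y jD C.cou_closed)
    then show "alg Y (monad_unit C Y y) = y"
      using X.alg_unit[OF j(1)[OF y]] by (simp add: aY[OF u] j(3) y)
  next
    fix F assume F: "F ::: (hom_module A C (hom_module A C Y))"
    then have Fr: "F \<in> right_hom A C (hom_module A C Y)" by simp
    note b = CY.hom_module_bal[OF Fr]
    have Fc: "F c ::: (hom_module A C Y)" if "c ::: C" for c using right_homD(2)[OF Fr that] .
    have JJ: "(\<lambda>c\<in>carrier C. J (F c)) ::: (hom_module A C (hom_module A C X))"
    proof -
      have "J \<in> right_hom A (hom_module A C Y) (hom_module A C X)"
        by (rule right_homI) (use J Jadd Jr in "simp_all del: hom_module_simps")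
      from right_hom_cong[OF right_hom_comp[OF Fr this] C.right_module_axioms, of "\<lambda>c\<in>carrier C. J (F c)"]
      show ?thesis by (subst hom_module_simps(1)) simp
    qed
    have 1: "alg Y (monad_map A C (hom_module A C Y) (alg Y) F) = \<theta> (alg X (monad_map A C (hom_module A C X) (alg X) (\<lambda>c\<in>carrier C. J (F c))))"
    proof -
      have m: "monad_map A C (hom_module A C Y) (alg Y) F = (\<lambda>c\<in>carrier C. alg Y (F c))"
        using F by (simp add: monad_map_def compose_def)
      have alr: "alg Y \<in> right_hom A (hom_module A C Y) Y"
        by (rule right_homI) (use J in "simp_all add: aY HY.add.m_closed ract Jadd Jr aX \<theta>D del: hom_module_simps")
      have "(\<lambda>c\<in>carrier C. alg Y (F c)) ::: (hom_module A C Y)"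
        using right_hom_cong[OF right_hom_comp[OF Fr alr] C.right_module_axioms, of "\<lambda>c\<in>carrier C. alg Y (F c)"] by simp
      moreover have "J (\<lambda>c\<in>carrier C. alg Y (F c)) = monad_map A C (hom_module A C X) (alg X) (\<lambda>c\<in>carrier C. J (F c))"
        unfolding monad_map_def restrict_apply'[OF JJ] unfolding J_def[of "\<lambda>c\<in>carrier C. alg Y (F c)"] compose_def
        by (rule restrict_ext) (simp add: aY[OF Fc] j(2) aX(2)[OF J[OF Fc]])
      ultimately show ?thesis unfolding m by (simp only: aY)
    qed
    have 2: "J (monad_mult A C Y F) = monad_mult A C X (\<lambda>c\<in>carrier C. J (F c))"
      unfolding J_def[of "monad_mult A C Y F"] unfolding monad_mult_def
    proof (rule restrict_ext)
      fix c assume c: "c ::: C"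
      have "j (tlift A C C Y (%x y. F x y) (cop C c)) = tlift A C C X (%x y. j (F x y)) (cop C c)"
        by (rule bal.lift_additive[OF b jD(1) X.M.abelian_group_axioms C.cop_closed[OF c]])
      also have "... = tlift A C C X (%x y. (\<lambda>c\<in>carrier C. J (F c)) x y) (cop C c)"
        by (rule lift_cong) (simp add: J_def)
      finally show "j ((\<lambda>c\<in>carrier C. tlift A C C Y (%x y. F x y) (cop C c)) c) = tlift A C C X (%x y. (\<lambda>c\<in>carrier C. J (F c)) x y) (cop C c)"
        using c by simp
    qed
    show "alg Y (monad_map A C (hom_module A C Y) (alg Y) F) = alg Y (monad_mult A C Y F)"
      unfolding 1 aY[OF CY.monad_mult_closed[OF Fr]] 2 X.alg_mult[OF JJ] ..
  qed
qed

context antipode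
begin

text \<open>The \<open>R\<close>-module \<open>N\<close> is the module of invariants of \<open>Hom\<^sub>R(H, N)\<close>, which is transported along \<open>e\<close>.\<close>

lemma hom_hopf_ess_surj:
  fixes N :: "('r, 'n, 's) right_mod_scheme" and e :: "('h => 'n) => 'v"
  assumes N: "right_module R N" and e: "inj e"
  shows "\<exists>Q :: ('h, 'v, 'h) em_mod. hom_hopf_module R H Q \<and>
    (\<exists>\<theta>\<in>right_hom R N (sub_module H Q (antipode_hom_module.invs H Q)).
      bij_betw \<theta> (carrier N) (antipode_hom_module.invs H Q))"
proof -
  interpret N: right_module R N by fact
  interpret CN: coring_module R HR N by (intro coring_module.intro co.is_coring_axioms N)
  let ?X = "carrier (hom_module R HR N)"
  let ?W = "sub_hom_em R HR N ?X"
  define j where "j = inv_into UNIV e"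
  have j: "j (e f) = f" for f using e by (simp add: j_def)
  have em0: "em_module R HR ?W" by (rule sub_hom.sub_hom_em_module[OF CN.hom_module_sub_hom])
  interpret X0: em_module R HR ?W by (rule em0)
  have X: "f \<in> ?X \<longleftrightarrow> f \<in> right_hom R HR N \<and> f \<in> extensional (carrier H)" for f by simp
  have XI: "(\<lambda>x\<in>carrier H. f x) \<in> ?X"
    if "\<And>x. x ::: H ==> f x ::: N" "\<And>x y. [|x ::: H; y ::: H|] ==> f (x \<oplus>[H] y) = f x \<oplus>[N] f y"
      "\<And>x r. [|x ::: H; r ::: R|] ==> f (r \<odot>[H] x) = f x \<triangleleft>[N] r" for f
    using that by (auto intro!: right_homI)
  have XD: "x ::: H ==> f x ::: N" "[|x ::: H; y ::: H|] ==> f (x \<oplus>[H] y) = f x \<oplus>[N] f y"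
      "[|x ::: H; r ::: R|] ==> f (r \<odot>[H] x) = f x \<triangleleft>[N] r" "(\<lambda>x\<in>carrier H. f x) = f" if "f \<in> ?X" for f x y r
    using right_homD(2-4)[of f R HR N x] that by (simp_all add: extensional_restrict)
  \<comment> \<open>The right action of \<open>H\<close> on \<open>Hom\<^sub>R(H, N)\<close> comes
    from left multiplication in the argument, (f b)(a) = f(b a).\<close>
  define Nm :: "('h, 'h => 'n) right_mod" where
    "Nm = \<lparr>carrier = ?X, monoid.mult = undefined, one = undefined, ring.zero = ring.zero (hom_module R HR N),
      add = add (hom_module R HR N), ract = (%f b. \<lambda>a\<in>carrier H. f (b \<otimes>[H] a))\<rparr>"
  have Nm: "carrier Nm = ?X" "add Nm = add (hom_module R HR N)" "ring.zero Nm = ring.zero (hom_module R HR N)"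
    "ract Nm = (%f b. \<lambda>a\<in>carrier H. f (b \<otimes>[H] a))"
    by (simp_all add: Nm_def)
  have add: "f \<oplus>[hom_module R HR N] g = (\<lambda>x\<in>carrier H. f x \<oplus>[N] g x)" for f g by simp
  interpret X: abelian_group "hom_module R HR N" by (rule CN.hom_module_abelian_group)
  have shift: "(\<lambda>a\<in>carrier H. f (b \<otimes>[H] a)) \<in> ?X" if "f \<in> ?X" "b ::: H" for f b
    by (rule XI) (use that in "simp_all add: XD[OF that(1)] H.r_distr smult_mult_right")
  interpret Nm: right_module H Nm
  proof (rule right_moduleI)
    show "abelian_group Nm" by (rule abelian_group_transfer[OF X.abelian_group_axioms]) (simp_all only: Nm)
    fix f a assume "f ::: Nm" and a: "a ::: H"
    then have f: "f \<in> ?X" by (simp only: Nm)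
    note fD = XD[OF f]
    show "f \<triangleleft>[Nm] a ::: Nm" unfolding Nm by (rule shift[OF f a])
    show "(f \<oplus>[Nm] g) \<triangleleft>[Nm] a = f \<triangleleft>[Nm] a \<oplus>[Nm] g \<triangleleft>[Nm] a" for g
      unfolding Nm add by (rule restrict_ext) (simp add: a)
    fix b assume b: "b ::: H"
    show "f \<triangleleft>[Nm] (a \<oplus>[H] b) = f \<triangleleft>[Nm] a \<oplus>[Nm] f \<triangleleft>[Nm] b"
      unfolding Nm add by (rule restrict_ext) (simp add: a b H.l_distr fD)
    show "f \<triangleleft>[Nm] (a \<otimes>[H] b) = f \<triangleleft>[Nm] a \<triangleleft>[Nm] b"
      unfolding Nm add by (rule restrict_ext) (simp add: a b H.m_assoc)
  next
    fix f assume "f ::: Nm"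
    then have f: "f \<in> ?X" by (simp only: Nm)
    have "(\<lambda>a\<in>carrier H. f (\<one>[H] \<otimes>[H] a)) = (\<lambda>a\<in>carrier H. f a)" by (rule restrict_ext) simp
    then show "f \<triangleleft>[Nm] \<one>[H] = f" unfolding Nm by (simp only: XD(4)[OF f])
  qed (rule H.ring_axioms)
  interpret I: split_endo H Nm e j
    by (intro split_endo.intro split_endo_axioms.intro Nm.right_module_axioms
        right_hom_cong[OF id_right_hom[unfolded id_def] Nm.right_module_axioms]) (simp_all add: j)
  \<comment> \<open>The structure map is the monad multiplication of the free module, conjugated by
    the embedding into the universe.\<close>
  define Q :: "('h, 'v, 'h) em_mod" where
    "Q = right_mod.extend (retract_mod Nm e j) \<lparr>alg = (%F. e (monad_mult R HR N (\<lambda>h\<in>carrier H. j (F h))))\<rparr>"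
  have Q: "carrier Q = carrier (retract_mod Nm e j)" "add Q = add (retract_mod Nm e j)" "ring.zero Q = ring.zero (retract_mod Nm e j)"
    "ract Q = ract (retract_mod Nm e j)" "alg Q = (%F. e (monad_mult R HR N (\<lambda>h\<in>carrier H. j (F h))))"
    by (simp_all add: Q_def right_mod.extend_def retract_mod_def)
  have Qc: "carrier Q = e ` ?X" unfolding Q retract_mod_simps Nm ..
  have ec: "e f ::: Q" if "f \<in> ?X" for f using that unfolding Qc by (rule imageI)
  have jc: "j q \<in> ?X" if q: "q ::: Q" for q
  proof -
    obtain f where "q = e f" "f \<in> ?X" using q unfolding Qc by (rule imageE)
    then show ?thesis by (simp only: j)
  qed
  have ej: "e (j q) = q" if q: "q ::: Q" for q
  proof -
    obtain f where "q = e f" "f \<in> ?X" using q unfolding Qc by (rule imageE)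
    then show ?thesis by (simp only: j)
  qed
  have ea: "e f \<oplus>[Q] e g = e (\<lambda>x\<in>carrier H. f x \<oplus>[N] g x)" for f g
    by (simp add: Q retract_mod_simps Nm j)
  have er: "e f \<triangleleft>[Q] b = e (\<lambda>a\<in>carrier H. f (b \<otimes>[H] a))" for f b
    by (simp add: Q retract_mod_simps Nm j)
  have Qm: "right_module H Q"
  proof -
    interpret I': right_module H "retract_mod Nm e j" by (rule I.retract_right_module)
    show ?thesis
      by (rule right_moduleI)
         (simp_all add: Q H.ring_axioms abelian_group_transfer[OF I'.M.abelian_group_axioms] I'.ract_closed I'.ract_add_left
            I'.ract_add_right I'.ract_assoc I'.ract_one)
  qed
  interpret B: bialgebra_module R H Q
    by (intro bialgebra_module.intro is_bialgebra_axioms Qm)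
  have Qem: "em_module R HR (restrict_em H Q)"
  proof (rule em_module_transport[OF em0 co.is_coring_axioms, of _ e j])
    show "right_module R (restrict_em H Q)"
      using B.MR.ract_closed B.MR.ract_add_left B.MR.ract_add_right B.MR.ract_assoc B.MR.ract_one
      by (intro right_moduleI) (simp_all add: R.ring_axioms abelian_group_transfer[OF B.M.M.abelian_group_axioms])
    show "e \<in> right_hom R ?W (restrict_em H Q)"
    proof (rule right_homI)
      fix f r assume "f ::: ?W" and r: "r ::: R"
      have "(\<lambda>a\<in>carrier H. f ((r \<odot>[H] \<one>[H]) \<otimes>[H] a)) = (\<lambda>a\<in>carrier H. f (r \<odot>[H] a))"
        by (rule restrict_ext) (simp add: r smult_one_mult)
      then show "e (f \<triangleleft>[?W] r) = e f \<triangleleft>[restrict_em H Q] r" by (simp add: er)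
    qed (use ec in "simp_all add: ea")
  qed (use jc ej in "simp_all add: j Q(5)")
  have je: "(%q. j q y) \<in> add_hom Q N" if y: "y ::: H" for y
  proof (rule add_homI)
    show "j q y ::: N" if "q ::: Q" for q using XD(1)[OF jc[OF that] y] .
    fix p q assume "p ::: Q" "q ::: Q"
    then show "j (p \<oplus>[Q] q) y = j p y \<oplus>[N] j q y" using ea[of "j p" "j q"] y by (simp add: ej j)
  qed
  have hm: "hom_hopf_module R H Q"
  proof (intro hom_hopf_module.intro hom_hopf_module_axioms.intro Qm Qem)
    fix F b assume "F ::: (hom_module R HR (restrict_em H Q))" and b: "b ::: H"
    then have Fr: "F \<in> right_hom R HR (restrict_em H Q)" by simp
    note FD = right_homD(2-4)[OF Fr, simplified]
    have jF: "j (F x) \<in> ?X" if "x ::: H" for x by (rule jc[OF FD(1)[OF that]])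
    note jFD = XD[OF jF]
    have bF: "bil N (%x y. j (F x) y)"
    proof (rule bilI)
      fix x x' y assume "x ::: H" "x' ::: H" "y ::: H"
      then show "j (F (x \<oplus>[H] x')) y = j (F x) y \<oplus>[N] j (F x') y"
        by (simp add: FD hom_add[OF je])
    next
      fix x r y assume x: "x ::: H" "r ::: R" "y ::: H"
      have "j (F (r \<odot>[H] x)) = (\<lambda>a\<in>carrier H. j (F x) ((r \<odot>[H] \<one>[H]) \<otimes>[H] a))"
        using er[of "j (F x)" "r \<odot>[H] \<one>[H]"] x by (simp add: FD ej j)
      then show "j (F (r \<odot>[H] x)) y = j (F x) (r \<odot>[H] y)" using x by (simp add: smult_one_mult)
    qed (simp_all add: N.M.abelian_group_axioms jFD)
    have bQ: "bil Q (%x y. F (x \<otimes>[H] a) \<triangleleft>[Q] y)" if "a ::: H" for a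
      by (rule bilI)
         (use that in "simp_all add: B.M.M.abelian_group_axioms FD B.M.ract_closed B.M.ract_add_left B.M.ract_add_right H.l_distr
            smult_mult_left B.ract_smult_one")
    have "alg Q F \<triangleleft>[Q] b = e (\<lambda>a\<in>carrier H. lift N (%x y. j (F x) y) (comult H (b \<otimes>[H] a)))"
      unfolding Q(5) er
    proof (rule arg_cong[where f=e], rule restrict_ext)
      fix a assume a: "a ::: H"
      show "monad_mult R HR N (\<lambda>h\<in>carrier H. j (F h)) (b \<otimes>[H] a) = lift N (%x y. j (F x) y) (comult H (b \<otimes>[H] a))"
        using a b by (simp add: monad_mult_def)
    qed
    also have "... = alg Q (\<lambda>a\<in>carrier H. lift Q (%x y. F (x \<otimes>[H] a) \<triangleleft>[Q] y) (comult H b))"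
      unfolding Q(5) monad_mult_def under_coalgebra_simps
    proof (rule arg_cong[where f=e], rule restrict_ext)
      fix a assume a: "a ::: H"
      \<comment> \<open>The compatibility condition, evaluated at \<open>a\<close>, is
        multiplicativity of \<Delta>: with F regarded as valued in functions, F at b a becomes
        \<open>F(b\<^sub>1 a\<^sub>1)(b\<^sub>2 a\<^sub>2) = (F(b\<^sub>1 a\<^sub>1)
        b\<^sub>2)(a\<^sub>2)\<close>. The sum over \<open>b\<close> is kept inside so that it can
        be collected in \<open>Q\<close>.\<close>
      have "lift N (%x y. j (F x) y) (comult H (b \<otimes>[H] a))
        = lift N (%x y. lift N (%b1 b2. j (F (b1 \<otimes>[H] x)) (b2 \<otimes>[H] y)) (comult H b)) (comult H a)"
        by (rule lift_comult_mult'[OF bF b a])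
      also have "... = lift N (%x y. (\<lambda>h\<in>carrier H. j ((\<lambda>a\<in>carrier H. lift Q (%x y. F (x \<otimes>[H] a) \<triangleleft>[Q] y) (comult H b)) h)) x y) (comult H a)"
      proof (rule lift_cong)
        fix x y assume "x ::: HR" "y ::: HR"
        then have xy: "x ::: H" "y ::: H" by simp_all
        have "lift N (%b1 b2. j (F (b1 \<otimes>[H] x)) (b2 \<otimes>[H] y)) (comult H b) = lift N (%b1 b2. j (F (b1 \<otimes>[H] x) \<triangleleft>[Q] b2) y) (comult H b)"
        proof (rule lift_cong)
          fix b1 b2 assume "b1 ::: HR" "b2 ::: HR"
          then show "j (F (b1 \<otimes>[H] x)) (b2 \<otimes>[H] y) = j (F (b1 \<otimes>[H] x) \<triangleleft>[Q] b2) y"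
            using xy er[of "j (F (b1 \<otimes>[H] x))" b2] by (simp add: FD ej j)
        qed
        also have "... = j (lift Q (%b1 b2. F (b1 \<otimes>[H] x) \<triangleleft>[Q] b2) (comult H b)) y"
          by (rule lift_additive[OF bQ[OF xy(1)] je[OF xy(2)] N.M.abelian_group_axioms b, symmetric])
        finally show "lift N (%b1 b2. j (F (b1 \<otimes>[H] x)) (b2 \<otimes>[H] y)) (comult H b)
          = (\<lambda>h\<in>carrier H. j ((\<lambda>a\<in>carrier H. lift Q (%x y. F (x \<otimes>[H] a) \<triangleleft>[Q] y) (comult H b)) h)) x y"
          using xy by simp
      qed
      finally show "lift N (%x y. j (F x) y) (comult H (b \<otimes>[H] a))
        = lift N (%x y. (\<lambda>h\<in>carrier H. j ((\<lambda>a\<in>carrier H. lift Q (%x y. F (x \<otimes>[H] a) \<triangleleft>[Q] y) (comult H b)) h)) x y) (comult H a)" .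
    qed
    finally show "alg Q F \<triangleleft>[Q] b = alg Q (\<lambda>a\<in>carrier H. lift Q (%x y. F (x \<otimes>[H] a) \<triangleleft>[Q] y) (comult H b))" .
  qed
  interpret W: antipode_hom_module R H S Q
    by (intro antipode_hom_module.intro antipode_axioms hm)
  \<comment> \<open>An element \<open>n\<close> corresponds to the function a \<mapsto> n
    \<epsilon>(a), the unit of the monad, which is invariant because \<epsilon> is
    multiplicative.\<close>
  define \<theta> where "\<theta> n = e (\<lambda>a\<in>carrier H. n \<triangleleft>[N] counit H a)" for n
  have cX: "(\<lambda>a\<in>carrier H. n \<triangleleft>[N] counit H a) \<in> ?X" if "n ::: N" for n
    by (rule XI) (use that in "simp_all add: counit_closed counit_rules N.ract_closed N.ract_add_right N.ract_assoc[symmetric] R.m_comm")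
  have \<theta>i: "\<theta> n \<in> W.invs" if n: "n ::: N" for n
    unfolding W.invs_def
  proof (intro CollectI conjI ballI)
    show "\<theta> n ::: Q" unfolding \<theta>_def by (rule ec[OF cX[OF n]])
    fix b assume b: "b ::: H"
    show "\<theta> n \<triangleleft>[Q] b = \<theta> n \<triangleleft>[Q] (counit H b \<odot>[H] \<one>[H])"
      unfolding \<theta>_def er
      by (rule arg_cong[where f=e], rule restrict_ext)
         (simp add: b counit_mult counit_closed counit_rules counit_one)
  qed
  have "\<theta> \<in> right_hom R N (sub_module H Q W.invs)"
  proof (rule right_homI)
    fix m n assume mn: "m ::: N" "n ::: N"
    show "\<theta> (m \<oplus>[N] n) = \<theta> m \<oplus>[sub_module H Q W.invs] \<theta> n"
      unfolding sub_module_simps \<theta>_def ea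
      by (rule arg_cong[where f=e], rule restrict_ext) (simp add: mn N.ract_add_left counit_closed)
  next
    fix n r assume nr: "n ::: N" "r ::: R"
    show "\<theta> (n \<triangleleft>[N] r) = \<theta> n \<triangleleft>[sub_module H Q W.invs] r"
      unfolding sub_module_simps \<theta>_def er
      by (rule arg_cong[where f=e], rule restrict_ext)
         (simp add: nr N.ract_assoc[symmetric] counit_closed smult_one_mult counit_rules)
  qed (simp add: \<theta>i)
  moreover have "bij_betw \<theta> (carrier N) W.invs"
  proof (rule bij_betw_byWitness[where f'="%q. j q \<one>[H]"])
    show "\<forall>n\<in>carrier N. j (\<theta> n) \<one>[H] = n" by (simp add: \<theta>_def j counit_one N.ract_one)
    show "\<theta> ` carrier N \<subseteq> W.invs" using \<theta>i by blast
    show "(%q. j q \<one>[H]) ` W.invs \<subseteq> carrier N" using XD(1)[OF jc H.one_closed] W.invs_closed by blast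
    show "\<forall>q\<in>W.invs. \<theta> (j q \<one>[H]) = q"
    proof
      fix q assume q: "q \<in> W.invs"
      note qc = W.invs_closed[OF q] and qD = XD[OF jc[OF W.invs_closed[OF q]]]
      have jq: "j (q \<triangleleft>[Q] b) = (\<lambda>a\<in>carrier H. j q (b \<otimes>[H] a))" for b
        using er[of "j q" b] by (simp add: ej qc j)
      have "(\<lambda>a\<in>carrier H. j q \<one>[H] \<triangleleft>[N] counit H a) = (\<lambda>a\<in>carrier H. j q a)"
      proof (rule restrict_ext)
        fix a assume a: "a ::: H"
        \<comment> \<open>Invariance evaluated at 1 reads f(a) = \<epsilon>(a) f(1), so an invariant
          function is determined by its value at 1.\<close>
        have "j (q \<triangleleft>[Q] a) \<one>[H] = j (q \<triangleleft>[Q] (counit H a \<odot>[H] \<one>[H])) \<one>[H]" using W.invs_ract[OF q a] by (rule arg_cong)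
        then show "j q \<one>[H] \<triangleleft>[N] counit H a = j q a" using a by (simp add: jq qD counit_closed)
      qed
      then show "\<theta> (j q \<one>[H]) = q" by (simp only: \<theta>_def qD(4) ej[OF qc])
    qed
  qed
  ultimately show ?thesis using hm by blast
qed

lemma hom_hopf_module_antipode: "hom_hopf_module R H M ==> antipode_hom_module R H S M"
  by (intro antipode_hom_module.intro antipode_axioms)

lemma hom_hopf_module_category:
  "is_category (hom_hopf_module_category R H :: (('h, 'v, 'h) em_mod, 'v => 'v) category)"
  unfolding hom_hopf_module_category_def
proof (rule concrete_category)
  fix X :: "('h, 'v, 'h) em_mod" assume "X \<in> {M. hom_hopf_module R H M}"
  then interpret X: antipode_hom_module R H S X by (simp add: hom_hopf_module_antipode)
  show "(\<lambda>x\<in>carrier X. x) \<in> right_hom H X X \<inter> em_hom R HR (restrict_em H X) (restrict_em H X)"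
    using right_hom_id[OF X.M.right_module_axioms] em_hom_id[OF X.M.em_module co.bimodule_axioms] by simp
  fix Y Z :: "('h, 'v, 'h) em_mod" and f g
  assume fg: "f \<in> right_hom H X Y \<inter> em_hom R HR (restrict_em H X) (restrict_em H Y)"
    "g \<in> right_hom H Y Z \<inter> em_hom R HR (restrict_em H Y) (restrict_em H Z)"
  show "compose (carrier X) g f \<in> right_hom H X Z \<inter> em_hom R HR (restrict_em H X) (restrict_em H Z)"
    using right_hom_compose[of f H X Y g Z] em_hom_compose[of f R HR "restrict_em H X" "restrict_em H Y" g "restrict_em H Z"]
      fg X.M.right_module_axioms X.M.em_module co.bimodule_axioms by simp
qed (auto dest: right_homD(2))

theorem hom_hopf_module_ff_es:
  assumes "closed_under_families TYPE('h) TYPE('v)"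
  shows "ff_es_functor (hom_hopf_module_category R H :: (('h, 'v, 'h) em_mod, 'v => 'v) category) (rmod_category R)
    \<lparr>Fob = (%M. sub_module H M (antipode_hom_module.invs H M)),
     Far = (%M N f. restrict f (carrier (sub_module H M (antipode_hom_module.invs H M))))\<rparr>"
  unfolding hom_hopf_module_category_def
proof (rule submodule_ff_es[OF hom_hopf_module_category[unfolded hom_hopf_module_category_def]]; (unfold mem_Collect_eq)?)
  note a = hom_hopf_module_antipode
  fix X :: "('h, 'v, 'h) em_mod" assume X: "hom_hopf_module R H X"
  interpret X: antipode_hom_module R H S X by (rule a[OF X])
  show "right_module R (sub_module H X X.invs)" by (rule X.invs_module)
  show "carrier (sub_module H X X.invs) \<subseteq> carrier X" using X.invs_closed by auto
  fix Y :: "('h, 'v, 'h) em_mod" assume Y: "hom_hopf_module R H Y"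
  show "h \<in> right_hom R (sub_module H X X.invs) (sub_module H Y (antipode_hom_module.invs H Y)) ==>
      \<exists>f\<in>right_hom H X Y \<inter> em_hom R HR (restrict_em H X) (restrict_em H Y).
         \<forall>x\<in>carrier (sub_module H X X.invs). f x = h x" for h
    using hom_hopf_hom_extension[OF a[OF X] a[OF Y]] by simp
  fix f assume f: "f \<in> right_hom H X Y \<inter> em_hom R HR (restrict_em H X) (restrict_em H Y)"
  show "f \<in> right_hom R (sub_module H X X.invs) (sub_module H Y (antipode_hom_module.invs H Y))"
    using hom_hopf_hom_invs[OF a[OF X] a[OF Y]] f by simp
  show "g \<in> right_hom H X Y \<inter> em_hom R HR (restrict_em H X) (restrict_em H Y)"
    if "\<And>x. x ::: X ==> g x = f x" for g
    using right_hom_cong[of f H X Y g] em_hom_cong[of f R HR "restrict_em H X" "restrict_em H Y" g]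
      f that X.M.right_module_axioms X.M.em_module by simp
  show "f x = g x"
    if "g \<in> right_hom H X Y \<inter> em_hom R HR (restrict_em H X) (restrict_em H Y)"
      "\<And>x. x ::: (sub_module H X X.invs) ==> f x = g x" "x ::: X" for g x
    by (rule hom_hopf_hom_eqI[OF a[OF X], of f Y g]) (use f that in simp_all)
next
  fix N :: "('r, 'v) right_mod" assume N: "right_module R N"
  obtain e :: "('h => 'v) => 'v" where "inj e"
    using assms by (auto simp: closed_under_families_def)
  from hom_hopf_ess_surj[OF N this]
  show "\<exists>X\<in>{M :: ('h, 'v, 'h) em_mod. hom_hopf_module R H M}. \<exists>\<theta>\<in>right_hom R N (sub_module H X (antipode_hom_module.invs H X)).
      bij_betw \<theta> (carrier N) (carrier (sub_module H X (antipode_hom_module.invs H X)))"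
    by simp
qed

end

theorem mainTheorem3:
  fixes R :: "('r, 'p) ring_scheme" and H :: "('r, 'h, 'z) bialgebra_scheme"
  assumes "cring R" and "hopf_algebra R H"
  shows "(is_coring H (hopf_coring R H) \<and> coseparable H (hopf_coring R H)) \<and>
    (closed_under_families TYPE(('h, 'h) tensor) TYPE('u) \<longrightarrow>
      is_equivalence
        (comod_category H (hopf_coring R H) :: (('h, 'u, ('h, 'h) tensor) comod, 'u \<Rightarrow> 'u) category)
        (em_category H (hopf_coring R H))
        (comod_hom_functor H (hopf_coring R H))) \<and>
    (closed_under_families TYPE('h) TYPE('v) \<longrightarrow>
      equivalent_categories
        (hopf_module_category R H :: (('h, 'v, 'h) comod, 'v \<Rightarrow> 'v) category)
        (hom_hopf_module_category R H :: (('h, 'v, 'h) em_mod, 'v \<Rightarrow> 'v) category))"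
proof -
  interpret hopf_algebra R H by fact
  obtain S where "is_antipode R H S" using antipode by blast
  then interpret antipode R H S by (intro antipode.intro antipode_axioms.intro is_bialgebra_axioms)
  show ?thesis
    by (intro conjI impI hopf_is_coring cointegral.cointegral_coseparable[OF hopf_cointegral]
        cointegral_equivalence[OF hopf_cointegral] equivalent_via[OF hopf_module_ff_es hom_hopf_module_ff_es])
qed

end
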